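(* Let $p\in[2,+\infty)$, $m\in\mathbb{N}$, $\ell\in\{1,\dots,m\}$, and $f\in\mathcal{S}_m$. Let $k_{\ell-1}=\#\{z\in\{1,\dots,\ell-1\}:f(z)=1\}$ (so $k_0=0$), let $K_m\subset\mathbb{R}^{d\times d}_{\rm diag}$ be the set of wells constructed from $f$ (see context), let $\Omega=(0,1)^d$, and suppose that $F\in K_m^{(\ell)}\setminus K_m^{(\ell-1)}$. Then there exists a constant $c>0$ such that for every $\epsilon\in(0,1)$ $$c\,\epsilon^{2p/(2p+2((\ell-1)-k_{\ell-1})+k_{\ell-1})}\le E^{(p)}_{\epsilon,m+1}(\mathcal{A}_F^{\rm per}),$$ where $E^{(p)}_{\epsilon,m+1}(\mathcal{A}_F^{\rm per})$ is the minimal singularly perturbed energy for the wells $K_m$ in the periodic setting with mean value $F$ (see context). Moreover, $c\to0$ as $\operatorname{dist}(F,K_m^{(\ell-1)})\to0$.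
   Context: **Wells.** $\mathcal{S}_m$ is the set of functions $f:\{1,\dots,m\}\to\{1,2\}$ such that there is no $i\in\{1,\dots,m-1\}$ with $f(i)=f(i+1)=1$. For $0\le r\le m$, $k_r=\#\{z\in\{1,\dots,r\}:f(z)=1\}$, $k_0=0$. The dimension is $d=2(m-k_m)+k_m=\sum_{j=1}^mf(j)$ for $m\ge2$, and $d=2$ for $m=1$. For $i=1,\dots,m$ let $M_i\in\mathbb{R}^{d\times d}$ be the diagonal matrix with entry $1$ at diagonal position $1+\sum_{j=1}^{i-1}f(j)$, entry $-1$ at diagonal position $2+\sum_{j=1}^{i-1}f(j)$ if $f(i)=2$, and all other entries zero. Set $J_i=\frac12\sum_{k=1}^iM_k$ ($J_0=0$), $A_0=0$, $A_i=J_{i-1}+M_i$ for $i=1,\dots,m$, and $K_m=\{A_0,\dots,A_m\}$. **Energy.** $\operatorname{sym}(M)=\frac12(M+M^T)$. A function $\chi:\Omega\to K_m$ is written $\chi=\sum_{j=0}^m\chi_jA_j$ with $\chi_j:\Omega\to\{0,1\}$, $\sum_{j=0}^m\chi_j=1$. Define $$E^{(p)}_{\epsilon,m+1}(u;\chi)=\int_\Omega|\operatorname{sym}(\nabla u)-\chi|^p\,dx+\epsilon\sum_{j=1}^m\|D\chi_j\|_{TV(\Omega)},$$ $$\mathcal{A}_F^{\rm per}=\Big\{u\in W^{1,p}_{\rm loc}(\mathbb{R}^d;\mathbb{R}^d): \langle\nabla u\rangle:=\int_{[0,1]^d}\nabla u\,dx=F,\ \nabla u\text{ is }[0,1]^d\text{-periodic}\Big\},$$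 $$E^{(p)}_{\epsilon,m+1}(\mathcal{A}_F^{\rm per})=\inf_{\chi\in BV(\Omega;K_m)}\ \inf_{u\in\mathcal{A}_F^{\rm per}}E^{(p)}_{\epsilon,m+1}(u;\chi).$$ **Laminates.** Two distinct matrices $A,B\in\mathbb{R}^{d\times d}_{\rm sym}$ are compatible if $A-B=a\odot b:=\frac12(a\otimes b+b\otimes a)$ for some $a,b\in\mathbb{R}^d\setminus\{0\}$. For $K\subset\mathbb{R}^{d\times d}_{\rm sym}$ set $K^{(0)}=K$ and, for $j\ge1$, $$K^{(j)}=K^{(j-1)}\cup\{\lambda B_1+(1-\lambda)B_2:\ \lambda\in(0,1),\ B_1,B_2\in K^{(j-1)}\text{ compatible}\}.$$ *)

theory Defs
  imports "HOL-Analysis.Analysis"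
begin

section \<open>Wells\<close>

definition admissible :: "nat \<Rightarrow> (nat \<Rightarrow> nat) set"  (* \<S>\<^sub>m *)
  where "admissible m =
    {f \<in> {1..m} \<rightarrow>\<^sub>E {1, 2}. \<not> (\<exists>i \<in> {1..m - 1}. f i = 1 \<and> f (i + 1) = 1)}"

definition ones_upto :: "(nat \<Rightarrow> nat) \<Rightarrow> nat \<Rightarrow> nat"  (* k\<^sub>r *)
  where "ones_upto f r = card {z \<in> {1..r}. f z = 1}"

definition space_dim :: "nat \<Rightarrow> (nat \<Rightarrow> nat) \<Rightarrow> nat"  (* d *)
  where "space_dim m f = (if m = 1 then 2 else \<Sum>j = 1..m. f j)"

text \<open>
  \<open>\<real>\<^sup>d\<close> is \<open>real ^ 'n\<close> with \<open>CARD('n) = d\<close>. Since the wells refer to the first, second etc.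
  coordinate, the index type is linearly ordered; \<open>position a\<close> is the place of the index \<open>a\<close> in
  this order, counted from 1.
\<close>
definition position :: "'n::{finite,linorder} \<Rightarrow> nat"
  where "position a = card {b. b \<le> a}"

definition step_matrix :: "(nat \<Rightarrow> nat) \<Rightarrow> nat \<Rightarrow> real ^ 'n::_ ^ 'n::{finite,linorder}"  (* M\<^sub>i *)
  where "step_matrix f i = (\<chi> a b.
    if a = b \<and> position a = 1 + (\<Sum>j\<in>{1..<i}. f j) then 1
    else if a = b \<and> f i = 2 \<and> position a = 2 + (\<Sum>j\<in>{1..<i}. f j) then - 1
    else 0)"

definition half_sum :: "(nat \<Rightarrow> nat) \<Rightarrow> nat \<Rightarrow> real ^ 'n::_ ^ 'n::{finite,linorder}"  (* J\<^sub>i *)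
  where "half_sum f i = (1/2) *\<^sub>R (\<Sum>k = 1..i. step_matrix f k)"

definition well :: "(nat \<Rightarrow> nat) \<Rightarrow> nat \<Rightarrow> real ^ 'n::_ ^ 'n::{finite,linorder}"  (* A\<^sub>i *)
  where "well f i = (if i = 0 then 0 else half_sum f (i - 1) + step_matrix f i)"

definition wells :: "nat \<Rightarrow> (nat \<Rightarrow> nat) \<Rightarrow> (real ^ 'n::_ ^ 'n::{finite,linorder}) set"  (* K\<^sub>m *)
  where "wells m f = well f ` {0..m}"


section \<open>Laminates\<close>

definition tensor :: "real ^ 'n \<Rightarrow> real ^ 'n \<Rightarrow> real ^ 'n ^ 'n"
  where "tensor a b = (\<chi> i j. a $ i * b $ j)"

definition sym_tensor :: "real ^ 'n \<Rightarrow> real ^ 'n \<Rightarrow> real ^ 'n ^ 'n"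
  where "sym_tensor a b = (1/2) *\<^sub>R (tensor a b + tensor b a)"

definition compatible :: "real ^ 'n ^ 'n \<Rightarrow> real ^ 'n ^ 'n \<Rightarrow> bool"
  where "compatible A B \<longleftrightarrow>
    transpose A = A \<and> transpose B = B \<and> A \<noteq> B \<and>
    (\<exists>a b. a \<noteq> 0 \<and> b \<noteq> 0 \<and> A - B = sym_tensor a b)"

primrec laminates :: "(real ^ 'n ^ 'n) set \<Rightarrow> nat \<Rightarrow> (real ^ 'n ^ 'n) set"  (* K\<^sup>(\<^sup>j\<^sup>) *)
  where
    "laminates K 0 = K"
  | "laminates K (Suc j) = laminates K j \<union>
      {t *\<^sub>R B1 + (1 - t) *\<^sub>R B2 | t B1 B2.
        t \<in> {0<..<1} \<and> B1 \<in> laminates K j \<and> B2 \<in> laminates K j \<and> compatible B1 B2}"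


section \<open>Functions of bounded variation and Sobolev functions\<close>

text \<open>The space \<open>C\<^sub>c\<^sup>1(\<Omega>; 'b)\<close>, its elements being extended by zero outside \<open>\<Omega>\<close>.\<close>
definition test_functions :: "(real ^ 'n) set \<Rightarrow> (real ^ 'n \<Rightarrow> 'b::euclidean_space) set"
  where "test_functions \<Omega> = {\<phi>.
    (\<forall>x. \<phi> differentiable (at x)) \<and>
    (\<forall>v. continuous_on UNIV (\<lambda>x. frechet_derivative \<phi> (at x) v)) \<and>
    (\<exists>C. compact C \<and> C \<subseteq> \<Omega> \<and> (\<forall>x. x \<notin> C \<longrightarrow> \<phi> x = 0))}"

definition partial_deriv :: "'n \<Rightarrow> (real ^ 'n \<Rightarrow> 'b::euclidean_space) \<Rightarrow> real ^ 'n \<Rightarrow> 'b"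
  where "partial_deriv j \<phi> x = frechet_derivative \<phi> (at x) (axis j 1)"

definition divergence :: "(real ^ 'n \<Rightarrow> real ^ 'n) \<Rightarrow> real ^ 'n \<Rightarrow> real"
  where "divergence \<phi> x = (\<Sum>i\<in>UNIV. partial_deriv i \<phi> x $ i)"

text \<open>
  The total variation \<open>\<parallel>Dg\<parallel>\<^sub>T\<^sub>V\<^sub>(\<^sub>\<Omega>\<^sub>)\<close> of an integrable function. The truncation of negative numbers by
  \<^const>\<open>ennreal\<close> does not affect the supremum, since \<open>\<phi> = 0\<close> is a competitor.
\<close>
definition total_variation :: "(real ^ 'n) set \<Rightarrow> (real ^ 'n \<Rightarrow> real) \<Rightarrow> ennreal"
  where "total_variation \<Omega> g =
    (SUP \<phi> \<in> {\<phi> \<in> test_functions \<Omega>. \<forall>x. norm (\<phi> x) \<le> 1}.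
      ennreal (LINT x:\<Omega>|lebesgue. g x * divergence \<phi> x))"

text \<open>\<open>BV(\<Omega>; V)\<close> for finite-dimensional \<open>V\<close>, defined through components.\<close>
definition BV :: "(real ^ 'n) set \<Rightarrow> (real ^ 'n \<Rightarrow> 'b::euclidean_space) set"
  where "BV \<Omega> = {g. \<forall>b\<in>Basis.
    set_integrable lebesgue \<Omega> (\<lambda>x. g x \<bullet> b) \<and> total_variation \<Omega> (\<lambda>x. g x \<bullet> b) < \<infinity>}"

definition Lp_loc :: "real \<Rightarrow> (real ^ 'n \<Rightarrow> 'b::euclidean_space) set"
  where "Lp_loc p = {g \<in> borel_measurable lebesgue.
    \<forall>C. compact C \<longrightarrow> set_integrable lebesgue C (\<lambda>x. norm (g x) powr p)}"

definition has_weak_gradient ::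
  "(real ^ 'n \<Rightarrow> real ^ 'n) \<Rightarrow> (real ^ 'n \<Rightarrow> real ^ 'n ^ 'n) \<Rightarrow> bool"
  where "has_weak_gradient u G \<longleftrightarrow> u \<in> Lp_loc 1 \<and> G \<in> Lp_loc 1 \<and>
    (\<forall>i j. \<forall>\<phi> \<in> test_functions UNIV.
      (LINT x|lebesgue. u x $ i * partial_deriv j \<phi> x) = - (LINT x|lebesgue. G x $ i $ j * \<phi> x))"

text \<open>
  The weak gradient is unique only up to null sets; everything below is insensitive to the choice
  of the representative.
\<close>
definition weak_gradient :: "(real ^ 'n \<Rightarrow> real ^ 'n) \<Rightarrow> real ^ 'n \<Rightarrow> real ^ 'n ^ 'n"
  where "weak_gradient u = (SOME G. has_weak_gradient u G)"

definition W1p_loc :: "real \<Rightarrow> (real ^ 'n \<Rightarrow> real ^ 'n) set"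
  where "W1p_loc p = {u. u \<in> Lp_loc p \<and> (\<exists>G. has_weak_gradient u G) \<and> weak_gradient u \<in> Lp_loc p}"


section \<open>Energy\<close>

definition sym_part :: "real ^ 'n ^ 'n \<Rightarrow> real ^ 'n ^ 'n"
  where "sym_part A = (1/2) *\<^sub>R (A + transpose A)"

definition admissible_per :: "real \<Rightarrow> real ^ 'n ^ 'n \<Rightarrow> (real ^ 'n \<Rightarrow> real ^ 'n) set"
  where "admissible_per p F = {u \<in> W1p_loc p.
    (LINT x:cbox 0 1|lebesgue. weak_gradient u x) = F \<and>
    (\<forall>i. AE x in lebesgue. weak_gradient u (x + axis i 1) = weak_gradient u x)}"

text \<open>\<open>BV(\<Omega>; K\<^sub>m)\<close>; the values of the total function \<open>X\<close> outside \<open>\<Omega>\<close> are irrelevant.\<close>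
definition phase_arrangements ::
  "(real ^ 'n::_) set \<Rightarrow> nat \<Rightarrow> (nat \<Rightarrow> nat) \<Rightarrow> (real ^ 'n::_ \<Rightarrow> real ^ 'n::_ ^ 'n::{finite,linorder}) set"
  where "phase_arrangements \<Omega> m f = {X \<in> BV \<Omega>. \<forall>x\<in>\<Omega>. X x \<in> wells m f}"

text \<open>
  The coefficients \<open>\<chi>\<^sub>j\<close> in \<open>\<chi> = \<Sum>\<^sub>j \<chi>\<^sub>j A\<^sub>j\<close>. They are uniquely determined, the wells being pairwise
  distinct (\<open>inj_on_well\<close> and \<open>phase_unique\<close> below).
\<close>
definition phase ::
  "(nat \<Rightarrow> nat) \<Rightarrow> (real ^ 'n::_ \<Rightarrow> real ^ 'n::_ ^ 'n::_) \<Rightarrow> nat \<Rightarrow> real ^ 'n::{finite,linorder} \<Rightarrow> real"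
  where "phase f X j x = (if X x = well f j then 1 else 0)"

definition energy ::
  "(real ^ 'n::{finite,linorder}) set \<Rightarrow> real \<Rightarrow> real \<Rightarrow> nat \<Rightarrow> (nat \<Rightarrow> nat) \<Rightarrow>
    (real ^ 'n::_ \<Rightarrow> real ^ 'n::_) \<Rightarrow> (real ^ 'n::_ \<Rightarrow> real ^ 'n::_ ^ 'n::_) \<Rightarrow> ennreal"
  where "energy \<Omega> p \<epsilon> m f u X =
    (\<integral>\<^sup>+ x\<in>\<Omega>. ennreal (norm (sym_part (weak_gradient u x) - X x) powr p) \<partial>lebesgue) +
    ennreal \<epsilon> * (\<Sum>j = 1..m. total_variation \<Omega> (phase f X j))"

definition min_energy ::
  "(real ^ 'n::{finite,linorder}) set \<Rightarrow> real \<Rightarrow> real \<Rightarrow> nat \<Rightarrow> (nat \<Rightarrow> nat) \<Rightarrow>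
    real ^ 'n::_ ^ 'n::_ \<Rightarrow> ennreal"
  where "min_energy \<Omega> p \<epsilon> m f F =
    (INF X \<in> phase_arrangements \<Omega> m f. INF u \<in> admissible_per p F. energy \<Omega> p \<epsilon> m f u X)"


section \<open>The phases are well defined\<close>

lemma position_surj:
  assumes "1 \<le> k" "k \<le> CARD('n::{finite,linorder})"
  obtains a :: "'n::{finite,linorder}" where "position a = k"
proof -
  have "inj (position :: 'n \<Rightarrow> nat)"
  proof (rule linorder_injI)
    fix a b :: 'n assume "a < b"
    then have "{c. c \<le> a} \<subseteq> {c. c \<le> b}" "b \<in> {c. c \<le> b} - {c. c \<le> a}" by auto
    then have "{c. c \<le> a} \<subset> {c. c \<le> b}" by blast
    then have "position a < position b"
      unfolding position_def by (simp add: psubset_card_mono)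
    then show "position a \<noteq> position b" by simp
  qed
  moreover have "range (position :: 'n \<Rightarrow> nat) \<subseteq> {1..CARD('n)}"
    unfolding position_def by (auto simp: card_gt_0_iff Suc_le_eq intro!: card_mono)
  ultimately have "range (position :: 'n \<Rightarrow> nat) = {1..CARD('n)}"
    by (metis card_atLeastAtMost card_image card_subset_eq diff_Suc_1 finite_atLeastAtMost)
  then show thesis
    using assms that by (metis atLeastAtMost_iff imageE)
qed

lemma inj_on_well:
  assumes f: "f \<in> admissible m" and d: "CARD('n::{finite,linorder}) = space_dim m f"
  shows "inj_on (well f :: nat \<Rightarrow> real ^ 'n::_ ^ 'n::_) {0..m}"
proof (rule linorder_inj_onI)
  fix i j assume ij: "i < j" "i \<in> {0..m}" "j \<in> {0..m}"
  have f12: "f k = 1 \<or> f k = 2" if "k \<in> {1..m}" for k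
    using f that by (auto simp: admissible_def)
  let ?s = "\<lambda>i. \<Sum>k\<in>{1..<i}. f k"
  have s_Suc: "?s (Suc k) = ?s k + f k" if "k \<ge> 1" for k
    using that by (simp add: sum.atLeastLessThan_Suc)
  have s_mono: "?s k \<le> ?s l" if "k \<le> l" for k l
    using that by (intro sum_mono2) auto
  have "?s j + 1 \<le> ?s (Suc m)"
  proof -
    have "?s j + 1 \<le> ?s (Suc j)" using s_Suc[of j] f12[of j] ij by auto
    also have "\<dots> \<le> ?s (Suc m)" using ij by (intro s_mono) auto
    finally show ?thesis .
  qed
  also have "?s (Suc m) \<le> CARD('n)"
    unfolding d space_dim_def using f12[of 1] by (auto simp: atLeastLessThanSuc_atLeastAtMost)
  finally obtain a :: 'n where a: "position a = 1 + ?s j"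
    using position_surj[of "1 + ?s j"] by auto
  have M0: "(step_matrix f k :: real ^ 'n::_ ^ 'n::_) $ a $ a = 0" if "1 \<le> k" "k < j" for k
  proof -
    have "?s k + f k \<le> ?s j" using s_mono[of "Suc k" j] s_Suc[of k] that by auto
    moreover have "f k = 1 \<or> f k = 2" using f12[of k] that ij by auto
    ultimately show ?thesis by (auto simp: step_matrix_def a)
  qed
  have J0: "(half_sum f k :: real ^ 'n::_ ^ 'n::_) $ a $ a = 0" if "k < j" for k
    using that by (simp add: half_sum_def M0)
  have "(well f i :: real ^ 'n::_ ^ 'n::_) $ a $ a = 0"
    using ij by (auto simp: well_def J0 M0)
  moreover have "(well f j :: real ^ 'n::_ ^ 'n::_) $ a $ a = 1"
    using ij by (simp add: well_def J0) (simp add: step_matrix_def a)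
  ultimately show "(well f i :: real ^ 'n::_ ^ 'n::_) \<noteq> well f j" by auto
qed auto

lemma phase_unique:
  fixes X :: "real ^ 'n::_ \<Rightarrow> real ^ 'n::_ ^ 'n::{finite,linorder}"
  assumes "f \<in> admissible m" "CARD('n) = space_dim m f" "X x \<in> wells m f"
  shows "(\<forall>j\<in>{0..m}. c j \<in> {0, 1}) \<and> (\<Sum>j = 0..m. c j) = 1 \<and> X x = (\<Sum>j = 0..m. c j *\<^sub>R well f j)
    \<longleftrightarrow> (\<forall>j\<in>{0..m}. c j = phase f X j x)" (is "?L \<longleftrightarrow> ?R")
proof -
  note inj = inj_on_well[OF assms(1,2)]
  obtain i where i: "i \<in> {0..m}" "X x = well f i" using assms(3) by (auto simp: wells_def)
  have ph: "phase f X j x = of_bool (j = i)" if "j \<in> {0..m}" for j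
    using inj_on_eq_iff[OF inj, of i j] that i by (auto simp: phase_def)
  show ?thesis
  proof
    assume L: ?L
    let ?I = "{j\<in>{0..m}. c j = 1}"
    have c: "c j = of_bool (j \<in> ?I)" if "j \<in> {0..m}" for j using L that by auto
    have "(\<Sum>j = 0..m. c j) = (\<Sum>j\<in>{0..m}. of_bool (j \<in> ?I))" using c by (intro sum.cong) auto
    also have "\<dots> = real (card ?I)" by (simp add: sum.If_cases of_bool_def Int_def)
    finally have "card ?I = 1" using L by linarith
    then obtain k where k: "?I = {k}" by (auto simp: card_1_singleton_iff)
    then have km: "k \<in> {0..m}" by auto
    have c': "c j = of_bool (j = k)" if "j \<in> {0..m}" for j
      using c[OF that] unfolding k by simp
    have "X x = (\<Sum>j = 0..m. of_bool (j = k) *\<^sub>R well f j)" using L c' by simp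
    also have "\<dots> = (\<Sum>j = 0..m. if j = k then well f j else 0)" by (intro sum.cong) auto
    also have "\<dots> = well f k" using km by simp
    finally have "k = i" using inj_on_eq_iff[OF inj, of i k] km i by auto
    then show ?R using c' ph by auto
  next
    assume ?R
    then have c: "c j = of_bool (j = i)" if "j \<in> {0..m}" for j using ph that by auto
    have "(\<Sum>j = 0..m. c j) = (\<Sum>j = 0..m. if j = i then 1 else 0)"
      using c by (intro sum.cong) auto
    moreover have "(\<Sum>j = 0..m. c j *\<^sub>R (well f j :: real ^ 'n::_ ^ 'n::_))
        = (\<Sum>j = 0..m. if j = i then well f j else 0)"
      using c by (intro sum.cong) auto
    ultimately show ?L using i c by auto
  qed
qed

end

theory Submission
  imports Defs
begin

text \<open>
  Let \<open>e\<^sup>p\<close> be the elastic energy of a competitor and \<open>S\<close> its surface energy, and write the phase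
  arrangement as \<open>\<Sum>\<^sub>i h\<^sub>i M\<^sub>i\<close>. Then \<open>h\<^sub>i\<close> has the values 0, 1/2 and 1, and it is 1/2 exactly where the
  next coefficient does not vanish; thus \<open>\<theta>\<^sub>i = 1\<close> on \<open>{h\<^sub>i \<noteq> 0}\<close> and 0 elsewhere satisfies
  \<open>\<theta>\<^sub>i = h\<^sub>i + \<theta>\<^sub>j / 2\<close> with \<open>j = i + 1\<close>. For the mollified periodic part \<open>w\<close> of the displacement,
  \<open>\<partial>\<^sub>a w\<^sub>b + \<partial>\<^sub>b w\<^sub>a = O(e)\<close> in L2 for \<open>a \<noteq> b\<close>, and \<open>\<partial>\<^sub>a w\<^sub>a = \<plusminus> (h\<^sub>i - \<langle>h\<^sub>i\<rangle>) + O(e)\<close> for the coordinates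
  \<open>a\<close> in the support of \<open>M\<^sub>i\<close>. Different coefficients are almost uncorrelated, since \<open>h\<^sub>i\<close> is close to its
  mean 1/2 where the later ones live; so \<open>\<integral> \<partial>\<^sub>a w\<^sub>a \<partial>\<^sub>z w\<^sub>z = \<integral> \<partial>\<^sub>z w\<^sub>a \<partial>\<^sub>a w\<^sub>z\<close> yields
  \<open>\<partial>\<^sub>z w\<^sub>a = O(\<surd>e)\<close> for later coordinates \<open>z\<close>.

  This gives an induction in physical space. Suppose that \<open>\<theta>\<^sub>i\<close>, hence also \<open>h\<^sub>i\<close>, is almost invariant
  under translations of length at most \<open>r\<close> in the directions of the supports of \<open>M\<^sub>i\<close> and its
  successors; for \<open>i = 1\<close> the surface energy allows \<open>r\<close> of order \<open>1 / S\<close>. Then \<open>h\<^sub>i\<close> is nearly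
  the average of \<open>\<partial>\<^sub>a w\<^sub>a\<close> over a segment of length \<open>r\<close>, which is a difference quotient of \<open>w\<^sub>a\<close>, and
  \<open>\<partial>\<^sub>z w\<^sub>a = O(\<surd>e)\<close> makes \<open>h\<^sub>i\<close> almost invariant up to the length \<open>r / \<surd>e\<close> in later directions. If
  \<open>f i = 2\<close>, there are two such representations of \<open>h\<^sub>i\<close>, with \<open>w\<^sub>a\<close> and with \<open>- w\<^sub>b\<close>. Pairing them
  replaces \<open>\<partial>\<^sub>z w\<^sub>a\<close> by \<open>\<partial>\<^sub>b \<partial>\<^sub>z w\<^sub>a\<close>, which is controlled by derivatives of the off-diagonal
  strains alone, and the length improves to \<open>r / e\<close>. By the relation between \<open>\<theta>\<^sub>i\<close>, \<open>h\<^sub>i\<close> and the next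
  indicator, the latter inherits the invariance.

  After \<open>l - 1\<close> steps the length is of order \<open>e\<^sup>-\<^sup>q / S\<close> with \<open>q = (l - 1) - k / 2\<close>, where \<open>k\<close> of the
  values \<open>f i\<close>, \<open>i < l\<close>, are 1. It cannot exceed the period: otherwise \<open>h\<^sub>l\<close> would be nearly constant,
  although it is nearly 0-1-valued with a mean in the open unit interval. So \<open>S e\<^sup>q\<close> is bounded below, and
  minimizing \<open>e\<^sup>p + \<epsilon> S\<close> gives the exponent \<open>p / (p + q)\<close>. For \<open>l = 1\<close> the isoperimetric inequality
  bounds \<open>S\<close> directly.
\<close>

section \<open>Periodic functions\<close>

text \<open>Only an L2 bound is drawn from the exponent: the cell has measure one and
  \<open>p\<close> is at least 2, so an elastic energy \<open>e^p\<close> makes the strain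
  \<open>e\<close>-small in L2, and everything afterwards concerns L2 products of translates. Each
  passage to the next coefficient worsens the tolerance from \<beta> to a multiple of its square
  root, by factors that do not depend on the competitor. There are at most \<open>l - 1\<close>
  passages, so the tolerance wanted at the end fixes all earlier ones, and only the powers of
  \<open>e\<close> in the lengths enter the exponent. The mollification scale may depend on the
  competitor, as no final bound contains it.

  The obstacle in the periodic setting is that the total variation is measured in the open cube,
  while the periodic extension may also jump across the faces. This puts \<open>S + d\<close> in the
  place of \<open>S\<close>. The additional \<open>d e^q\<close> is absorbed for small
  \<open>e\<close> if \<open>q > 0\<close>, but not for \<open>q = 0\<close>, which is why
  \<open>l = 1\<close> is treated through volume fractions.

  That \<open>c\<close> vanishes near the laminates of lower order is arranged at the end by a
  minimum with the distance.\<close>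

definition periodic :: "(real ^ 'n \<Rightarrow> 'b) \<Rightarrow> bool"
  where "periodic g \<longleftrightarrow> (\<forall>x i. g (x + axis i 1) = g x)"

text \<open>Half-open, so that every point has exactly one representative in it modulo integer
  vectors; the open cube of the energy differs from it by a null set.\<close>

definition unit_cell :: "(real ^ 'n) set"
  where "unit_cell = {x. \<forall>i. 0 \<le> x $ i \<and> x $ i < 1}"

text \<open>The restriction of \<open>lborel\<close> and not of its completion: Fubini's theorem is
  applied to products of this measure with \<open>lborel\<close>.\<close>

definition cell :: "(real ^ 'n) measure"
  where "cell = restrict_space lborel unit_cell"

definition frac_vec :: "real ^ 'n \<Rightarrow> real ^ 'n"
  where "frac_vec x = (\<chi> i. frac (x $ i))"

definition int_vec :: "(real ^ 'n) set"
  where "int_vec = {k. \<forall>i. k $ i \<in> \<int>}"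

lemma unit_cell_measurable [measurable]: "(unit_cell :: (real ^ 'n) set) \<in> sets borel"
proof -
  have "unit_cell = (\<Inter>i. {x :: real ^ 'n. 0 \<le> x $ i} \<inter> {x. x $ i < 1})"
    by (auto simp: unit_cell_def)
  also have "\<dots> \<in> sets borel"
    by (intro sets.finite_INT sets.Int borel_closed borel_open closed_halfspace_component_ge_cart
        open_halfspace_component_lt_cart) auto
  finally show ?thesis .
qed

lemma frac_vec_measurable [measurable]: "frac_vec \<in> borel_measurable borel"
proof -
  have eq: "frac_vec = (\<lambda>x :: real ^ 'n. \<Sum>i\<in>UNIV. frac (x $ i) *\<^sub>R axis i 1)"
  proof
    fix x :: "real ^ 'n"
    have "frac_vec x = (\<Sum>i\<in>UNIV. (frac_vec x $ i) *s axis i 1)" by (rule basis_expansion[symmetric])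
    then show "frac_vec x = (\<Sum>i\<in>UNIV. frac (x $ i) *\<^sub>R axis i 1)"
      by (simp add: frac_vec_def scalar_mult_eq_scaleR)
  qed
  have [measurable]: "(\<lambda>x :: real ^ 'n. x $ i) \<in> borel_measurable borel" for i
    by (intro borel_measurable_continuous_onI continuous_intros)
  show ?thesis unfolding eq frac_def by measurable
qed

lemma frac_vec_in_unit_cell: "frac_vec x \<in> unit_cell"
  by (simp add: unit_cell_def frac_vec_def frac_lt_1)

lemma frac_vec_eq: "x \<in> unit_cell \<Longrightarrow> frac_vec x = x"
  by (simp add: unit_cell_def frac_vec_def vec_eq_iff frac_eq)

lemma frac_vec_diff_int: "frac_vec x - x \<in> int_vec"
  by (simp add: int_vec_def frac_vec_def frac_def)

text \<open>Unit steps of both signs reach every integer multiple of one axis vector; the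
  coordinates of \<open>k\<close> are then filled in one at a time.\<close>

lemma int_vec_induct [consumes 1, case_names zero add minus]:
  assumes k: "k \<in> int_vec" and z: "P 0"
    and add: "\<And>x i. P x \<Longrightarrow> P (x + axis i 1)" and minus: "\<And>x i. P x \<Longrightarrow> P (x - axis i 1)"
  shows "P k"
proof -
  have nat_step: "P (x + real n *\<^sub>R axis i 1)" "P (x - real n *\<^sub>R axis i 1)" if "P x" for x n i
  proof (induction n)
    case (Suc n)
    case 1 show ?case using add[OF Suc(1), of i] by (simp add: algebra_simps)
    case 2 show ?case using minus[OF Suc(2), of i] by (simp add: algebra_simps)
  qed (use that in simp_all)
  have step: "P (x + c *\<^sub>R axis i 1)" if Px: "P x" and c: "c \<in> \<int>" for x i and c :: real
  proof -
    obtain n where n: "c = of_int n" using c by (auto elim: Ints_cases)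
    show ?thesis
    proof (cases "n \<ge> 0")
      case True
      then show ?thesis using nat_step(1)[OF Px, of "nat n" i] n by simp
    next
      case False
      then show ?thesis using nat_step(2)[OF Px, of "nat (- n)" i] n by simp
    qed
  qed
  have "P (\<Sum>i\<in>I. (k $ i) *\<^sub>R axis i 1)" if "finite I" for I
    using that
  proof (induction I)
    case (insert i I)
    then show ?case using step[OF insert.IH, of "k $ i" i] k by (simp add: int_vec_def add.commute)
  qed (simp add: z)
  from this[of UNIV] show ?thesis
    using basis_expansion[of k] by (simp add: scalar_mult_eq_scaleR)
qed

lemma periodic_int_vec: "periodic g \<Longrightarrow> k \<in> int_vec \<Longrightarrow> g (x + k) = g x"
proof -
  assume g: "periodic g" and k: "k \<in> int_vec"
  show "g (x + k) = g x"
    using k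
  proof (induction k rule: int_vec_induct)
    case (add k i)
    then show ?case using g by (metis add.assoc periodic_def)
  next
    case (minus k i)
    then show ?case using g by (metis add_diff_eq diff_add_cancel periodic_def)
  qed simp
qed

lemma periodic_frac_vec: "periodic g \<Longrightarrow> g (frac_vec x) = g x"
  using periodic_int_vec[OF _ frac_vec_diff_int, of g x x] by simp

lemma periodic_comp_frac_vec: "periodic (\<lambda>x :: real ^ 'n. g (frac_vec x))"
proof -
  have "frac_vec (x + axis i 1) = frac_vec x" for x :: "real ^ 'n" and i
    by (auto simp: frac_vec_def vec_eq_iff axis_def frac_1_eq)
  then show ?thesis by (simp add: periodic_def)
qed

lemma periodic_const [simp]: "periodic (\<lambda>x. c)"
  and periodic_shift: "periodic g \<Longrightarrow> periodic (\<lambda>x. g (x + v))"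
  unfolding periodic_def
  by simp_all (metis add.assoc add.commute)

lemma countable_int_vec: "countable (int_vec :: (real ^ 'n) set)"
proof -
  have "int_vec \<subseteq> (\<lambda>f :: 'n \<Rightarrow> int. \<chi> i. of_int (f i)) ` UNIV"
  proof
    fix k :: "real ^ 'n" assume "k \<in> int_vec"
    then have "k = (\<chi> i. of_int \<lfloor>k $ i\<rfloor>)" by (auto simp: int_vec_def vec_eq_iff)
    then show "k \<in> (\<lambda>f :: 'n \<Rightarrow> int. \<chi> i. of_int (f i)) ` UNIV"
      by (intro image_eqI[where x = "\<lambda>i. \<lfloor>k $ i\<rfloor>"]) auto
  qed
  then show ?thesis by (rule countable_subset) simp
qed

lemma nn_integral_lborel_shift:
  assumes [measurable]: "g \<in> borel_measurable borel"
  shows "(\<integral>\<^sup>+ x. g (x + v) \<partial>lborel) = (\<integral>\<^sup>+ x. g x \<partial>(lborel :: 'a::euclidean_space measure))"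
  by (subst (2) lborel_distr_plus[of v, symmetric], subst nn_integral_distr) (auto simp: add.commute)

lemma sets_cell [measurable_cong]: "sets cell = sets (restrict_space borel unit_cell)"
  by (simp add: cell_def sets_restrict_space)

lemma space_cell: "space cell = unit_cell"
  by (simp add: cell_def space_restrict_space)

lemma borel_measurable_cell [measurable (raw)]:
  "g \<in> borel_measurable borel \<Longrightarrow> g \<in> borel_measurable cell"
  by (simp add: cell_def measurable_restrict_space1)

lemma nn_integral_cell:
  "g \<in> borel_measurable borel \<Longrightarrow>
    (\<integral>\<^sup>+ x. g x \<partial>cell) = (\<integral>\<^sup>+ x. g x * indicator unit_cell x \<partial>lborel)"
  by (simp add: cell_def nn_integral_restrict_space)

text \<open>Both cells are fundamental domains: cut either of them into its pieces in the integer
  translates of the other one.\<close>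
lemma nn_integral_cell_shift:
  fixes g :: "real ^ 'n \<Rightarrow> ennreal"
  assumes [measurable]: "g \<in> borel_measurable borel" and g: "periodic g"
  shows "(\<integral>\<^sup>+ x. g (x + v) \<partial>cell) = (\<integral>\<^sup>+ x. g x \<partial>cell)"
proof -
  let ?C = "unit_cell :: (real ^ 'n) set" and ?Z = "int_vec :: (real ^ 'n) set"
  have tile: "(\<integral>\<^sup>+ k. indicator ?C (x + k) \<partial>count_space ?Z) = 1" for x
  proof -
    have "indicator ?C (x + k) = (indicator {frac_vec x - x} k :: ennreal)" if "k \<in> ?Z" for k
    proof -
      have "x + k \<in> ?C \<longleftrightarrow> k = frac_vec x - x"
      proof
        assume "x + k \<in> ?C"
        then have "0 \<le> x $ i + k $ i" "x $ i + k $ i < 1" "k $ i \<in> \<int>" for i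
          using that by (auto simp: unit_cell_def int_vec_def)
        then have "frac (x $ i) = x $ i + k $ i" for i
          by (subst frac_unique_iff) auto
        then show "k = frac_vec x - x" by (simp add: vec_eq_iff frac_vec_def)
      qed (use frac_vec_in_unit_cell[of x] in simp)
      then show ?thesis by (auto simp: indicator_def)
    qed
    then have "(\<integral>\<^sup>+ k. indicator ?C (x + k) \<partial>count_space ?Z)
        = (\<integral>\<^sup>+ k. indicator {frac_vec x - x} k \<partial>count_space ?Z)"
      by (intro nn_integral_cong) auto
    also have "\<dots> = 1" using frac_vec_diff_int[of x] by (subst nn_integral_indicator) auto
    finally show ?thesis .
  qed
  have tile': "(\<integral>\<^sup>+ k. indicator ?C (x - k) \<partial>count_space ?Z) = 1" for x
  proof -
    have "bij_betw uminus ?Z ?Z"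
      by (rule bij_betw_byWitness[where f'=uminus]) (auto simp: int_vec_def)
    from nn_integral_bij_count_space[OF this, of "\<lambda>k. indicator ?C (x + k)"] show ?thesis
      using tile[of x] by simp
  qed
  have gk: "g (x - k) = g x" if "k \<in> ?Z" for x k
    using periodic_int_vec[OF g that, of "x - k"] by simp
  have "(\<integral>\<^sup>+ x. g x \<partial>cell) = (\<integral>\<^sup>+ x. (\<integral>\<^sup>+ k. g x * indicator ?C x * indicator ?C (x - v + k) \<partial>count_space ?Z) \<partial>lborel)"
    by (simp add: nn_integral_cell nn_integral_cmult tile)
  also have "\<dots> = (\<integral>\<^sup>+ k. (\<integral>\<^sup>+ x. g x * indicator ?C x * indicator ?C (x - v + k) \<partial>lborel) \<partial>count_space ?Z)"
    by (rule nn_integral_count_space_nn_integral[OF countable_int_vec]) measurable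
  also have "\<dots> = (\<integral>\<^sup>+ k. (\<integral>\<^sup>+ x. g (x + v) * indicator ?C (x + v - k) * indicator ?C x \<partial>lborel) \<partial>count_space ?Z)"
  proof (rule nn_integral_cong)
    fix k assume "k \<in> space (count_space ?Z)"
    then have k: "k \<in> ?Z" by simp
    show "(\<integral>\<^sup>+ x. g x * indicator ?C x * indicator ?C (x - v + k) \<partial>lborel)
      = (\<integral>\<^sup>+ x. g (x + v) * indicator ?C (x + v - k) * indicator ?C x \<partial>lborel)"
      by (subst nn_integral_lborel_shift[where v = "v - k", symmetric])
        (use gk[OF k, of "_ + v"] in \<open>auto simp: add_diff_eq\<close>)
  qed
  also have "\<dots> = (\<integral>\<^sup>+ x. (\<integral>\<^sup>+ k. g (x + v) * indicator ?C (x + v - k) * indicator ?C x \<partial>count_space ?Z) \<partial>lborel)"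
    by (rule nn_integral_count_space_nn_integral[OF countable_int_vec, symmetric]) measurable
  also have "\<dots> = (\<integral>\<^sup>+ x. g (x + v) \<partial>cell)"
    by (simp add: nn_integral_cell nn_integral_cmult nn_integral_multc tile')
  finally show ?thesis by simp
qed

lemma emeasure_unit_cell: "emeasure lborel (unit_cell :: (real ^ 'n) set) = 1"
  and AE_box_unit_cell: "AE x in lborel. x \<in> box 0 (1 :: real ^ 'n) \<longleftrightarrow> x \<in> unit_cell"
proof -
  have sub: "box 0 (1 :: real ^ 'n) \<subseteq> unit_cell" "unit_cell \<subseteq> cbox 0 (1 :: real ^ 'n)"
    by (auto simp: unit_cell_def mem_box_cart less_imp_le)
  have 1: "emeasure lborel (box 0 (1 :: real ^ 'n)) = 1" "emeasure lborel (cbox 0 (1 :: real ^ 'n)) = 1"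
    by (auto simp: emeasure_lborel_box_eq emeasure_lborel_cbox_eq Basis_vec_def inner_axis intro!: prod.neutral)
  show "emeasure lborel (unit_cell :: (real ^ 'n) set) = 1"
    using emeasure_mono[OF sub(1), of lborel] emeasure_mono[OF sub(2), of lborel] 1
    by (intro antisym) simp_all
  have "cbox 0 1 - box 0 (1 :: real ^ 'n) \<in> null_sets lborel"
    using 1 by (auto simp: null_sets_def emeasure_Diff box_subset_cbox)
  then show "AE x in lborel. x \<in> box 0 (1 :: real ^ 'n) \<longleftrightarrow> x \<in> unit_cell"
    by (rule AE_I') (use sub in auto)
qed

interpretation cell: finite_measure "cell :: (real ^ 'n) measure"
proof
  have "emeasure cell (space cell :: (real ^ 'n) set) = emeasure lborel (unit_cell :: (real ^ 'n) set)"
    unfolding space_cell unfolding cell_def by (subst emeasure_restrict_space) auto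
  then show "emeasure cell (space cell :: (real ^ 'n) set) \<noteq> \<infinity>"
    by (simp add: emeasure_unit_cell)
qed

lemma measure_cell [simp]: "measure (cell :: (real ^ 'n) measure) unit_cell = 1"
  unfolding cell_def by (subst measure_restrict_space) (auto simp: measure_def emeasure_unit_cell)

text \<open>A periodic function factors through \<open>frac_vec\<close>, and by the nonnegative case
  a preceding shift does not change the push-forward of the cell measure under
  \<open>frac_vec\<close>. Comparing push-forwards makes the statement independent of
  integrability.\<close>

lemma integral_cell_shift:
  fixes g :: "real ^ 'n \<Rightarrow> 'b::{banach, second_countable_topology}"
  assumes g[measurable]: "g \<in> borel_measurable borel" and per: "periodic g"
  shows "(\<integral> x. g (x + v) \<partial>cell) = (\<integral> x. g x \<partial>cell)"
proof -
  have "distr cell borel (\<lambda>x :: real ^ 'n. frac_vec (x + v)) = distr cell borel frac_vec"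
  proof (rule measure_eqI)
    fix A :: "(real ^ 'n) set" assume "A \<in> sets (distr cell borel (\<lambda>x. frac_vec (x + v)))"
    then have [measurable]: "A \<in> sets borel" by simp
    have "emeasure (distr cell borel (\<lambda>x. frac_vec (x + v))) A
        = (\<integral>\<^sup>+ x. indicator A (frac_vec (x + v)) \<partial>cell)"
      by (subst nn_integral_indicator[symmetric], simp, subst nn_integral_distr) auto
    also have "\<dots> = (\<integral>\<^sup>+ x. indicator A (frac_vec x) \<partial>cell)"
      by (rule nn_integral_cell_shift) (auto intro: periodic_comp_frac_vec)
    also have "\<dots> = emeasure (distr cell borel frac_vec) A"
      by (subst nn_integral_indicator[symmetric], simp, subst nn_integral_distr) auto
    finally show "emeasure (distr cell borel (\<lambda>x. frac_vec (x + v))) A = emeasure (distr cell borel frac_vec) A" .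
  qed simp
  then have "integral\<^sup>L (distr cell borel (\<lambda>x :: real ^ 'n. frac_vec (x + v))) g = integral\<^sup>L (distr cell borel frac_vec) g"
    by simp
  then show ?thesis by (simp add: integral_distr periodic_frac_vec[OF per])
qed

section \<open>Mean values and L2 norms\<close>

abbreviation mean :: "(real ^ 'n \<Rightarrow> real) \<Rightarrow> real"
  where "mean g \<equiv> integral\<^sup>L cell g"

definition l2 :: "(real ^ 'n \<Rightarrow> real) \<Rightarrow> real"
  where "l2 g = sqrt (mean (\<lambda>x. (g x)\<^sup>2))"

text \<open>\<open>bper\<close> contains the phases, \<open>cper\<close> the mollified displacement
  and its derivatives, for which integrals along segments are taken. Boundedness settles every
  integrability question for means of products.\<close>

definition bper :: "(real ^ 'n \<Rightarrow> real) \<Rightarrow> bool"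
  where "bper g \<longleftrightarrow> g \<in> borel_measurable borel \<and> bounded (range g) \<and> periodic g"

definition cper :: "(real ^ 'n \<Rightarrow> real) \<Rightarrow> bool"
  where "cper g \<longleftrightarrow> continuous_on UNIV g \<and> periodic g"

lemma bper_const [simp]: "bper (\<lambda>x. c)"
  by (simp add: bper_def)

lemma bounded_range_real_iff: "bounded (range g) \<longleftrightarrow> (\<exists>B. \<forall>x. \<bar>g x :: real\<bar> \<le> B)"
  by (auto simp: bounded_iff)

lemma bper_add: "bper g \<Longrightarrow> bper k \<Longrightarrow> bper (\<lambda>x. g x + k x)"
  and bper_diff: "bper g \<Longrightarrow> bper k \<Longrightarrow> bper (\<lambda>x. g x - k x)"
proof -
  assume g: "bper g" and k: "bper k"
  obtain B C where B: "\<And>x. \<bar>g x\<bar> \<le> B" and C: "\<And>x. \<bar>k x\<bar> \<le> C"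
    using g k unfolding bper_def bounded_range_real_iff by auto
  have "\<bar>g x + k x\<bar> \<le> B + C" "\<bar>g x - k x\<bar> \<le> B + C" for x using B[of x] C[of x] by auto
  then show "bper (\<lambda>x. g x + k x)" "bper (\<lambda>x. g x - k x)"
    using g k unfolding bper_def bounded_range_real_iff by (auto simp: periodic_def)
qed

lemma bper_mult: "bper g \<Longrightarrow> bper k \<Longrightarrow> bper (\<lambda>x. g x * k x)"
proof -
  assume g: "bper g" and k: "bper k"
  obtain B C where B: "\<And>x. \<bar>g x\<bar> \<le> B" and C: "\<And>x. \<bar>k x\<bar> \<le> C"
    using g k unfolding bper_def bounded_range_real_iff by auto
  have "\<bar>g x * k x\<bar> \<le> B * C" for x
    using mult_mono[OF B C, of x x] B[of x] by (simp add: abs_mult)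
  with g k show "bper (\<lambda>x. g x * k x)"
    unfolding bper_def bounded_range_real_iff by (auto simp: periodic_def)
qed

lemma bper_minus: "bper g \<Longrightarrow> bper (\<lambda>x. - g x)"
  and bper_cmult: "bper g \<Longrightarrow> bper (\<lambda>x. c * g x)"
  and bper_power2: "bper g \<Longrightarrow> bper (\<lambda>x. (g x)\<^sup>2)"
  using bper_mult[of "\<lambda>_. - 1" g] bper_mult[of "\<lambda>_. c" g] bper_mult[of g g]
  by (simp_all add: power2_eq_square)

lemma bper_shift: "bper g \<Longrightarrow> bper (\<lambda>x. g (x + v))"
  unfolding bper_def by (auto intro!: periodic_shift simp: bounded_range_real_iff)

lemma bper_abs: "bper g \<Longrightarrow> bper (\<lambda>x. \<bar>g x\<bar>)"
  unfolding bper_def by (auto simp: bounded_range_real_iff periodic_def)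

lemmas bper_intros = bper_const bper_add bper_diff bper_mult bper_minus bper_cmult bper_power2

lemma cper_imp_bper: "cper g \<Longrightarrow> bper g"
proof -
  assume g: "cper g"
  then have "compact (g ` cbox 0 1)"
    by (intro compact_continuous_image) (auto simp: cper_def intro: continuous_on_subset)
  moreover have "range g \<subseteq> g ` cbox 0 1"
  proof
    fix y assume "y \<in> range g"
    then obtain x where "y = g x" by auto
    then have "y = g (frac_vec x)" using g by (simp add: cper_def periodic_frac_vec)
    moreover have "frac_vec x \<in> cbox 0 1"
      using frac_vec_in_unit_cell[of x] by (auto simp: unit_cell_def mem_box_cart less_imp_le)
    ultimately show "y \<in> g ` cbox 0 1" by blast
  qed
  ultimately show "bper g"
    using g bounded_subset compact_imp_bounded
    by (auto simp: bper_def cper_def intro: borel_measurable_continuous_onI)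
qed

lemma cper_const [simp]: "cper (\<lambda>x. c)"
  and cper_add: "cper g \<Longrightarrow> cper k \<Longrightarrow> cper (\<lambda>x. g x + k x)"
  and cper_diff: "cper g \<Longrightarrow> cper k \<Longrightarrow> cper (\<lambda>x. g x - k x)"
  and cper_mult: "cper g \<Longrightarrow> cper k \<Longrightarrow> cper (\<lambda>x. g x * k x)"
  and cper_cmult: "cper g \<Longrightarrow> cper (\<lambda>x. c * g x)"
  and cper_minus: "cper g \<Longrightarrow> cper (\<lambda>x. - g x)"
  unfolding cper_def periodic_def by (auto intro!: continuous_intros)

lemma cper_shift: "cper g \<Longrightarrow> cper (\<lambda>x. g (x + v))"
  unfolding cper_def
  by (auto intro!: periodic_shift continuous_intros intro: continuous_on_compose2[of UNIV g UNIV "\<lambda>x. x + v"])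

lemma bper_integrable: "bper g \<Longrightarrow> integrable cell g"
proof -
  assume g: "bper g"
  then obtain B where "\<And>x. \<bar>g x\<bar> \<le> B" unfolding bper_def bounded_range_real_iff by auto
  then have "AE x in cell. norm (g x) \<le> B" by (intro AE_I2) simp
  then show "integrable cell g"
    by (rule cell.integrable_const_bound) (use g borel_measurable_cell in \<open>auto simp: bper_def\<close>)
qed

lemma mean_const [simp]: "mean (\<lambda>x. c :: real) = c"
  by (simp add: space_cell)

lemma mean_add: "bper g \<Longrightarrow> bper k \<Longrightarrow> mean (\<lambda>x. g x + k x) = mean g + mean k"
  and mean_diff: "bper g \<Longrightarrow> bper k \<Longrightarrow> mean (\<lambda>x. g x - k x) = mean g - mean k"
  by (simp_all add: bper_integrable)

lemma mean_mono: "bper g \<Longrightarrow> bper k \<Longrightarrow> (\<And>x. g x \<le> k x) \<Longrightarrow> mean g \<le> mean k"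
  by (intro integral_mono bper_integrable)

lemma mean_shift: "bper g \<Longrightarrow> mean (\<lambda>x. g (x + v)) = mean g"
  by (intro integral_cell_shift) (auto simp: bper_def)

lemma mean_mult_shift: "bper g \<Longrightarrow> bper k \<Longrightarrow> mean (\<lambda>x. g (x + v) * k x) = mean (\<lambda>x. g x * k (x - v))"
  using mean_shift[of "\<lambda>x. g x * k (x - v)" v] bper_shift[of k "- v"] by (simp add: bper_mult)

lemma l2_nonneg [simp]: "0 \<le> l2 g"
  by (simp add: l2_def)

lemma l2_power2: "(l2 g)\<^sup>2 = mean (\<lambda>x. (g x)\<^sup>2)"
  by (simp add: l2_def)

lemma mean_mult_le_l2:
  assumes g: "bper g" and k: "bper k"
  shows "\<bar>mean (\<lambda>x. g x * k x)\<bar> \<le> l2 g * l2 k"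
proof -
  define A where "A = mean (\<lambda>x. (g x)\<^sup>2)"
  define B where "B = mean (\<lambda>x. g x * k x)"
  define C where "C = mean (\<lambda>x. (k x)\<^sup>2)"
  have C0: "0 \<le> C" and A0: "0 \<le> A" by (simp_all add: C_def A_def)
  have *: "0 \<le> A - 2 * t * B + t\<^sup>2 * C" for t
  proof -
    have "0 \<le> mean (\<lambda>x. (g x - t * k x)\<^sup>2)" by simp
    also have "\<dots> = mean (\<lambda>x. ((g x)\<^sup>2 - (2 * t) * (g x * k x)) + t\<^sup>2 * (k x)\<^sup>2)"
      by (intro Bochner_Integration.integral_cong) (auto simp: power2_eq_square algebra_simps)
    also have "\<dots> = A - 2 * t * B + t\<^sup>2 * C"
      unfolding A_def B_def C_def by (subst mean_add mean_diff, (intro bper_intros g k)+)+ simp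
    finally show ?thesis .
  qed
  have "B\<^sup>2 \<le> A * C"
  proof (cases "C = 0")
    case True
    have "B = 0"
    proof (rule ccontr)
      assume "B \<noteq> 0"
      \<comment> \<open>For \<open>C = 0\<close> the bound in \<open>*\<close> is affine in
        \<open>t\<close>, and at this point it equals -1.\<close>
      then show False using *[of "(A + 1) / (2 * B)"] True by (simp add: field_simps)
    qed
    then show ?thesis using True by simp
  next
    case False
    then show ?thesis using *[of "B / C"] C0 by (simp add: field_simps power2_eq_square)
  qed
  then have "sqrt (B\<^sup>2) \<le> sqrt (A * C)" by (rule real_sqrt_le_mono)
  then show ?thesis by (simp add: A_def B_def C_def l2_def real_sqrt_mult)
qed

lemma l2_add_le:
  assumes g: "bper g" and k: "bper k"
  shows "l2 (\<lambda>x. g x + k x) \<le> l2 g + l2 k"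
proof (rule power2_le_imp_le)
  have "(l2 (\<lambda>x. g x + k x))\<^sup>2 = mean (\<lambda>x. ((g x)\<^sup>2 + 2 * (g x * k x)) + (k x)\<^sup>2)"
    unfolding l2_power2 by (intro Bochner_Integration.integral_cong) (auto simp: power2_eq_square algebra_simps)
  also have "\<dots> = (l2 g)\<^sup>2 + 2 * mean (\<lambda>x. g x * k x) + (l2 k)\<^sup>2"
    unfolding l2_power2 by (subst mean_add, (intro bper_intros g k)+)+ simp
  also have "\<dots> \<le> (l2 g + l2 k)\<^sup>2"
    using mean_mult_le_l2[OF g k] by (simp add: power2_sum)
  finally show "(l2 (\<lambda>x. g x + k x))\<^sup>2 \<le> (l2 g + l2 k)\<^sup>2" .
qed simp

lemma l2_cmult: "l2 (\<lambda>x. c * g x) = \<bar>c\<bar> * l2 g"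
  by (simp add: l2_def power_mult_distrib real_sqrt_mult)

lemma l2_minus: "l2 (\<lambda>x. - g x) = l2 g"
  by (simp add: l2_def)

lemma l2_diff_le: "bper g \<Longrightarrow> bper k \<Longrightarrow> l2 (\<lambda>x. g x - k x) \<le> l2 g + l2 k"
  using l2_add_le[of g "\<lambda>x. - k x"] by (simp add: bper_minus l2_minus)

lemma l2_shift: "bper g \<Longrightarrow> l2 (\<lambda>x. g (x + v)) = l2 g"
  using mean_shift[of "\<lambda>x. (g x)\<^sup>2" v] by (simp add: l2_def bper_power2)

lemma l2_le_bound:
  fixes g :: "real ^ 'n \<Rightarrow> real"
  assumes "bper g" "\<And>x. \<bar>g x\<bar> \<le> B"
  shows "l2 g \<le> B"
proof (rule power2_le_imp_le)
  show B: "0 \<le> B" using assms(2)[of 0] by linarith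
  have "(l2 g)\<^sup>2 \<le> mean (\<lambda>x :: real ^ 'n. B\<^sup>2)"
    unfolding l2_power2
  proof (intro mean_mono bper_power2 bper_const assms(1))
    show "(g x)\<^sup>2 \<le> B\<^sup>2" for x using assms(2)[of x] B abs_le_square_iff[of "g x" B] by simp
  qed
  then show "(l2 g)\<^sup>2 \<le> B\<^sup>2" by (simp add: space_cell)
qed

lemma l2_mono: "bper g \<Longrightarrow> bper k \<Longrightarrow> (\<And>x. \<bar>g x\<bar> \<le> \<bar>k x\<bar>) \<Longrightarrow> l2 g \<le> l2 k"
  unfolding l2_def by (intro real_sqrt_le_mono mean_mono bper_intros) (auto simp: abs_le_square_iff[symmetric])

lemma mean_le_l2: "bper g \<Longrightarrow> \<bar>mean g\<bar> \<le> l2 g"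
  using mean_mult_le_l2[of g "\<lambda>_. 1"] by (simp add: l2_def space_cell)

text \<open>A bridge to the gauge integral over the closed cube, where iterated integrals of
  continuous functions can be swapped.\<close>

lemma mean_eq_integral:
  fixes g :: "real ^ 'n \<Rightarrow> real"
  assumes "continuous_on UNIV g"
  shows "mean g = integral (cbox 0 1) g"
proof -
  have [measurable]: "g \<in> borel_measurable borel" using assms by (rule borel_measurable_continuous_onI)
  have 1: "set_integrable lborel (cbox 0 1) g"
    using assms by (intro borel_integrable_compact[unfolded set_integrable_def[symmetric]])
      (auto intro: continuous_on_subset simp: set_integrable_def)
  have "mean g = (LINT x:unit_cell|lborel. g x)"
    unfolding cell_def set_lebesgue_integral_def
    by (subst integral_restrict_space) auto
  also have "\<dots> = (LINT x:cbox 0 1|lborel. g x)"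
  proof -
    have n: "cbox 0 1 - box 0 (1 :: real ^ 'n) \<in> null_sets lborel"
      using negligible_frontier_interval[of 0 "1 :: real ^ 'n"]
      by (simp add: negligible_iff_null_sets null_sets_completion_iff)
    have "AE x in lborel. x \<in> cbox 0 (1 :: real ^ 'n) \<longleftrightarrow> x \<in> box 0 1"
      by (rule AE_I'[OF n]) (use box_subset_cbox[of 0 "1 :: real ^ 'n"] in auto)
    then show ?thesis
      using AE_box_unit_cell unfolding set_lebesgue_integral_def
      by (intro integral_cong_AE) (auto simp: indicator_def)
  qed
  also have "\<dots> = integral (cbox 0 1) g"
    using 1 by (rule set_borel_integral_eq_integral(2))
  finally show ?thesis .
qed

text \<open>Minkowski's integral inequality: test the integral against itself.\<close>
lemma l2_integral_le:
  fixes F :: "real \<Rightarrow> real ^ 'n \<Rightarrow> real"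
  assumes cont: "continuous_on UNIV (\<lambda>(s, x). F s x)" and per: "\<And>s. periodic (F s)"
    and r: "0 \<le> r" and B: "\<And>s. s \<in> {0..r} \<Longrightarrow> l2 (F s) \<le> B"
  shows "cper (\<lambda>x. integral {0..r} (\<lambda>s. F s x))"
    and "l2 (\<lambda>x. integral {0..r} (\<lambda>s. F s x)) \<le> r * B"
proof -
  define g where "g = (\<lambda>x. integral {0..r} (\<lambda>s. F s x))"
  have c2: "continuous_on UNIV (\<lambda>(x, s). F s x)"
  proof -
    have "continuous_on UNIV (\<lambda>p. (\<lambda>(s, x). F s x) (snd p, fst p))"
      by (rule continuous_on_compose2[OF cont]) (auto intro!: continuous_intros)
    then show ?thesis by (simp add: case_prod_unfold)
  qed
  have contg: "continuous_on UNIV g"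
    unfolding g_def using integral_continuous_on_param[of UNIV 0 r "\<lambda>x s. F s x"]
    by (simp add: continuous_on_subset[OF c2])
  show g: "cper g"
    using contg per unfolding cper_def g_def periodic_def by auto
  have cF: "continuous_on UNIV (F s)" for s
  proof -
    have "continuous_on UNIV (\<lambda>x. (\<lambda>(s, x). F s x) (s, x))"
      by (rule continuous_on_compose2[OF cont]) (auto intro!: continuous_intros)
    then show ?thesis by simp
  qed
  have Fg: "continuous_on UNIV (\<lambda>(s, x). F s x * g x)"
    using cont continuous_on_compose2[OF contg continuous_on_snd[OF continuous_on_id], of UNIV]
    by (auto simp: case_prod_unfold intro!: continuous_intros)
  have bF: "bper (F s)" for s using cF per by (intro cper_imp_bper) (auto simp: cper_def)
  have "(l2 g)\<^sup>2 = integral (cbox 0 1) (\<lambda>x. integral (cbox 0 r) (\<lambda>s. F s x * g x))"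
  proof -
    have "(l2 g)\<^sup>2 = mean (\<lambda>x. g x * g x)" unfolding l2_power2 by (simp add: power2_eq_square)
    also have "\<dots> = integral (cbox 0 1) (\<lambda>x. g x * g x)"
      by (intro mean_eq_integral continuous_intros contg)
    also have "\<dots> = integral (cbox 0 1) (\<lambda>x. integral (cbox 0 r) (\<lambda>s. F s x * g x))"
      by (simp add: g_def)
    finally show ?thesis .
  qed
  also have "\<dots> = integral (cbox 0 r) (\<lambda>s. integral (cbox 0 1) (\<lambda>x. F s x * g x))"
    by (rule integral_swap_continuous[symmetric]) (rule continuous_on_subset[OF Fg], simp)
  also have "\<dots> \<le> integral (cbox 0 r) (\<lambda>s. B * l2 g)"
  proof (rule integral_le)
    show "(\<lambda>s. integral (cbox 0 1) (\<lambda>x. F s x * g x)) integrable_on cbox 0 r"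
      by (intro integrable_continuous integral_continuous_on_param) (rule continuous_on_subset[OF Fg], simp)
    fix s assume s: "s \<in> cbox 0 r"
    have "integral (cbox 0 1) (\<lambda>x. F s x * g x) = mean (\<lambda>x. F s x * g x)"
      by (intro mean_eq_integral[symmetric] continuous_intros contg cF)
    also have "\<dots> \<le> l2 (F s) * l2 g"
      using mean_mult_le_l2[OF bF cper_imp_bper[OF g]] by (simp add: abs_le_iff)
    also have "\<dots> \<le> B * l2 g" using B s by (intro mult_right_mono) auto
    finally show "integral (cbox 0 1) (\<lambda>x. F s x * g x) \<le> B * l2 g" .
  qed (intro integrable_continuous continuous_intros)
  also have "\<dots> = r * B * l2 g" using r by simp
  finally have *: "l2 g * l2 g \<le> r * B * l2 g" by (simp add: power2_eq_square)
  show "l2 g \<le> r * B"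
  proof (cases "l2 g = 0")
    case True
    have "0 \<le> B" using order_trans[OF l2_nonneg B[of 0]] r by simp
    then show ?thesis using True r by simp
  next
    case False
    then show ?thesis using * l2_nonneg[of g] by simp
  qed
qed

section \<open>Differences and partial derivatives\<close>

definition tdiff :: "real ^ 'n \<Rightarrow> (real ^ 'n \<Rightarrow> real) \<Rightarrow> real ^ 'n \<Rightarrow> real"
  where "tdiff v g x = g (x + v) - g x"

definition lint :: "'n \<Rightarrow> real \<Rightarrow> (real ^ 'n \<Rightarrow> real) \<Rightarrow> real ^ 'n \<Rightarrow> real"
  where "lint z r g x = integral {0..r} (\<lambda>s. g (x + s *\<^sub>R axis z 1))"

definition has_partial :: "'n \<Rightarrow> (real ^ 'n \<Rightarrow> real) \<Rightarrow> (real ^ 'n \<Rightarrow> real) \<Rightarrow> bool"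
  where "has_partial z g g' \<longleftrightarrow> cper g \<and> cper g' \<and>
    (\<forall>x. ((\<lambda>s. g (x + s *\<^sub>R axis z 1)) has_real_derivative g' x) (at 0))"

lemma bper_tdiff: "bper g \<Longrightarrow> bper (tdiff v g)"
  unfolding tdiff_def[abs_def] by (intro bper_diff bper_shift)

lemma cper_tdiff: "cper g \<Longrightarrow> cper (tdiff v g)"
  unfolding tdiff_def[abs_def] by (intro cper_diff cper_shift)

lemma l2_tdiff_le: "bper g \<Longrightarrow> l2 (tdiff v g) \<le> 2 * l2 g"
  unfolding tdiff_def[abs_def] using l2_diff_le[of "\<lambda>x. g (x + v)" g] by (simp add: bper_shift l2_shift)

lemma l2_tdiff_uminus: "bper g \<Longrightarrow> l2 (tdiff (- v) g) = l2 (tdiff v g)"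
proof -
  assume g: "bper g"
  have "tdiff (- v) g = (\<lambda>x. - tdiff v g (x + - v))"
    by (simp add: tdiff_def fun_eq_iff)
  then show ?thesis using l2_shift[OF bper_tdiff[OF g], of v "- v"] by (simp add: l2_minus)
qed

lemma mean_tdiff_mult:
  "bper g \<Longrightarrow> bper k \<Longrightarrow> mean (\<lambda>x. tdiff v g x * k x) = mean (\<lambda>x. g x * tdiff (- v) k x)"
proof -
  assume g: "bper g" and k: "bper k"
  have k': "bper (\<lambda>x. k (x - v))" using bper_shift[OF k, of "- v"] by simp
  have "mean (\<lambda>x. tdiff v g x * k x) = mean (\<lambda>x. g (x + v) * k x - g x * k x)"
    by (intro Bochner_Integration.integral_cong refl) (simp add: tdiff_def algebra_simps)
  also have "\<dots> = mean (\<lambda>x. g x * k (x - v)) - mean (\<lambda>x. g x * k x)"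
    using mean_mult_shift[OF g k, of v] by (subst mean_diff) (simp_all add: bper_mult bper_shift g k)
  also have "\<dots> = mean (\<lambda>x. g x * k (x - v) - g x * k x)"
    by (subst mean_diff) (simp_all add: bper_mult g k k')
  also have "\<dots> = mean (\<lambda>x. g x * tdiff (- v) k x)"
    by (intro Bochner_Integration.integral_cong refl) (simp add: tdiff_def algebra_simps)
  finally show ?thesis .
qed

lemma cper_compose: "cper g \<Longrightarrow> continuous_on S k \<Longrightarrow> continuous_on S (\<lambda>s. g (k s))"
  unfolding cper_def by (elim conjE) (erule continuous_on_compose2, simp_all)

lemma cper_line: "cper g \<Longrightarrow> continuous_on S (\<lambda>s. g (x + s *\<^sub>R axis z 1))"
  by (erule cper_compose) (intro continuous_intros)

lemma cper_joint: "cper g \<Longrightarrow> continuous_on UNIV (\<lambda>(s, x). g (x + s *\<^sub>R axis z 1))"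
  unfolding case_prod_unfold by (erule cper_compose) (intro continuous_intros)

lemma
  assumes g: "cper g" and r: "0 \<le> r"
  shows cper_lint: "cper (lint z r g)" and l2_lint_le: "l2 (lint z r g) \<le> r * l2 g"
proof -
  have "periodic (\<lambda>x. g (x + s *\<^sub>R axis z 1))" for s
    using g by (simp add: cper_def periodic_shift)
  from l2_integral_le[OF cper_joint[OF g] this r, of "l2 g"]
  show "cper (lint z r g)" "l2 (lint z r g) \<le> r * l2 g"
    using l2_shift[OF cper_imp_bper[OF g]] unfolding lint_def[abs_def] by auto
qed

text \<open>The difference is the integral over \<open>s\<close> of
  \<open>tdiff (s *\<^sub>R axis z 1) g\<close>, so Minkowski's inequality applies. In this way
  almost invariance along a segment allows a function to be replaced by its segment average.\<close>

lemma l2_lint_diff_le: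
  assumes g: "cper g" and r: "0 \<le> r" and B: "\<And>s. s \<in> {0..r} \<Longrightarrow> l2 (tdiff (s *\<^sub>R axis z 1) g) \<le> B"
  shows "l2 (\<lambda>x. lint z r g x - r * g x) \<le> r * B"
proof -
  have c: "continuous_on UNIV (\<lambda>(s, x). tdiff (s *\<^sub>R axis z 1) g x)"
  proof -
    have "continuous_on UNIV (\<lambda>p :: real \<times> (real ^ 'a). g (snd p))"
      by (intro cper_compose[OF g] continuous_intros)
    then show ?thesis
      using cper_joint[OF g, of z] unfolding tdiff_def case_prod_unfold by (intro continuous_on_diff)
  qed
  have p: "periodic (tdiff (s *\<^sub>R axis z 1) g)" for s
    using cper_tdiff[OF g] by (simp add: cper_def)
  have "lint z r g x - r * g x = integral {0..r} (\<lambda>s. tdiff (s *\<^sub>R axis z 1) g x)" for x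
    unfolding lint_def tdiff_def using r
    by (subst integral_diff) (auto intro!: integrable_continuous_interval cper_line[OF g])
  then show ?thesis using l2_integral_le(2)[OF c p r B] by simp
qed

lemma tdiff_lint: "cper g \<Longrightarrow> tdiff v (lint z r g) = lint z r (tdiff v g)"
proof
  fix x assume g: "cper g"
  have "(\<lambda>s. g (x + v + s *\<^sub>R axis z 1)) = (\<lambda>s. g (x + s *\<^sub>R axis z 1 + v))"
    by (simp add: add_ac)
  then show "tdiff v (lint z r g) x = lint z r (tdiff v g) x"
    unfolding lint_def tdiff_def
    using integral_diff[OF integrable_continuous_interval integrable_continuous_interval,
        OF cper_line[OF cper_shift[OF g]] cper_line[OF g], of 0 r x z v x z] by simp
qed

lemma tdiff_commute: "tdiff v (tdiff w g) = tdiff w (tdiff v g)"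
  by (simp add: tdiff_def fun_eq_iff add_ac)

lemma tdiff_add: "tdiff v (\<lambda>x. g x + k x) = (\<lambda>x. tdiff v g x + tdiff v k x)"
  and tdiff_cmult: "tdiff v (\<lambda>x. c * g x) = (\<lambda>x. c * tdiff v g x)"
  by (simp_all add: tdiff_def fun_eq_iff algebra_simps)

lemma lint_add: "cper g \<Longrightarrow> cper k \<Longrightarrow> lint z r (\<lambda>x. g x + k x) = (\<lambda>x. lint z r g x + lint z r k x)"
  unfolding lint_def by (rule ext, subst integral_add) (auto intro!: integrable_continuous_interval cper_line)

lemma lint_commute:
  assumes g: "cper g"
  shows "lint a r (lint b s g) = lint b s (lint a r g)"
proof
  fix x
  have "continuous_on UNIV (\<lambda>p. g (x + fst p *\<^sub>R axis a 1 + snd p *\<^sub>R axis b 1))"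
    by (intro cper_compose[OF g] continuous_intros)
  then have "integral (cbox 0 r) (\<lambda>t. integral (cbox 0 s) (\<lambda>u. g (x + t *\<^sub>R axis a 1 + u *\<^sub>R axis b 1)))
    = integral (cbox 0 s) (\<lambda>u. integral (cbox 0 r) (\<lambda>t. g (x + t *\<^sub>R axis a 1 + u *\<^sub>R axis b 1)))"
    by (intro integral_swap_continuous) (auto simp: case_prod_unfold intro: continuous_on_subset)
  then show "lint a r (lint b s g) x = lint b s (lint a r g) x"
    by (simp add: lint_def add_ac)
qed

text \<open>Periodicity of \<open>g\<close> is not assumed, because the periodicity of the
  displacement \<open>w\<close> is itself derived from this identity.\<close>

lemma lint_derivative:
  assumes g': "\<And>x. ((\<lambda>s. g (x + s *\<^sub>R axis z 1)) has_real_derivative g' x) (at 0)" and r: "0 \<le> r"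
  shows "lint z r g' = tdiff (r *\<^sub>R axis z 1) g"
proof
  fix x
  have "((\<lambda>s. g (x + s *\<^sub>R axis z 1)) has_real_derivative g' (x + s *\<^sub>R axis z 1)) (at s)" for s
  proof -
    have "((\<lambda>t. g (x + s *\<^sub>R axis z 1 + t *\<^sub>R axis z 1)) has_real_derivative g' (x + s *\<^sub>R axis z 1)) (at 0)"
      by (rule g')
    then have "((\<lambda>t. g (x + (s + t) *\<^sub>R axis z 1)) has_real_derivative g' (x + s *\<^sub>R axis z 1)) (at 0)"
      by (simp add: scaleR_add_left add.assoc)
    then show ?thesis
      using DERIV_shift[of "\<lambda>s. g (x + s *\<^sub>R axis z 1)" _ 0 s] by (simp add: add.commute)
  qed
  then have "((\<lambda>s. g' (x + s *\<^sub>R axis z 1)) has_integral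
      g (x + r *\<^sub>R axis z 1) - g (x + 0 *\<^sub>R axis z 1)) {0..r}"
    using r by (intro fundamental_theorem_of_calculus)
      (auto simp: has_real_derivative_iff_has_vector_derivative intro: has_vector_derivative_at_within)
  then show "lint z r g' x = tdiff (r *\<^sub>R axis z 1) g x"
    by (simp add: lint_def tdiff_def integral_unique)
qed

lemma lint_partial: "has_partial z g g' \<Longrightarrow> 0 \<le> r \<Longrightarrow> lint z r g' = tdiff (r *\<^sub>R axis z 1) g"
  unfolding has_partial_def by (intro lint_derivative) blast+

lemma has_partial_tdiff: "has_partial z g g' \<Longrightarrow> has_partial z (tdiff v g) (tdiff v g')"
proof -
  assume g: "has_partial z g g'"
  have "((\<lambda>s. g (x + s *\<^sub>R axis z 1 + v) - g (x + s *\<^sub>R axis z 1)) has_real_derivative g' (x + v) - g' x) (at 0)" for x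
  proof (intro DERIV_diff)
    show "((\<lambda>s. g (x + s *\<^sub>R axis z 1)) has_real_derivative g' x) (at 0)"
      using g by (simp add: has_partial_def)
    have "((\<lambda>s. g (x + v + s *\<^sub>R axis z 1)) has_real_derivative g' (x + v)) (at 0)"
      using g unfolding has_partial_def by blast
    then show "((\<lambda>s. g (x + s *\<^sub>R axis z 1 + v)) has_real_derivative g' (x + v)) (at 0)"
      by (simp add: add_ac)
  qed
  then show ?thesis using g by (simp add: has_partial_def cper_tdiff) (simp add: tdiff_def)
qed

lemma l2_tdiff_partial_le: "has_partial z g g' \<Longrightarrow> 0 \<le> r \<Longrightarrow> l2 (tdiff (r *\<^sub>R axis z 1) g) \<le> r * l2 g'"
  using lint_partial[of z g g' r] l2_lint_le[of g' r z] by (simp add: has_partial_def)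

text \<open>Exactly the data for dominated convergence: one bound for all difference quotients, of
  either sign of \<open>t\<close>, which comes from the boundedness of the continuous periodic
  derivative.\<close>

lemma has_partial_quotient:
  assumes g: "has_partial z g g'"
  obtains B where "\<And>t x. t \<noteq> 0 \<Longrightarrow> \<bar>tdiff (t *\<^sub>R axis z 1) g x / t\<bar> \<le> B"
    and "\<And>x. ((\<lambda>t. tdiff (t *\<^sub>R axis z 1) g x / t) \<longlongrightarrow> g' x) (at 0)"
proof -
  have "cper g'" using g by (simp add: has_partial_def)
  then obtain B where B: "\<And>x. \<bar>g' x\<bar> \<le> B"
    using cper_imp_bper unfolding bper_def bounded_range_real_iff by blast
  have pos: "\<bar>tdiff (t *\<^sub>R axis z 1) g x\<bar> \<le> B * t" if "t \<ge> 0" for t x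
  proof -
    have "norm (integral {0..t} (\<lambda>s. g' (x + s *\<^sub>R axis z 1))) \<le> B * (t - 0)"
      using that B by (intro integral_bound cper_line \<open>cper g'\<close>) auto
    then show ?thesis using lint_partial[OF g that, symmetric] by (simp add: lint_def)
  qed
  have "\<bar>tdiff (t *\<^sub>R axis z 1) g x / t\<bar> \<le> B" if "t \<noteq> 0" for t x
  proof (cases "t > 0")
    case True
    then show ?thesis using pos[of t x] by (simp add: field_simps)
  next
    case False
    have "tdiff (t *\<^sub>R axis z 1) g x = - tdiff ((- t) *\<^sub>R axis z 1) g (x + t *\<^sub>R axis z 1)"
      by (simp add: tdiff_def)
    then show ?thesis using pos[of "- t" "x + t *\<^sub>R axis z 1"] False that by (simp add: field_simps)
  qed
  moreover have "((\<lambda>t. tdiff (t *\<^sub>R axis z 1) g x / t) \<longlongrightarrow> g' x) (at 0)" for x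
    using g by (simp add: has_partial_def DERIV_def tdiff_def)
  ultimately show ?thesis using that by blast
qed

lemma mean_dominated_limit:
  fixes G :: "nat \<Rightarrow> real ^ 'n \<Rightarrow> real"
  assumes "\<And>n. bper (G n)" "bper g" "\<And>n x. \<bar>G n x\<bar> \<le> B" "\<And>x. (\<lambda>n. G n x) \<longlonglongrightarrow> g x"
  shows "(\<lambda>n. mean (G n)) \<longlonglongrightarrow> mean g"
proof (rule integral_dominated_convergence[where w = "\<lambda>_. B"])
  show "integrable cell (\<lambda>_. B)" by simp
  show "g \<in> borel_measurable cell" "\<And>n. G n \<in> borel_measurable cell"
    using assms(1,2) by (simp_all add: bper_def borel_measurable_cell)
qed (use assms in auto)

lemma bper_quotient: "bper g \<Longrightarrow> bper (\<lambda>x. tdiff v g x / t)"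
  using bper_cmult[OF bper_tdiff, of g "inverse t" v] by (simp add: divide_inverse mult.commute)

lemma filterlim_inverse_Suc_at_0: "filterlim (\<lambda>n. inverse (real (Suc n))) (at 0) sequentially"
  "filterlim (\<lambda>n. - inverse (real (Suc n))) (at 0) sequentially"
  unfolding filterlim_at
  using LIMSEQ_inverse_real_of_nat tendsto_minus[OF LIMSEQ_inverse_real_of_nat]
  by (simp_all del: of_nat_Suc)

lemma mean_partial:
  assumes g: "has_partial z g g'"
  shows "mean g' = 0"
proof -
  obtain B where B: "\<And>t x. t \<noteq> 0 \<Longrightarrow> \<bar>tdiff (t *\<^sub>R axis z 1) g x / t\<bar> \<le> B"
    and lim: "\<And>x. ((\<lambda>t. tdiff (t *\<^sub>R axis z 1) g x / t) \<longlongrightarrow> g' x) (at 0)"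
    using has_partial_quotient[OF g] by metis
  have g': "bper g" "bper g'" using g by (auto simp: has_partial_def cper_imp_bper)
  let ?t = "\<lambda>n. inverse (real (Suc n))"
  have "(\<lambda>n. mean (\<lambda>x. tdiff (?t n *\<^sub>R axis z 1) g x / ?t n)) \<longlonglongrightarrow> mean g'"
  proof (rule mean_dominated_limit)
    show "\<bar>tdiff (?t n *\<^sub>R axis z 1) g x / ?t n\<bar> \<le> B" for n x by (rule B) simp
    show "(\<lambda>n. tdiff (?t n *\<^sub>R axis z 1) g x / ?t n) \<longlonglongrightarrow> g' x" for x
      by (rule filterlim_compose[OF lim filterlim_inverse_Suc_at_0(1)])
  qed (intro bper_quotient g')+
  moreover have "mean (\<lambda>x. tdiff (?t n *\<^sub>R axis z 1) g x / ?t n) = 0" for n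
    using mean_tdiff_mult[OF g'(1) bper_const, of "?t n *\<^sub>R axis z 1" "inverse (?t n)"]
    by (simp add: divide_inverse tdiff_def[of _ "\<lambda>x. _"] del: of_nat_Suc)
  ultimately show ?thesis by (simp add: LIMSEQ_const_iff)
qed

text \<open>Shift both difference quotients on one side to obtain the identity for difference quotients.\<close>
lemma mean_partial_mult:
  assumes fa: "has_partial a g ga" and fb: "has_partial b g gb"
    and ka: "has_partial a k ka" and kb: "has_partial b k kb"
  shows "mean (\<lambda>x. ga x * kb x) = mean (\<lambda>x. gb x * ka x)"
proof -
  have bp: "bper g" "bper ga" "bper gb" "bper k" "bper ka" "bper kb"
    using assms by (auto simp: has_partial_def cper_imp_bper)
  obtain B1 where B1: "\<And>t x. t \<noteq> 0 \<Longrightarrow> \<bar>tdiff (t *\<^sub>R axis a 1) g x / t\<bar> \<le> B1"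
    and l1: "\<And>x. ((\<lambda>t. tdiff (t *\<^sub>R axis a 1) g x / t) \<longlongrightarrow> ga x) (at 0)"
    using has_partial_quotient[OF fa] by metis
  obtain B2 where B2: "\<And>t x. t \<noteq> 0 \<Longrightarrow> \<bar>tdiff (t *\<^sub>R axis b 1) g x / t\<bar> \<le> B2"
    and l2: "\<And>x. ((\<lambda>t. tdiff (t *\<^sub>R axis b 1) g x / t) \<longlongrightarrow> gb x) (at 0)"
    using has_partial_quotient[OF fb] by metis
  obtain B3 where B3: "\<And>t x. t \<noteq> 0 \<Longrightarrow> \<bar>tdiff (t *\<^sub>R axis a 1) k x / t\<bar> \<le> B3"
    and l3: "\<And>x. ((\<lambda>t. tdiff (t *\<^sub>R axis a 1) k x / t) \<longlongrightarrow> ka x) (at 0)"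
    using has_partial_quotient[OF ka] by metis
  obtain B4 where B4: "\<And>t x. t \<noteq> 0 \<Longrightarrow> \<bar>tdiff (t *\<^sub>R axis b 1) k x / t\<bar> \<le> B4"
    and l4: "\<And>x. ((\<lambda>t. tdiff (t *\<^sub>R axis b 1) k x / t) \<longlongrightarrow> kb x) (at 0)"
    using has_partial_quotient[OF kb] by metis
  let ?t = "\<lambda>n. inverse (real (Suc n))"
  let ?q = "\<lambda>t z g x. tdiff (t *\<^sub>R axis z 1) g x / t"
  have lim1: "(\<lambda>n. mean (\<lambda>x. ?q (?t n) a g x * ?q (?t n) b k x)) \<longlonglongrightarrow> mean (\<lambda>x. ga x * kb x)"
  proof (rule mean_dominated_limit)
    show "\<bar>?q (?t n) a g x * ?q (?t n) b k x\<bar> \<le> B1 * B4" for n x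
      unfolding abs_mult by (intro mult_mono' B1 B4) simp_all
    show "(\<lambda>n. ?q (?t n) a g x * ?q (?t n) b k x) \<longlonglongrightarrow> ga x * kb x" for x
      by (intro tendsto_mult filterlim_compose[OF l1 filterlim_inverse_Suc_at_0(1)] filterlim_compose[OF l4 filterlim_inverse_Suc_at_0(1)])
  qed (intro bper_mult bper_quotient bp)+
  \<comment> \<open>Step size \<open>- ?t n\<close>: moving a difference from one factor of a mean
    to the other reverses its direction.\<close>
  have lim2: "(\<lambda>n. mean (\<lambda>x. ?q (- ?t n) b g x * ?q (- ?t n) a k x)) \<longlonglongrightarrow> mean (\<lambda>x. gb x * ka x)"
  proof (rule mean_dominated_limit)
    show "\<bar>?q (- ?t n) b g x * ?q (- ?t n) a k x\<bar> \<le> B2 * B3" for n x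
      unfolding abs_mult by (intro mult_mono' B2 B3) simp_all
    show "(\<lambda>n. ?q (- ?t n) b g x * ?q (- ?t n) a k x) \<longlonglongrightarrow> gb x * ka x" for x
      by (intro tendsto_mult filterlim_compose[OF l2 filterlim_inverse_Suc_at_0(2)] filterlim_compose[OF l3 filterlim_inverse_Suc_at_0(2)])
  qed (intro bper_mult bper_quotient bp)+
  have shift: "mean (\<lambda>x. ?q t a g x * ?q t b k x) = mean (\<lambda>x. ?q (- t) b g x * ?q (- t) a k x)" for t
  proof -
    let ?a = "t *\<^sub>R axis a 1" and ?b = "t *\<^sub>R axis b 1"
    have "mean (\<lambda>x. tdiff ?a g x * tdiff ?b k x) = mean (\<lambda>x. g x * tdiff (- ?a) (tdiff ?b k) x)"
      by (intro mean_tdiff_mult bper_tdiff bp)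
    also have "\<dots> = mean (\<lambda>x. tdiff ?b (tdiff (- ?a) k) x * g x)"
      by (simp add: tdiff_commute[of "- ?a"] mult.commute)
    also have "\<dots> = mean (\<lambda>x. tdiff (- ?a) k x * tdiff (- ?b) g x)"
      by (intro mean_tdiff_mult bper_tdiff bp)
    finally show ?thesis by (simp add: mult.commute)
  qed
  from LIMSEQ_unique[OF lim1[unfolded shift] lim2] show ?thesis .
qed

section \<open>Approximate laminates\<close>

lemma mean_mult_diff:
  assumes "bper A" "bper B" "bper P" "bper Q"
  shows "\<bar>mean (\<lambda>x. A x * B x) - mean (\<lambda>x. P x * Q x)\<bar>
    \<le> l2 A * l2 (\<lambda>x. B x - Q x) + l2 (\<lambda>x. A x - P x) * l2 Q"
proof -
  have "mean (\<lambda>x. A x * B x) - mean (\<lambda>x. P x * Q x)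
      = mean (\<lambda>x. A x * B x - P x * Q x)"
    by (intro mean_diff[symmetric] bper_mult assms)
  also have "\<dots> = mean (\<lambda>x. A x * (B x - Q x) + (A x - P x) * Q x)"
    by (intro Bochner_Integration.integral_cong) (auto simp: algebra_simps)
  also have "\<dots> = mean (\<lambda>x. A x * (B x - Q x)) + mean (\<lambda>x. (A x - P x) * Q x)"
    by (intro mean_add bper_mult bper_diff assms)
  finally show ?thesis
    using mean_mult_le_l2[of A "\<lambda>x. B x - Q x"] mean_mult_le_l2[of "\<lambda>x. A x - P x" Q] assms
    by (simp add: bper_diff)
qed

text \<open>Differences annihilate constants, so the prescribed mean values can be carried as an
  arbitrary \<open>c\<close>.\<close>

lemma l2_tdiff_diff_le:
  assumes "bper g" "bper k" "l2 (\<lambda>x. g x - k x - c) \<le> e"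
  shows "l2 (\<lambda>x. tdiff v g x - tdiff v k x) \<le> 2 * e"
proof -
  have "(\<lambda>x. tdiff v g x - tdiff v k x) = tdiff v (\<lambda>x. g x - k x - c)"
    by (simp add: tdiff_def fun_eq_iff)
  then show ?thesis
    using l2_tdiff_le[of "\<lambda>x. g x - k x - c" v] assms by (simp add: bper_diff)
qed

lemma l2_triangle:
  assumes "bper g" "bper k"
  shows "l2 g \<le> l2 (\<lambda>x. g x - k x) + l2 k"
  using l2_add_le[of "\<lambda>x. g x - k x" k] assms by (simp add: bper_diff)

lemma l2_diff_commute: "l2 (\<lambda>x. g x - k x) = l2 (\<lambda>x. k x - g x)"
  using l2_minus[of "\<lambda>x. g x - k x"] by simp

lemma l2_tdiff_triangle:
  assumes "bper g" "bper k" "l2 (\<lambda>x. g x - k x - c) \<le> e"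
  shows "l2 (tdiff v g) \<le> l2 (tdiff v k) + 2 * e"
  using l2_triangle[of "tdiff v g" "tdiff v k"] l2_tdiff_diff_le[OF assms, of v] assms
  by (simp add: bper_tdiff)

lemma l2_tdiff_tdiff_le: "bper g \<Longrightarrow> l2 (tdiff v (tdiff u g)) \<le> 2 * l2 (tdiff v g)"
  by (subst tdiff_commute) (intro l2_tdiff_le bper_tdiff)


text \<open>
  Here \<open>w\<close> is the periodic part of the displacement and \<open>h i\<close> the coefficient of \<open>M\<^sub>i\<close> in the
  phase arrangement. The coordinate \<open>a\<close> belongs to the support of \<open>M\<^sub>i\<close>, \<open>i = blk a\<close>, with the
  diagonal entry \<open>sg a\<close>; the unused coordinates have \<open>blk a = 0\<close>. In \<open>base\<close>, \<open>L\<close> stands for the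
  surface energy.
\<close>
locale laminate_approx =
  fixes m l :: nat and f :: "nat \<Rightarrow> nat" and ca cb :: "nat \<Rightarrow> 'n::finite"
    and blk :: "'n \<Rightarrow> nat" and sg :: "'n \<Rightarrow> real"
    and t \<eta> L :: real and h :: "nat \<Rightarrow> real ^ 'n \<Rightarrow> real"
    and w :: "'n \<Rightarrow> real ^ 'n \<Rightarrow> real" and dw :: "'n \<Rightarrow> 'n \<Rightarrow> real ^ 'n \<Rightarrow> real"
  assumes l: "1 \<le> l" "l \<le> m" and f12: "\<And>i. i \<in> {1..m} \<Longrightarrow> f i = 1 \<or> f i = 2"
    and t: "0 < t" "t < 1" and eta: "0 < \<eta>" "\<eta> \<le> 1" and L: "0 < L"
    and blk_le: "\<And>a. blk a \<le> m" and sg: "\<And>a. 1 \<le> blk a \<Longrightarrow> \<bar>sg a\<bar> = 1"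
    and ca: "\<And>i. i \<in> {1..m} \<Longrightarrow> blk (ca i) = i \<and> sg (ca i) = 1"
    and cb: "\<And>i. i \<in> {1..m} \<Longrightarrow> f i = 2 \<Longrightarrow> blk (cb i) = i \<and> sg (cb i) = - 1"
    and h_bper: "\<And>i. bper (h i)" and h_val: "\<And>i x. h i x \<in> {0, 1/2, 1}"
    and h_chain: "\<And>i x. 1 \<le> i \<Longrightarrow> h i x = 1/2 \<longleftrightarrow> h (Suc i) x \<noteq> 0"
    and h_large: "\<And>i x. m < i \<Longrightarrow> h i x = 0"
    and partial: "\<And>a b. has_partial b (w a) (dw a b)"
    and shear: "\<And>a b. a \<noteq> b \<Longrightarrow> l2 (\<lambda>x. dw a b x + dw b a x) \<le> 2 * \<eta>"
    and diag: "\<And>a. 1 \<le> blk a \<Longrightarrow> l2 (\<lambda>x. dw a a x - sg a * (h (blk a) x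
      - (if blk a < l then 1/2 else if blk a = l then t else 0))) \<le> \<eta>"
    and base: "\<And>z s. 0 \<le> s \<Longrightarrow> (l2 (tdiff (s *\<^sub>R axis z 1) (\<lambda>x. of_bool (h 1 x \<noteq> 0))))\<^sup>2 \<le> L * s"
begin

text \<open>The coefficients of the step matrices in the mean gradient.\<close>

definition fbar :: "nat \<Rightarrow> real"
  where "fbar i = (if i < l then 1/2 else if i = l then t else 0)"

definition \<theta> :: "nat \<Rightarrow> real ^ 'n \<Rightarrow> real"
  where "\<theta> k x = of_bool (h k x \<noteq> 0)"

text \<open>\<open>h k\<close> may oscillate along its own directions, and the passage to the next
  coefficient lengthens the translations only across them. Hence the directions of block
  \<open>k\<close> are given up at each passage.\<close>

definition invar :: "nat \<Rightarrow> real \<Rightarrow> real \<Rightarrow> bool"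
  where "invar k r \<zeta> \<longleftrightarrow>
    (\<forall>z s. k \<le> blk z \<longrightarrow> 0 \<le> s \<longrightarrow> s \<le> r \<longrightarrow> l2 (tdiff (s *\<^sub>R axis z 1) (\<theta> k)) \<le> \<zeta>)"

section \<open>Correlations of the coefficients and of their increments\<close>

lemma dw_bper: "bper (dw a b)" and dw_cper: "cper (dw a b)" and w_cper: "cper (w a)"
  and w_bper: "bper (w a)"
  using partial[of b a] by (auto simp: has_partial_def cper_imp_bper)

lemma h_abs_le: "\<bar>h i x\<bar> \<le> 1" and h_nonneg: "0 \<le> h i x"
  using h_val[of i x] by auto

lemma fbar_bounds: "0 \<le> fbar i" "fbar i \<le> 1"
  using t by (auto simp: fbar_def)

lemma h_half: "1 \<le> i \<Longrightarrow> i < j \<Longrightarrow> h j x \<noteq> 0 \<Longrightarrow> h i x = 1/2"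
proof (induction j)
  case (Suc j)
  show ?case
  proof (cases "i = j")
    case False
    have "h j x = 1/2" using h_chain[of j x] Suc.prems by simp
    then show ?thesis using Suc False by simp
  qed (use h_chain Suc.prems in simp)
qed simp

lemma \<theta>_rec: "1 \<le> k \<Longrightarrow> \<theta> k x = h k x + (1/2) * \<theta> (Suc k) x"
  using h_val[of k x] h_chain[of k x] by (auto simp: \<theta>_def)

lemma \<theta>_large: "m < k \<Longrightarrow> \<theta> k x = 0"
  by (simp add: \<theta>_def h_large)

lemma \<theta>_bper: "bper (\<theta> k)"
proof -
  have [measurable]: "h k \<in> borel_measurable borel" using h_bper[of k] by (simp add: bper_def)
  have "\<theta> k \<in> borel_measurable borel" unfolding \<theta>_def[abs_def] of_bool_def by measurable
  then show ?thesis
    using h_bper[of k] unfolding bper_def bounded_range_real_iff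
    by (auto simp: \<theta>_def periodic_def intro: exI[of _ 1])
qed

lemma diag': "1 \<le> blk a \<Longrightarrow> l2 (\<lambda>x. dw a a x - sg a * (h (blk a) x - fbar (blk a))) \<le> \<eta>"
  using diag unfolding fbar_def .

lemma diag_const: "1 \<le> blk a \<Longrightarrow>
  l2 (\<lambda>x. dw a a x - sg a * h (blk a) x - - sg a * fbar (blk a)) \<le> \<eta>"
  using diag'[of a] by (simp add: algebra_simps)

text \<open>A partial derivative of a periodic function has mean zero, which prescribes the mean of
  each coefficient up to the strain error.\<close>

lemma mean_h: "i \<in> {1..m} \<Longrightarrow> \<bar>mean (h i) - fbar i\<bar> \<le> \<eta>"
proof -
  assume i: "i \<in> {1..m}"
  let ?a = "ca i"
  have a: "blk ?a = i" "sg ?a = 1" "1 \<le> i" using ca[OF i] i by auto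
  have b: "bper (\<lambda>x. h i x - fbar i)" by (intro bper_diff h_bper bper_const)
  have "\<bar>mean (\<lambda>x. dw ?a ?a x - (h i x - fbar i))\<bar> \<le> \<eta>"
    using mean_le_l2[OF bper_diff[OF dw_bper b], of ?a ?a] diag'[of ?a] a by simp
  moreover have "mean (\<lambda>x. dw ?a ?a x - (h i x - fbar i)) = 0 - (mean (h i) - fbar i)"
    using mean_diff[OF dw_bper b, of ?a ?a] mean_diff[OF h_bper[of i] bper_const, of "fbar i"]
      mean_partial[OF partial, of ?a ?a] by (simp add: space_cell)
  ultimately show ?thesis by simp
qed

text \<open>Write \<open>P\<close> and \<open>Q\<close> for the two coefficients minus their
  prescribed means, with signs. Where \<open>h j\<close> is nonzero, \<open>h i\<close> is 1/2 and
  \<open>P\<close> vanishes; where \<open>h j\<close> is zero, \<open>Q\<close> is constant. So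
  \<open>P Q\<close> is a multiple of \<open>h i - 1/2\<close> everywhere, and its mean is at most
  \<eta>. Replacing the derivatives by \<open>P\<close> and \<open>Q\<close> costs another
  3\<eta>.\<close>

lemma covariance:
  assumes a: "1 \<le> blk a" "blk a < l" and b: "blk a < blk b"
  shows "\<bar>mean (\<lambda>x. dw a a x * dw b b x)\<bar> \<le> 4 * \<eta>"
proof -
  define i j where "i = blk a" and "j = blk b"
  define P where "P = (\<lambda>x. sg a * (h i x - fbar i))"
  define Q where "Q = (\<lambda>x. sg b * (h j x - fbar j))"
  have ij: "i \<in> {1..m}" "j \<in> {1..m}" "i < j" "i < l" using assms blk_le[of a] blk_le[of b] by (auto simp: i_def j_def)
  have sab: "\<bar>sg a\<bar> = 1" "\<bar>sg b\<bar> = 1" using sg[of a] sg[of b] assms by auto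
  have bP: "bper P" and bQ: "bper Q" unfolding P_def Q_def by (intro bper_cmult bper_diff h_bper bper_const)+
  have dP: "l2 (\<lambda>x. dw a a x - P x) \<le> \<eta>" and dQ: "l2 (\<lambda>x. dw b b x - Q x) \<le> \<eta>"
    using diag'[of a] diag'[of b] assms by (simp_all add: P_def Q_def i_def j_def)
  have le1: "\<bar>h i x - fbar i\<bar> \<le> 1" for i x
    using h_nonneg[of i x] h_abs_le[of i x] fbar_bounds[of i] by simp
  have l2P: "l2 P \<le> 1" "l2 Q \<le> 1"
    using l2_le_bound[OF bP, of 1] l2_le_bound[OF bQ, of 1] le1 sab by (auto simp: P_def Q_def abs_mult)
  have l2A: "l2 (dw a a) \<le> 2"
    using l2_triangle[OF dw_bper bP, of a a] dP l2P eta by simp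
  have "mean (\<lambda>x. P x * Q x) = - (sg a * sg b * fbar j) * (mean (h i) - 1/2)"
  proof -
    have "P x * Q x = - (sg a * sg b * fbar j) * (h i x - 1/2)" for x
    proof (cases "h j x = 0")
      case False
      then have "h i x - 1/2 = 0" using h_half[of i j x] ij by simp
      then show ?thesis using ij by (simp only: P_def fbar_def) simp
    qed (use ij in \<open>simp add: P_def Q_def fbar_def\<close>)
    then have "mean (\<lambda>x. P x * Q x) = - (sg a * sg b * fbar j) * mean (\<lambda>x. h i x - 1/2)" by simp
    then show ?thesis using mean_diff[OF h_bper[of i] bper_const, of "1/2"] by (simp add: space_cell)
  qed
  then have "\<bar>mean (\<lambda>x. P x * Q x)\<bar> = fbar j * \<bar>mean (h i) - fbar i\<bar>"
    using sab fbar_bounds[of j] ij by (simp add: abs_mult fbar_def)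
  also have "\<dots> \<le> 1 * \<eta>" using mean_h[of i] ij fbar_bounds[of j] by (intro mult_mono) auto
  finally have PQ: "\<bar>mean (\<lambda>x. P x * Q x)\<bar> \<le> \<eta>" by simp
  have "l2 (dw a a) * l2 (\<lambda>x. dw b b x - Q x) \<le> 2 * \<eta>"
    using l2A dQ by (intro mult_mono) auto
  moreover have "l2 (\<lambda>x. dw a a x - P x) * l2 Q \<le> \<eta> * 1"
    using dP l2P eta by (intro mult_mono) auto
  ultimately show ?thesis
    using mean_mult_diff[OF dw_bper dw_bper bP bQ, of a a b b] PQ by simp
qed

text \<open>By \<open>mean_partial_mult\<close> the mean of \<open>dw a b * dw b a\<close> is small.
  The shear bound makes \<open>dw b a\<close> nearly equal to \<open>- dw a b\<close>, so this mean
  is almost minus the square of \<open>l2 (dw a b)\<close>.\<close>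

lemma cross_partial_le:
  assumes ab: "a \<noteq> b" and c: "\<bar>mean (\<lambda>x. dw a a x * dw b b x)\<bar> \<le> 4 * \<eta>"
  shows "(l2 (dw a b))\<^sup>2 \<le> 12 * \<eta>"
proof -
  define E where "E = (\<lambda>x. dw a b x + dw b a x)"
  have bE: "bper E" unfolding E_def by (intro bper_add dw_bper)
  have E: "l2 E \<le> 2 * \<eta>" unfolding E_def by (rule shear[OF ab])
  have "mean (\<lambda>x. dw a a x * dw b b x) = mean (\<lambda>x. dw a b x * dw b a x)"
    by (rule mean_partial_mult[OF partial partial partial partial])
  also have "\<dots> = mean (\<lambda>x. dw a b x * E x - (dw a b x)\<^sup>2)"
    by (intro Bochner_Integration.integral_cong) (auto simp: E_def power2_eq_square algebra_simps)
  also have "\<dots> = mean (\<lambda>x. dw a b x * E x) - (l2 (dw a b))\<^sup>2"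
    unfolding l2_power2 by (intro mean_diff bper_mult bper_power2 bE dw_bper)
  finally have "(l2 (dw a b))\<^sup>2 \<le> mean (\<lambda>x. dw a b x * E x) + 4 * \<eta>" using c by simp
  also have "mean (\<lambda>x. dw a b x * E x) \<le> l2 (dw a b) * (2 * \<eta>)"
    using mean_mult_le_l2[OF dw_bper bE, of a b] mult_left_mono[OF E, of "l2 (dw a b)"] by simp
  \<comment> \<open>Young's inequality, so that one half of the square is absorbed on the
    left.\<close>
  also have "\<dots> \<le> (l2 (dw a b))\<^sup>2 / 2 + 2 * \<eta>\<^sup>2"
    using zero_le_power2[of "l2 (dw a b) - 2 * \<eta>"] by (simp add: power2_eq_square algebra_simps)
  finally have "(l2 (dw a b))\<^sup>2 \<le> 4 * \<eta>\<^sup>2 + 8 * \<eta>" by simp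
  moreover have "\<eta>\<^sup>2 \<le> \<eta>" using eta by (simp add: power2_eq_square mult_left_le)
  ultimately show ?thesis by simp
qed

lemma dw_cross_le:
  assumes "1 \<le> blk a" "blk a < l" "blk a < blk b"
  shows "(l2 (dw a b))\<^sup>2 \<le> 12 * \<eta>" "(l2 (dw b a))\<^sup>2 \<le> 12 * \<eta>"
  using cross_partial_le[of a b] cross_partial_le[of b a] covariance[OF assms] assms
  by (auto simp: mult.commute)

text \<open>The identity \<open>mean_partial_mult\<close> again, now for translated differences: the
  cross derivatives on the other side are both of the order of the square root of \<eta>, so their
  product is of order \<eta>. Thus the increments of different coefficients are almost
  orthogonal.\<close>

lemma h_cross:
  assumes i: "1 \<le> i" "i < l" "i < j" "j \<le> m"
  shows "\<bar>mean (\<lambda>x. tdiff v (h i) x * tdiff v (h j) x)\<bar> \<le> 60 * \<eta>"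
proof -
  let ?a = "ca i" and ?b = "ca j"
  have a: "blk ?a = i" "sg ?a = 1" and b: "blk ?b = j" "sg ?b = 1" using ca[of i] ca[of j] i l by auto
  have dP: "l2 (\<lambda>x. tdiff v (dw ?a ?a) x - tdiff v (h i) x) \<le> 2 * \<eta>"
    and dQ: "l2 (\<lambda>x. tdiff v (dw ?b ?b) x - tdiff v (h j) x) \<le> 2 * \<eta>"
    using diag_const[of ?a] diag_const[of ?b] a b i
    by (auto intro!: l2_tdiff_diff_le[OF dw_bper h_bper, where c = "- fbar _"])
  have le1: "l2 (tdiff v (h i)) \<le> 1" for i
  proof (intro l2_le_bound bper_tdiff h_bper)
    show "\<bar>tdiff v (h i) x\<bar> \<le> 1" for x
      using h_nonneg[of i x] h_abs_le[of i x] h_nonneg[of i "x + v"] h_abs_le[of i "x + v"]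
      by (simp add: tdiff_def)
  qed
  have A: "l2 (tdiff v (dw ?a ?a)) \<le> 3"
    using l2_triangle[OF bper_tdiff[OF dw_bper] bper_tdiff[OF h_bper], of v ?a ?a v i] dP le1[of i] eta by simp
  have "mean (\<lambda>x. tdiff v (dw ?a ?a) x * tdiff v (dw ?b ?b) x)
      = mean (\<lambda>x. tdiff v (dw ?a ?b) x * tdiff v (dw ?b ?a) x)"
    by (rule mean_partial_mult[OF has_partial_tdiff has_partial_tdiff has_partial_tdiff has_partial_tdiff,
          OF partial partial partial partial])
  also have "\<bar>\<dots>\<bar> \<le> l2 (tdiff v (dw ?a ?b)) * l2 (tdiff v (dw ?b ?a))"
    by (intro mean_mult_le_l2 bper_tdiff dw_bper)
  also have "\<dots> \<le> (2 * l2 (dw ?a ?b)) * (2 * l2 (dw ?b ?a))"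
    by (intro mult_mono l2_tdiff_le dw_bper) auto
  also have "\<dots> \<le> 2 * ((l2 (dw ?a ?b))\<^sup>2 + (l2 (dw ?b ?a))\<^sup>2)"
    using sum_squares_bound[of "l2 (dw ?a ?b)" "l2 (dw ?b ?a)"] by simp
  also have "\<dots> \<le> 48 * \<eta>" using dw_cross_le[of ?a ?b] a b i by simp
  finally have AB: "\<bar>mean (\<lambda>x. tdiff v (dw ?a ?a) x * tdiff v (dw ?b ?b) x)\<bar> \<le> 48 * \<eta>" .
  have "l2 (tdiff v (dw ?a ?a)) * l2 (\<lambda>x. tdiff v (dw ?b ?b) x - tdiff v (h j) x) \<le> 3 * (2 * \<eta>)"
    using A dQ by (intro mult_mono) auto
  moreover have "l2 (\<lambda>x. tdiff v (dw ?a ?a) x - tdiff v (h i) x) * l2 (tdiff v (h j)) \<le> 2 * \<eta> * 1"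
    using dP le1 eta by (intro mult_mono) auto
  ultimately show ?thesis
    using mean_mult_diff[OF bper_tdiff bper_tdiff bper_tdiff bper_tdiff, OF dw_bper dw_bper h_bper h_bper, of v ?a ?a v ?b ?b v i v j] AB eta by simp
qed

lemma tdiff_\<theta>: "1 \<le> k \<Longrightarrow> tdiff v (\<theta> k) = (\<lambda>x. tdiff v (h k) x + (1/2) * tdiff v (\<theta> (Suc k)) x)"
  by (simp add: tdiff_def fun_eq_iff \<theta>_rec[of k] algebra_simps)

text \<open>Downward induction from \<open>m + 1\<close>, where the indicator vanishes: \<theta>
  splits into \<open>h j\<close> and half of the next indicator.\<close>

lemma h_\<theta>_cross:
  assumes k: "1 \<le> k" "k < l"
  shows "k < j \<Longrightarrow> \<bar>mean (\<lambda>x. tdiff v (h k) x * tdiff v (\<theta> j) x)\<bar> \<le> 60 * \<eta> * real (m + 1 - j)"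
proof (induction "m + 1 - j" arbitrary: j)
  case 0
  then show ?case by (simp add: tdiff_def \<theta>_large)
next
  case (Suc n)
  have jm: "j \<le> m" using Suc.hyps(2) by simp
  have IH: "\<bar>mean (\<lambda>x. tdiff v (h k) x * tdiff v (\<theta> (Suc j)) x)\<bar> \<le> 60 * \<eta> * real (m + 1 - Suc j)"
    using Suc by (intro Suc.hyps(1)) auto
  have "mean (\<lambda>x. tdiff v (h k) x * tdiff v (\<theta> j) x)
      = mean (\<lambda>x. tdiff v (h k) x * tdiff v (h j) x + (1/2) * (tdiff v (h k) x * tdiff v (\<theta> (Suc j)) x))"
    using Suc.prems k by (simp add: tdiff_\<theta>[of j] algebra_simps)
  also have "\<dots> = mean (\<lambda>x. tdiff v (h k) x * tdiff v (h j) x)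
      + (1/2) * mean (\<lambda>x. tdiff v (h k) x * tdiff v (\<theta> (Suc j)) x)"
    by (subst mean_add, (intro bper_intros bper_tdiff h_bper \<theta>_bper)+) simp
  finally have "\<bar>mean (\<lambda>x. tdiff v (h k) x * tdiff v (\<theta> j) x)\<bar> \<le> 60 * \<eta> + 60 * \<eta> * real (m + 1 - Suc j)"
    using IH h_cross[OF k Suc.prems jm, of v] by linarith
  also have "\<dots> = 60 * \<eta> * real (m + 1 - j)"
    using Suc.hyps(2) by (simp add: of_nat_diff algebra_simps)
  finally show ?case .
qed

text \<open>Between a region with \<open>h k = 1\<close> and one with \<open>h k = 1/2\<close> the
  indicator \<open>\<theta> k\<close> does not change, since the jumps of its two summands cancel.
  Almost orthogonality of these summands shows that this can happen only to the extent of \<eta>, so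
  invariance passes from \<open>\<theta> k\<close> to \<open>h k\<close>.\<close>

lemma h_le_\<theta>:
  assumes k: "1 \<le> k" "k < l"
  shows "(l2 (tdiff v (h k)))\<^sup>2 \<le> (l2 (tdiff v (\<theta> k)))\<^sup>2 + 60 * \<eta> * real m"
proof -
  let ?H = "tdiff v (h k)" and ?T = "tdiff v (\<theta> (Suc k))"
  have b: "bper ?H" "bper ?T" by (intro bper_tdiff h_bper \<theta>_bper)+
  have "(l2 (tdiff v (\<theta> k)))\<^sup>2 = mean (\<lambda>x. ((?H x)\<^sup>2 + ?H x * ?T x) + (1/4) * (?T x)\<^sup>2)"
    unfolding l2_power2 tdiff_\<theta>[OF k(1)]
    by (intro Bochner_Integration.integral_cong) (auto simp: power2_eq_square algebra_simps)
  also have "\<dots> = (l2 ?H)\<^sup>2 + mean (\<lambda>x. ?H x * ?T x) + (1/4) * (l2 ?T)\<^sup>2"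
    unfolding l2_power2 by (subst mean_add, (intro bper_intros b)+)+ simp
  finally have "(l2 ?H)\<^sup>2 \<le> (l2 (tdiff v (\<theta> k)))\<^sup>2 + \<bar>mean (\<lambda>x. ?H x * ?T x)\<bar>"
    using abs_ge_self[of "mean (\<lambda>x. ?H x * ?T x)"] zero_le_power2[of "l2 ?T"] by linarith
  also have "\<bar>mean (\<lambda>x. ?H x * ?T x)\<bar> \<le> 60 * \<eta> * real (m + 1 - Suc k)"
    by (rule h_\<theta>_cross) (use k in auto)
  also have "\<dots> \<le> 60 * \<eta> * real m" using eta by (intro mult_left_mono) auto
  finally show ?thesis by simp
qed

text \<open>The next indicator is 1 exactly where \<open>h k\<close> is 1/2, so wherever it jumps,
  \<open>h k\<close> jumps by at least 1/2.\<close>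

lemma \<theta>_le_h: "1 \<le> k \<Longrightarrow> l2 (tdiff v (\<theta> (Suc k))) \<le> 2 * l2 (tdiff v (h k))"
proof -
  assume k: "1 \<le> k"
  have "\<bar>tdiff v (\<theta> (Suc k)) x\<bar> \<le> \<bar>2 * tdiff v (h k) x\<bar>" for x
    using h_chain[OF k, of x] h_chain[OF k, of "x + v"] h_val[of k x] h_val[of k "x + v"]
    by (auto simp: tdiff_def \<theta>_def)
  then have "l2 (tdiff v (\<theta> (Suc k))) \<le> l2 (\<lambda>x. 2 * tdiff v (h k) x)"
    by (intro l2_mono bper_cmult bper_tdiff \<theta>_bper h_bper)
  then show ?thesis by (simp add: l2_cmult)
qed

end

section \<open>Propagation of the almost invariance\<close>

context laminate_approx
begin

lemma h_shift_le:
  assumes k: "1 \<le> k" "k < l" and inv: "invar k r \<beta>" and small: "60 * \<eta> * real m \<le> \<beta>\<^sup>2"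
    and s: "0 \<le> s" "s \<le> r" "k \<le> blk z" and \<beta>: "0 \<le> \<beta>"
  shows "l2 (tdiff (s *\<^sub>R axis z 1) (h k)) \<le> 2 * \<beta>"
proof (rule power2_le_imp_le)
  have "l2 (tdiff (s *\<^sub>R axis z 1) (\<theta> k)) \<le> \<beta>"
    using inv s by (simp add: invar_def)
  then have "(l2 (tdiff (s *\<^sub>R axis z 1) (\<theta> k)))\<^sup>2 \<le> \<beta>\<^sup>2" by (simp add: power_mono)
  show "(l2 (tdiff (s *\<^sub>R axis z 1) (h k)))\<^sup>2 \<le> (2 * \<beta>)\<^sup>2"
  proof -
    have "(2 * \<beta>)\<^sup>2 = 4 * \<beta>\<^sup>2" by (simp add: power_mult_distrib)
    then show ?thesis
      using h_le_\<theta>[OF k, of "s *\<^sub>R axis z 1"] small zero_le_power2[of \<beta>]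
        \<open>(l2 (tdiff (s *\<^sub>R axis z 1) (\<theta> k)))\<^sup>2 \<le> \<beta>\<^sup>2\<close> by linarith
  qed
qed (use \<beta> in simp)

lemma dw_shift_le:
  assumes k: "1 \<le> k" "k < l" and inv: "invar k r \<beta>" and small: "60 * \<eta> * real m \<le> \<beta>\<^sup>2" "\<eta> \<le> \<beta>"
    and s: "0 \<le> s" "s \<le> r" "k \<le> blk z" and a: "blk a = k"
  shows "l2 (tdiff (s *\<^sub>R axis z 1) (dw a a)) \<le> 4 * \<beta>"
proof -
  have sa: "\<bar>sg a\<bar> = 1" using sg[of a] a k by simp
  have "l2 (tdiff (s *\<^sub>R axis z 1) (dw a a)) \<le> l2 (tdiff (s *\<^sub>R axis z 1) (\<lambda>x. sg a * h k x)) + 2 * \<eta>"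
    using diag_const[of a] a k by (intro l2_tdiff_triangle[OF dw_bper bper_cmult[OF h_bper], where c = "- sg a * fbar (blk a)"]) auto
  also have "l2 (tdiff (s *\<^sub>R axis z 1) (\<lambda>x. sg a * h k x)) = l2 (tdiff (s *\<^sub>R axis z 1) (h k))"
    using sa by (simp add: tdiff_cmult l2_cmult)
  also have "\<dots> \<le> 2 * \<beta>" using small eta by (intro h_shift_le[OF k inv] s) auto
  finally show ?thesis using small by simp
qed

lemma lint_dw_le:
  assumes k: "1 \<le> k" "k < l" and inv: "invar k r \<beta>" and small: "60 * \<eta> * real m \<le> \<beta>\<^sup>2" "\<eta> \<le> \<beta>"
    and r: "0 < r" and z: "k \<le> blk z" and a: "blk a = k"
  shows "l2 (\<lambda>x. lint z r (dw a a) x - r * dw a a x) \<le> r * (4 * \<beta>)"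
  using r by (intro l2_lint_diff_le dw_cper dw_shift_le[OF k inv small _ _ z a]) auto

text \<open>The condition on \<rho> balances the two errors: replacing \<open>dw a a\<close> by its
  average over length \<open>r\<close> costs 8\<beta> in the difference, and the difference
  quotients of \<open>w a\<close> cost 7\<beta>. Returning from \<open>dw a a\<close> to
  \<open>h k\<close> adds 2\<eta>, hence 17.\<close>

lemma single_step:
  assumes k: "1 \<le> k" "k < l" and inv: "invar k r \<beta>" and small: "60 * \<eta> * real m \<le> \<beta>\<^sup>2" "\<eta> \<le> \<beta>"
    and r: "0 < r" and z: "k < blk z" and \<rho>: "0 \<le> \<rho>" "\<rho> * sqrt \<eta> \<le> \<beta> * r"
  shows "l2 (tdiff (\<rho> *\<^sub>R axis z 1) (h k)) \<le> 17 * \<beta>"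
proof -
  define a where "a = ca k"
  have a: "blk a = k" "sg a = 1" using ca[of k] k l by (auto simp: a_def)
  let ?T = "tdiff (\<rho> *\<^sub>R axis z 1)"
  have "l2 (?T (w a)) \<le> \<rho> * l2 (dw a z)"
    by (rule l2_tdiff_partial_le[OF partial \<rho>(1)])
  also have "\<dots> \<le> \<rho> * sqrt (12 * \<eta>)"
    using dw_cross_le(1)[of a z] a k z \<rho> by (intro mult_left_mono real_le_rsqrt) auto
  also have "\<dots> \<le> \<rho> * (7/2 * sqrt \<eta>)"
  proof -
    have "sqrt 12 \<le> 7/2" by (rule real_le_lsqrt) (simp_all add: power2_eq_square)
    then show ?thesis
      using \<rho> eta unfolding real_sqrt_mult by (intro mult_left_mono mult_right_mono) auto
  qed
  also have "\<dots> \<le> 7/2 * (\<beta> * r)" using \<rho> by simp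
  finally have Tw: "l2 (?T (w a)) \<le> 7/2 * (\<beta> * r)" .
  have "l2 (\<lambda>x. r * ?T (dw a a) x) \<le> l2 (\<lambda>x. r * ?T (dw a a) x - ?T (lint a r (dw a a)) x) + l2 (?T (lint a r (dw a a)))"
    using r by (intro l2_triangle bper_cmult bper_tdiff cper_imp_bper[OF cper_lint] dw_cper dw_bper) auto
  also have "l2 (?T (lint a r (dw a a))) \<le> 2 * (7/2 * (\<beta> * r))"
  proof -
    have "l2 (?T (tdiff (r *\<^sub>R axis a 1) (w a))) \<le> 2 * l2 (?T (w a))"
      by (intro l2_tdiff_tdiff_le w_bper)
    then show ?thesis using lint_partial[OF partial, of r a a] r Tw by simp
  qed
  also have "l2 (\<lambda>x. r * ?T (dw a a) x - ?T (lint a r (dw a a)) x) \<le> 2 * (r * (4 * \<beta>))"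
  proof -
    have "l2 (\<lambda>x. r * dw a a x - lint a r (dw a a) x - 0) \<le> r * (4 * \<beta>)"
      using lint_dw_le[OF k inv small r, of a a] a l2_diff_commute[of "lint a r (dw a a)"] by simp
    from l2_tdiff_diff_le[OF bper_cmult[OF dw_bper] cper_imp_bper[OF cper_lint[OF dw_cper]] this]
    show ?thesis using r by (simp add: tdiff_cmult)
  qed
  finally have "r * l2 (?T (dw a a)) \<le> r * (15 * \<beta>)"
    using r by (simp add: l2_cmult)
  then have p: "l2 (?T (dw a a)) \<le> 15 * \<beta>" using r by simp
  have "l2 (\<lambda>x. h k x - dw a a x - fbar k) \<le> \<eta>"
    using diag_const[of a] a k l2_minus[of "\<lambda>x. dw a a x - h k x + fbar k"] by (simp add: algebra_simps)
  from l2_tdiff_triangle[OF h_bper dw_bper this, of "\<rho> *\<^sub>R axis z 1"] p small show ?thesis by simp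
qed

text \<open>The discrete form of
  \<open>2 \<partial>\<^sub>b \<partial>\<^sub>z w\<^sub>a = \<partial>\<^sub>b \<epsilon>\<^sub>a\<^sub>z + \<partial>\<^sub>z \<epsilon>\<^sub>a\<^sub>b - \<partial>\<^sub>a \<epsilon>\<^sub>b\<^sub>z\<close>, where \<open>\<epsilon> = 2 sym (\<nabla>w)\<close>.\<close>
lemma mixed_difference:
  assumes ab: "a \<noteq> b" "a \<noteq> z" "b \<noteq> z" and r: "0 \<le> r" and \<rho>: "0 \<le> \<rho>"
  shows "l2 (tdiff (r *\<^sub>R axis b 1) (tdiff (\<rho> *\<^sub>R axis z 1) (lint a r (w a)))) \<le> 4 * r * \<rho> * \<eta> + 2 * r\<^sup>2 * \<eta>"
proof -
  define e where "e c d = (\<lambda>x. dw c d x + dw d c x)" for c d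
  let ?a = "r *\<^sub>R axis a 1" and ?b = "r *\<^sub>R axis b 1" and ?z = "\<rho> *\<^sub>R axis z 1"
  have ec: "cper (e c d)" for c d unfolding e_def by (intro cper_add dw_cper)
  have el: "l2 (e c d) \<le> 2 * \<eta>" if "c \<noteq> d" for c d unfolding e_def by (rule shear[OF that])
  have lc: "cper (lint c s g)" if "cper g" "0 \<le> s" for c s and g :: "real ^ 'n \<Rightarrow> real"
    using that by (rule cper_lint)
  \<comment> \<open>Integrating a strain over a rectangle in its own two directions turns both of
    its derivatives into differences; no second derivatives of \<open>w\<close> have to exist. What
    remains of the second integration is one segment average, the \<open>lint a r (w a)\<close> of
    the statement.\<close>
  have I: "lint c s (lint d s' (e c d)) = (\<lambda>x. tdiff (s' *\<^sub>R axis d 1) (lint c s (w c)) x + tdiff (s *\<^sub>R axis c 1) (lint d s' (w d)) x)"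
    if "0 \<le> s" "0 \<le> s'" for c d s s'
  proof -
    have "lint d s' (e c d) = (\<lambda>x. tdiff (s' *\<^sub>R axis d 1) (w c) x + lint d s' (dw d c) x)"
      unfolding e_def lint_add[OF dw_cper dw_cper] lint_partial[OF partial that(2)] ..
    then have "lint c s (lint d s' (e c d)) = (\<lambda>x. lint c s (tdiff (s' *\<^sub>R axis d 1) (w c)) x + lint c s (lint d s' (dw d c)) x)"
      using that by (simp add: lint_add cper_tdiff w_cper lc dw_cper)
    moreover have "lint c s (lint d s' (dw d c)) = lint d s' (tdiff (s *\<^sub>R axis c 1) (w d))"
      using lint_partial[OF partial that(1), of c d] by (subst lint_commute[OF dw_cper]) simp
    ultimately show ?thesis by (simp add: tdiff_lint w_cper)
  qed
  have bounds: "l2 (tdiff v (lint c s (lint d s' (e c' d')))) \<le> 4 * s * s' * \<eta>"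
    if "0 \<le> s" "0 \<le> s'" "c' \<noteq> d'" for v c d s s' c' d'
  proof -
    have "l2 (tdiff v (lint c s (lint d s' (e c' d')))) \<le> 2 * l2 (lint c s (lint d s' (e c' d')))"
      using that by (intro l2_tdiff_le cper_imp_bper lc ec)
    also have "l2 (lint c s (lint d s' (e c' d'))) \<le> s * (s' * (2 * \<eta>))"
    proof -
      have "l2 (lint c s (lint d s' (e c' d'))) \<le> s * l2 (lint d s' (e c' d'))"
        using that by (intro l2_lint_le lc ec)
      also have "l2 (lint d s' (e c' d')) \<le> s' * l2 (e c' d')"
        using that by (intro l2_lint_le ec)
      also have "l2 (e c' d') \<le> 2 * \<eta>" using el that by blast
      finally show ?thesis using that by (simp add: mult_left_mono)
    qed
    finally show ?thesis by simp
  qed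
  define X where "X = tdiff ?b (lint a r (lint z \<rho> (e a z)))"
  define Y where "Y = tdiff ?z (lint a r (lint b r (e a b)))"
  define Z where "Z = tdiff ?a (lint b r (lint z \<rho> (e b z)))"
  have bp: "bper X" "bper Y" "bper Z" unfolding X_def Y_def Z_def
    by (intro bper_tdiff cper_imp_bper lc ec r \<rho>)+
  \<comment> \<open>By \<open>I\<close>, the terms with \<open>w b\<close> and \<open>w z\<close>
    cancel and the term with \<open>w a\<close> occurs twice.\<close>
  have "2 * tdiff ?b (tdiff ?z (lint a r (w a))) x = (X x + Y x) - Z x" for x
    unfolding X_def Y_def Z_def I[OF r \<rho>] I[OF r r] tdiff_add
      tdiff_commute[of ?a ?b] tdiff_commute[of ?z ?a] tdiff_commute[of ?z ?b] by simp
  then have "2 * l2 (tdiff ?b (tdiff ?z (lint a r (w a)))) = l2 (\<lambda>x. (X x + Y x) - Z x)"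
    using l2_cmult[of 2 "tdiff ?b (tdiff ?z (lint a r (w a)))"] by simp
  also have "\<dots> \<le> l2 X + l2 Y + l2 Z"
    using l2_diff_le[OF bper_add[OF bp(1,2)] bp(3)] l2_add_le[OF bp(1,2)] by simp
  also have "\<dots> \<le> 4 * r * \<rho> * \<eta> + 4 * r * r * \<eta> + 4 * r * \<rho> * \<eta>"
    unfolding X_def Y_def Z_def using ab r \<rho> by (intro add_mono bounds) auto
  finally show ?thesis by (simp add: power2_eq_square algebra_simps)
qed

text \<open>\<open>X a\<close> and \<open>X b\<close> are two approximations of the same difference
  of \<open>h k\<close>, one from \<open>w a\<close> and the other from \<open>- w b\<close>. The
  square of its norm is therefore close to the mean of \<open>X a * X b\<close>, in which the
  differences can be exchanged between the factors so that each becomes a mixed difference. Only the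
  square is of order \<beta>, so the tolerance loses a square root here.\<close>

lemma double_step:
  assumes k: "1 \<le> k" "k < l" and fk: "f k = 2" and inv: "invar k r \<beta>"
    and small: "60 * \<eta> * real m \<le> \<beta>\<^sup>2" "\<eta> \<le> \<beta>" and \<beta>: "\<beta> \<le> 1"
    and r: "0 < r" and z: "k < blk z" and \<rho>: "0 \<le> \<rho>" "\<rho> * \<eta> \<le> \<beta> * r"
  shows "(l2 (tdiff (\<rho> *\<^sub>R axis z 1) (h k)))\<^sup>2 \<le> 400 * \<beta>"
proof -
  define a b where "a = ca k" and "b = cb k"
  have a: "blk a = k" "sg a = 1" and b: "blk b = k" "sg b = - 1"
    using ca[of k] cb[of k] k l fk by (auto simp: a_def b_def)
  have ab: "a \<noteq> b" "a \<noteq> z" "b \<noteq> z" using a b z by auto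
  let ?z = "\<rho> *\<^sub>R axis z 1"
  let ?T = "tdiff ?z"
  \<comment> \<open>Averaged twice: one integration turns \<open>dw c c\<close> into a difference of
    \<open>w c\<close>, the other supplies the average that \<open>mixed_difference\<close>
    contains.\<close>
  let ?I = "\<lambda>c. lint c r (lint c r (dw c c))"
  define X where "X c = (\<lambda>x. sg c / r\<^sup>2 * ?T (?I c) x)" for c
  have \<beta>0: "0 \<le> \<beta>" using small eta by simp
  have lc: "cper (lint c r g)" if "cper g" for c and g :: "real ^ 'n \<Rightarrow> real"
    using that r by (intro cper_lint) auto
  have bI: "bper (?I c)" for c by (intro cper_imp_bper lc dw_cper)
  have bX: "bper (X c)" for c unfolding X_def by (intro bper_cmult bper_tdiff bI)
  have bT: "bper (?T (h k))" by (intro bper_tdiff h_bper)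
  have TX: "l2 (\<lambda>x. ?T (h k) x - X c x) \<le> 18 * \<beta>" if c: "blk c = k" for c
  proof -
    have sc: "\<bar>sg c\<bar> = 1" "sg c * sg c = 1" using sg[of c] c k abs_mult_self_eq[of "sg c"] by auto
    have 1: "l2 (\<lambda>x. lint c r (dw c c) x - r * dw c c x) \<le> r * (4 * \<beta>)"
      using c by (intro lint_dw_le[OF k inv small r]) auto
    have 2: "l2 (\<lambda>x. ?I c x - r * lint c r (dw c c) x) \<le> r * (r * (4 * \<beta>))"
    proof (rule l2_lint_diff_le[OF lc[OF dw_cper]])
      fix s assume s: "s \<in> {0..r}"
      have "l2 (tdiff (s *\<^sub>R axis c 1) (lint c r (dw c c))) \<le> r * l2 (tdiff (s *\<^sub>R axis c 1) (dw c c))"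
        using r by (subst tdiff_lint[OF dw_cper]) (intro l2_lint_le cper_tdiff dw_cper, simp)
      also have "\<dots> \<le> r * (4 * \<beta>)"
        using r s c by (intro mult_left_mono dw_shift_le[OF k inv small]) auto
      finally show "l2 (tdiff (s *\<^sub>R axis c 1) (lint c r (dw c c))) \<le> r * (4 * \<beta>)" .
    qed (use r in simp)
    have "l2 (\<lambda>x. ?I c x - r\<^sup>2 * dw c c x) =
        l2 (\<lambda>x. (?I c x - r * lint c r (dw c c) x) + r * (lint c r (dw c c) x - r * dw c c x))"
      by (simp add: algebra_simps power2_eq_square)
    also have "\<dots> \<le> r * (r * (4 * \<beta>)) + r * (r * (4 * \<beta>))"
    proof (rule order_trans[OF l2_add_le])
      show "l2 (\<lambda>x. ?I c x - r * lint c r (dw c c) x) + l2 (\<lambda>x. r * (lint c r (dw c c) x - r * dw c c x))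
        \<le> r * (r * (4 * \<beta>)) + r * (r * (4 * \<beta>))"
        unfolding l2_cmult using 1 2 r by (intro add_mono) (auto intro: mult_left_mono)
    qed (intro bper_cmult bper_diff bI dw_bper cper_imp_bper[OF lc[OF dw_cper]])+
    finally have 3: "l2 (\<lambda>x. ?I c x - r\<^sup>2 * dw c c x) \<le> r\<^sup>2 * (8 * \<beta>)" by (simp add: power2_eq_square algebra_simps)
    have "l2 (\<lambda>x. h k x - sg c / r\<^sup>2 * ?I c x - fbar k) \<le> 9 * \<beta>"
    proof -
      have "h k x - sg c / r\<^sup>2 * ?I c x - fbar k
          = - sg c * (dw c c x - sg c * (h k x - fbar k)) + (- sg c / r\<^sup>2) * (?I c x - r\<^sup>2 * dw c c x)" for x
        using r sc by (simp add: field_simps) (simp add: mult.assoc[symmetric] sc)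
      then have "l2 (\<lambda>x. h k x - sg c / r\<^sup>2 * ?I c x - fbar k)
          = l2 (\<lambda>x. - sg c * (dw c c x - sg c * (h k x - fbar k)) + (- sg c / r\<^sup>2) * (?I c x - r\<^sup>2 * dw c c x))"
        by presburger
      also have "\<dots> \<le> l2 (\<lambda>x. - sg c * (dw c c x - sg c * (h k x - fbar k)))
          + l2 (\<lambda>x. (- sg c / r\<^sup>2) * (?I c x - r\<^sup>2 * dw c c x))"
        by (intro l2_add_le bper_cmult bper_diff dw_bper h_bper bper_const bI)
      also have "\<dots> = l2 (\<lambda>x. dw c c x - sg c * (h k x - fbar k)) + l2 (\<lambda>x. ?I c x - r\<^sup>2 * dw c c x) / r\<^sup>2"
        unfolding l2_cmult using sc r by (simp add: abs_divide)
      also have "\<dots> \<le> \<beta> + (r\<^sup>2 * (8 * \<beta>)) / r\<^sup>2"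
        using diag'[of c] c k small 3 by (intro add_mono divide_right_mono) auto
      finally show ?thesis using r by simp
    qed
    from l2_tdiff_diff_le[OF h_bper bper_cmult[OF bI] this, of ?z]
    show ?thesis unfolding X_def tdiff_cmult by simp
  qed
  have T1: "l2 (?T (h k)) \<le> 1"
  proof (rule l2_le_bound[OF bT])
    show "\<bar>?T (h k) x\<bar> \<le> 1" for x
      using h_nonneg[of k x] h_abs_le[of k x] h_nonneg[of k "x + ?z"] h_abs_le[of k "x + ?z"]
      by (simp add: tdiff_def)
  qed
  have Xb: "l2 (X b) \<le> 1 + 18 * \<beta>"
    using l2_triangle[OF bX bT, of b] l2_diff_commute[of "?T (h k)" "X b"] TX[OF b(1)] T1 by simp
  let ?a = "r *\<^sub>R axis a 1" and ?b = "r *\<^sub>R axis b 1"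
  define U where "U = ?T (lint a r (w a))"
  define V where "V = ?T (lint b r (w b))"
  have bUV: "bper U" "bper V" unfolding U_def V_def by (intro bper_tdiff cper_imp_bper[OF lc] w_cper)+
  have Xa_eq: "X a = (\<lambda>x. 1 / r\<^sup>2 * tdiff ?a U x)"
    and Xb_eq: "X b = (\<lambda>x. - (1 / r\<^sup>2) * tdiff ?b V x)"
    using r lint_partial[OF partial, of r a a] lint_partial[OF partial, of r b b]
    by (simp_all add: X_def U_def V_def a b tdiff_lint[symmetric] w_cper tdiff_commute[of ?z])
  have XX: "\<bar>mean (\<lambda>x. X a x * X b x)\<bar> \<le> 36 * \<beta>\<^sup>2"
  proof -
    \<comment> \<open>Summation by parts moves the \<open>a\<close>-difference from \<open>U\<close>
      to \<open>V\<close> and the \<open>b\<close>-difference from \<open>V\<close> to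
      \<open>U\<close>, where both are differences in the direction of the other coordinate of the
      block.\<close>
    have "mean (\<lambda>x. tdiff ?a U x * tdiff ?b V x) = mean (\<lambda>x. U x * tdiff (- ?a) (tdiff ?b V) x)"
      by (intro mean_tdiff_mult bper_tdiff bUV)
    also have "\<dots> = mean (\<lambda>x. tdiff ?b (tdiff (- ?a) V) x * U x)"
      by (simp add: tdiff_commute[of "- ?a"] mult.commute)
    also have "\<dots> = mean (\<lambda>x. tdiff (- ?a) V x * tdiff (- ?b) U x)"
      by (intro mean_tdiff_mult bper_tdiff bUV)
    also have "\<bar>\<dots>\<bar> \<le> l2 (tdiff (- ?a) V) * l2 (tdiff (- ?b) U)"
      by (intro mean_mult_le_l2 bper_tdiff bUV)
    also have "\<dots> = l2 (tdiff ?a V) * l2 (tdiff ?b U)"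
      by (simp only: l2_tdiff_uminus bUV)
    also have "\<dots> \<le> (6 * (r\<^sup>2 * \<beta>)) * (6 * (r\<^sup>2 * \<beta>))"
    proof -
      have "4 * r * \<rho> * \<eta> + 2 * r\<^sup>2 * \<eta> \<le> 6 * (r\<^sup>2 * \<beta>)"
      proof -
        have "4 * r * (\<rho> * \<eta>) \<le> 4 * r * (\<beta> * r)" "2 * r\<^sup>2 * \<eta> \<le> 2 * r\<^sup>2 * \<beta>"
          using mult_left_mono[OF \<rho>(2), of "4 * r"] mult_left_mono[OF small(2), of "2 * r\<^sup>2"] r by auto
        moreover have "4 * r * (\<beta> * r) + 2 * r\<^sup>2 * \<beta> = 6 * (r\<^sup>2 * \<beta>)"
          by (simp add: power2_eq_square)
        ultimately show ?thesis unfolding mult.assoc[of "4 * r"] by linarith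
      qed
      then have "l2 (tdiff ?a V) \<le> 6 * (r\<^sup>2 * \<beta>)" "l2 (tdiff ?b U) \<le> 6 * (r\<^sup>2 * \<beta>)"
        using mixed_difference[of a b z r \<rho>] mixed_difference[of b a z r \<rho>] ab r \<rho>(1)
        by (auto simp: U_def V_def)
      then show ?thesis using \<beta>0 by (intro mult_mono) auto
    qed
    finally have "\<bar>mean (\<lambda>x. tdiff ?a U x * tdiff ?b V x)\<bar> \<le> 36 * (r\<^sup>2 * r\<^sup>2) * \<beta>\<^sup>2"
      by (simp add: power2_eq_square algebra_simps)
    moreover have "mean (\<lambda>x. X a x * X b x) = - (1 / (r\<^sup>2 * r\<^sup>2)) * mean (\<lambda>x. tdiff ?a U x * tdiff ?b V x)"
      unfolding Xa_eq Xb_eq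
      by (subst Bochner_Integration.integral_mult_right_zero[symmetric])
        (intro Bochner_Integration.integral_cong, auto simp: field_simps)
    ultimately have "\<bar>mean (\<lambda>x. X a x * X b x)\<bar> \<le> 1 / (r\<^sup>2 * r\<^sup>2) * (36 * (r\<^sup>2 * r\<^sup>2) * \<beta>\<^sup>2)"
      by (simp only: abs_mult abs_minus) (intro mult_mono, auto)
    then show ?thesis using r by simp
  qed
  have "(l2 (?T (h k)))\<^sup>2 = mean (\<lambda>x. ?T (h k) x * ?T (h k) x)"
    unfolding l2_power2 by (simp add: power2_eq_square)
  also have "\<dots> \<le> \<bar>mean (\<lambda>x. X a x * X b x)\<bar> + (l2 (?T (h k)) * l2 (\<lambda>x. ?T (h k) x - X b x)
      + l2 (\<lambda>x. ?T (h k) x - X a x) * l2 (X b))"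
    using mean_mult_diff[OF bT bT bX bX, of a b] by simp
  also have "\<dots> \<le> 36 * \<beta>\<^sup>2 + (1 * (18 * \<beta>) + 18 * \<beta> * (1 + 18 * \<beta>))"
    using XX TX a b T1 Xb \<beta>0 by (intro add_mono mult_mono) auto
  \<comment> \<open>The quadratic terms add up to 36 + 18 * 18 = 360 and the linear ones to
    36.\<close>
  also have "\<dots> \<le> 400 * \<beta>"
  proof -
    have "\<beta> * \<beta> \<le> \<beta>" using mult_left_mono[OF \<beta> \<beta>0] by simp
    then have "360 * (\<beta> * \<beta>) + 36 * \<beta> \<le> 400 * \<beta>" using \<beta>0 by linarith
    then show ?thesis by (simp add: power2_eq_square algebra_simps)
  qed
  finally show ?thesis .
qed

text \<open>Both cases are brought to the common bound 400\<beta> for the square, which gives 20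
  times the square root of \<beta> for \<open>h k\<close> and, by \<open>\<theta>_le_h\<close>,
  twice that for the next indicator.\<close>

lemma invar_step:
  assumes k: "1 \<le> k" "k < l" and inv: "invar k r \<beta>"
    and small: "60 * \<eta> * real m \<le> \<beta>\<^sup>2" "\<eta> \<le> \<beta>" and \<beta>: "\<beta> \<le> 1" and r: "0 < r"
  shows "invar (Suc k) (\<beta> * r * \<eta> powr (- (if f k = 1 then 1/2 else 1))) (40 * sqrt \<beta>)"
  unfolding invar_def
proof (intro allI impI)
  fix z s assume z: "Suc k \<le> blk z" and s: "0 \<le> s" "s \<le> \<beta> * r * \<eta> powr (- (if f k = 1 then 1/2 else 1))"
  have \<beta>0: "0 \<le> \<beta>" using small eta by simp
  have "(l2 (tdiff (s *\<^sub>R axis z 1) (h k)))\<^sup>2 \<le> 400 * \<beta>"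
  proof (cases "f k = 1")
    case True
    have "s * sqrt \<eta> \<le> \<beta> * r"
      using mult_right_mono[OF s(2), of "sqrt \<eta>"] eta True
      by (simp add: powr_half_sqrt[symmetric] mult.assoc powr_add[symmetric])
    then have "l2 (tdiff (s *\<^sub>R axis z 1) (h k)) \<le> 17 * \<beta>"
      using z s by (intro single_step[OF k inv small r]) auto
    then have "(l2 (tdiff (s *\<^sub>R axis z 1) (h k)))\<^sup>2 \<le> (17 * \<beta>)\<^sup>2" by (rule power_mono) simp
    also have "\<dots> \<le> 400 * \<beta>"
      using mult_left_mono[OF \<beta> \<beta>0] \<beta>0 unfolding power2_eq_square by linarith
    finally show ?thesis .
  next
    case False
    then have fk: "f k = 2" using f12[of k] k l by auto
    have "s \<le> \<beta> * r * inverse \<eta>" using s(2) eta False by (simp add: powr_minus)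
    then have "s * \<eta> \<le> \<beta> * r" using eta by (simp add: field_simps)
    then show ?thesis using z s by (intro double_step[OF k fk inv small \<beta> r]) auto
  qed
  then have "l2 (tdiff (s *\<^sub>R axis z 1) (h k)) \<le> sqrt (400 * \<beta>)" by (rule real_le_rsqrt)
  also have "\<dots> = 20 * sqrt \<beta>"
    using real_sqrt_mult[of "20\<^sup>2" \<beta>] by simp
  finally show "l2 (tdiff (s *\<^sub>R axis z 1) (\<theta> (Suc k))) \<le> 40 * sqrt \<beta>"
    using \<theta>_le_h[of k "s *\<^sub>R axis z 1"] k by simp
qed

lemma invar_mono: "invar k r \<zeta> \<Longrightarrow> \<zeta> \<le> \<zeta>' \<Longrightarrow> invar k r \<zeta>'"
  unfolding invar_def by (meson order_trans)

lemma invar_base: "0 < \<zeta> \<Longrightarrow> invar 1 (\<zeta>\<^sup>2 / L) \<zeta>"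
  unfolding invar_def
proof (intro allI impI)
  fix z s assume \<zeta>: "0 < \<zeta>" and s: "0 \<le> s" "s \<le> \<zeta>\<^sup>2 / L"
  have "(l2 (tdiff (s *\<^sub>R axis z 1) (\<theta> 1)))\<^sup>2 \<le> L * s"
    using base[OF s(1)] unfolding \<theta>_def[abs_def] .
  also have "\<dots> \<le> \<zeta>\<^sup>2" using s L by (simp add: field_simps)
  finally show "l2 (tdiff (s *\<^sub>R axis z 1) (\<theta> 1)) \<le> \<zeta>" using \<zeta> by (auto intro: power2_le_imp_le)
qed

text \<open>A difference over a full period vanishes, so that \<open>h l\<close> is nearly constant.\<close>
lemma invar_final:
  assumes inv: "invar l r \<beta>" and r: "1 \<le> r" and small: "\<eta> \<le> \<beta>\<^sup>2" "0 \<le> \<beta>" "\<beta> \<le> 1"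
  shows "min t (1 - t) \<le> 7 * \<beta>"
proof -
  define a where "a = ca l"
  have a: "blk a = l" "sg a = 1" using ca[of l] l by (auto simp: a_def)
  \<comment> \<open>Next, \<open>\<theta> (Suc l)\<close> is small because the mean of
    \<open>h (Suc l)\<close> is prescribed to be 0 and a nonzero value of \<open>h (Suc l)\<close>
    is at least 1/2. Up to this error \<open>\<theta> l\<close> and \<open>h l\<close>
    agree.\<close>
  have etab: "\<eta> \<le> \<beta>" using small mult_left_mono[OF small(3) small(2)] by (simp add: power2_eq_square)
  have "(l2 (\<theta> (Suc l)))\<^sup>2 \<le> 2 * \<eta>"
  proof -
    have "(l2 (\<theta> (Suc l)))\<^sup>2 \<le> mean (\<lambda>x. 2 * h (Suc l) x)"
      unfolding l2_power2
    proof (intro mean_mono bper_power2 bper_cmult \<theta>_bper h_bper)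
      show "(\<theta> (Suc l) x)\<^sup>2 \<le> 2 * h (Suc l) x" for x
        using h_val[of "Suc l" x] by (auto simp: \<theta>_def)
    qed
    also have "\<dots> \<le> 2 * \<eta>"
    proof (cases "Suc l \<le> m")
      case True
      then show ?thesis using mean_h[of "Suc l"] by (simp add: fbar_def)
    qed (use eta in \<open>simp add: h_large\<close>)
    finally show ?thesis .
  qed
  also have "\<dots> \<le> (3/2 * \<beta>)\<^sup>2" 
  proof -
    have "(3/2 * \<beta>)\<^sup>2 = 9/4 * \<beta>\<^sup>2" by (simp add: power2_eq_square)
    then show ?thesis using small(1) zero_le_power2[of \<beta>] by linarith
  qed
  finally have \<theta>': "l2 (\<theta> (Suc l)) \<le> 3/2 * \<beta>" using small by (auto intro: power2_le_imp_le)
  have h\<theta>: "(\<lambda>x. \<theta> l x - h l x) = (\<lambda>x. (1/2) * \<theta> (Suc l) x)"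
    using \<theta>_rec[of l] l by auto
  have d: "l2 (\<lambda>x. dw a a x - (h l x - t)) \<le> \<eta>"
    using diag'[of a] a l by (simp add: fbar_def)
  have T: "l2 (tdiff (s *\<^sub>R axis a 1) (dw a a)) \<le> 9/2 * \<beta>" if s: "s \<in> {0..1}" for s
  proof -
    have "l2 (\<lambda>x. dw a a x - h l x - - t) \<le> \<eta>" using d by (simp add: algebra_simps)
    then have "l2 (tdiff (s *\<^sub>R axis a 1) (dw a a)) \<le> l2 (tdiff (s *\<^sub>R axis a 1) (h l)) + 2 * \<eta>"
      by (rule l2_tdiff_triangle[OF dw_bper h_bper])
    also have "l2 (tdiff (s *\<^sub>R axis a 1) (h l)) \<le> l2 (tdiff (s *\<^sub>R axis a 1) (\<theta> l)) + 2 * (1/2 * (3/2 * \<beta>))"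
    proof (rule l2_tdiff_triangle[OF h_bper \<theta>_bper, where c = 0])
      have "l2 (\<lambda>x. h l x - \<theta> l x - 0) = l2 (\<lambda>x. (1/2) * \<theta> (Suc l) x)"
        using l2_diff_commute[of "h l" "\<theta> l"] unfolding h\<theta> by simp
      also have "\<dots> \<le> 1/2 * (3/2 * \<beta>)" using \<theta>' unfolding l2_cmult by simp
      finally show "l2 (\<lambda>x. h l x - \<theta> l x - 0) \<le> 1/2 * (3/2 * \<beta>)" .
    qed
    also have "l2 (tdiff (s *\<^sub>R axis a 1) (\<theta> l)) \<le> \<beta>"
      using inv s r a by (simp add: invar_def)
    finally show ?thesis using etab by simp
  qed
  have "lint a 1 (dw a a) = (\<lambda>x. 0)"
    using lint_partial[OF partial, of 1 a a] w_cper[of a] by (simp add: tdiff_def fun_eq_iff cper_def periodic_def)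
  then have p: "l2 (dw a a) \<le> 9/2 * \<beta>"
    using l2_lint_diff_le[OF dw_cper, of 1 a a a "9/2 * \<beta>"] T by (simp add: l2_minus)
  \<comment> \<open>\<open>\<theta> l\<close> has only the values 0 and 1, so it keeps this distance
    from \<open>t\<close> at every point. The errors below add up to 25/4 \<beta>.\<close>
  have "min t (1 - t) \<le> l2 (\<lambda>x. \<theta> l x - t)"
  proof -
    have "sqrt (mean (\<lambda>x :: real ^ 'n. (min t (1 - t))\<^sup>2)) \<le> l2 (\<lambda>x. \<theta> l x - t)"
      unfolding l2_def
    proof (intro real_sqrt_le_mono mean_mono bper_power2 bper_diff \<theta>_bper bper_const)
      show "(min t (1 - t))\<^sup>2 \<le> (\<theta> l x - t)\<^sup>2" for x
      proof -
        have "min t (1 - t) \<le> \<bar>\<theta> l x - t\<bar>" using t by (auto simp: \<theta>_def)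
        then show ?thesis using power_mono[of "min t (1 - t)" "\<bar>\<theta> l x - t\<bar>" 2] t by simp
      qed
    qed
    then show ?thesis using t by (simp add: space_cell)
  qed
  also have "\<dots> = l2 (\<lambda>x. (\<theta> l x - h l x) + (dw a a x - (dw a a x - (h l x - t))))"
    by simp
  also have "\<dots> \<le> l2 (\<lambda>x. \<theta> l x - h l x) + (l2 (dw a a) + l2 (\<lambda>x. dw a a x - (h l x - t)))"
    by (intro order_trans[OF l2_add_le] add_left_mono l2_diff_le bper_diff dw_bper \<theta>_bper h_bper bper_const)
  also have "\<dots> \<le> 3/4 * \<beta> + (9/2 * \<beta> + \<beta>)"
    unfolding h\<theta> l2_cmult using \<theta>' p d etab by (intro add_mono) auto
  finally show ?thesis using small by simp
qed

end

text \<open>The tolerance \<zeta> is prescribed for the last coefficient and the earlier ones are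
  chosen backwards. The statement lives outside the locale because \<open>c\<close> and
  \<open>e\<close> must be found before \<eta>, \<open>L\<close>, \<open>h\<close>, \<open>w\<close>
  and \<open>dw\<close> are given.\<close>

lemma laminate_approx_invar:
  fixes m l :: nat and f :: "nat \<Rightarrow> nat" and ca cb :: "nat \<Rightarrow> 'n::finite"
    and blk :: "'n \<Rightarrow> nat" and sg :: "'n \<Rightarrow> real" and t :: real
  assumes "1 \<le> k" "k \<le> l" "0 < \<zeta>"
  shows "\<exists>c>0. \<exists>e>0. \<forall>\<eta> L h w dw. laminate_approx m l f ca cb blk sg t \<eta> L h w dw \<longrightarrow> \<eta> \<le> e \<longrightarrow>
    laminate_approx.invar blk h k (c / L * \<eta> powr (- (\<Sum>i = 1..<k. if f i = 1 then 1/2 else 1))) \<zeta>"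
  using assms
proof (induction k arbitrary: \<zeta> rule: nat_induct_at_least)
  case base
  show ?case
  proof (rule exI[of _ "\<zeta>\<^sup>2"], rule conjI[OF _ exI[of _ 1]], goal_cases)
    case 2
    show ?case
  proof (intro conjI allI impI)
    fix \<eta> L h w dw assume "laminate_approx m l f ca cb blk sg t \<eta> L h w dw"
    then interpret laminate_approx m l f ca cb blk sg t \<eta> L h w dw .
    show "invar 1 (\<zeta>\<^sup>2 / L * \<eta> powr (- (\<Sum>i = 1..<1. if f i = 1 then 1/2 else 1))) \<zeta>"
      using invar_base[OF base.prems(2)] eta by simp
  qed simp
  qed (use base in simp)
next
  case (Suc k)
  define \<beta> where "\<beta> = min 1 ((\<zeta> / 40)\<^sup>2)"
  have \<beta>: "0 < \<beta>" "\<beta> \<le> 1" "40 * sqrt \<beta> \<le> \<zeta>"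
  proof -
    have "sqrt \<beta> \<le> sqrt ((\<zeta> / 40)\<^sup>2)" unfolding \<beta>_def by (intro real_sqrt_le_mono) simp
    then show "40 * sqrt \<beta> \<le> \<zeta>" using Suc.prems by simp
  qed (use Suc.prems in \<open>auto simp: \<beta>_def\<close>)
  obtain c e where c: "0 < c" "0 < e" and
    IH: "\<And>\<eta> L h w dw. laminate_approx m l f ca cb blk sg t \<eta> L h w dw \<Longrightarrow> \<eta> \<le> e \<Longrightarrow>
      laminate_approx.invar blk h k (c / L * \<eta> powr (- (\<Sum>i = 1..<k. if f i = 1 then 1/2 else 1))) \<beta>"
    using Suc.IH[of \<beta>] Suc.prems \<beta> by (metis Suc_leD)
  \<comment> \<open>The three bounds are the smallness of \<eta> assumed for the tolerance \<beta>:
    that of the induction hypothesis and the two of \<open>invar_step\<close>.\<close>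
  define e' where "e' = min e (min \<beta> (\<beta>\<^sup>2 / (60 * (real m + 1))))"
  show ?case
  proof (rule exI[of _ "\<beta> * c"], rule conjI[OF _ exI[of _ e']], goal_cases)
    case 2
    show ?case
  proof (intro conjI allI impI)
    fix \<eta> L h w dw assume A: "laminate_approx m l f ca cb blk sg t \<eta> L h w dw" and e: "\<eta> \<le> e'"
    then interpret laminate_approx m l f ca cb blk sg t \<eta> L h w dw by simp
    let ?q = "\<Sum>i = 1..<k. if f i = 1 then 1/2 else 1 :: real"
    have "\<eta> \<le> \<beta>\<^sup>2 / (60 * (real m + 1))" using e by (simp add: e'_def)
    then have "60 * \<eta> * (real m + 1) \<le> \<beta>\<^sup>2" by (simp add: field_simps)
    moreover have "60 * \<eta> * real m \<le> 60 * \<eta> * (real m + 1)" using eta by simp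
    ultimately have small: "60 * \<eta> * real m \<le> \<beta>\<^sup>2" by linarith
    have step: "invar (Suc k) (\<beta> * (c / L * \<eta> powr (- ?q)) * \<eta> powr (- (if f k = 1 then 1/2 else 1))) (40 * sqrt \<beta>)"
    proof (rule invar_step)
      show "invar k (c / L * \<eta> powr (- ?q)) \<beta>" using IH[OF A] e by (simp add: e'_def)
      show "0 < c / L * \<eta> powr (- ?q)" using c L eta by simp
    qed (use Suc small \<beta> e in \<open>auto simp: e'_def\<close>)
    have eq: "\<beta> * (c / L * \<eta> powr (- ?q)) * \<eta> powr (- (if f k = 1 then 1/2 else 1))
        = \<beta> * c / L * \<eta> powr (- (\<Sum>i = 1..<Suc k. if f i = 1 then 1/2 else 1))"
    proof -
      have "- (\<Sum>i = 1..<Suc k. if f i = 1 then 1/2 else 1) = - ?q + - (if f k = 1 then 1/2 else 1)"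
        using Suc.hyps by simp
      then show ?thesis by (simp only: powr_add mult.assoc times_divide_eq_left times_divide_eq_right)
    qed
    show "invar (Suc k) (\<beta> * c / L * \<eta> powr (- (\<Sum>i = 1..<Suc k. if f i = 1 then 1/2 else 1))) \<zeta>"
      using invar_mono[OF step \<beta>(3)] unfolding eq .
  qed (use c \<beta> in \<open>auto simp: e'_def\<close>)
  qed (use c \<beta> in simp)
qed

theorem laminate_approx_lower_bound:
  fixes m l :: nat and f :: "nat \<Rightarrow> nat" and ca cb :: "nat \<Rightarrow> 'n::finite"
    and blk :: "'n \<Rightarrow> nat" and sg :: "'n \<Rightarrow> real" and t :: real
  assumes l: "1 \<le> l" and t: "0 < t" "t < 1"
  obtains c e where "0 < c" "0 < e"
    "\<And>\<eta> L h w dw. laminate_approx m l f ca cb blk sg t \<eta> L h w dw \<Longrightarrow> \<eta> \<le> e \<Longrightarrow>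
      c \<le> L * \<eta> powr (\<Sum>i = 1..<l. if f i = 1 then 1/2 else 1)"
proof -
  \<comment> \<open>Any \<beta> with \<open>7 * \<beta> < min t (1 - t)\<close> contradicts
    \<open>invar_final\<close>, so the length reached must be less than one period.\<close>
  define \<beta> where "\<beta> = min t (1 - t) / 8"
  have \<beta>: "0 < \<beta>" "\<beta> \<le> 1" "7 * \<beta> < min t (1 - t)" using t by (auto simp: \<beta>_def min_def field_simps)
  obtain c e where c: "0 < c" "0 < e" and
    I: "\<And>\<eta> L h w dw. laminate_approx m l f ca cb blk sg t \<eta> L h w dw \<Longrightarrow> \<eta> \<le> e \<Longrightarrow>
      laminate_approx.invar blk h l (c / L * \<eta> powr (- (\<Sum>i = 1..<l. if f i = 1 then 1/2 else 1))) \<beta>"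
    using laminate_approx_invar[of l l \<beta>, where m = m and f = f and ca = ca and cb = cb and blk = blk and sg = sg and t = t] l \<beta>
    by (metis order_refl)
  show ?thesis
  proof (rule that[of c "min e (\<beta>\<^sup>2)"])
    fix \<eta> L h w dw assume A: "laminate_approx m l f ca cb blk sg t \<eta> L h w dw" and e: "\<eta> \<le> min e (\<beta>\<^sup>2)"
    then interpret laminate_approx m l f ca cb blk sg t \<eta> L h w dw by simp
    let ?q = "\<Sum>i = 1..<l. if f i = 1 then 1/2 else 1 :: real"
    have "invar l (c / L * \<eta> powr (- ?q)) \<beta>" using I[OF A] e by simp
    then have "\<not> 1 \<le> c / L * \<eta> powr (- ?q)" using invar_final[of "c / L * \<eta> powr (- ?q)" \<beta>] e \<beta> by fastforce
    then show "c \<le> L * \<eta> powr ?q" using L eta by (simp add: powr_minus field_simps)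
  qed (use c \<beta> in auto)
qed

section \<open>Laminates of the wells\<close>

lemma position_inj: "inj (position :: 'n::{finite,linorder} \<Rightarrow> nat)"
proof (rule linorder_injI)
  fix a b :: 'n assume "a < b"
  then have "{c. c \<le> a} \<subseteq> {c. c \<le> b}" "b \<in> {c. c \<le> b} - {c. c \<le> a}" by auto
  then have "{c. c \<le> a} \<subset> {c. c \<le> b}" by blast
  then show "position a \<noteq> position b"
    unfolding position_def by (metis finite less_irrefl psubset_card_mono)
qed

lemma sym_tensor_nth: "sym_tensor a b $ i $ j = (a $ i * b $ j + b $ i * a $ j) / 2"
  by (simp add: sym_tensor_def tensor_def)

text \<open>If the off-diagonal entries vanish, then \<open>a\<^sub>i b\<^sub>j = - a\<^sub>j b\<^sub>i\<close>; multiply this cyclically.\<close>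
lemma diagonal_sym_tensor_three:
  assumes off: "\<And>i j. i \<noteq> j \<Longrightarrow> sym_tensor a b $ i $ j = 0"
    and d: "i \<noteq> j" "j \<noteq> k" "i \<noteq> k"
  shows "sym_tensor a b $ i $ i = 0 \<or> sym_tensor a b $ j $ j = 0 \<or> sym_tensor a b $ k $ k = 0"
proof -
  have 1: "a $ i * b $ j = - (b $ i * a $ j)" "a $ j * b $ k = - (b $ j * a $ k)" "a $ k * b $ i = - (b $ k * a $ i)"
    using off[of i j] off[of j k] off[of k i] d by (auto simp: sym_tensor_nth)
  have "(a $ i * b $ i) * (a $ j * b $ j) * (a $ k * b $ k) = (a $ i * b $ j) * (a $ j * b $ k) * (a $ k * b $ i)"
    by simp
  also have "\<dots> = - ((a $ i * b $ i) * (a $ j * b $ j) * (a $ k * b $ k))"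
    unfolding 1 by simp
  finally have "(a $ i * b $ i) * (a $ j * b $ j) * (a $ k * b $ k) = 0" by linarith
  then show ?thesis by (auto simp: sym_tensor_nth)
qed

locale well_coordinates =
  fixes m :: nat and f :: "nat \<Rightarrow> nat" and ca cb :: "nat \<Rightarrow> 'n::{finite,linorder}"
  assumes f12: "\<And>i. i \<in> {1..m} \<Longrightarrow> f i = 1 \<or> f i = 2"
    and nonadjacent: "\<And>i. 1 \<le> i \<Longrightarrow> i < m \<Longrightarrow> \<not> (f i = 1 \<and> f (Suc i) = 1)"
    and position_ca: "\<And>i. i \<in> {1..m} \<Longrightarrow> position (ca i) = 1 + (\<Sum>j\<in>{1..<i}. f j)"
    and position_cb: "\<And>i. i \<in> {1..m} \<Longrightarrow> f i = 2 \<Longrightarrow> position (cb i) = 2 + (\<Sum>j\<in>{1..<i}. f j)"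
begin

text \<open>The value 0 marks coordinates outside the supports of all step matrices. There is such a
  coordinate for \<open>m = 1\<close> and \<open>f 1 = 1\<close>, where the dimension is 2.\<close>

definition blk :: "'n \<Rightarrow> nat"
  where "blk a = (if \<exists>i\<in>{1..m}. a = ca i \<or> f i = 2 \<and> a = cb i
    then SOME i. i \<in> {1..m} \<and> (a = ca i \<or> f i = 2 \<and> a = cb i) else 0)"

definition sg :: "'n \<Rightarrow> real"
  where "sg a = (if a = ca (blk a) then 1 else - 1)"

definition comb :: "(nat \<Rightarrow> real) \<Rightarrow> real ^ 'n::_ ^ 'n::_"
  where "comb c = (\<Sum>k = 1..m. c k *\<^sub>R step_matrix f k)"

text \<open>\<open>comb (profile i s)\<close> is \<open>J\<^sub>i\<^sub>-\<^sub>1 + s M\<^sub>i\<close>.\<close>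
definition profile :: "nat \<Rightarrow> real \<Rightarrow> nat \<Rightarrow> real"
  where "profile i s k = (if k < i then 1/2 else if k = i then s else 0)"

text \<open>The supports occupy consecutive ranges of positions, the \<open>i\<close>-th having
  length \<open>f i\<close>.\<close>

lemma block_unique:
  assumes i: "i \<in> {1..m}" "a = ca i \<or> f i = 2 \<and> a = cb i"
    and j: "j \<in> {1..m}" "a = ca j \<or> f j = 2 \<and> a = cb j"
  shows "i = j"
proof -
  have *: False if ij: "i < j" "i \<in> {1..m}" "j \<in> {1..m}" "a = ca i \<or> f i = 2 \<and> a = cb i"
    "a = ca j \<or> f j = 2 \<and> a = cb j" for i j
  proof -
    have "(\<Sum>k\<in>{1..<i}. f k) + f i = (\<Sum>k\<in>{1..<Suc i}. f k)"
      using ij by simp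
    also have "\<dots> \<le> (\<Sum>k\<in>{1..<j}. f k)" using ij by (intro sum_mono2) auto
    finally have "(\<Sum>k\<in>{1..<i}. f k) + f i \<le> (\<Sum>k\<in>{1..<j}. f k)" .
    then show False
      using position_ca[of i] position_ca[of j] position_cb[of i] position_cb[of j] f12[of i] ij by auto
  qed
  show ?thesis using *[of i j] *[of j i] assms by (metis linorder_neqE_nat)
qed

lemma blk_eq: "i \<in> {1..m} \<Longrightarrow> a = ca i \<or> f i = 2 \<and> a = cb i \<Longrightarrow> blk a = i"
proof -
  assume i: "i \<in> {1..m}" "a = ca i \<or> f i = 2 \<and> a = cb i"
  then have "(SOME i. i \<in> {1..m} \<and> (a = ca i \<or> f i = 2 \<and> a = cb i)) = i"
    using block_unique by (intro some_equality) blast+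
  then show ?thesis using i by (auto simp: blk_def)
qed

lemma ca_neq_cb: "i \<in> {1..m} \<Longrightarrow> f i = 2 \<Longrightarrow> ca i \<noteq> cb i"
  using position_ca[of i] position_cb[of i] by fastforce

lemma blk_ca: "i \<in> {1..m} \<Longrightarrow> blk (ca i) = i \<and> sg (ca i) = 1"
  and blk_cb: "i \<in> {1..m} \<Longrightarrow> f i = 2 \<Longrightarrow> blk (cb i) = i \<and> sg (cb i) = - 1"
  using blk_eq[of i] ca_neq_cb[of i] by (auto simp: sg_def)

lemma abs_sg: "\<bar>sg a\<bar> = 1"
  by (simp add: sg_def)

lemma blk_cases: "blk a = 0 \<or> blk a \<in> {1..m} \<and> (a = ca (blk a) \<or> f (blk a) = 2 \<and> a = cb (blk a))"
proof (cases "\<exists>i\<in>{1..m}. a = ca i \<or> f i = 2 \<and> a = cb i")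
  case True
  then show ?thesis using blk_eq by metis
next
  case False
  then have "blk a = 0" unfolding blk_def by (rule if_not_P)
  then show ?thesis by simp
qed

lemma blk_le: "blk a \<le> m"
  using blk_cases[of a] by auto

lemma step_matrix_nth:
  assumes "k \<in> {1..m}"
  shows "(step_matrix f k :: real ^ 'n::_ ^ 'n::_) $ a $ b = (if a = b \<and> blk a = k then sg a else 0)"
proof -
  have 1: "position a = 1 + (\<Sum>j\<in>{1..<k}. f j) \<longleftrightarrow> a = ca k"
    using position_ca[OF assms] inj_eq[OF position_inj] by metis
  have 2: "f k = 2 \<Longrightarrow> position a = 2 + (\<Sum>j\<in>{1..<k}. f j) \<longleftrightarrow> a = cb k"
    using position_cb[OF assms] inj_eq[OF position_inj] by metis
  have "blk a = k \<longleftrightarrow> a = ca k \<or> f k = 2 \<and> a = cb k"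
    using blk_eq[OF assms, of a] blk_cases[of a] assms by auto
  then show ?thesis
    using 1 2 ca_neq_cb[OF assms] by (auto simp: step_matrix_def sg_def)
qed

lemma comb_nth: "comb c $ a $ b = (if a = b \<and> 1 \<le> blk a then sg a * c (blk a) else 0)"
proof -
  have "comb c $ a $ b = (\<Sum>k = 1..m. c k * step_matrix f k $ a $ b)"
    by (simp add: comb_def)
  also have "\<dots> = (\<Sum>k = 1..m. if k = blk a then (if a = b then sg a * c (blk a) else 0) else 0)"
    by (intro sum.cong refl) (auto simp: step_matrix_nth)
  also have "\<dots> = (if a = b \<and> 1 \<le> blk a then sg a * c (blk a) else 0)"
    using blk_cases[of a] by (subst sum.delta) auto
  finally show ?thesis .
qed

lemma comb_diff: "comb c - comb c' = comb (\<lambda>k. c k - c' k)"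
  by (simp add: comb_def scaleR_diff_left sum_subtractf)

lemma comb_convex: "t *\<^sub>R comb c + (1 - t) *\<^sub>R comb c' = comb (\<lambda>k. t * c k + (1 - t) * c' k)"
  by (simp add: comb_def scaleR_sum_right scaleR_add_left sum.distrib)

lemma comb_cong: "(\<And>k. k \<in> {1..m} \<Longrightarrow> c k = c' k) \<Longrightarrow> comb c = comb c'"
  unfolding comb_def by (intro sum.cong) auto

lemma transpose_comb: "transpose (comb c) = comb c"
  by (auto simp: transpose_def vec_eq_iff comb_nth)

lemma well_eq: "j \<in> {1..m} \<Longrightarrow> well f j = comb (profile j 1)" and well_0_eq: "well f 0 = comb (profile 1 0)"
proof -
  assume j: "j \<in> {1..m}"
  have "comb (profile j 1) = (\<Sum>k = 1..j. profile j 1 k *\<^sub>R step_matrix f k)"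
    unfolding comb_def using j by (intro sum.mono_neutral_right) (auto simp: profile_def)
  also have "\<dots> = (\<Sum>k = 1..j - 1. profile j 1 k *\<^sub>R step_matrix f k) + step_matrix f j"
    using j by (cases j) (auto simp: profile_def)
  also have "(\<Sum>k = 1..j - 1. profile j 1 k *\<^sub>R step_matrix f k) = (\<Sum>k = 1..j - 1. (1/2) *\<^sub>R (step_matrix f k :: real ^ 'n::_ ^ 'n::_))"
    by (intro sum.cong) (auto simp: profile_def)
  finally show "well f j = comb (profile j 1)"
    using j by (simp add: well_def half_sum_def scaleR_sum_right)
next
  have "comb (profile 1 0) = 0" unfolding comb_def by (intro sum.neutral) (auto simp: profile_def)
  then show "well f 0 = comb (profile 1 0)" by (simp add: well_def)
qed

text \<open>A diagonal symmetrized product has at most two nonzero diagonal entries. Two differing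
  blocks already give three of them unless both are single; two single blocks are not neighbours,
  and then a block between them differs as well. This is where the condition defining
  \<open>admissible\<close> enters.\<close>

lemma compatible_blocks:
  assumes comp: "compatible (comb c) (comb c')"
    and ij: "i \<in> {1..m}" "j \<in> {1..m}" "i < j" "c i \<noteq> c' i" "c j \<noteq> c' j"
    and between: "\<And>k. i < k \<Longrightarrow> k < j \<Longrightarrow> c k \<noteq> c' k"
  shows False
proof -
  obtain a b where ab: "comb (\<lambda>k. c k - c' k) = sym_tensor a b"
    using comp comb_diff[of c c'] by (auto simp: compatible_def)
  have off: "sym_tensor a b $ i $ j = 0" if "i \<noteq> j" for i j
    using that unfolding ab[symmetric] by (simp add: comb_nth)
  have nz: "sym_tensor a b $ x $ x \<noteq> 0" if "blk x = k" "k \<in> {1..m}" "c k \<noteq> c' k" for x k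
    using that abs_sg[of x] unfolding ab[symmetric] by (auto simp: comb_nth)
  have three: False if "blk x \<in> {1..m}" "blk y \<in> {1..m}" "blk z \<in> {1..m}" "x \<noteq> y" "y \<noteq> z" "x \<noteq> z"
    "c (blk x) \<noteq> c' (blk x)" "c (blk y) \<noteq> c' (blk y)" "c (blk z) \<noteq> c' (blk z)" for x y z
    using diagonal_sym_tensor_three[OF off that(4-6)] nz[of x] nz[of y] nz[of z] that by blast
  have ne: "ca i \<noteq> ca j" using blk_ca[of i] blk_ca[of j] ij by auto
  consider "f i = 2" | "f j = 2" | "f i = 1" "f j = 1" using f12 ij by blast
  then show False
  proof cases
    case 1
    then show False using three[of "ca i" "cb i" "ca j"] blk_ca[of i] blk_cb[of i] blk_ca[of j] ij ne ca_neq_cb[of i] by force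
  next
    case 2
    then show False using three[of "ca j" "cb j" "ca i"] blk_ca[of i] blk_cb[of j] blk_ca[of j] ij ne ca_neq_cb[of j] by force
  next
    case 3
    then have "Suc i \<noteq> j" using nonadjacent[of i] ij by auto
    then have k: "i < Suc i" "Suc i < j" "Suc i \<in> {1..m}" using ij by auto
    then show False
      using three[of "ca i" "ca (Suc i)" "ca j"] blk_ca[of i] blk_ca[of "Suc i"] blk_ca[of j] ij between[OF k(1,2)] by force
  qed
qed

text \<open>The segments from \<open>half_sum f (i - 1)\<close> to the well with index
  \<open>i\<close> for \<open>i \<le> j\<close>, and besides them the wells; the well with index 0
  is the starting point of the first segment.\<close>

definition rank_set :: "nat \<Rightarrow> (real ^ 'n::_ ^ 'n::_) set"
  where "rank_set j = {comb (profile i s) | i s.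
    i \<in> {1..m} \<and> s \<in> {0..1} \<and> (i \<le> j \<or> s = 1 \<or> i = 1 \<and> s = 0)}"

text \<open>The midpoint of each segment is the starting point of the next: here laminates of
  successive orders are attached to each other.\<close>

lemma profile_half: "comb (profile i (1/2)) = comb (profile (Suc i) 0)"
  by (intro comb_cong) (auto simp: profile_def)

text \<open>For \<open>i < k\<close> only one coefficient may differ. If \<open>s\<close> is not
  1/2, it is the one with index \<open>i\<close>, which forces the second matrix to be the midpoint
  of segment \<open>i\<close>. If \<open>s\<close> is 1/2, the first matrix is the starting point of
  segment \<open>i + 1\<close>, and the second one lies there too, either because
  \<open>k = i + 1\<close> or as its midpoint.\<close>

lemma compatible_segment:
  assumes comp: "compatible (comb (profile i s)) (comb (profile k s'))" and ik: "i \<le> k"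
    and i: "i \<in> {1..m}" "s \<in> {0..1}" "i \<le> j \<or> s = 1 \<or> i = 1 \<and> s = 0"
    and k: "k \<in> {1..m}" "s' \<in> {0..1}" "k \<le> j \<or> s' = 1 \<or> k = 1 \<and> s' = 0"
  shows "\<exists>n \<sigma> \<tau>. comb (profile i s) = comb (profile n \<sigma>) \<and> comb (profile k s') = comb (profile n \<tau>) \<and>
    n \<in> {1..m} \<and> n \<le> Suc j \<and> \<sigma> \<in> {0..1} \<and> \<tau> \<in> {0..1}"
proof (cases "i = k")
  case True
  have "s \<noteq> s'" using comp True by (auto simp: compatible_def)
  then have "i \<le> Suc j" using i k True by auto
  then show ?thesis using i k True by blast
next
  case False
  then have ik: "i < k" using ik by simp
  have eq: "x = y" if "x \<in> {i..k}" "y \<in> {i..k}" "profile i s x \<noteq> profile k s' x" "profile i s y \<noteq> profile k s' y" for x y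
  proof -
    have *: False if "x < y" "x \<in> {i..k}" "y \<in> {i..k}" "profile i s x \<noteq> profile k s' x" "profile i s y \<noteq> profile k s' y" for x y
      using that i k by (intro compatible_blocks[OF comp, of x y]) (auto simp: profile_def)
    show ?thesis using *[of x y] *[of y x] that by (metis linorder_neqE_nat)
  qed
  show ?thesis
  proof (cases "s = 1/2")
    case False
    have "s' = 0" using eq[of i k] ik False by (auto simp: profile_def split: if_splits)
    moreover have "k = Suc i"
    proof (rule ccontr)
      assume "k \<noteq> Suc i"
      then show False using eq[of i "Suc i"] ik False by (auto simp: profile_def)
    qed
    ultimately have "comb (profile i s) = comb (profile i s) \<and> comb (profile k s') = comb (profile i (1/2)) \<and>
        i \<in> {1..m} \<and> i \<le> Suc j \<and> s \<in> {0..1} \<and> (1/2 :: real) \<in> {0..1}"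
      using i k by (auto simp: profile_half)
    then show ?thesis by blast
  next
    case s: True
    show ?thesis
    proof (cases "k = Suc i")
      case True
      then have "comb (profile i s) = comb (profile k 0) \<and> comb (profile k s') = comb (profile k s') \<and>
        k \<in> {1..m} \<and> k \<le> Suc j \<and> (0 :: real) \<in> {0..1} \<and> s' \<in> {0..1}"
        using i k unfolding s by (auto simp: profile_half)
      then show ?thesis by blast
    next
      case False
      have "s' = 0" using eq[of "Suc i" k] ik False by (auto simp: profile_def split: if_splits)
      moreover have "k = Suc (Suc i)"
      proof (rule ccontr)
        assume "k \<noteq> Suc (Suc i)"
        then show False using eq[of "Suc i" "Suc (Suc i)"] ik False by (auto simp: profile_def)
      qed
      ultimately have "comb (profile i s) = comb (profile (Suc i) 0) \<and> comb (profile k s') = comb (profile (Suc i) (1/2)) \<and>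
        Suc i \<in> {1..m} \<and> Suc i \<le> Suc j \<and> (0 :: real) \<in> {0..1} \<and> (1/2 :: real) \<in> {0..1}"
        using i k unfolding s by (auto simp: profile_half)
      then show ?thesis by blast
    qed
  qed
qed

lemma profile_convex: "t *\<^sub>R comb (profile n \<sigma>) + (1 - t) *\<^sub>R comb (profile n \<tau>) = comb (profile n (t * \<sigma> + (1 - t) * \<tau>))"
  unfolding comb_convex by (intro comb_cong) (auto simp: profile_def algebra_simps)

lemma compatible_sym: "compatible A B \<Longrightarrow> compatible B A" for A B :: "real ^ 'n::_ ^ 'n::_"
proof -
  assume "compatible A B"
  then obtain a b where ab: "transpose A = A" "transpose B = B" "A \<noteq> B" "a \<noteq> 0" "b \<noteq> 0" "A - B = sym_tensor a b"
    by (auto simp: compatible_def)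
  have "B - A = - (A - B)" by simp
  also have "\<dots> = sym_tensor (- a) b"
    unfolding ab(6) by (simp add: vec_eq_iff sym_tensor_nth field_simps)
  finally show "compatible B A" using ab unfolding compatible_def by (metis neg_equal_0_iff_equal)
qed

text \<open>By \<open>compatible_segment\<close>, a lamination of two members stays on a segment of
  index at most \<open>j + 1\<close>.\<close>

lemma laminates_subset: "m \<ge> 1 \<Longrightarrow> laminates (wells m f :: (real ^ 'n::_ ^ 'n::_) set) j \<subseteq> rank_set j"
proof (induction j)
  case 0
  show ?case
  proof
    fix A :: "real ^ 'n::_ ^ 'n::_" assume "A \<in> laminates (wells m f) 0"
    then obtain i where i: "i \<le> m" "A = well f i" by (auto simp: wells_def)
    show "A \<in> rank_set 0"
    proof (cases "i = 0")
      case True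
      then show ?thesis using i 0 unfolding rank_set_def well_0_eq
        by (intro CollectI exI[of _ 1] exI[of _ 0]) (auto simp: well_0_eq)
    next
      case False
      then show ?thesis using i well_eq[of i] unfolding rank_set_def
        by (intro CollectI exI[of _ i] exI[of _ 1]) auto
    qed
  qed
next
  case (Suc j)
  show ?case
  proof
    fix A :: "real ^ 'n::_ ^ 'n::_" assume A: "A \<in> laminates (wells m f) (Suc j)"
    show "A \<in> rank_set (Suc j)"
    proof (cases "A \<in> laminates (wells m f) j")
      case True
      then show ?thesis using Suc unfolding rank_set_def by fastforce
    next
      case False
      then obtain t B1 B2 where t: "0 < t" "t < 1" and A_eq: "A = t *\<^sub>R B1 + (1 - t) *\<^sub>R B2"
        and B: "B1 \<in> rank_set j" "B2 \<in> rank_set j" and comp: "compatible B1 B2"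
        using A Suc by auto
      obtain i s where i: "B1 = comb (profile i s)" "i \<in> {1..m}" "s \<in> {0..1}" "i \<le> j \<or> s = 1 \<or> i = 1 \<and> s = 0"
        using B(1) by (auto simp: rank_set_def)
      obtain k s' where k: "B2 = comb (profile k s')" "k \<in> {1..m}" "s' \<in> {0..1}" "k \<le> j \<or> s' = 1 \<or> k = 1 \<and> s' = 0"
        using B(2) by (auto simp: rank_set_def)
      have "\<exists>n \<sigma> \<tau>. B1 = comb (profile n \<sigma>) \<and> B2 = comb (profile n \<tau>) \<and>
        n \<in> {1..m} \<and> n \<le> Suc j \<and> \<sigma> \<in> {0..1} \<and> \<tau> \<in> {0..1}"
      proof (cases "i \<le> k")
        case True
        then show ?thesis using compatible_segment[OF _ True i(2-4) k(2-4)] comp i(1) k(1) by simp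
      next
        case False
        then show ?thesis
          using compatible_segment[OF _ _ k(2-4) i(2-4)] compatible_sym[OF comp] i(1) k(1) by (metis nat_le_linear)
      qed
      then obtain n \<sigma> \<tau> where n: "B1 = comb (profile n \<sigma>)" "B2 = comb (profile n \<tau>)"
        "n \<in> {1..m}" "n \<le> Suc j" "\<sigma> \<in> {0..1}" "\<tau> \<in> {0..1}" by blast
      have "t * \<sigma> + (1 - t) * \<tau> \<in> {0..1}"
        using n t convex_bound_le[of \<sigma> 1 \<tau> t "1 - t"] by (auto intro!: add_nonneg_nonneg)
      then show ?thesis unfolding A_eq n(1,2) profile_convex rank_set_def using n by blast
    qed
  qed
qed

lemma laminates_mono: "i \<le> j \<Longrightarrow> laminates K i \<subseteq> laminates K j" for K :: "(real ^ 'n::_ ^ 'n::_) set"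
  by (induction j) (auto simp: le_Suc_eq)

lemma compatible_step:
  assumes n: "n \<in> {1..m}"
  shows "compatible (comb (profile n 1)) (comb (profile n 0))"
proof -
  let ?e = "\<lambda>i. axis i 1 :: real ^ 'n::_"
  \<comment> \<open>The diagonal matrix with entries 1 and -1 is the symmetrized product of the sum
    and the difference of the two unit vectors.\<close>
  define a where "a = (if f n = 1 then ?e (ca n) else ?e (ca n) + ?e (cb n))"
  define b where "b = (if f n = 1 then ?e (ca n) else ?e (ca n) - ?e (cb n))"
  have f: "f n \<noteq> 1 \<Longrightarrow> f n = 2" using f12[OF n] by auto
  have blk: "blk i = n \<longleftrightarrow> i = ca n \<or> f n = 2 \<and> i = cb n" for i
    using blk_eq[OF n, of i] blk_cases[of i] n by auto
  have sg: "sg (ca n) = 1" "f n = 2 \<Longrightarrow> sg (cb n) = - 1"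
    using blk_ca[OF n] blk_cb[OF n] by auto
  have "comb (profile n 1) - comb (profile n 0) = sym_tensor a b"
    unfolding comb_diff vec_eq_iff
  proof (intro allI)
    fix i j
    have "comb (\<lambda>k. profile n 1 k - profile n 0 k) $ i $ j = (if i = j \<and> blk i = n then sg i else 0)"
      using n by (auto simp: comb_nth profile_def)
    also have "\<dots> = sym_tensor a b $ i $ j"
    proof (cases "f n = 1")
      case True
      then show ?thesis using sg(1) by (auto simp: sym_tensor_nth a_def b_def axis_def blk)
    next
      case False
      then show ?thesis
        using f sg ca_neq_cb[OF n] by (auto simp: sym_tensor_nth a_def b_def axis_def blk)
    qed
    finally show "comb (\<lambda>k. profile n 1 k - profile n 0 k) $ i $ j = sym_tensor a b $ i $ j" .
  qed
  moreover have "a $ ca n \<noteq> 0" "b $ ca n \<noteq> 0"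
    using f ca_neq_cb[OF n] by (auto simp: a_def b_def axis_def)
  then have "a \<noteq> 0" "b \<noteq> 0" by auto
  moreover have "comb (profile n 1) $ ca n $ ca n \<noteq> comb (profile n 0) $ ca n $ ca n"
    using n blk_ca[OF n] by (simp add: comb_nth profile_def)
  then have "comb (profile n 1) \<noteq> comb (profile n 0)" by metis
  ultimately show ?thesis unfolding compatible_def transpose_comb by blast
qed

lemma well_in_laminates: "i \<le> m \<Longrightarrow> well f i \<in> laminates (wells m f :: (real ^ 'n::_ ^ 'n::_) set) j"
proof -
  assume "i \<le> m"
  then have "well f i \<in> laminates (wells m f :: (real ^ 'n::_ ^ 'n::_) set) 0" by (auto simp: wells_def)
  then show "well f i \<in> laminates (wells m f :: (real ^ 'n::_ ^ 'n::_) set) j"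
    using laminates_mono[of 0 j] by blast
qed

lemma laminates_SucI:
  fixes B1 B2 :: "real ^ 'n::_ ^ 'n::_"
  shows "t \<in> {0<..<1} \<Longrightarrow> B1 \<in> laminates K j \<Longrightarrow> B2 \<in> laminates K j \<Longrightarrow> compatible B1 B2 \<Longrightarrow>
    t *\<^sub>R B1 + (1 - t) *\<^sub>R B2 \<in> laminates K (Suc j)"
  unfolding laminates.simps
  by (rule UnI2, rule CollectI, rule exI[of _ t], rule exI[of _ B1], rule exI[of _ B2]) simp

text \<open>The end of segment \<open>n + 1\<close> is a well, and its starting point is the
  midpoint of segment \<open>n\<close>, or the zero well for \<open>n = 0\<close>.\<close>

lemma segment_in_laminates:
  "n \<in> {1..m} \<Longrightarrow> s \<in> {0..1} \<Longrightarrow> comb (profile n s) \<in> laminates (wells m f) n"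
proof (induction n arbitrary: s)
  case (Suc n)
  have 1: "comb (profile (Suc n) 1) \<in> laminates (wells m f) n"
    using well_eq[of "Suc n"] Suc.prems well_in_laminates[of "Suc n" n] by simp
  have 0: "comb (profile (Suc n) 0) \<in> laminates (wells m f) n"
  proof (cases "n = 0")
    case True
    then show ?thesis using well_0_eq well_in_laminates[of 0 n] by simp
  next
    case False
    then show ?thesis using Suc.IH[of "1/2"] Suc.prems by (simp add: profile_half)
  qed
  show ?case
  proof (cases "s = 0 \<or> s = 1")
    case True
    then show ?thesis using 0 1 by auto
  next
    case False
    have eq: "comb (profile (Suc n) s) = s *\<^sub>R comb (profile (Suc n) 1) + (1 - s) *\<^sub>R comb (profile (Suc n) 0)"
      unfolding profile_convex by simp
    have s: "s \<in> {0<..<1}" using False Suc.prems by auto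
    show ?thesis by (subst eq) (rule laminates_SucI[OF s 1 0 compatible_step[OF Suc.prems(1)]])
  qed
qed simp

lemma laminates_eq: "m \<ge> 1 \<Longrightarrow> laminates (wells m f) j = rank_set j"
proof (rule antisym[OF laminates_subset])
  assume m: "m \<ge> 1"
  show "rank_set j \<subseteq> laminates (wells m f) j"
  proof
    fix A :: "real ^ 'n::_ ^ 'n::_" assume "A \<in> rank_set j"
    then obtain i s where i: "A = comb (profile i s)" "i \<in> {1..m}" "s \<in> {0..1}" "i \<le> j \<or> s = 1 \<or> i = 1 \<and> s = 0"
      by (auto simp: rank_set_def)
    have "comb (profile i 1) \<in> laminates (wells m f) j" "comb (profile 1 0) \<in> laminates (wells m f) j"
      using well_eq[of i] well_0_eq i well_in_laminates[of i j] well_in_laminates[of 0 j] by auto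
    then show "A \<in> laminates (wells m f) j"
      using i(4)
    proof (elim disjE conjE)
      assume "i \<le> j"
      then show ?thesis using i(1) segment_in_laminates[OF i(2,3)] laminates_mono[of i j "wells m f"] by blast
    qed (simp_all add: i(1))
  qed
qed

text \<open>The end points of segment \<open>l\<close> are excluded because they have lower order:
  one is a well, the other the midpoint of segment \<open>l - 1\<close> or the zero well.\<close>

lemma laminates_difference:
  assumes F: "F \<in> laminates (wells m f) l - laminates (wells m f) (l - 1)" and l: "l \<in> {1..m}"
  obtains t where "0 < t" "t < 1" "F = comb (profile l t)"
proof -
  have m: "m \<ge> 1" using l by simp
  obtain i s where i: "F = comb (profile i s)" "i \<in> {1..m}" "s \<in> {0..1}" "i \<le> l \<or> s = 1 \<or> i = 1 \<and> s = 0"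
    and nF: "F \<notin> rank_set (l - 1)"
    using F unfolding laminates_eq[OF m] by (auto simp: rank_set_def)
  have not: "\<not> (i \<le> l - 1 \<or> s = 1 \<or> i = 1 \<and> s = 0)" using nF i unfolding rank_set_def by blast
  then have il: "i = l" "s \<noteq> 1" using i by auto
  have "s \<noteq> 0"
  proof
    assume "s = 0"
    then have "l \<noteq> 1" using not il by auto
    then have "F = comb (profile (l - 1) (1/2))"
      using i il \<open>s = 0\<close> l by (cases l) (auto simp: profile_half)
    then show False using nF \<open>l \<noteq> 1\<close> l unfolding rank_set_def by fastforce
  qed
  then show ?thesis using that[of s] i il by auto
qed

text \<open>Finitely many continuous images of compact parameter sets. Closedness makes the distance
  from the laminates of order \<open>l - 1\<close> positive, which the final constant
  requires.\<close>

lemma closed_laminates: "m \<ge> 1 \<Longrightarrow> closed (laminates (wells m f :: (real ^ 'n::_ ^ 'n::_) set) j)"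
proof -
  assume m: "m \<ge> 1"
  let ?S = "\<lambda>i. {s \<in> {0..1::real}. i \<le> j \<or> s = 1 \<or> i = 1 \<and> s = 0}"
  have S: "compact (?S i)" for i
  proof (cases "i \<le> j")
    case True
    then have "?S i = {0..1}" by auto
    then show ?thesis by simp
  next
    case False
    then have "?S i \<subseteq> {0, 1}" by auto
    then show ?thesis using finite_subset finite_imp_compact by blast
  qed
  have lin: "comb (profile i s) = s *\<^sub>R comb (profile i 1) + (1 - s) *\<^sub>R comb (profile i 0)" for i s
    unfolding profile_convex by simp
  have "compact ((\<lambda>s. comb (profile i s)) ` ?S i)" for i
    by (subst lin) (intro compact_continuous_image continuous_intros S)
  then have cpt: "compact (\<Union>i\<in>{1..m}. (\<lambda>s. comb (profile i s)) ` ?S i)"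
    by (intro compact_UN) auto
  have eq: "rank_set j = (\<Union>i\<in>{1..m}. (\<lambda>s. comb (profile i s)) ` ?S i)"
  proof (intro equalityI subsetI)
    fix A :: "real ^ 'n::_ ^ 'n::_" assume "A \<in> rank_set j"
    then obtain i s where i: "A = comb (profile i s)" "i \<in> {1..m}" and s: "s \<in> ?S i"
      by (auto simp: rank_set_def)
    show "A \<in> (\<Union>i\<in>{1..m}. (\<lambda>s. comb (profile i s)) ` ?S i)"
      using imageI[OF s, of "\<lambda>s. comb (profile i s)"] unfolding i(1) by (rule UN_I[OF i(2)])
  next
    fix A :: "real ^ 'n::_ ^ 'n::_" assume "A \<in> (\<Union>i\<in>{1..m}. (\<lambda>s. comb (profile i s)) ` ?S i)"
    then obtain i s where i: "A = comb (profile i s)" "i \<in> {1..m}" and s: "s \<in> ?S i"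
      by (elim UN_E imageE)
    show "A \<in> rank_set j"
      unfolding rank_set_def
      by (rule CollectI, rule exI[of _ i], rule exI[of _ s]) (use i s in simp)
  qed
  show ?thesis unfolding laminates_eq[OF m] eq by (rule compact_imp_closed[OF cpt])
qed

end

lemma well_coordinates_exist:
  assumes f: "f \<in> admissible m" and d: "CARD('n::{finite,linorder}) = space_dim m f"
  obtains ca cb :: "nat \<Rightarrow> 'n::{finite,linorder}" where "well_coordinates m f ca cb"
proof -
  have f12: "f i = 1 \<or> f i = 2" if "i \<in> {1..m}" for i
    using f that by (auto simp: admissible_def)
  have nonadj: "\<not> (f i = 1 \<and> f (Suc i) = 1)" if "1 \<le> i" "i < m" for i
    using f that by (auto simp: admissible_def)
  have le: "f i + (\<Sum>j\<in>{1..<i}. f j) \<le> CARD('n)" if i: "i \<in> {1..m}" for i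
  proof -
    have "f i + (\<Sum>j\<in>{1..<i}. f j) = (\<Sum>j\<in>{1..<Suc i}. f j)" using i by simp
    also have "\<dots> \<le> (\<Sum>j\<in>{1..m}. f j)" using i by (intro sum_mono2) auto
    also have "\<dots> \<le> CARD('n)" unfolding d space_dim_def using f12[of 1] by auto
    finally show ?thesis .
  qed
  have "\<exists>a :: 'n. position a = 1 + (\<Sum>j\<in>{1..<i}. f j)" if i: "i \<in> {1..m}" for i
    using position_surj[of "1 + (\<Sum>j\<in>{1..<i}. f j)", where 'n = 'n] le[OF i] f12[OF i] by fastforce
  then obtain ca :: "nat \<Rightarrow> 'n" where ca: "\<And>i. i \<in> {1..m} \<Longrightarrow> position (ca i) = 1 + (\<Sum>j\<in>{1..<i}. f j)"
    by metis
  have "\<exists>a :: 'n. position a = 2 + (\<Sum>j\<in>{1..<i}. f j)" if i: "i \<in> {1..m}" "f i = 2" for i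
    using position_surj[of "2 + (\<Sum>j\<in>{1..<i}. f j)", where 'n = 'n] le[OF i(1)] i by fastforce
  then obtain cb :: "nat \<Rightarrow> 'n" where cb: "\<And>i. i \<in> {1..m} \<Longrightarrow> f i = 2 \<Longrightarrow> position (cb i) = 2 + (\<Sum>j\<in>{1..<i}. f j)"
    by metis
  show ?thesis
    using that[of ca cb] f12 nonadj ca cb by (simp add: well_coordinates_def)
qed

section \<open>Mollification\<close>

text \<open>A quadratic bound for the remainder survives integration against a function that is
  merely locally integrable, without any passage to the limit; the derivatives of the kernel and of
  the convolutions are obtained in this form.\<close>

lemma has_derivative_quadratic:
  fixes g :: "'a::real_normed_vector \<Rightarrow> real"
  assumes lin: "bounded_linear g'" and bd: "\<And>h. norm h \<le> 1 \<Longrightarrow> \<bar>g (x + h) - g x - g' h\<bar> \<le> C * (norm h)\<^sup>2"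
  shows "(g has_derivative g') (at x)"
  unfolding has_derivative_at
proof (intro conjI lin)
  have "((\<lambda>h :: 'a. C * norm h) \<longlongrightarrow> 0) (at 0)"
    by (rule tendsto_mult_right_zero, rule tendsto_norm_zero, rule tendsto_ident_at)
  moreover have "\<forall>\<^sub>F h in at 0. norm (norm (g (x + h) - g x - g' h) / norm h) \<le> C * norm h"
    unfolding eventually_at
  proof (intro exI[of _ 1] conjI ballI impI)
    fix h :: 'a assume h: "h \<noteq> 0 \<and> dist h 0 < 1"
    then show "norm (norm (g (x + h) - g x - g' h) / norm h) \<le> C * norm h"
      using bd[of h] by (simp add: field_simps power2_eq_square)
  qed simp
  ultimately show "((\<lambda>h. norm (g (x + h) - g x - g' h) / norm h) \<longlongrightarrow> 0) (at 0)"
    by (rule Lim_null_comparison[rotated])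
qed

text \<open>Once continuously differentiable with Lipschitz gradient, which suffices since test
  functions need just one continuous derivative. The positive part enters squared so that the Taylor
  remainder is quadratic (\<open>square_max_taylor\<close>).\<close>

definition bump :: "real \<Rightarrow> real ^ 'n \<Rightarrow> real"
  where "bump \<kappa> z = (max 0 (\<kappa>\<^sup>2 - (norm z)\<^sup>2))\<^sup>2"

definition bump_mass :: "'n::finite itself \<Rightarrow> real \<Rightarrow> real"
  where "bump_mass _ \<kappa> = (LINT z|lborel. bump \<kappa> (z :: real ^ 'n))"

definition moll :: "real \<Rightarrow> real ^ 'n \<Rightarrow> real"
  where "moll \<kappa> z = bump \<kappa> z / bump_mass TYPE('n) \<kappa>"

text \<open>The partial derivative of \<open>moll\<close> in closed form.\<close>

definition gmoll :: "real \<Rightarrow> 'n \<Rightarrow> real ^ 'n \<Rightarrow> real"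
  where "gmoll \<kappa> j z = - 4 * max 0 (\<kappa>\<^sup>2 - (norm z)\<^sup>2) * z $ j / bump_mass TYPE('n) \<kappa>"

lemma bump_nonneg: "0 \<le> bump \<kappa> z" by (simp add: bump_def)

lemma continuous_bump: "continuous_on UNIV (bump \<kappa>)"
  unfolding bump_def[abs_def] by (intro continuous_intros)

lemma max_zero_outside: "0 \<le> \<kappa> \<Longrightarrow> \<kappa> \<le> norm z \<Longrightarrow> max 0 (\<kappa>\<^sup>2 - (norm z)\<^sup>2) = 0"
  using power_mono[of \<kappa> "norm z" 2] by simp

lemma bump_zero: "0 \<le> \<kappa> \<Longrightarrow> \<kappa> \<le> norm z \<Longrightarrow> bump \<kappa> z = 0"
  by (simp add: bump_def max_zero_outside)

lemma bump_integrable: "0 \<le> \<kappa> \<Longrightarrow> integrable lborel (bump \<kappa> :: real ^ 'n \<Rightarrow> real)"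
proof -
  assume \<kappa>: "0 \<le> \<kappa>"
  have "integrable lborel (\<lambda>z. indicator (cball 0 \<kappa>) z *\<^sub>R bump \<kappa> (z :: real ^ 'n))"
    by (intro borel_integrable_compact continuous_on_subset[OF continuous_bump]) auto
  moreover have "(\<lambda>z. indicator (cball 0 \<kappa>) z *\<^sub>R bump \<kappa> z) = (bump \<kappa> :: real ^ 'n \<Rightarrow> real)"
    by (auto simp: indicator_def fun_eq_iff not_le intro: bump_zero[OF \<kappa> less_imp_le])
  ultimately show ?thesis by simp
qed

lemma bump_mass_pos: "0 < \<kappa> \<Longrightarrow> 0 < bump_mass TYPE('n::finite) \<kappa>"
proof -
  assume \<kappa>: "0 < \<kappa>"
  have "bump_mass TYPE('n) \<kappa> \<noteq> 0"
  proof
    assume "bump_mass TYPE('n) \<kappa> = 0"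
    then have "AE z in lborel. bump \<kappa> (z :: real ^ 'n) = 0"
      unfolding bump_mass_def using bump_integrable[of \<kappa>] \<kappa>
      by (subst integral_nonneg_eq_0_iff_AE[symmetric]) (auto simp: bump_nonneg)
    then have "AE z in lborel. z \<notin> ball (0 :: real ^ 'n) \<kappa>"
    proof (rule eventually_mono)
      fix z :: "real ^ 'n" assume "bump \<kappa> z = 0"
      then have "\<kappa>\<^sup>2 \<le> (norm z)\<^sup>2" by (simp add: bump_def max_def split: if_splits)
      then show "z \<notin> ball 0 \<kappa>" using \<kappa> power2_le_imp_le[of \<kappa> "norm z"] by simp
    qed
    then have "ball 0 \<kappa> \<in> null_sets (lborel :: (real ^ 'n) measure)"
      by (subst AE_iff_null_sets) auto
    then have "emeasure lborel (ball (0 :: real ^ 'n) \<kappa>) = 0" by auto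
    then show False using content_ball_pos[OF \<kappa>, of "0 :: real ^ 'n"]
      by (simp add: measure_def)
  qed
  moreover have "0 \<le> bump_mass TYPE('n) \<kappa>" unfolding bump_mass_def by (simp add: bump_nonneg)
  ultimately show ?thesis by simp
qed

lemma moll_nonneg: "0 < \<kappa> \<Longrightarrow> 0 \<le> moll \<kappa> (z :: real ^ 'n)"
  using bump_mass_pos[of \<kappa>, where 'n = 'n] by (simp add: moll_def bump_nonneg)

lemma moll_zero: "0 < \<kappa> \<Longrightarrow> \<kappa> \<le> norm z \<Longrightarrow> moll \<kappa> z = 0"
  by (simp add: moll_def bump_zero)

lemma gmoll_zero: "0 < \<kappa> \<Longrightarrow> \<kappa> \<le> norm z \<Longrightarrow> gmoll \<kappa> j z = 0"
  using max_zero_outside[of \<kappa> z] by (simp add: gmoll_def)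

lemma continuous_moll: "continuous_on UNIV (moll \<kappa>)"
  unfolding moll_def[abs_def] divide_inverse by (intro continuous_intros continuous_bump)

lemma continuous_gmoll: "continuous_on UNIV (gmoll \<kappa> j)"
  unfolding gmoll_def[abs_def] divide_inverse by (intro continuous_intros)

lemma moll_integrable: "0 < \<kappa> \<Longrightarrow> integrable lborel (moll \<kappa> :: real ^ 'n \<Rightarrow> real)"
  by (simp add: moll_def[abs_def] bump_integrable less_imp_le)

lemma integral_moll: "0 < \<kappa> \<Longrightarrow> (LINT z|lborel. moll \<kappa> (z :: real ^ 'n)) = 1"
  using bump_mass_pos[of \<kappa>, where 'n = 'n] by (simp add: moll_def) (simp add: bump_mass_def)

lemma moll_bounded: "0 < \<kappa> \<Longrightarrow> \<exists>B. \<forall>z. \<bar>moll \<kappa> z\<bar> \<le> B"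
  and gmoll_bounded: "0 < \<kappa> \<Longrightarrow> \<exists>B. \<forall>z j. \<bar>gmoll \<kappa> j z\<bar> \<le> B"
proof -
  assume \<kappa>: "0 < \<kappa>"
  let ?Z = "bump_mass TYPE('a) \<kappa>"
  have Z: "0 < ?Z" by (rule bump_mass_pos[OF \<kappa>])
  have le: "max 0 (\<kappa>\<^sup>2 - (norm z)\<^sup>2) \<le> \<kappa>\<^sup>2" for z :: "real ^ 'a" by simp
  have "\<bar>moll \<kappa> z\<bar> \<le> (\<kappa>\<^sup>2)\<^sup>2 / ?Z" for z :: "real ^ 'a"
    using power_mono[OF le, of z 2] Z by (simp add: moll_def bump_def divide_right_mono)
  then show "\<exists>B. \<forall>z :: real ^ 'a. \<bar>moll \<kappa> z\<bar> \<le> B" by blast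
next
  assume \<kappa>: "0 < \<kappa>"
  let ?Z = "bump_mass TYPE('b) \<kappa>"
  have Z: "0 < ?Z" by (rule bump_mass_pos[OF \<kappa>])
  have "\<bar>gmoll \<kappa> j z\<bar> \<le> 4 * \<kappa>\<^sup>2 * \<kappa> / ?Z" for z :: "real ^ 'b" and j
  proof (cases "norm z \<le> \<kappa>")
    case True
    have "\<bar>max 0 (\<kappa>\<^sup>2 - (norm z)\<^sup>2)\<bar> * \<bar>z $ j\<bar> \<le> \<kappa>\<^sup>2 * \<kappa>"
      using component_le_norm_cart[of z j] True by (intro mult_mono) auto
    then show ?thesis using Z by (simp add: gmoll_def abs_mult divide_right_mono)
  next
    case False
    then show ?thesis using gmoll_zero[OF \<kappa>, of z j] \<kappa> Z by simp
  qed
  then show "\<exists>B. \<forall>(z :: real ^ 'b) j. \<bar>gmoll \<kappa> j z\<bar> \<le> B" by blast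
qed

lemma square_max_taylor: "\<bar>(max 0 (t + s))\<^sup>2 - (max 0 t)\<^sup>2 - 2 * max 0 t * s\<bar> \<le> s\<^sup>2" for s t :: real
proof -
  consider "0 \<le> t" "0 \<le> t + s" | "0 \<le> t" "t + s < 0" | "t < 0" "0 \<le> t + s" | "t < 0" "t + s < 0" by linarith
  then show ?thesis
  proof cases
    case 2
    have "(max 0 (t + s))\<^sup>2 - (max 0 t)\<^sup>2 - 2 * max 0 t * s = s\<^sup>2 - (t + s)\<^sup>2"
      using 2 by (simp add: power2_eq_square algebra_simps)
    moreover have "(t + s)\<^sup>2 \<le> s\<^sup>2" using 2 by (intro abs_le_square_iff[THEN iffD1]) auto
    ultimately show ?thesis by simp
  next
    case 3
    then show ?thesis using abs_le_square_iff[of "t + s" s] by simp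
  qed (auto simp: power2_eq_square algebra_simps)
qed

lemma norm_square_diff_le:
  fixes z h :: "real ^ 'n"
  assumes "norm z \<le> \<kappa> + 1" "norm h \<le> 1" "0 < \<kappa>"
  shows "\<bar>(norm (z + h))\<^sup>2 - (norm z)\<^sup>2\<bar> \<le> (2 * \<kappa> + 3) * norm h"
proof -
  have "(norm (z + h))\<^sup>2 - (norm z)\<^sup>2 = 2 * (z \<bullet> h) + (norm h)\<^sup>2"
    by (simp add: power2_norm_eq_inner inner_add_left inner_add_right inner_commute)
  also have "\<bar>\<dots>\<bar> \<le> 2 * (norm z * norm h) + norm h * norm h"
    using Cauchy_Schwarz_ineq2[of z h] zero_le_square[of "norm h"] unfolding power2_eq_square by linarith
  also have "\<dots> \<le> 2 * ((\<kappa> + 1) * norm h) + 1 * norm h"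
    using assms by (intro add_mono mult_left_mono mult_right_mono) auto
  finally show ?thesis by (simp add: algebra_simps)
qed

lemma moll_taylor:
  assumes \<kappa>: "0 < \<kappa>"
  shows "\<exists>C\<ge>0. \<forall>(z :: real ^ 'n) h. norm h \<le> 1 \<longrightarrow>
    \<bar>moll \<kappa> (z + h) - moll \<kappa> z - (\<Sum>j\<in>UNIV. gmoll \<kappa> j z * h $ j)\<bar> \<le> C * (norm h)\<^sup>2"
proof (intro exI conjI allI impI)
  let ?Z = "bump_mass TYPE('n) \<kappa>"
  have Z: "0 < ?Z" by (rule bump_mass_pos[OF \<kappa>])
  show "0 \<le> ((2 * \<kappa> + 3)\<^sup>2 + 2 * \<kappa>\<^sup>2) / ?Z" using Z by simp
  fix z h :: "real ^ 'n" assume h: "norm h \<le> 1"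
  define t where "t = \<kappa>\<^sup>2 - (norm z)\<^sup>2"
  define s where "s = (norm z)\<^sup>2 - (norm (z + h))\<^sup>2"
  show "\<bar>moll \<kappa> (z + h) - moll \<kappa> z - (\<Sum>j\<in>UNIV. gmoll \<kappa> j z * h $ j)\<bar>
    \<le> ((2 * \<kappa> + 3)\<^sup>2 + 2 * \<kappa>\<^sup>2) / ?Z * (norm h)\<^sup>2"
  \<comment> \<open>Beyond this radius an increment of length at most 1 does not lead into the
    support.\<close>
  proof (cases "norm z \<le> \<kappa> + 1")
    case True
    have s: "s = - (2 * (z \<bullet> h) + (norm h)\<^sup>2)"
      unfolding s_def by (simp add: power2_norm_eq_inner inner_add_left inner_add_right inner_commute)
    have "(\<Sum>j\<in>UNIV. gmoll \<kappa> j z * h $ j) = (- 4 * max 0 t * (z \<bullet> h)) / ?Z"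
      unfolding inner_vec_def sum_distrib_left sum_divide_distrib
      by (intro sum.cong) (auto simp: gmoll_def t_def)
    then have "moll \<kappa> (z + h) - moll \<kappa> z - (\<Sum>j\<in>UNIV. gmoll \<kappa> j z * h $ j)
        = (((max 0 (t + s))\<^sup>2 - (max 0 t)\<^sup>2 - 2 * max 0 t * s) - 2 * max 0 t * (norm h)\<^sup>2) / ?Z"
    proof -
      assume sum: "(\<Sum>j\<in>UNIV. gmoll \<kappa> j z * h $ j) = (- 4 * max 0 t * (z \<bullet> h)) / ?Z"
      have ts: "\<kappa>\<^sup>2 - (norm (z + h))\<^sup>2 = t + s" by (simp add: t_def s_def)
      have "a / ?Z - b / ?Z - (- 4 * u * (z \<bullet> h)) / ?Z = ((a - b - 2 * u * s) - 2 * u * (norm h)\<^sup>2) / ?Z" for a b u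
        using Z unfolding s by (simp add: field_simps)
      then show ?thesis unfolding sum moll_def bump_def ts t_def[symmetric] .
    qed
    also have "\<bar>\<dots>\<bar> \<le> (s\<^sup>2 + 2 * \<kappa>\<^sup>2 * (norm h)\<^sup>2) / ?Z"
    proof -
      have "2 * max 0 t * (norm h)\<^sup>2 \<le> 2 * \<kappa>\<^sup>2 * (norm h)\<^sup>2" "0 \<le> 2 * max 0 t * (norm h)\<^sup>2"
        by (auto simp: t_def intro!: mult_right_mono)
      then have "\<bar>((max 0 (t + s))\<^sup>2 - (max 0 t)\<^sup>2 - 2 * max 0 t * s) - 2 * max 0 t * (norm h)\<^sup>2\<bar>
        \<le> s\<^sup>2 + 2 * \<kappa>\<^sup>2 * (norm h)\<^sup>2"
        using square_max_taylor[of t s] by linarith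
      then show ?thesis using Z by (simp add: abs_divide divide_right_mono)
    qed
    also have "\<dots> \<le> (((2 * \<kappa> + 3) * norm h)\<^sup>2 + 2 * \<kappa>\<^sup>2 * (norm h)\<^sup>2) / ?Z"
    proof -
      have "\<bar>s\<bar> \<le> \<bar>(2 * \<kappa> + 3) * norm h\<bar>"
        using norm_square_diff_le[OF True h \<kappa>] \<kappa> by (simp add: s_def abs_minus_commute)
      then have "s\<^sup>2 \<le> ((2 * \<kappa> + 3) * norm h)\<^sup>2" by (simp only: abs_le_square_iff)
      then show ?thesis using Z by (simp add: divide_right_mono)
    qed
    finally show ?thesis
      unfolding power_mult_distrib distrib_right[symmetric] times_divide_eq_left .
  next
    case False
    then have "norm (z + h) \<ge> \<kappa>" using h norm_triangle_ineq4[of "z + h" h] by simp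
    then show ?thesis using False \<kappa> Z by (simp add: moll_zero gmoll_zero)
  qed
qed

lemma moll_lipschitz:
  assumes \<kappa>: "0 < \<kappa>"
  shows "\<exists>C\<ge>0. \<forall>(z :: real ^ 'n) h. norm h \<le> 1 \<longrightarrow> \<bar>moll \<kappa> (z + h) - moll \<kappa> z\<bar> \<le> C * norm h"
proof -
  obtain C where C: "0 \<le> C" "\<And>(z :: real ^ 'n) h. norm h \<le> 1 \<Longrightarrow>
    \<bar>moll \<kappa> (z + h) - moll \<kappa> z - (\<Sum>j\<in>UNIV. gmoll \<kappa> j z * h $ j)\<bar> \<le> C * (norm h)\<^sup>2"
    using moll_taylor[OF \<kappa>] by blast
  obtain B where B: "\<And>(z :: real ^ 'n) j. \<bar>gmoll \<kappa> j z\<bar> \<le> B" using gmoll_bounded[OF \<kappa>] by blast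
  have B0: "0 \<le> B" using B[of undefined 0] by simp
  show ?thesis
  proof (intro exI[of _ "C + real CARD('n) * B"] conjI allI impI)
    fix z h :: "real ^ 'n" assume h: "norm h \<le> 1"
    have "\<bar>\<Sum>j\<in>UNIV. gmoll \<kappa> j z * h $ j\<bar> \<le> (\<Sum>j\<in>(UNIV :: 'n set). B * norm h)"
    proof (rule order_trans[OF sum_abs sum_mono])
      show "\<bar>gmoll \<kappa> j z * h $ j\<bar> \<le> B * norm h" for j
        unfolding abs_mult using B component_le_norm_cart B0 by (intro mult_mono) auto
    qed
    moreover have "C * (norm h)\<^sup>2 \<le> C * norm h"
      using h C(1) by (intro mult_left_mono) (auto simp: power2_eq_square mult_left_le)
    ultimately show "\<bar>moll \<kappa> (z + h) - moll \<kappa> z\<bar> \<le> (C + real CARD('n) * B) * norm h"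
      using C(2)[OF h, of z] by (simp add: algebra_simps)
  qed (use C B0 in simp)
qed

lemma gmoll_lipschitz:
  assumes \<kappa>: "0 < \<kappa>"
  shows "\<exists>C\<ge>0. \<forall>(z :: real ^ 'n) h. norm h \<le> 1 \<longrightarrow> \<bar>gmoll \<kappa> j (z + h) - gmoll \<kappa> j z\<bar> \<le> C * norm h"
proof (intro exI conjI allI impI)
  let ?Z = "bump_mass TYPE('n) \<kappa>"
  let ?C = "(2 * \<kappa> + 3) * (\<kappa> + 2) + \<kappa>\<^sup>2"
  have Z: "0 < ?Z" by (rule bump_mass_pos[OF \<kappa>])
  show "0 \<le> 4 * ?C / ?Z" using Z \<kappa> by simp
  fix z h :: "real ^ 'n" assume h: "norm h \<le> 1"
  let ?M = "\<lambda>z :: real ^ 'n. max 0 (\<kappa>\<^sup>2 - (norm z)\<^sup>2)"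
  show "\<bar>gmoll \<kappa> j (z + h) - gmoll \<kappa> j z\<bar> \<le> 4 * ?C / ?Z * norm h"
  proof (cases "norm z \<le> \<kappa> + 1")
    case True
    have "\<bar>?M (z + h) - ?M z\<bar> \<le> (2 * \<kappa> + 3) * norm h"
      using norm_square_diff_le[OF True h \<kappa>] by linarith
    moreover have "\<bar>(z + h) $ j\<bar> \<le> \<kappa> + 2"
      using component_le_norm_cart[of "z + h" j] norm_triangle_ineq[of z h] True h by linarith
    ultimately have 1: "\<bar>(?M (z + h) - ?M z) * (z + h) $ j\<bar> \<le> ((2 * \<kappa> + 3) * norm h) * (\<kappa> + 2)"
      unfolding abs_mult using \<kappa> by (intro mult_mono) auto
    have 2: "\<bar>?M z * h $ j\<bar> \<le> \<kappa>\<^sup>2 * norm h"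
      unfolding abs_mult using component_le_norm_cart[of h j] by (intro mult_mono) auto
    have "gmoll \<kappa> j (z + h) - gmoll \<kappa> j z = - 4 * ((?M (z + h) - ?M z) * (z + h) $ j + ?M z * h $ j) / ?Z"
      unfolding gmoll_def using Z by (simp add: field_simps)
    also have "\<bar>\<dots>\<bar> = 4 * \<bar>(?M (z + h) - ?M z) * (z + h) $ j + ?M z * h $ j\<bar> / ?Z"
    proof -
      have "\<bar>- 4 * X / ?Z\<bar> = 4 * \<bar>X\<bar> / ?Z" for X using Z by (simp add: abs_mult abs_divide)
      then show ?thesis .
    qed
    also have "\<dots> \<le> 4 * (?C * norm h) / ?Z"
    proof -
      have "\<bar>(?M (z + h) - ?M z) * (z + h) $ j + ?M z * h $ j\<bar> \<le> ((2 * \<kappa> + 3) * norm h) * (\<kappa> + 2) + \<kappa>\<^sup>2 * norm h"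
        using 1 2 by (rule order_trans[OF abs_triangle_ineq add_mono])
      also have "\<dots> = ?C * norm h" by (simp add: algebra_simps)
      finally show ?thesis using Z by (intro divide_right_mono mult_left_mono) auto
    qed
    finally show ?thesis by (simp only: mult.assoc times_divide_eq_left)
  next
    case False
    then have "norm (z + h) \<ge> \<kappa>" using h norm_triangle_ineq4[of "z + h" h] by simp
    then show ?thesis using False \<kappa> Z by (simp add: gmoll_zero)
  qed
qed

section \<open>Convolution with the kernel and its gradient\<close>

definition locally_integrable :: "(real ^ 'n \<Rightarrow> real) \<Rightarrow> bool"
  where "locally_integrable g \<longleftrightarrow> g \<in> borel_measurable lebesgue \<and>
    (\<forall>r. integrable lebesgue (\<lambda>y. indicator (cball 0 r) y * g y))"

definition mconv :: "real \<Rightarrow> (real ^ 'n \<Rightarrow> real) \<Rightarrow> real ^ 'n \<Rightarrow> real"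
  where "mconv \<kappa> g x = (LINT y|lebesgue. moll \<kappa> (y - x) * g y)"

text \<open>The minus sign comes from differentiating \<open>moll \<kappa> (y - x)\<close> with
  respect to \<open>x\<close>.\<close>

definition gconv :: "real \<Rightarrow> 'n \<Rightarrow> (real ^ 'n \<Rightarrow> real) \<Rightarrow> real ^ 'n \<Rightarrow> real"
  where "gconv \<kappa> j g x = - (LINT y|lebesgue. gmoll \<kappa> j (y - x) * g y)"

text \<open>The radius is free because the kernels occur also through their increments, whose
  support is larger. A fixed \<open>R\<close> serves all \<open>x\<close> in a ball and so gives
  constants that are uniform there.\<close>

lemma compact_kernel_integral:
  fixes g :: "real ^ 'n \<Rightarrow> real"
  assumes g: "locally_integrable g" and k: "k \<in> borel_measurable borel"
    and B: "\<And>z. \<bar>k z\<bar> \<le> B" and supp: "\<And>z. r < norm z \<Longrightarrow> k z = 0"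
    and x: "norm x + r \<le> R"
  shows "integrable lebesgue (\<lambda>y. k (y - x) * g y)"
    and "\<bar>LINT y|lebesgue. k (y - x) * g y\<bar> \<le> B * (LINT y|lebesgue. indicator (cball 0 R) y * \<bar>g y\<bar>)"
proof -
  have [measurable]: "g \<in> borel_measurable lebesgue" using g by (simp add: locally_integrable_def)
  have "(\<lambda>y. k (y - x)) \<in> borel_measurable borel" using k by measurable
  then have [measurable]: "(\<lambda>y. k (y - x)) \<in> borel_measurable lebesgue"
    by (simp add: measurable_completion)
  have ig: "integrable lebesgue (\<lambda>y. indicator (cball 0 R) y * g y)"
    using g by (simp add: locally_integrable_def)
  have abs_eq: "\<bar>indicator (cball 0 R) y * g y\<bar> = indicator (cball 0 R) y * \<bar>g y\<bar>" for y
    by (simp add: abs_mult)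
  have ia: "integrable lebesgue (\<lambda>y. indicator (cball 0 R) y * \<bar>g y\<bar>)"
    using integrable_abs[OF ig] unfolding abs_eq .
  have B0: "0 \<le> B" using B[of 0] by linarith
  have bd: "\<bar>k (y - x) * g y\<bar> \<le> B * (indicator (cball 0 R) y * \<bar>g y\<bar>)" for y
  proof (cases "norm y \<le> R")
    case True
    then show ?thesis using B[of "y - x"] by (simp add: abs_mult mult_right_mono)
  next
    case False
    then have "r < norm (y - x)" using x norm_triangle_ineq[of "y - x" x] by simp
    then show ?thesis using supp False by simp
  qed
  show int: "integrable lebesgue (\<lambda>y. k (y - x) * g y)"
    by (rule Bochner_Integration.integrable_bound[OF integrable_mult_right[OF ia, of B]])
      (use bd B0 in \<open>auto simp: abs_mult\<close>)
  have "\<bar>LINT y|lebesgue. k (y - x) * g y\<bar> \<le> (LINT y|lebesgue. \<bar>k (y - x) * g y\<bar>)"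
    by (rule integral_abs_bound)
  also have "\<dots> \<le> (LINT y|lebesgue. B * (indicator (cball 0 R) y * \<bar>g y\<bar>))"
    by (intro integral_mono integrable_abs int integrable_mult_right ia bd)
  finally show "\<bar>LINT y|lebesgue. k (y - x) * g y\<bar> \<le> B * (LINT y|lebesgue. indicator (cball 0 R) y * \<bar>g y\<bar>)"
    by simp
qed

lemma moll_measurable [measurable]: "moll \<kappa> \<in> borel_measurable borel"
  by (intro borel_measurable_continuous_onI continuous_moll)

lemma gmoll_measurable [measurable]: "gmoll \<kappa> j \<in> borel_measurable borel"
  by (intro borel_measurable_continuous_onI continuous_gmoll)

lemma mconv_integrable:
  assumes "locally_integrable g" "0 < \<kappa>"
  shows "integrable lebesgue (\<lambda>y. moll \<kappa> (y - x) * g y)"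
  using moll_bounded[OF assms(2)] assms
  by (auto intro!: compact_kernel_integral(1)[where r = \<kappa> and R = "norm x + \<kappa>"] moll_zero)

lemma gconv_integrable:
  assumes "locally_integrable g" "0 < \<kappa>"
  shows "integrable lebesgue (\<lambda>y. gmoll \<kappa> j (y - x) * g y)"
proof -
  obtain B where "\<And>z. \<bar>gmoll \<kappa> j z\<bar> \<le> B" using gmoll_bounded[OF assms(2)] by blast
  then show ?thesis
    using assms by (auto intro!: compact_kernel_integral(1)[where r = \<kappa> and R = "norm x + \<kappa>" and B = B] gmoll_zero)
qed

lemma lipschitz_continuous:
  fixes k :: "real ^ 'n \<Rightarrow> real"
  assumes "\<And>x h. norm h \<le> 1 \<Longrightarrow> \<bar>k (x + h) - k x\<bar> \<le> C x * norm h"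
  shows "continuous_on UNIV k"
  unfolding continuous_on_eq_continuous_at[OF open_UNIV] isCont_iff
proof
  fix x
  have "((\<lambda>h. C x * norm h) \<longlongrightarrow> 0) (at 0)"
    by (rule tendsto_mult_right_zero, rule tendsto_norm_zero, rule tendsto_ident_at)
  moreover have "\<forall>\<^sub>F h in at 0. norm (k (x + h) - k x) \<le> C x * norm h"
    unfolding eventually_at using assms by (intro exI[of _ 1]) auto
  ultimately have "((\<lambda>h. k (x + h) - k x) \<longlongrightarrow> 0) (at 0)"
    by (rule Lim_null_comparison[rotated])
  then show "((\<lambda>h. k (x + h)) \<longlongrightarrow> k x) (at 0)" by (rule LIM_zero_cancel)
qed

lemma conv_lipschitz:
  fixes g :: "real ^ 'n \<Rightarrow> real"
  assumes g: "locally_integrable g" and k: "k \<in> borel_measurable borel" "\<And>z. \<bar>k z\<bar> \<le> B"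
    and C: "\<And>z h. norm h \<le> 1 \<Longrightarrow> \<bar>k (z + h) - k z\<bar> \<le> C * norm h"
    and supp: "\<And>z. \<kappa> \<le> norm z \<Longrightarrow> k z = 0" and \<kappa>: "0 < \<kappa>"
  shows "continuous_on UNIV (\<lambda>x. LINT y|lebesgue. k (y - x) * g y)"
proof (rule lipschitz_continuous)
  fix x h :: "real ^ 'n" assume h: "norm h \<le> 1"
  let ?K = "LINT y|lebesgue. indicator (cball 0 (norm x + \<kappa> + 1)) y * \<bar>g y\<bar>"
  have int: "integrable lebesgue (\<lambda>y. k (y - x) * g y)" for x
    by (rule compact_kernel_integral(1)[OF g k, where r = \<kappa>]) (use supp in auto)
  have "(LINT y|lebesgue. k (y - (x + h)) * g y) - (LINT y|lebesgue. k (y - x) * g y)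
      = (LINT y|lebesgue. (k (y - x - h) - k (y - x)) * g y)"
    using Bochner_Integration.integral_diff[OF int[of "x + h"] int[of x]] by (simp add: algebra_simps)
  also have "\<bar>\<dots>\<bar> \<le> (C * norm h) * ?K"
  proof (rule compact_kernel_integral(2)[OF g, where k = "\<lambda>z. k (z - h) - k z" and r = "\<kappa> + 1"])
    show "(\<lambda>z. k (z - h) - k z) \<in> borel_measurable borel" using k(1) by measurable
    show "\<bar>k (z - h) - k z\<bar> \<le> C * norm h" for z using C[of "- h" z] h by simp
    show "k (z - h) - k z = 0" if "\<kappa> + 1 < norm z" for z
      using that h supp[of z] supp[of "z - h"] norm_triangle_ineq2[of z h] by simp
  qed simp
  finally show "\<bar>(LINT y|lebesgue. k (y - (x + h)) * g y) - (LINT y|lebesgue. k (y - x) * g y)\<bar> \<le> C * ?K * norm h"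
    by (simp add: mult_ac)
qed

lemma continuous_mconv: "locally_integrable g \<Longrightarrow> 0 < \<kappa> \<Longrightarrow> continuous_on UNIV (mconv \<kappa> g)"
proof -
  assume g: "locally_integrable g" and \<kappa>: "0 < \<kappa>"
  obtain B where B: "\<And>z :: real ^ 'a. \<bar>moll \<kappa> z\<bar> \<le> B" using moll_bounded[OF \<kappa>] by blast
  obtain C where C: "\<And>z h :: real ^ 'a. norm h \<le> 1 \<Longrightarrow> \<bar>moll \<kappa> (z + h) - moll \<kappa> z\<bar> \<le> C * norm h"
    using moll_lipschitz[OF \<kappa>] by blast
  show ?thesis
    unfolding mconv_def[abs_def]
    by (rule conv_lipschitz[OF g moll_measurable B C _ \<kappa>]) (auto intro: moll_zero[OF \<kappa>])
qed

lemma continuous_gconv: "locally_integrable g \<Longrightarrow> 0 < \<kappa> \<Longrightarrow> continuous_on UNIV (gconv \<kappa> j g)"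
proof -
  assume g: "locally_integrable g" and \<kappa>: "0 < \<kappa>"
  obtain B where B: "\<And>z. \<bar>gmoll \<kappa> j z\<bar> \<le> B" using gmoll_bounded[OF \<kappa>] by blast
  obtain C where C: "\<And>z h. norm h \<le> 1 \<Longrightarrow> \<bar>gmoll \<kappa> j (z + h) - gmoll \<kappa> j z\<bar> \<le> C * norm h"
    using gmoll_lipschitz[OF \<kappa>] by blast
  show ?thesis
    unfolding gconv_def[abs_def]
    by (intro continuous_on_minus conv_lipschitz[OF g gmoll_measurable B C _ \<kappa>]) (auto intro: gmoll_zero[OF \<kappa>])
qed

lemma bounded_linear_component_sum: "bounded_linear (\<lambda>h :: real ^ 'n. \<Sum>j\<in>UNIV. c j * h $ j)"
  by (intro bounded_linear_sum bounded_linear_mult_right[THEN bounded_linear_compose] bounded_linear_vec_nth)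

text \<open>The remainder of the kernel is quadratic uniformly in the base point. That
  \<open>C\<close> is uniform on balls is what permits integrating this expansion along a segment
  for \<open>line_average_has_derivative\<close>.\<close>

lemma mconv_taylor:
  assumes g: "locally_integrable g" and \<kappa>: "0 < \<kappa>"
  shows "\<exists>C. \<forall>x h. norm x \<le> R \<longrightarrow> norm h \<le> 1 \<longrightarrow>
    \<bar>mconv \<kappa> g (x + h) - mconv \<kappa> g x - (\<Sum>j\<in>UNIV. gconv \<kappa> j g x * h $ j)\<bar> \<le> C * (norm h)\<^sup>2"
proof -
  obtain C where C: "0 \<le> C" "\<And>z h :: real ^ 'a. norm h \<le> 1 \<Longrightarrow>
    \<bar>moll \<kappa> (z + h) - moll \<kappa> z - (\<Sum>j\<in>UNIV. gmoll \<kappa> j z * h $ j)\<bar> \<le> C * (norm h)\<^sup>2"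
    using moll_taylor[OF \<kappa>] by blast
  let ?K = "LINT y|lebesgue. indicator (cball 0 (R + \<kappa> + 1)) y * \<bar>g y\<bar>"
  show ?thesis
  proof (intro exI[of _ "C * ?K"] allI impI)
  fix x h :: "real ^ 'a" assume x: "norm x \<le> R" and h: "norm h \<le> 1"
  let ?k = "\<lambda>z. moll \<kappa> (z - h) - moll \<kappa> z + (\<Sum>j\<in>UNIV. gmoll \<kappa> j z * h $ j)"
  have "(\<Sum>j\<in>UNIV. gconv \<kappa> j g x * h $ j) = - (LINT y|lebesgue. (\<Sum>j\<in>UNIV. gmoll \<kappa> j (y - x) * h $ j) * g y)"
  proof -
    have "(LINT y|lebesgue. (\<Sum>j\<in>UNIV. gmoll \<kappa> j (y - x) * h $ j) * g y)
        = (LINT y|lebesgue. (\<Sum>j\<in>UNIV. h $ j * (gmoll \<kappa> j (y - x) * g y)))"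
      unfolding sum_distrib_right by (intro Bochner_Integration.integral_cong sum.cong refl) (simp add: mult_ac)
    also have "\<dots> = (\<Sum>j\<in>UNIV. h $ j * (LINT y|lebesgue. gmoll \<kappa> j (y - x) * g y))"
      by (subst Bochner_Integration.integral_sum) (auto intro!: gconv_integrable[OF g \<kappa>])
    finally show ?thesis by (simp add: gconv_def sum_negf mult_ac)
  qed
  moreover have "integrable lebesgue (\<lambda>y. (\<Sum>j\<in>UNIV. gmoll \<kappa> j (y - x) * h $ j) * g y)"
  proof -
    have "(\<lambda>y. (\<Sum>j\<in>UNIV. gmoll \<kappa> j (y - x) * h $ j) * g y) = (\<lambda>y. (\<Sum>j\<in>UNIV. h $ j * (gmoll \<kappa> j (y - x) * g y)))"
      unfolding sum_distrib_right by (intro ext sum.cong refl) (simp add: mult_ac)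
    then show ?thesis by (auto intro!: gconv_integrable[OF g \<kappa>])
  qed
  ultimately have "mconv \<kappa> g (x + h) - mconv \<kappa> g x - (\<Sum>j\<in>UNIV. gconv \<kappa> j g x * h $ j)
      = (LINT y|lebesgue. ?k (y - x) * g y)"
    unfolding mconv_def using mconv_integrable[OF g \<kappa>, of "x + h"] mconv_integrable[OF g \<kappa>, of x]
    by (simp add: distrib_right left_diff_distrib diff_diff_eq)
  also have "\<bar>\<dots>\<bar> \<le> (C * (norm h)\<^sup>2) * ?K"
  proof (rule compact_kernel_integral(2)[OF g, where k = ?k and r = "\<kappa> + 1"])
    show "?k \<in> borel_measurable borel" by measurable
    show "\<bar>?k z\<bar> \<le> C * (norm h)\<^sup>2" for z using C(2)[of "- h" z] h by (simp add: sum_negf)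
    show "?k z = 0" if "\<kappa> + 1 < norm z" for z
      using that h moll_zero[OF \<kappa>, of z] moll_zero[OF \<kappa>, of "z - h"] gmoll_zero[OF \<kappa>, of z] norm_triangle_ineq2[of z h] by simp
  qed (use x in simp)
  finally show "\<bar>mconv \<kappa> g (x + h) - mconv \<kappa> g x - (\<Sum>j\<in>UNIV. gconv \<kappa> j g x * h $ j)\<bar> \<le> (C * ?K) * (norm h)\<^sup>2"
    by (simp add: mult_ac)
  qed
qed

lemma mconv_has_derivative:
  assumes g: "locally_integrable g" and \<kappa>: "0 < \<kappa>"
  shows "(mconv \<kappa> g has_derivative (\<lambda>h. \<Sum>j\<in>UNIV. gconv \<kappa> j g x * h $ j)) (at x)"
proof -
  obtain C where "\<And>h. norm h \<le> 1 \<Longrightarrow>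
    \<bar>mconv \<kappa> g (x + h) - mconv \<kappa> g x - (\<Sum>j\<in>UNIV. gconv \<kappa> j g x * h $ j)\<bar> \<le> C * (norm h)\<^sup>2"
    using mconv_taylor[OF g \<kappa>, of "norm x"] by blast
  then show ?thesis by (rule has_derivative_quadratic[OF bounded_linear_component_sum])
qed

lemma moll_shift_test_function:
  assumes \<kappa>: "0 < \<kappa>"
  shows "(\<lambda>y. moll \<kappa> (y - x)) \<in> test_functions UNIV"
    and "partial_deriv j (\<lambda>y. moll \<kappa> (y - x)) y = gmoll \<kappa> j (y - x)"
proof -
  obtain C where C: "\<And>z h :: real ^ 'a. norm h \<le> 1 \<Longrightarrow>
    \<bar>moll \<kappa> (z + h) - moll \<kappa> z - (\<Sum>j\<in>UNIV. gmoll \<kappa> j z * h $ j)\<bar> \<le> C * (norm h)\<^sup>2"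
    using moll_taylor[OF \<kappa>] by blast
  have der: "((\<lambda>y. moll \<kappa> (y - x)) has_derivative (\<lambda>h. \<Sum>j\<in>UNIV. gmoll \<kappa> j (y - x) * h $ j)) (at y)" for y
  proof (rule has_derivative_quadratic[OF bounded_linear_component_sum])
    show "\<bar>moll \<kappa> (y + h - x) - moll \<kappa> (y - x) - (\<Sum>j\<in>UNIV. gmoll \<kappa> j (y - x) * h $ j)\<bar> \<le> C * (norm h)\<^sup>2"
      if "norm h \<le> 1" for h using C[OF that, of "y - x"] by (simp add: algebra_simps)
  qed
  have D: "frechet_derivative (\<lambda>y. moll \<kappa> (y - x)) (at y) = (\<lambda>h. \<Sum>j\<in>UNIV. gmoll \<kappa> j (y - x) * h $ j)" for y
    using frechet_derivative_at[OF der] by metis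
  have c: "continuous_on UNIV (\<lambda>y. gmoll \<kappa> j (y - x))" for j
    by (rule continuous_on_compose2[OF continuous_gmoll]) (auto intro!: continuous_intros)
  show "(\<lambda>y. moll \<kappa> (y - x)) \<in> test_functions UNIV"
    unfolding test_functions_def mem_Collect_eq D
  proof (intro conjI allI)
    show "(\<lambda>y. moll \<kappa> (y - x)) differentiable at y" for y using der by (auto simp: differentiable_def)
    show "continuous_on UNIV (\<lambda>y. \<Sum>j\<in>UNIV. gmoll \<kappa> j (y - x) * v $ j)" for v
      by (intro continuous_intros c)
    show "\<exists>K. compact K \<and> K \<subseteq> UNIV \<and> (\<forall>y. y \<notin> K \<longrightarrow> moll \<kappa> (y - x) = 0)"
      by (intro exI[of _ "cball x \<kappa>"]) (auto simp: dist_norm norm_minus_commute intro!: moll_zero[OF \<kappa>])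
  qed
  have "(\<Sum>i\<in>UNIV. gmoll \<kappa> i (y - x) * axis j 1 $ i) = (\<Sum>i\<in>UNIV. if i = j then gmoll \<kappa> j (y - x) else 0)"
    by (intro sum.cong) (auto simp: axis_def)
  then show "partial_deriv j (\<lambda>y. moll \<kappa> (y - x)) y = gmoll \<kappa> j (y - x)"
    unfolding partial_deriv_def D by simp
qed

lemma Lp_loc_one_component:
  fixes g :: "real ^ 'n \<Rightarrow> 'b::euclidean_space"
  assumes "g \<in> Lp_loc 1" and c: "c \<in> borel_measurable borel" "\<And>v. \<bar>c v\<bar> \<le> norm v"
  shows "locally_integrable (\<lambda>x. c (g x))"
  unfolding locally_integrable_def
proof (intro conjI allI)
  have [measurable]: "g \<in> borel_measurable lebesgue" using assms by (simp add: Lp_loc_def)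
  show m: "(\<lambda>x. c (g x)) \<in> borel_measurable lebesgue" using c(1) by measurable
  fix r :: real
  have "set_integrable lebesgue (cball 0 r) (\<lambda>x. norm (g x) powr 1)"
    using assms by (auto simp: Lp_loc_def)
  then have "integrable lebesgue (\<lambda>x. indicator (cball 0 r) x *\<^sub>R norm (g x))"
    by (simp add: set_integrable_def)
  then show "integrable lebesgue (\<lambda>x. indicator (cball 0 r) x * c (g x))"
  proof (rule Bochner_Integration.integrable_bound)
    show "(\<lambda>x. indicator (cball 0 r) x * c (g x)) \<in> borel_measurable lebesgue"
      by (intro borel_measurable_times borel_measurable_indicator m) auto
  qed (use c(2) in \<open>auto simp: abs_mult mult_left_mono\<close>)
qed

lemma weak_gradient_components:
  assumes "has_weak_gradient u G"
  shows "locally_integrable (\<lambda>x. u x $ i)" "locally_integrable (\<lambda>x. G x $ i $ j)"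
proof -
  have m: "(\<lambda>v :: real ^ 'a. v $ i) \<in> borel_measurable borel"
    "(\<lambda>v :: real ^ 'a ^ 'a. v $ i $ j) \<in> borel_measurable borel"
    by (intro borel_measurable_continuous_onI continuous_intros)+
  show "locally_integrable (\<lambda>x. u x $ i)"
    using assms component_le_norm_cart unfolding has_weak_gradient_def
    by (intro Lp_loc_one_component[where c = "\<lambda>v. v $ i"] m) auto
  show "locally_integrable (\<lambda>x. G x $ i $ j)"
    using assms order_trans[OF component_le_norm_cart Finite_Cartesian_Product.norm_nth_le] unfolding has_weak_gradient_def
    by (intro Lp_loc_one_component[where c = "\<lambda>v. v $ i $ j"] m) auto
qed

text \<open>The translated kernel is itself a test function; the sign in the weak formulation
  cancels the one in \<open>gconv\<close>.\<close>

lemma gconv_weak_gradient: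
  assumes u: "has_weak_gradient u G" and \<kappa>: "0 < \<kappa>"
  shows "gconv \<kappa> j (\<lambda>x. u x $ i) x = mconv \<kappa> (\<lambda>x. G x $ i $ j) x"
proof -
  have "(LINT y|lebesgue. u y $ i * partial_deriv j (\<lambda>y. moll \<kappa> (y - x)) y) = - (LINT y|lebesgue. G y $ i $ j * moll \<kappa> (y - x))"
    using u moll_shift_test_function(1)[OF \<kappa>, of x] unfolding has_weak_gradient_def by blast
  then show ?thesis
    unfolding gconv_def mconv_def moll_shift_test_function(2)[OF \<kappa>] by (simp add: mult.commute)
qed

lemma mconv_weak_partial:
  assumes u: "has_weak_gradient u G" and \<kappa>: "0 < \<kappa>"
  shows "((\<lambda>s. mconv \<kappa> (\<lambda>x. u x $ i) (x + s *\<^sub>R axis j 1)) has_real_derivative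
    mconv \<kappa> (\<lambda>x. G x $ i $ j) x) (at 0)"
proof -
  note li = weak_gradient_components[OF u]
  have "((\<lambda>s. mconv \<kappa> (\<lambda>x. u x $ i) (x + s *\<^sub>R axis j 1)) has_derivative
      (\<lambda>s. \<Sum>k\<in>UNIV. gconv \<kappa> k (\<lambda>x. u x $ i) x * (s *\<^sub>R axis j 1) $ k)) (at 0)"
    by (rule has_derivative_compose[where g = "mconv \<kappa> (\<lambda>x. u x $ i)" and f = "\<lambda>s. x + s *\<^sub>R axis j 1"])
      (auto intro!: derivative_eq_intros mconv_has_derivative[OF li(1) \<kappa>])
  moreover have "(\<Sum>k\<in>UNIV. gconv \<kappa> k (\<lambda>x. u x $ i) x * (s *\<^sub>R axis j 1) $ k) = mconv \<kappa> (\<lambda>x. G x $ i $ j) x * s" for s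
  proof -
    have "(\<Sum>k\<in>UNIV. gconv \<kappa> k (\<lambda>x. u x $ i) x * (s *\<^sub>R axis j 1) $ k)
        = (\<Sum>k\<in>UNIV. if k = j then gconv \<kappa> j (\<lambda>x. u x $ i) x * s else 0)"
      by (intro sum.cong) (auto simp: axis_def)
    then show ?thesis using gconv_weak_gradient[OF u \<kappa>, of j i x] by simp
  qed
  ultimately show ?thesis by (simp add: has_field_derivative_def)
qed

lemma mconv_borel:
  assumes k: "k \<in> borel_measurable borel"
  shows "mconv \<kappa> k x = (LINT y|lborel. moll \<kappa> y * k (x + y))"
proof -
  have m: "(\<lambda>y. moll \<kappa> (y - x) * k y) \<in> borel_measurable borel" using k by measurable
  have "mconv \<kappa> k x = (LINT y|lborel. moll \<kappa> (y - x) * k y)"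
    unfolding mconv_def by (rule integral_completion) (use m in simp)
  also have "\<dots> = (LINT y|distr lborel borel ((+) x). moll \<kappa> (y - x) * k y)"
    by (simp add: lborel_distr_plus)
  also have "\<dots> = (LINT y|lborel. moll \<kappa> y * k (x + y))"
    using m by (subst integral_distr) auto
  finally show ?thesis .
qed

lemma periodic_mconv:
  assumes k: "k \<in> borel_measurable borel" and per: "periodic k"
  shows "periodic (mconv \<kappa> k)"
proof -
  have "k (x + axis i 1 + y) = k (x + y)" for x y i
    using periodic_shift[OF per, of y] by (simp add: periodic_def)
  then show ?thesis by (simp add: periodic_def mconv_borel[OF k])
qed

section \<open>L2 estimates for mollified periodic functions\<close>

lemma id_cell_measurable: "(\<lambda>x. x) \<in> cell \<rightarrow>\<^sub>M borel"
  by (rule borel_measurable_cell) simp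

interpretation cell_lborel: pair_sigma_finite "cell :: (real ^ 'n) measure" "lborel :: (real ^ 'n) measure"
  by standard

lemma nn_integral_moll: "0 < \<kappa> \<Longrightarrow> (\<integral>\<^sup>+ y. ennreal (moll \<kappa> (y :: real ^ 'n)) \<partial>lborel) = 1"
  using nn_integral_eq_integral[OF moll_integrable[of \<kappa>, where 'n = 'n]] integral_moll[of \<kappa>, where 'n = 'n]
  by (simp add: moll_nonneg)

text \<open>Cauchy-Schwarz with the kernel, which has integral 1, split into two square roots.
  Without integrability the left side is 0 by convention.\<close>

lemma moll_jensen_pointwise:
  assumes \<kappa>: "0 < \<kappa>" and [measurable]: "K \<in> borel_measurable borel"
  shows "ennreal ((LINT y|lborel. moll \<kappa> (y :: real ^ 'n) * K y)\<^sup>2)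
    \<le> (\<integral>\<^sup>+ y. ennreal (moll \<kappa> y) * ennreal ((K y)\<^sup>2) \<partial>lborel)"
proof (cases "integrable lborel (\<lambda>y. moll \<kappa> y * K y)")
  case True
  let ?a = "\<lambda>y :: real ^ 'n. ennreal (sqrt (moll \<kappa> y))"
  let ?b = "\<lambda>y. ennreal (sqrt (moll \<kappa> y) * \<bar>K y\<bar>)"
  have nn: "0 \<le> moll \<kappa> y" for y :: "real ^ 'n" by (rule moll_nonneg[OF \<kappa>])
  have "ennreal \<bar>LINT y|lborel. moll \<kappa> y * K y\<bar> \<le> (\<integral>\<^sup>+ y. ennreal \<bar>moll \<kappa> y * K y\<bar> \<partial>lborel)"
    using integral_norm_bound_ennreal[OF True] by simp
  also have "\<dots> = (\<integral>\<^sup>+ y. ?a y * ?b y \<partial>lborel)"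
    by (intro nn_integral_cong) (simp add: ennreal_mult[symmetric] mult.assoc[symmetric] nn abs_mult)
  finally have "(ennreal \<bar>LINT y|lborel. moll \<kappa> y * K y\<bar>)\<^sup>2 \<le> (\<integral>\<^sup>+ y. ?a y * ?b y \<partial>lborel)\<^sup>2"
    by (rule power_mono) simp
  also have "\<dots> \<le> (\<integral>\<^sup>+ y. (?a y)\<^sup>2 \<partial>lborel) * (\<integral>\<^sup>+ y. (?b y)\<^sup>2 \<partial>lborel)"
    by (rule Cauchy_Schwarz_nn_integral) measurable
  also have "(\<integral>\<^sup>+ y. (?a y)\<^sup>2 \<partial>lborel) = 1"
    using nn_integral_moll[OF \<kappa>, where 'n = 'n] by (simp add: ennreal_power nn)
  also have "(\<integral>\<^sup>+ y. (?b y)\<^sup>2 \<partial>lborel) = (\<integral>\<^sup>+ y. ennreal (moll \<kappa> y) * ennreal ((K y)\<^sup>2) \<partial>lborel)"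
    by (intro nn_integral_cong) (simp add: ennreal_power power_mult_distrib nn ennreal_mult)
  finally show ?thesis by (simp add: ennreal_power)
qed (simp add: not_integrable_integral_eq)

text \<open>Only shifts within the support of the kernel matter. With
  \<open>K x y = k (x + y)\<close> this bounds a mollification, with
  \<open>K x y = tdiff y k x\<close> its distance from the original function.\<close>

lemma moll_jensen:
  fixes K :: "real ^ 'n \<Rightarrow> real ^ 'n \<Rightarrow> real"
  assumes \<kappa>: "0 < \<kappa>" and K[measurable]: "(\<lambda>p. K (fst p) (snd p)) \<in> borel_measurable (borel \<Otimes>\<^sub>M borel)"
    and D: "\<And>y. norm y \<le> \<kappa> \<Longrightarrow> (\<integral>\<^sup>+ x. ennreal ((K x y)\<^sup>2) \<partial>cell) \<le> D"
  shows "(\<integral>\<^sup>+ x. ennreal ((LINT y|lborel. moll \<kappa> y * K x y)\<^sup>2) \<partial>cell) \<le> D"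
proof -
  have Kx: "K x \<in> borel_measurable borel" for x
    using measurable_compose[of "\<lambda>y. (x, y)" borel "borel \<Otimes>\<^sub>M borel", OF _ K] by simp
  have m: "(\<lambda>p. ennreal (moll \<kappa> (snd p)) * ennreal ((K (fst p) (snd p))\<^sup>2)) \<in> borel_measurable (cell \<Otimes>\<^sub>M lborel)"
  proof -
    have "(\<lambda>p :: (real ^ 'n) \<times> (real ^ 'n). (fst p, snd p)) \<in> cell \<Otimes>\<^sub>M lborel \<rightarrow>\<^sub>M borel \<Otimes>\<^sub>M borel"
      using measurable_compose[OF measurable_fst id_cell_measurable] by measurable
    from measurable_compose[OF this K]
    have [measurable]: "(\<lambda>p. K (fst p) (snd p)) \<in> borel_measurable (cell \<Otimes>\<^sub>M lborel)" by simp
    show ?thesis by measurable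
  qed
  have "(\<integral>\<^sup>+ x. ennreal ((LINT y|lborel. moll \<kappa> y * K x y)\<^sup>2) \<partial>cell)
      \<le> (\<integral>\<^sup>+ x. (\<integral>\<^sup>+ y. ennreal (moll \<kappa> y) * ennreal ((K x y)\<^sup>2) \<partial>lborel) \<partial>cell)"
    by (intro nn_integral_mono moll_jensen_pointwise[OF \<kappa> Kx])
  also have "\<dots> = (\<integral>\<^sup>+ y. (\<integral>\<^sup>+ x. ennreal (moll \<kappa> y) * ennreal ((K x y)\<^sup>2) \<partial>cell) \<partial>lborel)"
    using cell_lborel.Fubini[OF m] by simp
  also have "\<dots> \<le> (\<integral>\<^sup>+ y. ennreal (moll \<kappa> (y :: real ^ 'n)) * D \<partial>lborel)"
  proof (rule nn_integral_mono)
    fix y :: "real ^ 'n"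
    have [measurable]: "(\<lambda>x. K x y) \<in> borel_measurable borel"
      using measurable_compose[of "\<lambda>x. (x, y)" borel "borel \<Otimes>\<^sub>M borel", OF _ K] by simp
    show "(\<integral>\<^sup>+ x. ennreal (moll \<kappa> y) * ennreal ((K x y)\<^sup>2) \<partial>cell) \<le> ennreal (moll \<kappa> y) * D"
    proof (cases "norm y \<le> \<kappa>")
      case True
      have "(\<integral>\<^sup>+ x. ennreal (moll \<kappa> y) * ennreal ((K x y)\<^sup>2) \<partial>cell) = ennreal (moll \<kappa> y) * (\<integral>\<^sup>+ x. ennreal ((K x y)\<^sup>2) \<partial>cell)"
        by (intro nn_integral_cmult borel_measurable_cell) measurable
      then show ?thesis using D[OF True] by (simp add: mult_left_mono)
    next
      case False
      then show ?thesis using moll_zero[OF \<kappa>, of y] by simp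
    qed
  qed
  also have "\<dots> = D" by (simp add: nn_integral_multc nn_integral_moll[OF \<kappa>])
  finally show ?thesis .
qed

lemma nn_integral_square_l2:
  "bper g \<Longrightarrow> (\<integral>\<^sup>+ x. ennreal ((g x)\<^sup>2) \<partial>cell) = ennreal ((l2 g)\<^sup>2)"
  unfolding l2_power2 by (intro nn_integral_eq_integral bper_integrable bper_power2) auto

lemma l2_le_nn_integral:
  assumes "bper g" "0 \<le> D" "(\<integral>\<^sup>+ x. ennreal ((g x)\<^sup>2) \<partial>cell) \<le> ennreal (D\<^sup>2)"
  shows "l2 g \<le> D"
  using assms nn_integral_square_l2[OF assms(1)] by (auto simp: ennreal_le_iff intro: power2_le_imp_le)

lemma cper_mconv:
  assumes "k \<in> borel_measurable borel" "periodic k" "locally_integrable k" "0 < \<kappa>"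
  shows "cper (mconv \<kappa> k)"
  using assms by (simp add: cper_def periodic_mconv continuous_mconv)

text \<open>The bound on \<open>k\<close> is a nonnegative integral because the strain need not be
  bounded; its mollification is continuous and periodic, so \<open>l2\<close> applies to it.\<close>

lemma l2_mconv_le:
  assumes k[measurable]: "k \<in> borel_measurable borel" and per: "periodic k" and "locally_integrable k" and \<kappa>: "0 < \<kappa>"
    and D: "0 \<le> D" "(\<integral>\<^sup>+ x. ennreal ((k x)\<^sup>2) \<partial>cell) \<le> ennreal (D\<^sup>2)"
  shows "l2 (mconv \<kappa> k) \<le> D"
proof (rule l2_le_nn_integral[OF _ D(1)])
  show "bper (mconv \<kappa> k)" using assms by (intro cper_imp_bper cper_mconv)
  show "(\<integral>\<^sup>+ x. ennreal ((mconv \<kappa> k x)\<^sup>2) \<partial>cell) \<le> ennreal (D\<^sup>2)"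
    unfolding mconv_borel[OF k]
  proof (rule moll_jensen[OF \<kappa>])
    show "(\<integral>\<^sup>+ x. ennreal ((k (x + y))\<^sup>2) \<partial>cell) \<le> ennreal (D\<^sup>2)" for y
      using D(2) per nn_integral_cell_shift[of "\<lambda>x. ennreal ((k x)\<^sup>2)" y] by (simp add: periodic_def)
  qed measurable
qed

lemma locally_integrable_bounded:
  assumes "k \<in> borel_measurable borel" "\<And>x. \<bar>k x\<bar> \<le> B"
  shows "locally_integrable k"
  unfolding locally_integrable_def
proof (intro conjI allI)
  show m: "k \<in> borel_measurable lebesgue" using assms(1) by (simp add: measurable_completion)
  fix r :: real
  have "integrable lebesgue (\<lambda>y. B * indicator (cball 0 r) y :: real)"
    by (intro integrable_mult_right integrable_real_indicator) (auto simp: emeasure_bounded_finite[unfolded infinity_ennreal_def])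
  then show "integrable lebesgue (\<lambda>y. indicator (cball 0 r) y * k y)"
  proof (rule Bochner_Integration.integrable_bound)
    show "(\<lambda>y. indicator (cball 0 r) y * k y) \<in> borel_measurable lebesgue"
      by (intro borel_measurable_times borel_measurable_indicator m) auto
    show "AE y in lebesgue. norm (indicator (cball 0 r) y * k y) \<le> norm (B * indicator (cball 0 r) y :: real)"
      using assms(2) by (intro AE_I2) (auto simp: indicator_def intro: order_trans[OF _ abs_ge_self])
  qed
qed

lemma bper_locally_integrable: "bper k \<Longrightarrow> locally_integrable k"
  unfolding bper_def bounded_range_real_iff using locally_integrable_bounded by blast

lemma l2_mconv_diff_le:
  assumes k: "bper k" and \<kappa>: "0 < \<kappa>" and D: "0 \<le> D" "\<And>y. norm y \<le> \<kappa> \<Longrightarrow> l2 (tdiff y k) \<le> D"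
  shows "l2 (\<lambda>x. mconv \<kappa> k x - k x) \<le> D"
proof (rule l2_le_nn_integral[OF _ D(1)])
  have m[measurable]: "k \<in> borel_measurable borel" and per: "periodic k" using k by (auto simp: bper_def)
  show "bper (\<lambda>x. mconv \<kappa> k x - k x)"
    by (intro bper_diff k cper_imp_bper cper_mconv m per bper_locally_integrable \<kappa>)
  have eq: "mconv \<kappa> k x - k x = (LINT y|lborel. moll \<kappa> y * tdiff y k x)" for x
  proof -
    have "integrable lborel (\<lambda>y. moll \<kappa> (y - x) * k y)"
      using mconv_integrable[OF bper_locally_integrable[OF k] \<kappa>, of x]
      by (subst (asm) integrable_completion) auto
    then have "integrable lborel (\<lambda>y. moll \<kappa> y * k (x + y))"
      using integrable_distr_eq[of "(+) x" lborel borel "\<lambda>y. moll \<kappa> (y - x) * k y"]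
      by (simp add: lborel_distr_plus)
    moreover have "integrable lborel (\<lambda>y. moll \<kappa> y * k x)"
      by (intro integrable_mult_left moll_integrable \<kappa>)
    ultimately have "(LINT y|lborel. moll \<kappa> y * k (x + y) - moll \<kappa> y * k x) = mconv \<kappa> k x - k x"
      by (subst Bochner_Integration.integral_diff) (auto simp: mconv_borel[OF m] integral_moll[OF \<kappa>])
    then show ?thesis by (simp add: tdiff_def right_diff_distrib)
  qed
  show "(\<integral>\<^sup>+ x. ennreal ((mconv \<kappa> k x - k x)\<^sup>2) \<partial>cell) \<le> ennreal (D\<^sup>2)"
    unfolding eq
  proof (rule moll_jensen[OF \<kappa>])
    show "(\<lambda>p. tdiff (snd p) k (fst p)) \<in> borel_measurable (borel \<Otimes>\<^sub>M borel)"
      unfolding tdiff_def by measurable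
    show "(\<integral>\<^sup>+ x. ennreal ((tdiff y k x)\<^sup>2) \<partial>cell) \<le> ennreal (D\<^sup>2)" if "norm y \<le> \<kappa>" for y
      using nn_integral_square_l2[OF bper_tdiff[OF k], of y] D(2)[OF that] by (simp add: power_mono ennreal_leI)
  qed
qed

text \<open>Fubini and the invariance of the cell under shifts. As \<open>k\<close> is merely
  integrable, absolute integrability on the product is checked first.\<close>

lemma mean_mconv:
  assumes k[measurable]: "k \<in> borel_measurable borel" and per: "periodic k" and \<kappa>: "0 < \<kappa>"
    and int: "integrable cell k"
  shows "mean (mconv \<kappa> k) = mean k"
proof -
  let ?F = "\<lambda>p. moll \<kappa> (snd p) * k (fst p + snd p)"
  have [measurable]: "?F \<in> borel_measurable (cell \<Otimes>\<^sub>M lborel)"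
  proof -
    have "(\<lambda>p. fst p + snd p) \<in> cell \<Otimes>\<^sub>M lborel \<rightarrow>\<^sub>M borel"
      using measurable_compose[OF measurable_fst id_cell_measurable] by measurable
    from measurable_compose[OF this k] show ?thesis by measurable
  qed
  have cs: "(\<integral>\<^sup>+ x. ennreal \<bar>k (x + y)\<bar> \<partial>cell) = (\<integral>\<^sup>+ x. ennreal \<bar>k x\<bar> \<partial>cell)" for y
    using per by (intro nn_integral_cell_shift[of "\<lambda>x. ennreal \<bar>k x\<bar>"]) (auto simp: periodic_def)
  have "integrable (cell \<Otimes>\<^sub>M lborel) ?F"
  proof (rule integrableI_bounded)
    have "(\<integral>\<^sup>+ p. ennreal (norm (?F p)) \<partial>(cell \<Otimes>\<^sub>M lborel)) = (\<integral>\<^sup>+ y. (\<integral>\<^sup>+ x. ennreal (norm (?F (x, y))) \<partial>cell) \<partial>lborel)"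
      by (rule cell_lborel.nn_integral_snd[symmetric]) measurable
    also have "\<dots> = (\<integral>\<^sup>+ y. ennreal (moll \<kappa> (y :: real ^ 'a)) * (\<integral>\<^sup>+ x. ennreal \<bar>k x\<bar> \<partial>cell) \<partial>lborel)"
    proof (rule nn_integral_cong)
      fix y :: "real ^ 'a"
      have "(\<integral>\<^sup>+ x. ennreal (norm (?F (x, y))) \<partial>cell) = (\<integral>\<^sup>+ x. ennreal (moll \<kappa> y) * ennreal \<bar>k (x + y)\<bar> \<partial>cell)"
        by (intro nn_integral_cong) (simp add: abs_mult ennreal_mult moll_nonneg[OF \<kappa>])
      also have "\<dots> = ennreal (moll \<kappa> y) * (\<integral>\<^sup>+ x. ennreal \<bar>k (x + y)\<bar> \<partial>cell)"
        by (intro nn_integral_cmult borel_measurable_cell) measurable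
      finally show "(\<integral>\<^sup>+ x. ennreal (norm (?F (x, y))) \<partial>cell) = ennreal (moll \<kappa> y) * (\<integral>\<^sup>+ x. ennreal \<bar>k x\<bar> \<partial>cell)"
        by (simp add: cs)
    qed
    also have "\<dots> < \<infinity>"
      using int by (simp add: nn_integral_multc nn_integral_moll[OF \<kappa>] integrable_iff_bounded)
    finally show "(\<integral>\<^sup>+ p. ennreal (norm (?F p)) \<partial>(cell \<Otimes>\<^sub>M lborel)) < \<infinity>" .
  qed measurable
  then have "(\<integral> y. (\<integral> x. moll \<kappa> y * k (x + y) \<partial>cell) \<partial>lborel) = (\<integral> x. (\<integral> y. moll \<kappa> y * k (x + y) \<partial>lborel) \<partial>cell)"
    using cell_lborel.Fubini_integral[of "\<lambda>x y. moll \<kappa> y * k (x + y)"] by (simp add: case_prod_unfold)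
  then have "mean (mconv \<kappa> k) = (\<integral> y. (\<integral> x. moll \<kappa> y * k (x + y) \<partial>cell) \<partial>lborel)"
    by (simp add: ext[of "mconv \<kappa> k", OF mconv_borel[OF k]])
  also have "\<dots> = (\<integral> y. moll \<kappa> (y :: real ^ 'a) * mean k \<partial>lborel)"
    using integral_cell_shift[OF k per] by simp
  also have "\<dots> = mean k" by (simp add: integral_moll[OF \<kappa>])
  finally show ?thesis .
qed

section \<open>Total variation and translations\<close>

text \<open>\<Psi> averages the mollified function over the segment from \<open>x - v\<close> to
  \<open>x\<close>, so its derivative along \<open>v\<close> is a plain difference of two values.
  This gives continuously differentiable fields whose divergence is a difference of
  translates.\<close>

lemma
  fixes g :: "real ^ 'n \<Rightarrow> real" and v :: "real ^ 'n"
  assumes g: "locally_integrable g" and \<kappa>: "0 < \<kappa>"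
  defines "\<Psi> \<equiv> \<lambda>x. integral {0..1} (\<lambda>t. mconv \<kappa> g (x - t *\<^sub>R v))"
    and "I \<equiv> \<lambda>j x. integral {0..1} (\<lambda>t. gconv \<kappa> j g (x - t *\<^sub>R v))"
  shows line_average_has_derivative: "(\<Psi> has_derivative (\<lambda>h. \<Sum>j\<in>UNIV. I j x * h $ j)) (at x)"
    and continuous_line_average_gradient: "continuous_on UNIV (I j)"
    and line_average_along: "(\<Sum>j\<in>UNIV. I j x * v $ j) = mconv \<kappa> g x - mconv \<kappa> g (x - v)"
proof -
  have cl: "continuous_on {0..1} (\<lambda>t. k (x - t *\<^sub>R v))" if "continuous_on UNIV k" for k :: "real ^ 'n \<Rightarrow> real" and x
    by (rule continuous_on_compose2[OF that]) (auto intro!: continuous_intros)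
  note ints = integrable_continuous_interval[OF cl[OF continuous_mconv[OF g \<kappa>]]]
    integrable_continuous_interval[OF cl[OF continuous_gconv[OF g \<kappa>]]]
  obtain C where C: "\<And>y h. norm y \<le> norm x + norm v \<Longrightarrow> norm h \<le> 1 \<Longrightarrow>
    \<bar>mconv \<kappa> g (y + h) - mconv \<kappa> g y - (\<Sum>j\<in>UNIV. gconv \<kappa> j g y * h $ j)\<bar> \<le> C * (norm h)\<^sup>2"
    using mconv_taylor[OF g \<kappa>, of "norm x + norm v"] by blast
  show "(\<Psi> has_derivative (\<lambda>h. \<Sum>j\<in>UNIV. I j x * h $ j)) (at x)"
  proof (rule has_derivative_quadratic[OF bounded_linear_component_sum])
    fix h :: "real ^ 'n" assume h: "norm h \<le> 1"
    let ?d = "\<lambda>t. mconv \<kappa> g (x + h - t *\<^sub>R v) - mconv \<kappa> g (x - t *\<^sub>R v) - (\<Sum>j\<in>UNIV. gconv \<kappa> j g (x - t *\<^sub>R v) * h $ j)"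
    have d: "?d integrable_on {0..1}"
      by (intro integrable_diff integrable_sum integrable_on_mult_left ints) auto
    have "\<Psi> (x + h) - \<Psi> x - (\<Sum>j\<in>UNIV. I j x * h $ j) = integral {0..1} ?d"
    proof -
      have "(\<Sum>j\<in>UNIV. I j x * h $ j) = integral {0..1} (\<lambda>t. \<Sum>j\<in>UNIV. gconv \<kappa> j g (x - t *\<^sub>R v) * h $ j)"
        unfolding I_def by (subst integral_sum) (auto intro!: integrable_on_mult_left ints)
      then show ?thesis
        unfolding \<Psi>_def by (simp add: integral_diff integrable_diff integrable_sum integrable_on_mult_left ints)
    qed
    also have "\<bar>\<dots>\<bar> \<le> integral {0..1} (\<lambda>t :: real. C * (norm h)\<^sup>2)"
      unfolding real_norm_def[symmetric]
    proof (rule integral_norm_bound_integral[OF d])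
      fix t :: real assume "t \<in> {0..1}"
      then have t: "0 \<le> t" "t \<le> 1" by auto
      have "norm (x - t *\<^sub>R v) \<le> norm x + norm v"
        using norm_triangle_ineq4[of x "t *\<^sub>R v"] mult_right_mono[OF t(2), of "norm v"] t by simp
      from C[OF this h] show "norm (?d t) \<le> C * (norm h)\<^sup>2" by (simp add: algebra_simps)
    qed auto
    finally show "\<bar>\<Psi> (x + h) - \<Psi> x - (\<Sum>j\<in>UNIV. I j x * h $ j)\<bar> \<le> C * (norm h)\<^sup>2" by simp
  qed
  show "continuous_on UNIV (I j)"
  proof -
    have "continuous_on (UNIV \<times> cbox 0 1) (\<lambda>p. gconv \<kappa> j g (fst p - snd p *\<^sub>R v))"
      by (rule continuous_on_compose2[OF continuous_gconv[OF g \<kappa>]]) (auto intro!: continuous_intros)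
    then show ?thesis
      unfolding I_def using integral_continuous_on_param[of UNIV 0 "1::real" "\<lambda>x t. gconv \<kappa> j g (x - t *\<^sub>R v)"]
      by (simp add: case_prod_unfold)
  qed
  have "((\<lambda>t. mconv \<kappa> g (x - t *\<^sub>R v)) has_real_derivative - (\<Sum>j\<in>UNIV. gconv \<kappa> j g (x - t *\<^sub>R v) * v $ j)) (at t within {0..1})" for t
  proof -
    have der: "((\<lambda>t. mconv \<kappa> g (x - t *\<^sub>R v)) has_derivative
        (\<lambda>s. \<Sum>j\<in>UNIV. gconv \<kappa> j g (x - t *\<^sub>R v) * (- (s *\<^sub>R v)) $ j)) (at t within {0..1})"
      by (rule has_derivative_compose[where g = "mconv \<kappa> g" and f = "\<lambda>t. x - t *\<^sub>R v"])
        (auto intro!: derivative_eq_intros mconv_has_derivative[OF g \<kappa>])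
    have eq: "(*) (- (\<Sum>j\<in>UNIV. gconv \<kappa> j g (x - t *\<^sub>R v) * v $ j))
        = (\<lambda>s. \<Sum>j\<in>UNIV. gconv \<kappa> j g (x - t *\<^sub>R v) * (- (s *\<^sub>R v)) $ j)"
      unfolding fun_eq_iff sum_negf[symmetric] sum_distrib_right by (intro allI sum.cong) auto
    show ?thesis unfolding has_field_derivative_def eq by (rule der)
  qed
  then have "((\<lambda>t. - (\<Sum>j\<in>UNIV. gconv \<kappa> j g (x - t *\<^sub>R v) * v $ j)) has_integral
      mconv \<kappa> g (x - 1 *\<^sub>R v) - mconv \<kappa> g (x - 0 *\<^sub>R v)) {0..1}"
    by (intro fundamental_theorem_of_calculus) (auto simp: has_real_derivative_iff_has_vector_derivative)
  from integral_unique[OF this]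
  have "integral {0..1} (\<lambda>t. - (\<Sum>j\<in>UNIV. gconv \<kappa> j g (x - t *\<^sub>R v) * v $ j)) = mconv \<kappa> g (x - v) - mconv \<kappa> g x"
    by (simp only: scaleR_one scaleR_zero_left diff_zero)
  moreover have "integral {0..1} (\<lambda>t. - (\<Sum>j\<in>UNIV. gconv \<kappa> j g (x - t *\<^sub>R v) * v $ j)) = - (\<Sum>j\<in>UNIV. I j x * v $ j)"
    unfolding I_def by (simp add: integral_sum integrable_on_mult_left ints)
  ultimately show "(\<Sum>j\<in>UNIV. I j x * v $ j) = mconv \<kappa> g x - mconv \<kappa> g (x - v)" by simp
qed

text \<open>Test the total variation with \<Psi> times the unit vector along \<open>v\<close>. The
  field is bounded by 1 as an average, and its divergence is the difference of
  \<open>mconv \<kappa> g\<close> at \<open>x\<close> and \<open>x - v\<close>, divided by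
  \<open>norm v\<close>. A change of variables moves the difference onto the indicator.\<close>

lemma translation_duality:
  fixes E \<Omega> :: "(real ^ 'n) set" and v :: "real ^ 'n"
  assumes E: "E \<in> sets borel" "E \<subseteq> \<Omega>" "bounded E"
    and S: "0 \<le> S" "total_variation \<Omega> (indicator E) \<le> ennreal S"
    and g: "g \<in> borel_measurable borel" "\<And>x. \<bar>g x\<bar> \<le> 1" and \<kappa>: "0 < \<kappa>"
    and \<psi>1: "\<And>x. \<bar>mconv \<kappa> g x\<bar> \<le> 1"
    and K: "compact K" "\<And>x. x \<notin> K \<Longrightarrow> mconv \<kappa> g x = 0" "\<And>x t. x \<in> K \<Longrightarrow> t \<in> {0..1} \<Longrightarrow> x + t *\<^sub>R v \<in> \<Omega>"
    and v: "v \<noteq> 0"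
  shows "(LINT x|lborel. (indicator E x - indicator E (x + v)) * mconv \<kappa> g x) \<le> norm v * S"
proof -
  have li: "locally_integrable g" using g by (rule locally_integrable_bounded)
  define \<psi> where "\<psi> = mconv \<kappa> g"
  define \<Psi> where "\<Psi> = (\<lambda>x. integral {0..1} (\<lambda>t. \<psi> (x - t *\<^sub>R v)))"
  define I where "I = (\<lambda>j x. integral {0..1} (\<lambda>t. gconv \<kappa> j g (x - t *\<^sub>R v)))"
  define u where "u = inverse (norm v) *\<^sub>R v"
  define \<Phi> where "\<Phi> = (\<lambda>x. \<Psi> x *\<^sub>R u)"
  have cont: "continuous_on UNIV \<psi>" unfolding \<psi>_def by (rule continuous_mconv[OF li \<kappa>])
  have [measurable]: "\<psi> \<in> borel_measurable borel" by (rule borel_measurable_continuous_onI[OF cont])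
  note [measurable] = E(1)
  have der: "(\<Psi> has_derivative (\<lambda>h. \<Sum>j\<in>UNIV. I j x * h $ j)) (at x)" for x
    unfolding \<Psi>_def I_def \<psi>_def by (rule line_average_has_derivative[OF li \<kappa>])
  have der\<Phi>: "(\<Phi> has_derivative (\<lambda>h. (\<Sum>j\<in>UNIV. I j x * h $ j) *\<^sub>R u)) (at x)" for x
    unfolding \<Phi>_def by (rule has_derivative_scaleR_left[OF der])
  have D: "frechet_derivative \<Phi> (at x) = (\<lambda>h. (\<Sum>j\<in>UNIV. I j x * h $ j) *\<^sub>R u)" for x
    using frechet_derivative_at[OF der\<Phi>] by metis
  have cI: "continuous_on UNIV (I j)" for j
    unfolding I_def by (rule continuous_line_average_gradient[OF li \<kappa>])
  \<comment> \<open>The set swept out by \<open>K\<close> along the segment; outside it every value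
    that is averaged vanishes.\<close>
  let ?C = "(\<lambda>p. fst p + snd p *\<^sub>R v) ` (K \<times> {0..1})"
  have "\<Phi> \<in> test_functions \<Omega>"
    unfolding test_functions_def mem_Collect_eq D
  proof (intro conjI allI exI[of _ ?C])
    show "\<Phi> differentiable at x" for x using der\<Phi> by (auto simp: differentiable_def)
    show "continuous_on UNIV (\<lambda>x. (\<Sum>j\<in>UNIV. I j x * w $ j) *\<^sub>R u)" for w
      by (intro continuous_intros cI)
    show "compact ?C"
      by (intro compact_continuous_image compact_Times K(1) compact_Icc continuous_intros)
    show "?C \<subseteq> \<Omega>" using K(3) by auto
    show "x \<notin> ?C \<longrightarrow> \<Phi> x = 0" for x
    proof
      assume x: "x \<notin> ?C"
      have "\<psi> (x - t *\<^sub>R v) = 0" if "t \<in> {0..1}" for t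
      proof (rule ccontr)
        assume "\<psi> (x - t *\<^sub>R v) \<noteq> 0"
        then have "x - t *\<^sub>R v \<in> K" using K(2) by (auto simp: \<psi>_def)
        then have "x \<in> ?C" using that by (intro image_eqI[where x = "(x - t *\<^sub>R v, t)"]) auto
        then show False using x by simp
      qed
      then have "integral {0..1} (\<lambda>t. \<psi> (x - t *\<^sub>R v)) = integral {0..1} (\<lambda>t :: real. 0)"
        by (intro integral_cong) auto
      then show "\<Phi> x = 0" by (simp add: \<Phi>_def \<Psi>_def)
    qed
  qed
  moreover have "norm (\<Phi> x) \<le> 1" for x
  proof -
    have c: "continuous_on {0..1} (\<lambda>t. \<psi> (x - t *\<^sub>R v))"
      by (rule continuous_on_compose2[OF cont]) (auto intro!: continuous_intros)
    have "norm (integral {0..1} (\<lambda>t. \<psi> (x - t *\<^sub>R v))) \<le> 1 * (1 - 0)"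
      using c \<psi>1 by (intro integral_bound) (auto simp: \<psi>_def)
    moreover have "norm u = 1" using v by (simp add: u_def)
    ultimately show ?thesis by (simp add: \<Phi>_def \<Psi>_def)
  qed
  ultimately have "ennreal (LINT x:\<Omega>|lebesgue. indicator E x * divergence \<Phi> x) \<le> total_variation \<Omega> (indicator E)"
    unfolding total_variation_def by (intro SUP_upper) auto
  also note S(2)
  finally have "(LINT x:\<Omega>|lebesgue. indicator E x * divergence \<Phi> x) \<le> S" using S(1) by (auto simp: ennreal_le_iff2)
  moreover have "divergence \<Phi> x = inverse (norm v) * (\<psi> x - \<psi> (x - v))" for x
  proof -
    have "partial_deriv i \<Phi> x = I i x *\<^sub>R u" for i
    proof -
      have "(\<Sum>j\<in>UNIV. I j x * axis i 1 $ j) = (\<Sum>j\<in>UNIV. if j = i then I i x else 0)"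
        by (intro sum.cong) (auto simp: axis_def)
      then show ?thesis by (simp add: partial_deriv_def D)
    qed
    then have "divergence \<Phi> x = inverse (norm v) * (\<Sum>i\<in>UNIV. I i x * v $ i)"
      by (simp add: divergence_def u_def sum_distrib_left mult_ac)
    then show ?thesis
      unfolding I_def line_average_along[OF li \<kappa>] \<psi>_def .
  qed
  moreover have "(LINT x:\<Omega>|lebesgue. indicator E x * (inverse (norm v) * (\<psi> x - \<psi> (x - v))))
      = inverse (norm v) * (LINT x|lborel. indicator E x * (\<psi> x - \<psi> (x - v)))"
  proof -
    have "(LINT x:\<Omega>|lebesgue. indicator E x * (inverse (norm v) * (\<psi> x - \<psi> (x - v))))
        = (LINT x|lebesgue. inverse (norm v) * (indicator E x * (\<psi> x - \<psi> (x - v))))"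
      unfolding set_lebesgue_integral_def using E(2)
      by (intro Bochner_Integration.integral_cong) (auto simp: indicator_def)
    also have "\<dots> = (LINT x|lborel. inverse (norm v) * (indicator E x * (\<psi> x - \<psi> (x - v))))"
      by (rule integral_completion) measurable
    finally show ?thesis by simp
  qed
  ultimately have le: "(LINT x|lborel. indicator E x * (\<psi> x - \<psi> (x - v))) \<le> norm v * S"
    using v by (simp add: field_simps)
  have fin: "emeasure lborel A < \<infinity>" if "bounded A" for A :: "(real ^ 'n) set"
    using that by (rule emeasure_bounded_finite)
  have i1: "integrable lborel (\<lambda>x. indicator E x * \<psi> (x + w))" for w
  proof (rule Bochner_Integration.integrable_bound)
    show "integrable lborel (indicator E :: _ \<Rightarrow> real)" using fin[OF E(3)] by simp
    show "AE x in lborel. norm (indicator E x * \<psi> (x + w)) \<le> norm (indicator E x :: real)"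
      using \<psi>1 by (intro AE_I2) (auto simp: \<psi>_def abs_mult indicator_def)
  qed measurable
  have i2: "integrable lborel (\<lambda>x. indicator E (x + v) * \<psi> x)"
    and eq2: "(LINT x|lborel. indicator E (x + v) * \<psi> x) = (LINT x|lborel. indicator E x * \<psi> (x - v))"
  proof -
    have d: "lborel = distr lborel borel ((+) v :: real ^ 'n \<Rightarrow> _)" by (simp add: lborel_distr_plus)
    have "integrable (distr lborel borel ((+) v)) (\<lambda>x. indicator E x * \<psi> (x - v))"
      using i1[of "- v"] by (simp add: lborel_distr_plus)
    then show "integrable lborel (\<lambda>x. indicator E (x + v) * \<psi> x)"
      by (subst (asm) integrable_distr_eq) (auto simp: add.commute)
    have "(LINT x|lborel. indicator E x * \<psi> (x - v)) = (LINT x|distr lborel borel ((+) v). indicator E x * \<psi> (x - v))"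
      by (simp add: lborel_distr_plus)
    also have "\<dots> = (LINT x|lborel. indicator E (x + v) * \<psi> x)"
      by (subst integral_distr) (auto simp: add.commute)
    finally show "(LINT x|lborel. indicator E (x + v) * \<psi> x) = (LINT x|lborel. indicator E x * \<psi> (x - v))" by simp
  qed
  have "(LINT x|lborel. (indicator E x - indicator E (x + v)) * \<psi> x)
      = (LINT x|lborel. indicator E x * \<psi> x - indicator E (x + v) * \<psi> x)"
    by (simp add: left_diff_distrib)
  also have "\<dots> = (LINT x|lborel. indicator E x * \<psi> x) - (LINT x|lborel. indicator E x * \<psi> (x - v))"
    using i1[of 0] i2 by (subst Bochner_Integration.integral_diff) (auto simp: eq2)
  also have "\<dots> = (LINT x|lborel. indicator E x * (\<psi> x - \<psi> (x - v)))"
    using i1[of 0] i1[of "- v"] by (subst Bochner_Integration.integral_diff[symmetric]) (auto simp: right_diff_distrib)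
  finally show ?thesis using le by (simp add: \<psi>_def)
qed

lemma compact_inner_approx:
  fixes A :: "(real ^ 'n) set"
  assumes A: "A \<in> sets borel" "bounded A" and e: "0 < e"
  obtains K where "compact K" "K \<subseteq> A" "measure lborel (A - K) < e"
proof -
  have "A \<in> sets lebesgue" using A by simp
  then obtain K where K: "closed K" "K \<subseteq> A" "emeasure lebesgue (A - K) < ennreal e"
    using sets_lebesgue_inner_closed[OF _ e] by metis
  have "compact K" using K A bounded_subset compact_eq_bounded_closed by blast
  moreover have "emeasure lborel (A - K) < ennreal e"
    using K A by (simp add: borel_closed)
  then have "ennreal (measure lborel (A - K)) < ennreal e"
    by (subst emeasure_eq_ennreal_measure[symmetric]) auto
  then have "measure lborel (A - K) < e" by (simp add: ennreal_less_iff)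
  ultimately show ?thesis using that K by blast
qed

text \<open>The test function is a mollification of \<open>\<plusminus> 1\<close> on neighbourhoods of compact subsets of the
  two sets on which \<open>1\<^sub>E - 1\<^sub>E(\<sqdot> + v)\<close> has a sign.\<close>
lemma total_variation_translation:
  fixes E \<Omega> :: "(real ^ 'n) set" and v :: "real ^ 'n"
  assumes \<Omega>: "open \<Omega>" "convex \<Omega>" "bounded \<Omega>"
    and E: "E \<in> sets borel" "E \<subseteq> \<Omega>"
    and S: "0 \<le> S" "total_variation \<Omega> (indicator E) \<le> ennreal S"
  shows "measure lborel {x \<in> \<Omega>. x + v \<in> \<Omega> \<and> (x \<in> E) \<noteq> (x + v \<in> E)} \<le> norm v * S"
proof (cases "v = 0")
  case False
  define \<Omega>' where "\<Omega>' = {x \<in> \<Omega>. x + v \<in> \<Omega>}"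
  define P where "P = {x \<in> \<Omega>'. x \<in> E \<and> x + v \<notin> E}"
  define Q where "Q = {x \<in> \<Omega>'. x \<notin> E \<and> x + v \<in> E}"
  note [measurable] = E(1) borel_open[OF \<Omega>(1)]
  have o: "open \<Omega>'"
  proof -
    have "open ((\<lambda>x. x + v) -` \<Omega>)" by (intro open_vimage \<Omega> continuous_intros)
    then show ?thesis using \<Omega>(1) unfolding \<Omega>'_def by (simp add: open_Int vimage_def Collect_conj_eq)
  qed
  note [measurable] = borel_open[OF o]
  have PQ[measurable]: "P \<in> sets borel" "Q \<in> sets borel" unfolding P_def Q_def by measurable
  have bd: "bounded A" if "A \<subseteq> \<Omega>'" for A using that \<Omega>(3) by (auto simp: \<Omega>'_def intro: bounded_subset)
  have bPQ: "bounded P" "bounded Q" by (auto simp: P_def Q_def intro!: bd)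
  have fin: "emeasure lborel A \<noteq> \<infinity>" if "bounded A" for A :: "(real ^ 'n) set"
    using emeasure_bounded_finite[OF that] by simp
  have "measure lborel P + measure lborel Q \<le> norm v * S + 4 * e" if e: "0 < e" for e
  proof -
    obtain K1 where K1: "compact K1" "K1 \<subseteq> P" "measure lborel (P - K1) < e" using compact_inner_approx[OF PQ(1) bPQ(1) e] .
    obtain K2 where K2: "compact K2" "K2 \<subseteq> Q" "measure lborel (Q - K2) < e" using compact_inner_approx[OF PQ(2) bPQ(2) e] .
    note [measurable] = borel_compact[OF K1(1)] borel_compact[OF K2(1)]
    obtain e1 where e1: "0 < e1" "(\<Union>x\<in>K1 \<union> K2. ball x e1) \<subseteq> \<Omega>'"
      using compact_subset_open_imp_ball_epsilon_subset[of "K1 \<union> K2" \<Omega>'] K1 K2 o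
      by (auto simp: P_def Q_def compact_Un)
    have "K1 \<subseteq> - K2" using K1 K2 by (auto simp: P_def Q_def)
    then obtain e2 where e2: "0 < e2" "(\<Union>x\<in>K1. ball x e2) \<subseteq> - K2"
      using compact_subset_open_imp_ball_epsilon_subset[of K1 "- K2"] K1 K2 compact_imp_closed by (metis open_Compl)
    \<comment> \<open>Neighbourhoods and kernel both have radius \<kappa>:
      \<open>2 * \<kappa> < e1\<close> keeps the support of the mollification in \<Omega>', and
      \<open>2 * \<kappa> < e2\<close> ensures that from a point of \<open>K1\<close> the kernel
      sees only \<open>N1\<close>, and from a point of \<open>K2\<close> only
      \<open>N2\<close>.\<close>
    define \<kappa> where "\<kappa> = min e1 e2 / 4"
    have \<kappa>: "0 < \<kappa>" "2 * \<kappa> < e1" "2 * \<kappa> < e2" using e1 e2 by (auto simp: \<kappa>_def)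
    define N1 where "N1 = (\<Union>x\<in>K1. ball x \<kappa>)"
    define N2 where "N2 = (\<Union>x\<in>K2. ball x \<kappa>)"
    have [measurable]: "N1 \<in> sets borel" "N2 \<in> sets borel" unfolding N1_def N2_def by (intro borel_open open_UN; simp)+
    have far: "2 * \<kappa> \<le> dist x y" if "x \<in> K1" "y \<in> K2" for x y
      using e2 that \<kappa> by (force simp: not_less[symmetric])
    define b :: "real ^ 'n \<Rightarrow> real" where "b = (\<lambda>y. indicator N1 y - indicator N2 y)"
    have b: "b \<in> borel_measurable borel" "\<And>y. \<bar>b y\<bar> \<le> 1" unfolding b_def by (auto simp: indicator_def)
    have lb: "locally_integrable b" using b by (rule locally_integrable_bounded)
    define \<psi> where "\<psi> = mconv \<kappa> b"
    have \<psi>_eq: "\<psi> x = (LINT y|lborel. moll \<kappa> y * b (x + y))" for x unfolding \<psi>_def by (rule mconv_borel[OF b(1)])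
    have const: "\<psi> x = c" if "\<And>y. norm y < \<kappa> \<Longrightarrow> b (x + y) = c" for x c
    proof -
      have "moll \<kappa> y * b (x + y) = moll \<kappa> y * c" for y
        using that[of y] moll_zero[OF \<kappa>(1), of y] by (cases "norm y < \<kappa>") auto
      then have "\<psi> x = (LINT y|lborel. moll \<kappa> (y :: real ^ 'n) * c)" unfolding \<psi>_eq by presburger
      then show ?thesis by (simp add: integral_moll[OF \<kappa>(1)])
    qed
    have \<psi>_abs: "\<bar>\<psi> x\<bar> \<le> 1" for x
    proof -
      have "\<bar>\<psi> x\<bar> \<le> (LINT y|lborel. \<bar>moll \<kappa> y * b (x + y)\<bar>)" unfolding \<psi>_eq by (rule integral_abs_bound)
      also have "\<dots> \<le> (LINT y|lborel. moll \<kappa> (y :: real ^ 'n))"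
      proof (rule integral_mono')
        show "\<bar>moll \<kappa> y * b (x + y)\<bar> \<le> moll \<kappa> y" for y
          using mult_left_mono[OF b(2)[of "x + y"] moll_nonneg[OF \<kappa>(1), of y]] moll_nonneg[OF \<kappa>(1), of y] by (simp add: abs_mult)
      qed (auto intro: moll_integrable[OF \<kappa>(1)] moll_nonneg[OF \<kappa>(1)])
      finally show ?thesis by (simp add: integral_moll[OF \<kappa>(1)])
    qed
    have \<psi>1: "\<psi> x = 1" if x: "x \<in> K1" for x
    proof (rule const)
      fix y :: "real ^ 'n" assume y: "norm y < \<kappa>"
      have "x + y \<in> N1" using x y by (auto simp: N1_def dist_norm intro!: bexI[of _ x])
      moreover have "x + y \<notin> N2"
      proof
        assume "x + y \<in> N2"
        then obtain z where z: "z \<in> K2" "dist z (x + y) < \<kappa>" by (auto simp: N2_def)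
        have "dist x z \<le> dist x (x + y) + dist z (x + y)" by (rule dist_triangle2)
        then show False using far[OF x z(1)] z(2) y by (simp add: dist_norm)
      qed
      ultimately show "b (x + y) = 1" by (simp add: b_def)
    qed
    have \<psi>2: "\<psi> x = - 1" if x: "x \<in> K2" for x
    proof (rule const)
      fix y :: "real ^ 'n" assume y: "norm y < \<kappa>"
      have "x + y \<in> N2" using x y by (auto simp: N2_def dist_norm intro!: bexI[of _ x])
      moreover have "x + y \<notin> N1"
      proof
        assume "x + y \<in> N1"
        then obtain z where z: "z \<in> K1" "dist z (x + y) < \<kappa>" by (auto simp: N1_def)
        have "dist z x \<le> dist z (x + y) + dist x (x + y)" by (rule dist_triangle2)
        then show False using far[OF z(1) x] z(2) y by (simp add: dist_norm)
      qed
      ultimately show "b (x + y) = - 1" by (simp add: b_def)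
    qed
    let ?K = "(\<lambda>p. fst p + snd p) ` ((K1 \<union> K2) \<times> cball 0 (2 * \<kappa>))"
    have K: "compact ?K"
      by (intro compact_continuous_image compact_Times compact_Un K1 K2 compact_cball continuous_intros)
    have K0: "\<psi> x = 0" if "x \<notin> ?K" for x
    proof (rule const)
      fix y :: "real ^ 'n" assume y: "norm y < \<kappa>"
      have "x + y \<notin> ball z \<kappa>" if z: "z \<in> K1 \<union> K2" for z
      proof
        assume "x + y \<in> ball z \<kappa>"
        then have "norm (x - z) \<le> 2 * \<kappa>"
          using y norm_triangle_ineq4[of "x + y - z" y] by (simp add: dist_norm norm_minus_commute algebra_simps)
        then have "x \<in> ?K" using z by (intro image_eqI[where x = "(z, x - z)"]) auto
        then show False using \<open>x \<notin> ?K\<close> by simp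
      qed
      then show "b (x + y) = 0" by (auto simp: b_def N1_def N2_def)
    qed
    have K\<Omega>': "?K \<subseteq> \<Omega>'"
    proof clarsimp
      fix z w :: "real ^ 'n" assume z: "z \<in> K1 \<or> z \<in> K2" and w: "norm w \<le> 2 * \<kappa>"
      then have "z + w \<in> ball z e1" using \<kappa> by (simp add: dist_norm)
      then show "z + w \<in> \<Omega>'" using e1(2) z by blast
    qed
    \<comment> \<open>Convexity enters here: if both \<open>x\<close> and \<open>x + v\<close>
      belong to \<Omega>, so does the segment between them.\<close>
    have K\<Omega>: "x + t *\<^sub>R v \<in> \<Omega>" if "x \<in> ?K" "t \<in> {0..1}" for x t
    proof -
      have x: "x \<in> \<Omega>" "x + v \<in> \<Omega>" using that K\<Omega>' by (auto simp: \<Omega>'_def)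
      have "(1 - t) *\<^sub>R x + t *\<^sub>R (x + v) \<in> \<Omega>"
        using convexD[OF \<Omega>(2) x, of "1 - t" t] that by simp
      then show ?thesis by (simp add: algebra_simps)
    qed
    have bE: "bounded E" using E \<Omega> bounded_subset by blast
    have main: "(LINT x|lborel. (indicator E x - indicator E (x + v)) * \<psi> x) \<le> norm v * S"
      unfolding \<psi>_def
      by (rule translation_duality[OF E bE S b \<kappa>(1) \<psi>_abs[unfolded \<psi>_def] K K0[unfolded \<psi>_def] K\<Omega> False])
    let ?low = "\<lambda>x. indicator K1 x + indicator K2 x - indicator (P - K1) x - indicator (Q - K2) x :: real"
    have low: "?low x \<le> (indicator E x - indicator E (x + v)) * \<psi> x" for x
    proof -
      consider "x \<in> K1" | "x \<in> K2" | "x \<in> P - K1" | "x \<in> Q - K2" | "x \<notin> P" "x \<notin> Q" by blast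
      then show ?thesis
      proof cases
        case 1
        then have "x \<in> P" "x \<notin> Q" "x \<notin> K2" using K1 K2 by (auto simp: P_def Q_def)
        then show ?thesis using 1 \<psi>1[OF 1] by (simp add: P_def)
      next
        case 2
        then have "x \<in> Q" "x \<notin> P" "x \<notin> K1" using K1 K2 by (auto simp: P_def Q_def)
        then show ?thesis using 2 \<psi>2[OF 2] by (simp add: Q_def)
      next
        case 3
        then have "x \<notin> Q" "x \<notin> K2" using K1 K2 by (auto simp: P_def Q_def)
        then show ?thesis using 3 \<psi>_abs[of x] by (simp add: P_def abs_le_iff)
      next
        case 4
        then have "x \<notin> P" "x \<notin> K1" using K1 K2 by (auto simp: P_def Q_def)
        then show ?thesis using 4 \<psi>_abs[of x] by (simp add: Q_def abs_le_iff)
      next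
        case 5
        then have not: "x \<notin> K1" "x \<notin> K2" using K1 K2 by auto
        have zero: "(indicator E x - indicator E (x + v)) * \<psi> x = 0"
        proof (cases "x \<in> \<Omega>'")
          case True
          then have "x \<in> E \<longleftrightarrow> x + v \<in> E" using 5 unfolding P_def Q_def by blast
          then have "indicator E x = (indicator E (x + v) :: real)" by (simp only: indicator_def)
          then show ?thesis by simp
        next
          case False
          then have "x \<notin> ?K" using subsetD[OF K\<Omega>', of x] by metis
          then show ?thesis using K0[of x] by simp
        qed
        show ?thesis unfolding zero using 5 not by simp
      qed
    qed
    have ind: "integrable lborel (indicator A :: _ \<Rightarrow> real)" if "A \<in> sets borel" "bounded A" for A :: "(real ^ 'n) set"
      using that fin[OF that(2)] by (simp add: less_top[symmetric])
    have bs: "bounded K1" "bounded K2" "bounded (P - K1)" "bounded (Q - K2)"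
      using bPQ K1 K2 bounded_subset by (blast intro: bounded_subset)+
    have "(LINT x|lborel. ?low x) \<le> (LINT x|lborel. (indicator E x - indicator E (x + v)) * \<psi> x)"
    proof (rule integral_mono[OF _ _ low])
      show "integrable lborel ?low" by (intro Bochner_Integration.integrable_add Bochner_Integration.integrable_diff ind bs) measurable
      have "\<psi> \<in> borel_measurable borel"
        unfolding \<psi>_def by (intro borel_measurable_continuous_onI continuous_mconv lb \<kappa>)
      note [measurable] = this
      show "integrable lborel (\<lambda>x. (indicator E x - indicator E (x + v)) * \<psi> x)"
      proof (rule Bochner_Integration.integrable_bound[OF ind[of ?K]])
        show "AE x in lborel. norm ((indicator E x - indicator E (x + v)) * \<psi> x) \<le> norm (indicator ?K x :: real)"
        proof (rule AE_I2)
          fix x show "norm ((indicator E x - indicator E (x + v)) * \<psi> x) \<le> norm (indicator ?K x :: real)"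
          proof (cases "x \<in> ?K")
            case True
            have "\<bar>indicator E x - indicator E (x + v) :: real\<bar> \<le> 1" by (auto simp: indicator_def)
            then have "\<bar>indicator E x - indicator E (x + v)\<bar> * \<bar>\<psi> x\<bar> \<le> 1 * 1"
              using \<psi>_abs[of x] by (intro mult_mono) auto
            then show ?thesis using True by (simp add: abs_mult)
          qed (simp add: K0)
        qed
        show "?K \<in> sets borel" using K by (rule borel_compact)
        show "bounded ?K" using K by (rule compact_imp_bounded)
      qed measurable
    qed
    also have "(LINT x|lborel. ?low x) = measure lborel K1 + measure lborel K2 - measure lborel (P - K1) - measure lborel (Q - K2)"
      using ind[of K1] ind[of K2] ind[of "P - K1"] ind[of "Q - K2"] bs by simp
    finally have "measure lborel K1 + measure lborel K2 \<le> norm v * S + 2 * e" using main K1(3) K2(3) by simp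
    moreover have "measure lborel P = measure lborel K1 + measure lborel (P - K1)"
      using K1(2) fin[OF bPQ(1)] fin[OF bs(1)] by (subst measure_Diff) auto
    moreover have "measure lborel Q = measure lborel K2 + measure lborel (Q - K2)"
      using K2(2) fin[OF bPQ(2)] fin[OF bs(2)] by (subst measure_Diff) auto
    ultimately show ?thesis using K1(3) K2(3) by simp
  qed
  note * = this
  have "measure lborel P + measure lborel Q \<le> norm v * S"
  proof (rule field_le_epsilon)
    fix e :: real assume "0 < e"
    then show "measure lborel P + measure lborel Q \<le> norm v * S + e" using *[of "e / 4"] by simp
  qed
  moreover have "{x \<in> \<Omega>. x + v \<in> \<Omega> \<and> (x \<in> E) \<noteq> (x + v \<in> E)} = P \<union> Q" by (auto simp: P_def Q_def \<Omega>'_def)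
  moreover have "measure lborel (P \<union> Q) = measure lborel P + measure lborel Q"
    using fin[OF bPQ(1)] fin[OF bPQ(2)] by (intro measure_Union) (auto simp: P_def Q_def)
  ultimately show ?thesis by simp
qed simp

section \<open>Periodic sets of finite perimeter\<close>

lemma sum_abs_nth_le: "(\<Sum>i\<in>UNIV. \<bar>v $ i\<bar>) \<le> real CARD('n) * norm (v :: real ^ 'n)"
  using sum_mono[of UNIV "\<lambda>i. \<bar>v $ i\<bar>" "\<lambda>_. norm v"] component_le_norm_cart[of v] by simp

lemma measure_cell_boundary:
  fixes v :: "real ^ 'n"
  shows "measure lborel {x \<in> box 0 1. x + v \<notin> box 0 1} \<le> real CARD('n) * norm v"
proof -
  \<comment> \<open>A slab of width \<open>\<bar>v $ i\<bar>\<close> at the face through which a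
    translation by \<open>v\<close> leaves the cube in coordinate \<open>i\<close>, cut off at the
    whole cube if \<open>\<bar>v $ i\<bar>\<close> exceeds 1.\<close>
  define A where "A i = (if 0 \<le> v $ i then cbox (\<chi> k. if k = i then max 0 (1 - v $ i) else 0) (1 :: real ^ 'n)
    else cbox 0 (\<chi> k. if k = i then min 1 (- v $ i) else 1))" for i
  have mA: "measure lborel (A i) \<le> \<bar>v $ i\<bar>" for i
  proof (cases "0 \<le> v $ i")
    case True
    have ne: "cbox (\<chi> k. if k = i then max 0 (1 - v $ i) else 0) (1 :: real ^ 'n) \<noteq> {}"
      using True by (auto simp: interval_ne_empty_cart)
    have "measure lborel (A i) = (\<Prod>k\<in>UNIV. (1 :: real ^ 'n) $ k - (\<chi> k. if k = i then max 0 (1 - v $ i) else 0) $ k)"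
      unfolding A_def if_P[OF True] by (rule content_cbox_cart[OF ne])
    also have "\<dots> = (\<Prod>k\<in>UNIV. if k = i then 1 - max 0 (1 - v $ i) else 1)"
      by (intro prod.cong) auto
    finally show ?thesis using True by simp
  next
    case False
    have ne: "cbox (0 :: real ^ 'n) (\<chi> k. if k = i then min 1 (- v $ i) else 1) \<noteq> {}"
      using False by (auto simp: interval_ne_empty_cart)
    have "measure lborel (A i) = (\<Prod>k\<in>UNIV. (\<chi> k. if k = i then min 1 (- v $ i) else 1) $ k - (0 :: real ^ 'n) $ k)"
      unfolding A_def if_not_P[OF False] by (rule content_cbox_cart[OF ne])
    also have "\<dots> = (\<Prod>k\<in>UNIV. if k = i then min 1 (- v $ i) else 1)"
      by (intro prod.cong) auto
    finally show ?thesis using False by simp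
  qed
  have [measurable]: "A i \<in> sets borel" for i unfolding A_def by auto
  have fm: "A i \<in> fmeasurable lborel" for i
    by (intro fmeasurableI) (auto simp: A_def emeasure_bounded_finite[OF bounded_cbox, unfolded infinity_ennreal_def])
  have "{x \<in> box 0 1. x + v \<notin> box 0 1} \<subseteq> (\<Union>i. A i)"
  proof
    fix x assume "x \<in> {x \<in> box 0 1. x + v \<notin> box 0 1}"
    then have x: "\<And>k. 0 < x $ k \<and> x $ k < 1" and "x + v \<notin> box 0 1" by (auto simp: mem_box_cart)
    then obtain i where i: "x $ i + v $ i \<le> 0 \<or> 1 \<le> x $ i + v $ i" by (auto simp: mem_box_cart not_less)
    have xi: "0 < x $ i" "x $ i < 1" using x by auto
    have "x \<in> A i"
    proof (cases "0 \<le> v $ i")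
      case True
      then have "1 - v $ i \<le> x $ i" using i xi by linarith
      then show ?thesis unfolding A_def if_P[OF True] using x xi by (auto simp: mem_box_cart less_imp_le)
    next
      case False
      then have "x $ i \<le> - v $ i" using i xi by linarith
      then show ?thesis unfolding A_def if_not_P[OF False] using x xi by (auto simp: mem_box_cart less_imp_le)
    qed
    then show "x \<in> (\<Union>i. A i)" by blast
  qed
  then have "measure lborel {x \<in> box 0 1. x + v \<notin> box 0 1} \<le> measure lborel (\<Union>i. A i)"
  proof (rule measure_mono_fmeasurable)
    have "open ((\<lambda>x. x + v) -` box 0 1)" by (intro open_vimage open_box continuous_intros)
    then have [measurable]: "{x. x + v \<in> box 0 1} \<in> sets borel" using borel_open by (simp add: vimage_def)
    have "{x \<in> box 0 1. x + v \<notin> box 0 1} = box 0 1 - {x. x + v \<in> box 0 1}" by auto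
    then show "{x \<in> box 0 1. x + v \<notin> box 0 1} \<in> sets lborel" by simp
    show "(\<Union>i. A i) \<in> fmeasurable lborel" by (intro fmeasurable.finite_UN fm) auto
  qed
  also have "\<dots> \<le> (\<Sum>i\<in>UNIV. measure lborel (A i))"
    by (intro measure_UNION_le) (auto intro: fm)
  also have "\<dots> \<le> (\<Sum>i\<in>UNIV. \<bar>v $ i\<bar>)" by (intro sum_mono mA)
  also have "\<dots> \<le> real CARD('n) * norm v" by (rule sum_abs_nth_le)
  finally show ?thesis .
qed

definition per_ind :: "(real ^ 'n) set \<Rightarrow> real ^ 'n \<Rightarrow> real"
  where "per_ind E x = indicator E (frac_vec x)"

lemma bper_per_ind: "E \<in> sets borel \<Longrightarrow> bper (per_ind E)"
  unfolding bper_def bounded_range_real_iff per_ind_def[abs_def]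
  by (auto intro!: periodic_comp_frac_vec exI[of _ 1] simp: indicator_def)

lemma mean_indicator: "A \<in> sets borel \<Longrightarrow> mean (indicator A) = measure lborel (A \<inter> unit_cell)"
proof -
  assume A: "A \<in> sets borel"
  have "mean (indicator A) = measure cell (A \<inter> unit_cell)"
    by (simp add: space_cell Int_commute)
  also have "\<dots> = measure lborel (A \<inter> unit_cell)"
    unfolding cell_def using A by (intro measure_restrict_space) auto
  finally show ?thesis .
qed

lemma emeasure_box_01: "emeasure lborel (box 0 (1 :: real ^ 'n)) = 1"
  by (auto simp: emeasure_lborel_box_eq Basis_vec_def inner_axis intro!: prod.neutral)

lemma measure_unit_cell_Int: "A \<in> sets borel \<Longrightarrow> measure lborel (A \<inter> unit_cell) = measure lborel (A \<inter> box 0 1)"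
proof -
  assume [measurable]: "A \<in> sets borel"
  have "emeasure lborel (A \<inter> unit_cell) = emeasure lborel (A \<inter> box 0 1)"
    using AE_box_unit_cell by (intro emeasure_eq_AE) auto
  then show ?thesis by (simp add: measure_def)
qed

text \<open>The term with \<open>CARD('n)\<close> accounts for points that the translation carries
  out of the cube: across the faces the periodic extension can jump without being seen by the total
  variation.\<close>

lemma mean_tdiff_per_ind:
  fixes E :: "(real ^ 'n) set"
  assumes E: "E \<in> sets borel" "E \<subseteq> box 0 1" and S: "0 \<le> S" "total_variation (box 0 1) (indicator E) \<le> ennreal S"
  shows "mean (\<lambda>x. \<bar>tdiff v (per_ind E) x\<bar>) \<le> norm v * (S + real CARD('n))"
proof -
  note [measurable] = E(1)
  define D where "D = {x. (frac_vec x \<in> E) \<noteq> (frac_vec (x + v) \<in> E)}"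
  have D[measurable]: "D \<in> sets borel" unfolding D_def by measurable
  have eq: "(\<lambda>x. \<bar>tdiff v (per_ind E) x\<bar>) = indicator D"
    by (auto simp: fun_eq_iff tdiff_def per_ind_def D_def indicator_def)
  have "mean (\<lambda>x. \<bar>tdiff v (per_ind E) x\<bar>) = measure lborel (D \<inter> box 0 1)"
    unfolding eq by (simp only: mean_indicator[OF D] measure_unit_cell_Int[OF D])
  also have "\<dots> \<le> measure lborel ({x \<in> box 0 1. x + v \<in> box 0 1 \<and> (x \<in> E) \<noteq> (x + v \<in> E)} \<union> {x \<in> box 0 1. x + v \<notin> box 0 1})"
  proof (rule measure_mono_fmeasurable)
    have fr: "frac_vec x = x" if "x \<in> box 0 1" for x :: "real ^ 'n"
      using that by (intro frac_vec_eq) (auto simp: unit_cell_def mem_box_cart less_imp_le)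
    show "D \<inter> box 0 1 \<subseteq> {x \<in> box 0 1. x + v \<in> box 0 1 \<and> (x \<in> E) \<noteq> (x + v \<in> E)} \<union> {x \<in> box 0 1. x + v \<notin> box 0 1}"
      by (auto simp: D_def fr)
    have "{x \<in> box 0 1. x + v \<in> box 0 1 \<and> (x \<in> E) \<noteq> (x + v \<in> E)} \<union> {x \<in> box 0 1. x + v \<notin> box 0 1} \<in> sets lborel"
      by measurable
    then show "{x \<in> box 0 1. x + v \<in> box 0 1 \<and> (x \<in> E) \<noteq> (x + v \<in> E)} \<union> {x \<in> box 0 1. x + v \<notin> box 0 1} \<in> fmeasurable lborel"
      by (rule fmeasurableI2[rotated -1]) (auto intro: fmeasurableI simp: emeasure_box_01)
  qed measurable
  also have "\<dots> \<le> measure lborel {x \<in> box 0 1. x + v \<in> box 0 1 \<and> (x \<in> E) \<noteq> (x + v \<in> E)} + measure lborel {x \<in> box 0 1. x + v \<notin> box 0 1}"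
    by (intro measure_Un_le) measurable
  also have "\<dots> \<le> norm v * S + real CARD('n) * norm v"
    by (intro add_mono total_variation_translation measure_cell_boundary E S) auto
  finally show ?thesis by (simp add: algebra_simps)
qed

lemma l2_tdiff_per_ind:
  fixes E :: "(real ^ 'n) set"
  assumes E: "E \<in> sets borel" "E \<subseteq> box 0 1" and S: "0 \<le> S" "total_variation (box 0 1) (indicator E) \<le> ennreal S"
  shows "l2 (tdiff v (per_ind E)) \<le> sqrt (norm v * (S + real CARD('n)))"
proof (rule real_le_rsqrt)
  have "(tdiff v (per_ind E) x)\<^sup>2 = \<bar>tdiff v (per_ind E) x\<bar>" for x
    by (auto simp: tdiff_def per_ind_def indicator_def)
  then have "(l2 (tdiff v (per_ind E)))\<^sup>2 = mean (\<lambda>x. \<bar>tdiff v (per_ind E) x\<bar>)" by (simp add: l2_power2)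
  then show "(l2 (tdiff v (per_ind E)))\<^sup>2 \<le> norm v * (S + real CARD('n))"
    using mean_tdiff_per_ind[OF assms, of v] by simp
qed

lemma nn_integral_segment_indicator:
  fixes E :: "(real ^ 'n) set"
  assumes [measurable]: "E \<in> sets borel"
  shows "(\<integral>\<^sup>+ x. (\<integral>\<^sup>+ y. indicator (box 0 1 \<inter> E) x * indicator (box 0 1 - E) y \<partial>lborel) \<partial>lborel)
    = (\<integral>\<^sup>+ v. emeasure lborel {x \<in> box 0 1 \<inter> E. x + v \<in> box 0 1 - E} \<partial>lborel)"
proof -
  let ?B = "box 0 1 :: (real ^ 'n) set"
  have "(\<integral>\<^sup>+ x. (\<integral>\<^sup>+ y. indicator (?B \<inter> E) x * indicator (?B - E) y \<partial>lborel) \<partial>lborel)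
      = (\<integral>\<^sup>+ x. (\<integral>\<^sup>+ v. indicator (?B \<inter> E) x * indicator (?B - E) (v + x) \<partial>lborel) \<partial>lborel)"
    by (intro nn_integral_cong nn_integral_lborel_shift[symmetric]) measurable
  also have "\<dots> = (\<integral>\<^sup>+ v. (\<integral>\<^sup>+ x. indicator (?B \<inter> E) x * indicator (?B - E) (v + x) \<partial>lborel) \<partial>lborel)"
    by (rule lborel_pair.Fubini'[symmetric]) measurable
  also have "\<dots> = (\<integral>\<^sup>+ v. emeasure lborel {x \<in> ?B \<inter> E. x + v \<in> ?B - E} \<partial>lborel)"
  proof (rule nn_integral_cong)
    fix v :: "real ^ 'n"
    have "{x \<in> ?B \<inter> E. x + v \<in> ?B - E} \<in> sets lborel" by measurable
    then have "emeasure lborel {x \<in> ?B \<inter> E. x + v \<in> ?B - E} = (\<integral>\<^sup>+ x. indicator {x \<in> ?B \<inter> E. x + v \<in> ?B - E} x \<partial>lborel)"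
      by (rule nn_integral_indicator[symmetric])
    also have "\<dots> = (\<integral>\<^sup>+ x. indicator (?B \<inter> E) x * indicator (?B - E) (v + x) \<partial>lborel)"
      by (intro nn_integral_cong) (simp add: indicator_def add.commute)
    finally show "(\<integral>\<^sup>+ x. indicator (?B \<inter> E) x * indicator (?B - E) (v + x) \<partial>lborel)
      = emeasure lborel {x \<in> ?B \<inter> E. x + v \<in> ?B - E}" by simp
  qed
  finally show ?thesis .
qed

text \<open>The product of the volumes of \<open>E\<close> and its complement is an integral over
  the vectors \<open>v\<close> joining a point of the one to a point of the other. Such
  \<open>v\<close> lie in a cube of volume \<open>2 ^ CARD('n)\<close> and have norm at most
  \<open>CARD('n)\<close>, and for each of them the translation estimate applies.\<close>

lemma isoperimetric_unit_cube:
  fixes E :: "(real ^ 'n) set"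
  assumes E: "E \<in> sets borel" "E \<subseteq> box 0 1" and S: "0 \<le> S" "total_variation (box 0 1) (indicator E) \<le> ennreal S"
  shows "measure lborel E * (1 - measure lborel E) \<le> 2 ^ CARD('n) * real CARD('n) * S"
proof -
  note [measurable] = E(1)
  let ?B = "box 0 1 :: (real ^ 'n) set" and ?n = "real CARD('n)"
  have fin: "emeasure lborel E \<noteq> \<infinity>"
    using emeasure_mono[OF E(2), of lborel] emeasure_box_01[where 'n = 'n] by (auto simp: top_unique)
  have eE: "emeasure lborel E = ennreal (measure lborel E)" using fin by (simp add: emeasure_eq_ennreal_measure)
  have eB: "emeasure lborel (?B - E) = ennreal (1 - measure lborel E)"
    using E fin emeasure_box_01[where 'n = 'n] by (subst emeasure_Diff) (auto simp: eE ennreal_minus[symmetric])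
  have "measure lborel E \<le> 1"
    using emeasure_mono[OF E(2), of lborel] emeasure_box_01[where 'n = 'n] by (simp add: eE)
  then have "ennreal (measure lborel E * (1 - measure lborel E)) = emeasure lborel E * emeasure lborel (?B - E)"
    unfolding eE eB by (simp add: ennreal_mult)
  also have "\<dots> = (\<integral>\<^sup>+ x. (\<integral>\<^sup>+ y. indicator (?B \<inter> E) x * indicator (?B - E) y \<partial>lborel) \<partial>lborel)"
    using E(2) by (simp add: nn_integral_cmult nn_integral_multc Int_absorb1)
  also have "\<dots> = (\<integral>\<^sup>+ v. emeasure lborel {x \<in> ?B \<inter> E. x + v \<in> ?B - E} \<partial>lborel)"
    by (rule nn_integral_segment_indicator) measurable
  also have "\<dots> \<le> (\<integral>\<^sup>+ v. ennreal (?n * S) * indicator (cbox (- 1) (1 :: real ^ 'n)) v \<partial>lborel)"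
  proof (rule nn_integral_mono)
    fix v :: "real ^ 'n"
    show "emeasure lborel {x \<in> ?B \<inter> E. x + v \<in> ?B - E} \<le> ennreal (?n * S) * indicator (cbox (- 1) 1) v"
    proof (cases "v \<in> cbox (- 1) 1")
      case True
      let ?D = "{x \<in> ?B. x + v \<in> ?B \<and> (x \<in> E) \<noteq> (x + v \<in> E)}"
      have "\<bar>v $ i\<bar> \<le> 1" for i using True by (auto simp: mem_box_cart abs_le_iff)
      then have nv: "norm v \<le> ?n" using norm_le_l1_cart[of v] sum_mono[of UNIV "\<lambda>i. \<bar>v $ i\<bar>" "\<lambda>_. 1"] by simp
      have D: "?D \<in> sets lborel" by measurable
      have finD: "emeasure lborel ?D \<noteq> \<infinity>"
        using emeasure_mono[of ?D ?B lborel] emeasure_box_01[where 'n = 'n] by (auto simp: top_unique)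
      have "emeasure lborel {x \<in> ?B \<inter> E. x + v \<in> ?B - E} \<le> emeasure lborel ?D"
        by (intro emeasure_mono D) auto
      also have "\<dots> = ennreal (measure lborel ?D)" using finD by (simp add: emeasure_eq_ennreal_measure)
      also have "\<dots> \<le> ennreal (norm v * S)"
        by (intro ennreal_leI total_variation_translation E S) auto
      also have "\<dots> \<le> ennreal (?n * S)" by (intro ennreal_leI mult_right_mono nv S)
      finally show ?thesis using True by simp
    next
      case False
      have empty: "{x \<in> ?B \<inter> E. x + v \<in> ?B - E} = {}"
      proof (rule ccontr)
        assume "{x \<in> ?B \<inter> E. x + v \<in> ?B - E} \<noteq> {}"
        then obtain x where x: "x \<in> ?B" "x + v \<in> ?B" by auto
        have "- 1 \<le> v $ i \<and> v $ i \<le> 1" for i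
          using x[unfolded mem_box_cart, THEN spec, of i] by auto
        then show False using False by (simp add: mem_box_cart)
      qed
      show ?thesis unfolding empty by simp
    qed
  qed
  also have "\<dots> = ennreal (?n * S) * ennreal (2 ^ CARD('n))"
  proof -
    have "emeasure lborel (cbox (- 1) (1 :: real ^ 'n)) = ennreal (2 ^ CARD('n))"
    proof -
      have "(\<Prod>b\<in>Basis. (1 - - 1 :: real ^ 'n) \<bullet> b) = (\<Prod>b\<in>(Basis :: (real ^ 'n) set). 2)"
        by (intro prod.cong) (auto simp: Basis_vec_def inner_axis)
      moreover have "\<forall>b\<in>Basis. (- 1 :: real ^ 'n) \<bullet> b \<le> 1 \<bullet> b"
        by (auto simp: Basis_vec_def inner_axis)
      ultimately show ?thesis unfolding emeasure_lborel_cbox_eq by simp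
    qed
    then show ?thesis by (simp add: nn_integral_cmult)
  qed
  also have "\<dots> = ennreal (2 ^ CARD('n) * ?n * S)" using S by (simp add: ennreal_mult[symmetric] mult_ac)
  finally show ?thesis using S by (simp add: ennreal_le_iff)
qed

lemma mean_lint:
  assumes g: "cper g" and r: "0 \<le> r"
  shows "mean (lint z r g) = r * mean g"
proof -
  have "continuous_on UNIV (lint z r g)" using cper_lint[OF g r] by (simp add: cper_def)
  then have "mean (lint z r g) = integral (cbox 0 1) (\<lambda>x. integral (cbox 0 r) (\<lambda>s. g (x + s *\<^sub>R axis z 1)))"
    by (simp add: mean_eq_integral lint_def[abs_def])
  also have "\<dots> = integral (cbox 0 r) (\<lambda>s. integral (cbox 0 1) (\<lambda>x. g (x + s *\<^sub>R axis z 1)))"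
    by (rule integral_swap_continuous[symmetric]) (rule continuous_on_subset[OF cper_joint[OF g]], simp)
  also have "\<dots> = integral (cbox 0 r) (\<lambda>s. mean g)"
  proof (rule integral_cong)
    fix s
    have "continuous_on UNIV (\<lambda>x. g (x + s *\<^sub>R axis z 1))" using cper_shift[OF g] by (simp add: cper_def)
    then show "integral (cbox 0 1) (\<lambda>x. g (x + s *\<^sub>R axis z 1)) = mean g"
      using mean_shift[OF cper_imp_bper[OF g]] by (simp add: mean_eq_integral[symmetric])
  qed
  also have "\<dots> = r * mean g" using r by simp
  finally show ?thesis .
qed

section \<open>Periodic representatives and the reduction from p to 2\<close>

lemma AE_lborel_shift:
  assumes "AE x in lborel. P x"
  shows "AE x in lborel. P (x + v :: real ^ 'n)"
proof -
  obtain N where N: "N \<in> null_sets lborel" "{x. \<not> P x} \<subseteq> N"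
    using assms by (auto simp: eventually_ae_filter)
  note [measurable] = null_setsD2[OF N(1)]
  have meas: "{x. x + v \<in> N} \<in> sets lborel" by measurable
  have "emeasure lborel {x. x + v \<in> N} = (\<integral>\<^sup>+ x. indicator {x. x + v \<in> N} x \<partial>lborel)"
    by (rule nn_integral_indicator[symmetric, OF meas])
  also have "\<dots> = (\<integral>\<^sup>+ x. indicator N (x + v) \<partial>lborel)"
    by (intro nn_integral_cong) (simp add: indicator_def)
  also have "\<dots> = (\<integral>\<^sup>+ x. indicator N x \<partial>lborel)"
    by (rule nn_integral_lborel_shift) measurable
  also have "\<dots> = emeasure lborel N" by (rule nn_integral_indicator) measurable
  also have "\<dots> = 0" using N(1) by (rule null_setsD1)
  finally have "{x. x + v \<in> N} \<in> null_sets lborel" by (auto simp: null_sets_def)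
  then show ?thesis using N(2) by (rule_tac AE_I'[of "{x. x + v \<in> N}"]) auto
qed

text \<open>Compose a Borel representative with \<open>frac_vec\<close>. The translations involved
  are countably many, so the exceptional null sets can be united.\<close>

lemma AE_periodic_representative:
  fixes G :: "real ^ 'n \<Rightarrow> real"
  assumes G: "G \<in> borel_measurable lebesgue" and per: "\<And>i. AE x in lebesgue. G (x + axis i 1) = G x"
  obtains G' where "G' \<in> borel_measurable borel" "periodic G'" "AE x in lborel. G' x = G x"
proof -
  obtain g where g: "g \<in> borel_measurable lborel" "AE x in lborel. G x = g x"
    using completion_ex_borel_measurable_real[OF G] by blast
  have per': "AE x in lborel. G (x + axis i 1) = G x" for i
    using per[of i] by (simp add: AE_completion_iff)
  have "AE x in lborel. G (x + k) = G x" if "k \<in> int_vec" for k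
    using that
  proof (induction k rule: int_vec_induct)
    case (add k i)
    have "AE x in lborel. G (x + k + axis i 1) = G (x + k)" by (rule AE_lborel_shift[OF per'])
    with add show ?case by eventually_elim (simp add: add.assoc)
  next
    case (minus k i)
    have "AE x in lborel. G (x + (k - axis i 1) + axis i 1) = G (x + (k - axis i 1))" by (rule AE_lborel_shift[OF per'])
    with minus show ?case by eventually_elim (simp add: algebra_simps)
  qed simp
  then have 1: "AE x in lborel. \<forall>k\<in>int_vec. G (x + k) = G x"
    by (intro AE_ball_countable[THEN iffD2] countable_int_vec) auto
  have 2: "AE x in lborel. \<forall>k\<in>int_vec. G (x + k) = g (x + k)"
    by (intro AE_ball_countable[THEN iffD2] countable_int_vec ballI AE_lborel_shift g(2))
  have "AE x in lborel. g (frac_vec x) = G x"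
    using 1 2
  proof eventually_elim
    case (elim x)
    have "g (frac_vec x) = g (x + (frac_vec x - x))" by simp
    also have "\<dots> = G x" using elim frac_vec_diff_int[of x] by metis
    finally show ?case .
  qed
  moreover have "(\<lambda>x. g (frac_vec x)) \<in> borel_measurable borel" using g(1) by simp
  ultimately show ?thesis using that periodic_comp_frac_vec by blast
qed

text \<open>Young's inequality for \<open>s^2 = (s^p e^(2-p))^(2/p) (e^2)^(1-2/p)\<close>. On a
  space of measure one, a bound \<open>e^p\<close> for the integral of \<open>s^p\<close> then
  returns exactly \<open>e^2\<close>.\<close>

lemma square_le_powr:
  fixes s e p :: real
  assumes "2 \<le> p" "0 \<le> s" "0 < e"
  shows "s\<^sup>2 \<le> 2 / p * e powr (2 - p) * s powr p + (1 - 2 / p) * e\<^sup>2"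
proof (cases "s = 0")
  case False
  have "(s powr p * e powr (2 - p)) powr (2 / p) * (e powr 2) powr (1 - 2 / p)
      \<le> 2 / p * (s powr p * e powr (2 - p)) + (1 - 2 / p) * (e powr 2)"
    using assms False by (intro Youngs_inequality_0) (auto simp: field_simps)
  moreover have "(s powr p * e powr (2 - p)) powr (2 / p) * (e powr 2) powr (1 - 2 / p) = s powr 2"
  proof -
    have "(2 - p) * (2 / p) + 2 * (1 - 2 / p) = 0" using assms by (simp add: field_simps)
    then have "e powr ((2 - p) * (2 / p)) * e powr (2 * (1 - 2 / p)) = 1"
      using assms by (simp add: powr_add[symmetric])
    moreover have "(s powr p * e powr (2 - p)) powr (2 / p) = s powr 2 * e powr ((2 - p) * (2 / p))"
      using assms by (simp add: powr_mult powr_powr)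
    ultimately show ?thesis unfolding powr_powr by (simp only: mult.assoc mult_1_right)
  qed
  ultimately show ?thesis using assms False by (simp add: powr_numeral mult_ac)
qed (use assms in simp)

lemma nn_integral_square_le:
  assumes p: "2 \<le> p" and e: "0 < e" and [measurable]: "g \<in> borel_measurable M" and g0: "\<And>x. 0 \<le> g x"
    and M: "emeasure M (space M) = 1" and le: "(\<integral>\<^sup>+ x. ennreal (g x powr p) \<partial>M) \<le> ennreal (e powr p)"
  shows "(\<integral>\<^sup>+ x. ennreal ((g x)\<^sup>2) \<partial>M) \<le> ennreal (e\<^sup>2)"
proof -
  define c d where "c = 2 / p * e powr (2 - p)" and "d = (1 - 2 / p) * e\<^sup>2"
  have cd: "0 \<le> c" "0 \<le> d" using p by (auto simp: c_def d_def)
  have "(\<integral>\<^sup>+ x. ennreal ((g x)\<^sup>2) \<partial>M) \<le> (\<integral>\<^sup>+ x. ennreal c * ennreal (g x powr p) + ennreal d \<partial>M)"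
  proof (rule nn_integral_mono)
    fix x
    have "ennreal ((g x)\<^sup>2) \<le> ennreal (c * g x powr p + d)"
      using square_le_powr[OF p g0 e] unfolding c_def d_def by (rule ennreal_leI)
    also have "\<dots> = ennreal c * ennreal (g x powr p) + ennreal d"
      using cd by (simp add: ennreal_mult)
    finally show "ennreal ((g x)\<^sup>2) \<le> ennreal c * ennreal (g x powr p) + ennreal d" .
  qed
  also have "\<dots> = ennreal c * (\<integral>\<^sup>+ x. ennreal (g x powr p) \<partial>M) + ennreal d"
    by (simp add: nn_integral_add nn_integral_cmult M)
  also have "\<dots> \<le> ennreal c * ennreal (e powr p) + ennreal d"
    by (intro add_mono mult_left_mono le) auto
  also have "\<dots> = ennreal (c * e powr p + d)"
    using cd by (simp add: ennreal_mult)
  also have "c * e powr p + d = 2 / p * e powr (2 - p) * e powr p + (1 - 2 / p) * e\<^sup>2"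
    by (simp add: c_def d_def)
  also have "2 / p * e powr (2 - p) * e powr p + (1 - 2 / p) * e\<^sup>2 = e\<^sup>2"
  proof -
    have "e powr (2 - p) * e powr p = e\<^sup>2" using e by (simp add: powr_add[symmetric] powr_numeral)
    then show ?thesis by (simp add: mult.assoc) (simp add: algebra_simps)
  qed
  finally show ?thesis .
qed

section \<open>From low energy to approximate laminates\<close>

lemma test_function_divergence_measurable:
  assumes "\<phi> \<in> test_functions \<Omega>"
  shows "divergence \<phi> \<in> borel_measurable borel"
proof (rule borel_measurable_continuous_onI)
  have "continuous_on UNIV (\<lambda>x. partial_deriv i \<phi> x $ i)" for i
    using assms unfolding test_functions_def partial_deriv_def
    by (intro continuous_on_component) auto
  then show "continuous_on UNIV (divergence \<phi>)"
    unfolding divergence_def[abs_def] by (intro continuous_on_sum)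
qed

lemma total_variation_cong_AE:
  assumes g: "(\<lambda>x. indicator \<Omega> x * g x) \<in> borel_measurable lebesgue"
    and k: "(\<lambda>x. indicator \<Omega> x * k x) \<in> borel_measurable lebesgue"
    and eq: "AE x in lebesgue. x \<in> \<Omega> \<longrightarrow> g x = k x"
  shows "total_variation \<Omega> g = total_variation \<Omega> k"
proof -
  have "(LINT x:\<Omega>|lebesgue. g x * divergence \<phi> x) = (LINT x:\<Omega>|lebesgue. k x * divergence \<phi> x)"
    if "\<phi> \<in> test_functions \<Omega>" for \<phi>
  proof -
    have d: "divergence \<phi> \<in> borel_measurable lebesgue"
      using test_function_divergence_measurable[OF that] by (simp add: measurable_completion)
    have "(LINT x|lebesgue. (indicator \<Omega> x * g x) * divergence \<phi> x) = (LINT x|lebesgue. (indicator \<Omega> x * k x) * divergence \<phi> x)"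
      by (intro integral_cong_AE borel_measurable_times g k d) (use eq in \<open>auto simp: indicator_def\<close>)
    then show ?thesis by (simp add: set_lebesgue_integral_def mult.assoc)
  qed
  then show ?thesis unfolding total_variation_def by (intro SUP_cong) auto
qed

lemma borel_part:
  assumes "A \<in> sets lebesgue"
  obtains B where "B \<in> sets borel" "B \<subseteq> A" "AE x in lborel. x \<in> A \<longrightarrow> x \<in> B"
proof -
  obtain B N N' where B: "A = B \<union> N" "N \<subseteq> N'" "N' \<in> null_sets lborel" "B \<in> sets lborel"
    using assms by (elim sets_completionE)
  have "AE x in lborel. x \<in> A \<longrightarrow> x \<in> B"
    using AE_not_in[OF B(3)] by eventually_elim (use B in auto)
  then show ?thesis using that[of B] B by auto
qed

text \<open>The phases are only Lebesgue measurable. Taking Borel subsets of the level sets, and not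
  just any almost equal sets, keeps them disjoint and inside the open cube exactly; the null sets
  lost do not affect the total variation.\<close>

lemma borel_phases:
  fixes X :: "real ^ 'n::_ \<Rightarrow> real ^ 'n::_ ^ 'n::{finite,linorder}"
  assumes X: "X \<in> phase_arrangements (box 0 1) m f"
  obtains E where "\<And>j. E j \<in> sets borel" "\<And>j. E j \<subseteq> box 0 1" "\<And>j x. x \<in> E j \<Longrightarrow> X x = well f j"
    "\<And>j. total_variation (box 0 1) (indicator (E j)) = total_variation (box 0 1) (phase f X j)"
    "AE x in lborel. \<forall>j\<in>{0..m}. x \<in> box 0 1 \<longrightarrow> X x = well f j \<longrightarrow> x \<in> E j"
    "(\<lambda>x. indicator (box 0 1) x *\<^sub>R X x) \<in> borel_measurable lebesgue"
proof -
  let ?B = "box 0 1 :: (real ^ 'n::_) set"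
  define Y where "Y = (\<lambda>x. indicator ?B x *\<^sub>R X x)"
  have Y[measurable]: "Y \<in> borel_measurable lebesgue"
  proof (subst borel_measurable_euclidean_space, intro ballI)
    fix b :: "real ^ 'n::_ ^ 'n::_" assume "b \<in> Basis"
    then have "integrable lebesgue (\<lambda>x. indicator ?B x *\<^sub>R (X x \<bullet> b))"
      using X by (auto simp: phase_arrangements_def BV_def set_integrable_def)
    then show "(\<lambda>x. Y x \<bullet> b) \<in> borel_measurable lebesgue" by (simp add: Y_def)
  qed
  define E0 where "E0 j = {x \<in> ?B. X x = well f j}" for j
  have E0: "E0 j \<in> sets lebesgue" for j
  proof -
    have "E0 j = ?B \<inter> {x \<in> space lebesgue. Y x = well f j}" by (auto simp: E0_def Y_def)
    also have "\<dots> \<in> sets lebesgue"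
    proof (intro sets.Int)
      have "{x \<in> space lebesgue. Y x = well f j} = Y -` {well f j} \<inter> space lebesgue" by auto
      then show "{x \<in> space lebesgue. Y x = well f j} \<in> sets lebesgue"
        using measurable_sets[OF Y, of "{well f j}"] by simp
    qed simp
    finally show ?thesis .
  qed
  have "\<exists>B. B \<in> sets borel \<and> B \<subseteq> E0 j \<and> (AE x in lborel. x \<in> E0 j \<longrightarrow> x \<in> B)" for j
    using borel_part[OF E0[of j]] by metis
  then obtain E where E: "\<And>j. E j \<in> sets borel" "\<And>j. E j \<subseteq> E0 j" "\<And>j. AE x in lborel. x \<in> E0 j \<longrightarrow> x \<in> E j"
    by metis
  have tv: "total_variation ?B (indicator (E j)) = total_variation ?B (phase f X j)" for j
  proof (rule total_variation_cong_AE)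
    show "(\<lambda>x. (indicator ?B x :: real) * indicator (E j) x) \<in> borel_measurable lebesgue"
    proof -
      have "(\<lambda>x. indicator ?B x * indicator (E j) x) = (indicator (E j) :: _ \<Rightarrow> real)"
        using E(2)[of j] by (auto simp: fun_eq_iff E0_def indicator_def)
      moreover have "E j \<in> sets lebesgue" using E(1)[of j] by (simp add: sets_completionI_sets)
      ultimately show ?thesis using borel_measurable_indicator[of "E j" lebesgue] by simp
    qed
    have "(\<lambda>x. indicator ?B x * phase f X j x) = indicator (E0 j)"
      by (auto simp: fun_eq_iff E0_def phase_def indicator_def)
    then show "(\<lambda>x. indicator ?B x * phase f X j x) \<in> borel_measurable lebesgue"
      using E0[of j] by simp
    have "AE x in lborel. x \<in> ?B \<longrightarrow> indicator (E j) x = phase f X j x"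
      using E(3)[of j] by eventually_elim (use E(2)[of j] in \<open>auto simp: E0_def phase_def indicator_def\<close>)
    then show "AE x in lebesgue. x \<in> ?B \<longrightarrow> indicator (E j) x = phase f X j x"
      by (simp add: AE_completion_iff)
  qed
  have ae: "AE x in lborel. \<forall>j\<in>{0..m}. x \<in> ?B \<longrightarrow> X x = well f j \<longrightarrow> x \<in> E j"
  proof (subst AE_ball_countable)
    show "\<forall>j\<in>{0..m}. AE x in lborel. x \<in> ?B \<longrightarrow> X x = well f j \<longrightarrow> x \<in> E j"
    proof
      fix j
      show "AE x in lborel. x \<in> ?B \<longrightarrow> X x = well f j \<longrightarrow> x \<in> E j"
        using E(3)[of j] by eventually_elim (auto simp: E0_def)
    qed
  qed auto
  show ?thesis
    by (rule that[of E]) (use E tv ae Y in \<open>auto simp: E0_def Y_def\<close>)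
qed

lemma mean_eq_lborel: "mean k = (LINT x|lborel. indicator unit_cell x * k x)"
  unfolding cell_def by (subst integral_restrict_space) auto

text \<open>Periodicity in \<open>admissible_per\<close> holds almost everywhere and the mean is
  taken over the closed cube. The entrywise representatives are Borel and periodic at every point,
  and their mean over the half-open cell is the same because the faces are null sets.\<close>

lemma gradient_representative:
  fixes u :: "real ^ 'n \<Rightarrow> real ^ 'n"
  assumes u: "u \<in> admissible_per p F"
  obtains G where "has_weak_gradient u (weak_gradient u)"
    "\<And>i j. G i j \<in> borel_measurable borel" "\<And>i j. periodic (G i j)"
    "\<And>i j. AE x in lborel. G i j x = weak_gradient u x $ i $ j"
    "\<And>i j. locally_integrable (G i j)" "\<And>i j. integrable cell (G i j)" "\<And>i j. mean (G i j) = F $ i $ j"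
    "weak_gradient u \<in> borel_measurable lebesgue"
proof -
  define W where "W = weak_gradient u"
  have wg: "has_weak_gradient u W"
    using u someI_ex[of "has_weak_gradient u"] by (auto simp: admissible_per_def W1p_loc_def W_def weak_gradient_def)
  then have W1: "W \<in> Lp_loc 1" by (simp add: has_weak_gradient_def)
  then have Wm[measurable]: "W \<in> borel_measurable lebesgue" by (simp add: Lp_loc_def)
  have li: "locally_integrable (\<lambda>x. W x $ i $ j)" for i j using weak_gradient_components[OF wg] by simp
  have ex: "\<exists>g. g \<in> borel_measurable borel \<and> periodic g \<and> (AE x in lborel. g x = W x $ i $ j)" for i j
  proof -
    have m: "(\<lambda>x. W x $ i $ j) \<in> borel_measurable lebesgue" using li by (simp add: locally_integrable_def)
    have per: "AE x in lebesgue. W (x + axis k 1) $ i $ j = W x $ i $ j" for k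
    proof -
      have "AE x in lebesgue. W (x + axis k 1) = W x" using u by (auto simp: admissible_per_def W_def)
      then show ?thesis by eventually_elim simp
    qed
    show ?thesis by (rule AE_periodic_representative[OF m per]) (intro exI conjI)
  qed
  define G where "G i j = (SOME g. g \<in> borel_measurable borel \<and> periodic g \<and> (AE x in lborel. g x = W x $ i $ j))" for i j
  have G: "G i j \<in> borel_measurable borel" "periodic (G i j)" "AE x in lborel. G i j x = W x $ i $ j" for i j
    using someI_ex[OF ex[of i j]] unfolding G_def by blast+
  have Gm: "G i j \<in> borel_measurable lebesgue" for i j using G(1)[of i j] by (simp add: measurable_completion)
  have ae: "AE x in lebesgue. G i j x = W x $ i $ j" for i j using G(3)[of i j] by (simp add: AE_completion_iff)
  have ind: "(\<lambda>x. indicator A x * k x) \<in> borel_measurable lebesgue" if "A \<in> sets lebesgue" "k \<in> borel_measurable lebesgue"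
    for A :: "(real ^ 'n) set" and k :: "_ \<Rightarrow> real"
    using that by (intro borel_measurable_times borel_measurable_indicator)
  have lG: "locally_integrable (G i j)" for i j
    unfolding locally_integrable_def
  proof (intro conjI allI Gm)
    fix r :: real
    have "integrable lebesgue (\<lambda>y. indicator (cball 0 r) y * (W y $ i $ j))" using li by (simp add: locally_integrable_def)
    then show "integrable lebesgue (\<lambda>y. indicator (cball 0 r) y * G i j y)"
    proof (rule integrable_cong_AE_imp)
      show "AE y in lebesgue. indicator (cball 0 r) y * (W y $ i $ j) = indicator (cball 0 r) y * G i j y"
        using ae[of i j] by eventually_elim simp
    qed (intro ind Gm; simp)
  qed
  have setI: "integrable lebesgue (\<lambda>x. indicator (cbox 0 1) x *\<^sub>R W x)"
  proof (rule Bochner_Integration.integrable_bound)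
    have "set_integrable lebesgue (cbox 0 1) (\<lambda>x. norm (W x) powr 1)" using W1 by (auto simp: Lp_loc_def)
    then show "integrable lebesgue (\<lambda>x. indicator (cbox 0 1) x *\<^sub>R norm (W x))" by (simp add: set_integrable_def)
    show "(\<lambda>x. indicator (cbox 0 1) x *\<^sub>R W x) \<in> borel_measurable lebesgue"
      by (intro borel_measurable_scaleR borel_measurable_indicator Wm) auto
  qed auto
  have cbox_cell: "AE x in lebesgue. (indicator (cbox 0 1) x :: real) = indicator unit_cell (x :: real ^ 'n)"
  proof -
    have n: "cbox 0 1 - box 0 (1 :: real ^ 'n) \<in> null_sets lborel"
      using negligible_frontier_interval[of 0 "1 :: real ^ 'n"]
      by (simp add: negligible_iff_null_sets null_sets_completion_iff)
    have "AE x in lborel. x \<in> cbox 0 (1 :: real ^ 'n) \<longleftrightarrow> x \<in> box 0 1"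
      by (rule AE_I'[OF n]) (use box_subset_cbox[of 0 "1 :: real ^ 'n"] in auto)
    then have "AE x in lborel. (indicator (cbox 0 1) x :: real) = indicator unit_cell (x :: real ^ 'n)"
      using AE_box_unit_cell by eventually_elim (auto simp: indicator_def)
    then show ?thesis by (simp add: AE_completion_iff)
  qed
  have comp: "bounded_linear (\<lambda>A :: real ^ 'n ^ 'n. A $ i $ j)" for i j
    by (rule bounded_linear_compose[OF bounded_linear_vec_nth bounded_linear_vec_nth])
  have int0: "integrable lebesgue (\<lambda>x. indicator (cbox 0 1) x * (W x $ i $ j))" for i j
    using integrable_bounded_linear[OF comp setI, of i j] by simp
  have aeG: "AE x in lebesgue. indicator (cbox 0 1) x * (W x $ i $ j) = indicator unit_cell x * G i j x" for i j
    using cbox_cell ae[of i j] by eventually_elim simp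
  have uc: "unit_cell \<in> sets lebesgue" using unit_cell_measurable by simp
  have mG: "(\<lambda>x. indicator unit_cell x * G i j x) \<in> borel_measurable borel" for i j
    by (intro borel_measurable_times borel_measurable_indicator G(1)) simp
  have intG: "integrable lborel (\<lambda>x. indicator unit_cell x * G i j x)" for i j
  proof -
    have "integrable lebesgue (\<lambda>x. indicator unit_cell x * G i j x)"
      by (rule integrable_cong_AE_imp[OF int0[of i j] ind[OF uc Gm]]) (use aeG[of i j] in eventually_elim, simp)
    then show ?thesis using mG[of i j] by (subst (asm) integrable_completion) auto
  qed
  have "integrable cell (G i j)" for i j
    unfolding cell_def by (subst integrable_restrict_space) (use intG[of i j] in auto)
  moreover have "mean (G i j) = F $ i $ j" for i j
  proof -
    have "F $ i $ j = (LINT x|lebesgue. indicator (cbox 0 1) x *\<^sub>R W x) $ i $ j"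
      using u by (auto simp: admissible_per_def W_def set_lebesgue_integral_def)
    also have "\<dots> = (LINT x|lebesgue. indicator (cbox 0 1) x * (W x $ i $ j))"
      using integral_bounded_linear[OF comp setI, of i j] by simp
    also have "\<dots> = (LINT x|lebesgue. indicator unit_cell x * G i j x)"
      by (rule integral_cong_AE[OF _ ind[OF uc Gm] aeG]) (use int0 in simp)
    also have "\<dots> = (LINT x|lborel. indicator unit_cell x * G i j x)"
      by (rule integral_completion) (use mG in simp)
    finally show ?thesis by (simp add: mean_eq_lborel)
  qed
  ultimately show ?thesis
    by (intro that[of G]) (use wg G lG Wm in \<open>auto simp: W_def\<close>)
qed

lemma nn_integral_cell_square_le:
  fixes k g :: "real ^ 'n \<Rightarrow> real"
  assumes k[measurable]: "k \<in> borel_measurable borel" and g[measurable]: "g \<in> borel_measurable lebesgue"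
    and le: "AE x in lborel. x \<in> box 0 1 \<longrightarrow> \<bar>k x\<bar> \<le> c * g x"
    and e: "(\<integral>\<^sup>+ x. ennreal ((g x)\<^sup>2) \<partial>lebesgue) \<le> ennreal (e\<^sup>2)"
  shows "(\<integral>\<^sup>+ x. ennreal ((k x)\<^sup>2) \<partial>cell) \<le> ennreal ((c * e)\<^sup>2)"
proof -
  have "(\<integral>\<^sup>+ x. ennreal ((k x)\<^sup>2) \<partial>cell) = (\<integral>\<^sup>+ x. ennreal ((k x)\<^sup>2) * indicator unit_cell x \<partial>lborel)"
    unfolding cell_def by (subst nn_integral_restrict_space) auto
  also have "\<dots> = (\<integral>\<^sup>+ x. ennreal ((k x)\<^sup>2) * indicator unit_cell x \<partial>lebesgue)"
    by (rule nn_integral_completion[symmetric])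
  also have "\<dots> \<le> (\<integral>\<^sup>+ x. ennreal (c\<^sup>2) * ennreal ((g x)\<^sup>2) \<partial>lebesgue)"
  proof (rule nn_integral_mono_AE)
    have "AE x in lborel. ennreal ((k x)\<^sup>2) * indicator unit_cell x \<le> ennreal (c\<^sup>2) * ennreal ((g x)\<^sup>2)"
      using le AE_box_unit_cell
    proof eventually_elim
      case (elim x)
      show ?case
      proof (cases "x \<in> box 0 1")
        case True
        then have "(k x)\<^sup>2 \<le> (c * g x)\<^sup>2" using elim abs_ge_self[of "c * g x"] by (auto simp flip: abs_le_square_iff)
        then have "ennreal ((k x)\<^sup>2) \<le> ennreal (c\<^sup>2 * (g x)\<^sup>2)" by (intro ennreal_leI) (simp add: power_mult_distrib)
        then show ?thesis using True elim by (simp add: ennreal_mult indicator_def)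
      qed (use elim in simp)
    qed
    then show "AE x in lebesgue. ennreal ((k x)\<^sup>2) * indicator unit_cell x \<le> ennreal (c\<^sup>2) * ennreal ((g x)\<^sup>2)"
      by (rule AE_completion)
  qed
  also have "\<dots> = ennreal (c\<^sup>2) * (\<integral>\<^sup>+ x. ennreal ((g x)\<^sup>2) \<partial>lebesgue)"
    by (rule nn_integral_cmult) measurable
  also have "\<dots> \<le> ennreal (c\<^sup>2) * ennreal (e\<^sup>2)" by (intro mult_left_mono e) simp
  also have "\<dots> = ennreal ((c * e)\<^sup>2)" by (simp add: ennreal_mult[symmetric] power_mult_distrib)
  finally show ?thesis .
qed

lemma nn_integral_box_square_le:
  fixes D :: "real ^ 'n \<Rightarrow> 'b::euclidean_space"
  assumes p: "2 \<le> p" and e: "0 < e" and D: "(\<lambda>x. indicator (box 0 1) x *\<^sub>R D x) \<in> borel_measurable lebesgue"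
    and le: "(\<integral>\<^sup>+ x\<in>box 0 1. ennreal (norm (D x) powr p) \<partial>lebesgue) \<le> ennreal (e powr p)"
  shows "(\<integral>\<^sup>+ x. ennreal ((norm (indicator (box 0 1) x *\<^sub>R D x))\<^sup>2) \<partial>lebesgue) \<le> ennreal (e\<^sup>2)"
proof -
  let ?B = "box 0 1 :: (real ^ 'n) set"
  define M where "M = restrict_space lebesgue ?B"
  let ?g = "\<lambda>x. norm (indicator ?B x *\<^sub>R D x)"
  have g: "?g \<in> borel_measurable lebesgue" by (rule measurable_compose[OF D borel_measurable_norm])
  have B: "?B \<inter> space lebesgue \<in> sets lebesgue" by simp
  have "(\<integral>\<^sup>+ x. ennreal ((?g x)\<^sup>2) \<partial>M) \<le> ennreal (e\<^sup>2)"
  proof (rule nn_integral_square_le[OF p e])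
    show "?g \<in> borel_measurable M" unfolding M_def by (rule measurable_restrict_space1[OF g])
    show "emeasure M (space M) = 1"
      unfolding M_def by (subst emeasure_restrict_space) (auto simp: emeasure_box_01 space_restrict_space)
    have "(\<integral>\<^sup>+ x. ennreal (?g x powr p) \<partial>M) = (\<integral>\<^sup>+ x. ennreal (?g x powr p) * indicator ?B x \<partial>lebesgue)"
      unfolding M_def by (rule nn_integral_restrict_space[OF B])
    also have "\<dots> = (\<integral>\<^sup>+ x\<in>?B. ennreal (norm (D x) powr p) \<partial>lebesgue)"
      by (intro nn_integral_cong) (auto simp: indicator_def)
    finally show "(\<integral>\<^sup>+ x. ennreal (?g x powr p) \<partial>M) \<le> ennreal (e powr p)" using le by simp
  qed simp
  moreover have "(\<integral>\<^sup>+ x. ennreal ((?g x)\<^sup>2) \<partial>M) = (\<integral>\<^sup>+ x. ennreal ((?g x)\<^sup>2) \<partial>lebesgue)"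
  proof -
    have "(\<integral>\<^sup>+ x. ennreal ((?g x)\<^sup>2) \<partial>M) = (\<integral>\<^sup>+ x. ennreal ((?g x)\<^sup>2) * indicator ?B x \<partial>lebesgue)"
      unfolding M_def by (rule nn_integral_restrict_space[OF B])
    also have "\<dots> = (\<integral>\<^sup>+ x. ennreal ((?g x)\<^sup>2) \<partial>lebesgue)"
      by (intro nn_integral_cong) (auto simp: indicator_def)
    finally show ?thesis .
  qed
  ultimately show ?thesis by simp
qed

lemma bper_sum: "(\<And>j. j \<in> A \<Longrightarrow> bper (g j)) \<Longrightarrow> bper (\<lambda>x. \<Sum>j\<in>A. g j x)"
  by (induction A rule: infinite_finite_induct) (auto intro: bper_add)

lemma l2_sum_le: "(\<And>j. j \<in> A \<Longrightarrow> bper (g j)) \<Longrightarrow> l2 (\<lambda>x. \<Sum>j\<in>A. g j x) \<le> (\<Sum>j\<in>A. l2 (g j))"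
proof (induction A rule: infinite_finite_induct)
  case (insert a A)
  have "l2 (\<lambda>x. g a x + (\<Sum>j\<in>A. g j x)) \<le> l2 (g a) + l2 (\<lambda>x. \<Sum>j\<in>A. g j x)"
    using insert.prems by (intro l2_add_le bper_sum) auto
  also have "l2 (\<lambda>x. \<Sum>j\<in>A. g j x) \<le> (\<Sum>j\<in>A. l2 (g j))" using insert by auto
  finally show ?case using insert.hyps by simp
qed (auto simp: l2_def)

lemma locally_integrable_add:
  assumes "locally_integrable g" "locally_integrable k"
  shows "locally_integrable (\<lambda>x. g x + k x)"
  using assms unfolding locally_integrable_def by (auto simp: distrib_left)

lemma mconv_add:
  "locally_integrable g \<Longrightarrow> locally_integrable k \<Longrightarrow> 0 < \<kappa> \<Longrightarrow>
    mconv \<kappa> (\<lambda>x. g x + k x) x = mconv \<kappa> g x + mconv \<kappa> k x"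
  unfolding mconv_def distrib_left by (intro Bochner_Integration.integral_add mconv_integrable)

lemma mconv_cong_AE:
  assumes g: "locally_integrable g" and k: "locally_integrable k" and "0 < \<kappa>"
    and eq: "AE x in lborel. g x = k x"
  shows "mconv \<kappa> g x = mconv \<kappa> k x"
  unfolding mconv_def
proof (rule integral_cong_AE)
  have "AE y in lborel. moll \<kappa> (y - x) * g y = moll \<kappa> (y - x) * k y"
    using eq by eventually_elim simp
  then show "AE y in lebesgue. moll \<kappa> (y - x) * g y = moll \<kappa> (y - x) * k y" by (rule AE_completion)
qed (use mconv_integrable[OF g \<open>0 < \<kappa>\<close>] mconv_integrable[OF k \<open>0 < \<kappa>\<close>] in auto)

lemma mean_per_ind:
  assumes E: "E \<in> sets borel" "E \<subseteq> box 0 1"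
  shows "mean (per_ind E) = measure lborel E"
proof -
  have "mean (per_ind E) = mean (indicator E)"
    by (intro Bochner_Integration.integral_cong) (auto simp: per_ind_def space_cell frac_vec_eq)
  also have "\<dots> = measure lborel E"
    unfolding mean_indicator[OF E(1)] measure_unit_cell_Int[OF E(1)] using E(2) by (simp add: Int_absorb2)
  finally show ?thesis .
qed

text \<open>
  \<open>E j\<close> is the region of the phase \<open>A\<^sub>j\<close>, \<open>G\<close> a Borel representative of the gradient, and \<open>g\<close> the
  modulus of the elastic strain. By the choice of the mollification scale \<open>\<kappa>\<close>, mollifying the
  phases costs no more than the elastic energy.
\<close>
locale low_energy = well_coordinates m f ca cb
  for m f and ca cb :: "nat \<Rightarrow> 'n::{finite,linorder}" +
  fixes l :: nat and t e S \<kappa> :: real and E :: "nat \<Rightarrow> (real ^ 'n::_) set" and u :: "real ^ 'n::_ \<Rightarrow> real ^ 'n::_"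
    and W :: "real ^ 'n::_ \<Rightarrow> real ^ 'n::_ ^ 'n::_" and G :: "'n \<Rightarrow> 'n \<Rightarrow> real ^ 'n::_ \<Rightarrow> real"
    and g :: "real ^ 'n::_ \<Rightarrow> real"
  assumes l: "1 \<le> l" "l \<le> m" and t: "0 < t" "t < 1" and e: "0 < e" "e \<le> 1/2" and S: "0 \<le> S"
    and \<kappa>: "0 < \<kappa>" "\<kappa> * (S + real CARD('n)) \<le> (e / real m)\<^sup>2"
    and E: "\<And>j. E j \<in> sets borel" "\<And>j. E j \<subseteq> box 0 1"
    and E_disjoint: "\<And>i j x. i \<in> {1..m} \<Longrightarrow> j \<in> {1..m} \<Longrightarrow> x \<in> E i \<Longrightarrow> x \<in> E j \<Longrightarrow> i = j"
    and TV: "\<And>j. j \<in> {1..m} \<Longrightarrow> total_variation (box 0 1) (indicator (E j)) \<le> ennreal S"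
    and W: "has_weak_gradient u W"
    and G: "\<And>i j. G i j \<in> borel_measurable borel" "\<And>i j. periodic (G i j)"
      "\<And>i j. AE x in lborel. G i j x = W x $ i $ j" "\<And>i j. locally_integrable (G i j)"
      "\<And>i j. integrable cell (G i j)" "\<And>i j. mean (G i j) = comb (profile l t) $ i $ j"
    and g: "g \<in> borel_measurable lebesgue" "(\<integral>\<^sup>+ x. ennreal ((g x)\<^sup>2) \<partial>lebesgue) \<le> ennreal (e\<^sup>2)"
    and off: "\<And>a b. a \<noteq> b \<Longrightarrow> AE x in lborel. x \<in> box 0 1 \<longrightarrow> \<bar>G a b x + G b a x\<bar> \<le> 2 * g x"
    and dia: "\<And>a. 1 \<le> blk a \<Longrightarrow> AE x in lborel. x \<in> box 0 1 \<longrightarrow>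
      \<bar>G a a x - sg a * (\<Sum>j = 1..m. profile j 1 (blk a) * indicator (E j) x)\<bar> \<le> 1 * g x"
begin

text \<open>The coefficient of the \<open>i\<close>-th step matrix in the well with index
  \<open>j\<close> is \<open>profile j 1 i\<close>; the well with index 0 contributes
  nothing.\<close>

definition h :: "nat \<Rightarrow> real ^ 'n::_ \<Rightarrow> real"
  where "h i x = (\<Sum>j = 1..m. profile j 1 i * per_ind (E j) x)"

text \<open>The mean gradient is diagonal, so only the coordinate \<open>x $ a\<close> appears in
  the linear part of component \<open>a\<close>.\<close>

definition w :: "'n \<Rightarrow> real ^ 'n::_ \<Rightarrow> real"
  where "w a x = mconv \<kappa> (\<lambda>x. u x $ a) x - comb (profile l t) $ a $ a * x $ a"

definition dw :: "'n \<Rightarrow> 'n \<Rightarrow> real ^ 'n::_ \<Rightarrow> real"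
  where "dw a b x = mconv \<kappa> (G a b) x - comb (profile l t) $ a $ b"

text \<open>A point outside all the sets counts as phase 0. This includes the null set lost in the
  passage to Borel sets, so that the relations between the coefficients hold at every point.\<close>

lemma h_cases:
  obtains "\<And>j. j \<in> {1..m} \<Longrightarrow> per_ind (E j) x = 0" "\<And>i. h i x = 0"
  | j where "j \<in> {1..m}" "\<And>k. k \<in> {1..m} \<Longrightarrow> per_ind (E k) x = of_bool (k = j)" "\<And>i. h i x = profile j 1 i"
proof (cases "\<exists>j\<in>{1..m}. frac_vec x \<in> E j")
  case True
  then obtain j where j: "j \<in> {1..m}" "frac_vec x \<in> E j" by auto
  have ind: "per_ind (E k) x = of_bool (k = j)" if "k \<in> {1..m}" for k
    using E_disjoint[OF that j(1)] j by (auto simp: per_ind_def indicator_def)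
  have "h i x = profile j 1 i" for i
  proof -
    have "h i x = (\<Sum>k = 1..m. if k = j then profile k 1 i else 0)"
      unfolding h_def by (intro sum.cong) (auto simp: ind)
    then show ?thesis using j by simp
  qed
  then show ?thesis using that(2) j ind by blast
next
  case False
  then have ind: "per_ind (E k) x = 0" if "k \<in> {1..m}" for k
    using that by (auto simp: per_ind_def indicator_def)
  then have "h i x = 0" for i unfolding h_def by simp
  then show ?thesis using that(1) ind by blast
qed

lemma h_val: "h i x \<in> {0, 1/2, 1}"
  by (rule h_cases[of x]) (auto simp: profile_def)

lemma h_chain: "1 \<le> i \<Longrightarrow> h i x = 1/2 \<longleftrightarrow> h (Suc i) x \<noteq> 0"
  by (rule h_cases[of x]) (auto simp: profile_def)

lemma h_large: "m < i \<Longrightarrow> h i x = 0"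
  by (rule h_cases[of x]) (auto simp: profile_def)

lemma bper_h: "bper (h i)"
  unfolding h_def[abs_def] by (intro bper_sum bper_cmult bper_per_ind E)

lemma \<theta>_eq: "of_bool (h 1 x \<noteq> 0) = (\<Sum>j = 1..m. per_ind (E j) x)"
proof (rule h_cases[of x])
  fix j assume j: "j \<in> {1..m}" "\<And>k. k \<in> {1..m} \<Longrightarrow> per_ind (E k) x = of_bool (k = j)" "\<And>i. h i x = profile j 1 i"
  then have "(\<Sum>k = 1..m. per_ind (E k) x) = (\<Sum>k = 1..m. if k = j then 1 else 0)"
    by (intro sum.cong) auto
  then show ?thesis using j by (simp add: profile_def)
qed simp

text \<open>The increments have only the values -1, 0 and 1, so their squares are absolute values,
  and the bound is linear in \<open>s\<close>.\<close>

lemma base: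
  assumes "0 \<le> s"
  shows "(l2 (tdiff (s *\<^sub>R axis z 1) (\<lambda>x. of_bool (h 1 x \<noteq> 0))))\<^sup>2 \<le> real m * (S + real CARD('n)) * s"
proof -
  let ?v = "s *\<^sub>R axis z 1 :: real ^ 'n::_"
  let ?\<theta> = "\<lambda>x. of_bool (h 1 x \<noteq> 0) :: real"
  have b: "bper ?\<theta>" unfolding \<theta>_eq by (intro bper_sum bper_per_ind E)
  have "(l2 (tdiff ?v ?\<theta>))\<^sup>2 \<le> mean (\<lambda>x. \<Sum>j = 1..m. \<bar>tdiff ?v (per_ind (E j)) x\<bar>)"
    unfolding l2_power2
  proof (rule mean_mono)
    fix x
    have td: "tdiff ?v ?\<theta> x = (\<Sum>j = 1..m. tdiff ?v (per_ind (E j)) x)"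
      unfolding tdiff_def \<theta>_eq by (simp add: sum_subtractf)
    have "(tdiff ?v ?\<theta> x)\<^sup>2 = \<bar>tdiff ?v ?\<theta> x\<bar>" by (simp add: tdiff_def of_bool_def)
    also have "\<dots> = \<bar>\<Sum>j = 1..m. tdiff ?v (per_ind (E j)) x\<bar>" unfolding td ..
    also have "\<dots> \<le> (\<Sum>j = 1..m. \<bar>tdiff ?v (per_ind (E j)) x\<bar>)" by (rule sum_abs)
    finally show "(tdiff ?v ?\<theta> x)\<^sup>2 \<le> (\<Sum>j = 1..m. \<bar>tdiff ?v (per_ind (E j)) x\<bar>)" .
  qed (intro bper_power2 bper_tdiff b bper_sum bper_abs bper_per_ind E)+
  also have "\<dots> = (\<Sum>j = 1..m. mean (\<lambda>x. \<bar>tdiff ?v (per_ind (E j)) x\<bar>))"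
    by (intro Bochner_Integration.integral_sum bper_integrable bper_abs bper_tdiff bper_per_ind E)
  also have "\<dots> \<le> (\<Sum>j = 1..m. norm ?v * (S + real CARD('n)))"
    by (intro sum_mono mean_tdiff_per_ind E S TV)
  also have "\<dots> = real m * (S + real CARD('n)) * s" using assms by (simp add: norm_axis_1)
  finally show ?thesis .
qed

text \<open>Enlarging the complement of the union to the complement of each single phase reduces the
  claim to the isoperimetric inequality for every phase separately.\<close>

lemma volume_fraction:
  "mean (\<lambda>x. of_bool (h 1 x \<noteq> 0)) * (1 - mean (\<lambda>x. of_bool (h 1 x \<noteq> 0)))
    \<le> real m * (2 ^ CARD('n) * real CARD('n) * S)"
proof -
  define \<mu> where "\<mu> j = measure lborel (E j)" for j
  have \<mu>0: "0 \<le> \<mu> j" for j by (simp add: \<mu>_def)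
  have "mean (\<lambda>x. of_bool (h 1 x \<noteq> 0)) = (\<Sum>j = 1..m. mean (per_ind (E j)))"
    unfolding \<theta>_eq by (intro Bochner_Integration.integral_sum bper_integrable bper_per_ind E)
  also have "\<dots> = (\<Sum>j = 1..m. \<mu> j)" by (intro sum.cong refl) (simp add: mean_per_ind E \<mu>_def)
  finally have m: "mean (\<lambda>x. of_bool (h 1 x \<noteq> 0)) = (\<Sum>j = 1..m. \<mu> j)" .
  have "(\<Sum>j = 1..m. \<mu> j) * (1 - (\<Sum>k = 1..m. \<mu> k)) = (\<Sum>j = 1..m. \<mu> j * (1 - (\<Sum>k = 1..m. \<mu> k)))"
    by (rule sum_distrib_right)
  also have "\<dots> \<le> (\<Sum>j = 1..m. \<mu> j * (1 - \<mu> j))"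
    using \<mu>0 by (intro sum_mono mult_left_mono) (auto intro!: member_le_sum)
  also have "\<dots> \<le> (\<Sum>j = 1..m. 2 ^ CARD('n) * real CARD('n) * S)"
    unfolding \<mu>_def by (intro sum_mono isoperimetric_unit_cube E S TV)
  finally show ?thesis unfolding m by simp
qed

lemma mconv_G: "mconv \<kappa> (G a b) = mconv \<kappa> (\<lambda>x. W x $ a $ b)"
  by (rule ext, rule mconv_cong_AE) (use G weak_gradient_components[OF W] \<kappa> in auto)

lemma cper_dw: "cper (dw a b)"
  unfolding dw_def[abs_def] by (intro cper_diff cper_mconv cper_const G \<kappa>)

lemma mean_dw: "mean (dw a b) = 0"
proof -
  have "mean (dw a b) = mean (mconv \<kappa> (G a b)) - mean (\<lambda>x :: real ^ 'n::_. comb (profile l t) $ a $ b)"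
    unfolding dw_def[abs_def] by (rule mean_diff) (intro cper_imp_bper cper_mconv cper_const G \<kappa>)+
  then show ?thesis by (simp only: mean_const mean_mconv[OF G(1,2) \<kappa>(1) G(5)] G(6) diff_self)
qed

lemma derivative_w: "((\<lambda>s. w a (x + s *\<^sub>R axis b 1)) has_real_derivative dw a b x) (at 0)"
proof -
  have "((\<lambda>s. mconv \<kappa> (\<lambda>x. u x $ a) (x + s *\<^sub>R axis b 1)) has_real_derivative mconv \<kappa> (G a b) x) (at 0)"
    unfolding mconv_G by (rule mconv_weak_partial[OF W \<kappa>(1)])
  moreover have "((\<lambda>s. comb (profile l t) $ a $ a * (x + s *\<^sub>R axis b 1) $ a)
      has_real_derivative comb (profile l t) $ a $ b) (at 0)"
    by (auto simp: comb_nth axis_def intro!: derivative_eq_intros)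
  ultimately show ?thesis unfolding w_def dw_def by (rule DERIV_diff)
qed

lemma w_shift_const: "w a (x + v) - w a x = mconv \<kappa> (\<lambda>x. u x $ a) (x + v) - mconv \<kappa> (\<lambda>x. u x $ a) x
    - comb (profile l t) $ a $ a * v $ a"
  by (simp add: w_def algebra_simps)

text \<open>The mollified gradient is periodic, so the change of the displacement over one period
  does not depend on the point. Averaged over the cell it is the mean of \<open>dw a b\<close>,
  which is 0 once the linear part has been subtracted.\<close>

lemma periodic_w: "periodic (w a)"
proof -
  have "w a (x + axis b 1) = w a x" for x b
  proof -
    let ?v = "axis b 1 :: real ^ 'n::_"
    let ?U = "mconv \<kappa> (\<lambda>x. u x $ a)"
    have li: "locally_integrable (\<lambda>x. u x $ a)" by (rule weak_gradient_components[OF W])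
    have gc: "gconv \<kappa> j (\<lambda>x. u x $ a) (y + ?v) = gconv \<kappa> j (\<lambda>x. u x $ a) y" for j y
      using periodic_mconv[OF G(1,2), of \<kappa> a j]
      unfolding gconv_weak_gradient[OF W \<kappa>(1)] mconv_G periodic_def by blast
    have "((\<lambda>y. ?U (y + ?v) - ?U y) has_derivative (\<lambda>h. 0)) (at y)" for y
    proof -
      have "((\<lambda>y. y + ?v) has_derivative (\<lambda>h. h)) (at y)" by (auto intro!: derivative_eq_intros)
      then have "((\<lambda>y. ?U (y + ?v)) has_derivative (\<lambda>h. \<Sum>j\<in>UNIV. gconv \<kappa> j (\<lambda>x. u x $ a) (y + ?v) * h $ j)) (at y)"
        by (rule has_derivative_compose[OF _ mconv_has_derivative[OF li \<kappa>(1)]])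
      from has_derivative_diff[OF this mconv_has_derivative[OF li \<kappa>(1), of y]]
      show ?thesis by (simp add: gc)
    qed
    then obtain c where c: "\<And>y. ?U (y + ?v) - ?U y = c"
      using has_derivative_zero_constant[of UNIV "\<lambda>y. ?U (y + ?v) - ?U y"] by auto
    have "lint b 1 (dw a b) = tdiff (1 *\<^sub>R ?v) (w a)"
      by (rule lint_derivative[OF derivative_w]) simp
    then have eq: "lint b 1 (dw a b) = (\<lambda>y. c - comb (profile l t) $ a $ a * ?v $ a)"
      by (simp add: tdiff_def[abs_def] w_shift_const c)
    have "mean (lint b 1 (dw a b)) = 0" by (simp add: mean_lint cper_dw mean_dw)
    then have "c - comb (profile l t) $ a $ a * ?v $ a = 0" unfolding eq by (simp only: mean_const)
    then show ?thesis using w_shift_const[of a x ?v] c[of x] by simp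
  qed
  then show ?thesis by (simp add: periodic_def)
qed

lemma partial: "has_partial b (w a) (dw a b)"
proof -
  have "continuous_on UNIV (w a)"
    unfolding w_def[abs_def]
    by (intro continuous_on_diff continuous_mconv weak_gradient_components[OF W] \<kappa> continuous_intros)
  then show ?thesis
    unfolding has_partial_def using periodic_w cper_dw derivative_w by (auto simp: cper_def)
qed

lemma shear:
  assumes "a \<noteq> b"
  shows "l2 (\<lambda>x. dw a b x + dw b a x) \<le> 2 * (2 * e)"
proof -
  have "(\<lambda>x. dw a b x + dw b a x) = mconv \<kappa> (\<lambda>x. G a b x + G b a x)"
    using assms by (simp add: fun_eq_iff dw_def comb_nth mconv_add G \<kappa>)
  moreover have "l2 (mconv \<kappa> (\<lambda>x. G a b x + G b a x)) \<le> 2 * e"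
  proof (rule l2_mconv_le)
    show m: "(\<lambda>x. G a b x + G b a x) \<in> borel_measurable borel" by (intro borel_measurable_add G)
    show "periodic (\<lambda>x. G a b x + G b a x)" using G(2) by (simp add: periodic_def)
    show "(\<integral>\<^sup>+ x. ennreal ((G a b x + G b a x)\<^sup>2) \<partial>cell) \<le> ennreal ((2 * e)\<^sup>2)"
      by (rule nn_integral_cell_square_le[OF m g(1) off[OF assms] g(2)])
  qed (use G e \<kappa> in \<open>auto intro: locally_integrable_add\<close>)
  ultimately show ?thesis using e by simp
qed

text \<open>One \<open>e\<close> is the mollified elastic strain, the other the mollification error
  of the phases, which \<kappa> limits to \<open>e / m\<close> for each of the \<open>m\<close>
  phases. Hence \<eta> is \<open>2 * e\<close>.\<close>

lemma diag:
  assumes a: "1 \<le> blk a"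
  shows "l2 (\<lambda>x. dw a a x - sg a * (h (blk a) x - profile l t (blk a))) \<le> 2 * e"
proof -
  define \<rho> where "\<rho> x = sg a * h (blk a) x" for x
  have \<rho>: "bper \<rho>" unfolding \<rho>_def[abs_def] by (intro bper_cmult bper_h)
  have n: "bper (\<lambda>x. - \<rho> x)" by (rule bper_minus[OF \<rho>])
  have li: "locally_integrable (\<lambda>x. G a a x + - \<rho> x)"
    by (intro locally_integrable_add G bper_locally_integrable n)
  have m: "(\<lambda>x. G a a x + - \<rho> x) \<in> borel_measurable borel"
    using \<rho> G(1) by (intro borel_measurable_add) (auto simp: bper_def)
  have per: "periodic (\<lambda>x. G a a x + - \<rho> x)" using G(2) \<rho> by (simp add: periodic_def bper_def)
  have eq: "dw a a x - sg a * (h (blk a) x - profile l t (blk a))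
      = mconv \<kappa> (\<lambda>x. G a a x + - \<rho> x) x + (mconv \<kappa> \<rho> x - \<rho> x)" for x
  proof -
    have "mconv \<kappa> (G a a) x = mconv \<kappa> (\<lambda>x. (G a a x + - \<rho> x) + \<rho> x) x" by simp
    also have "\<dots> = mconv \<kappa> (\<lambda>x. G a a x + - \<rho> x) x + mconv \<kappa> \<rho> x"
      by (rule mconv_add[OF li bper_locally_integrable[OF \<rho>] \<kappa>(1)])
    finally show ?thesis using a by (simp add: dw_def comb_nth \<rho>_def algebra_simps)
  qed
  have 1: "l2 (mconv \<kappa> (\<lambda>x. G a a x + - \<rho> x)) \<le> e"
  proof (rule l2_mconv_le[OF m per li \<kappa>(1)])
    have "AE x in lborel. x \<in> box 0 1 \<longrightarrow> \<bar>G a a x + - \<rho> x\<bar> \<le> 1 * g x"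
      using dia[OF a]
    proof eventually_elim
      case (elim x)
      show ?case
      proof
        assume x: "x \<in> box 0 1"
        then have "frac_vec x = x" by (intro frac_vec_eq) (auto simp: unit_cell_def mem_box_cart less_imp_le)
        then show "\<bar>G a a x + - \<rho> x\<bar> \<le> 1 * g x" using elim x by (simp add: \<rho>_def h_def per_ind_def)
      qed
    qed
    from nn_integral_cell_square_le[OF m g(1) this g(2)]
    show "(\<integral>\<^sup>+ x. ennreal ((G a a x + - \<rho> x)\<^sup>2) \<partial>cell) \<le> ennreal (e\<^sup>2)" by simp
  qed (use e in simp)
  have 2: "l2 (\<lambda>x. mconv \<kappa> \<rho> x - \<rho> x) \<le> e"
  proof (rule l2_mconv_diff_le[OF \<rho> \<kappa>(1)])
    fix y :: "real ^ 'n::_" assume y: "norm y \<le> \<kappa>"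
    have td: "tdiff y \<rho> = (\<lambda>x. \<Sum>j = 1..m. (sg a * profile j 1 (blk a)) * tdiff y (per_ind (E j)) x)"
      by (simp add: fun_eq_iff tdiff_def \<rho>_def h_def sum_distrib_left sum_subtractf[symmetric] right_diff_distrib mult.assoc)
    have "l2 (tdiff y \<rho>) \<le> (\<Sum>j = 1..m. l2 (\<lambda>x. (sg a * profile j 1 (blk a)) * tdiff y (per_ind (E j)) x))"
      unfolding td by (intro l2_sum_le bper_cmult bper_tdiff bper_per_ind E)
    also have "\<dots> \<le> (\<Sum>j = 1..m. e / real m)"
    proof (rule sum_mono)
      fix j assume j: "j \<in> {1..m}"
      have "l2 (\<lambda>x. (sg a * profile j 1 (blk a)) * tdiff y (per_ind (E j)) x)
          = \<bar>sg a * profile j 1 (blk a)\<bar> * l2 (tdiff y (per_ind (E j)))" by (rule l2_cmult)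
      also have "\<dots> \<le> 1 * l2 (tdiff y (per_ind (E j)))"
        by (intro mult_right_mono) (auto simp: abs_mult abs_sg profile_def)
      also have "\<dots> \<le> 1 * sqrt (norm y * (S + real CARD('n)))"
        by (intro mult_left_mono l2_tdiff_per_ind E S TV j) simp
      also have "\<dots> \<le> sqrt (\<kappa> * (S + real CARD('n)))"
        using y S by (auto intro!: mult_right_mono)
      also have "\<dots> \<le> sqrt ((e / real m)\<^sup>2)" by (rule real_sqrt_le_mono[OF \<kappa>(2)])
      also have "\<dots> = e / real m" using e by simp
      finally show "l2 (\<lambda>x. (sg a * profile j 1 (blk a)) * tdiff y (per_ind (E j)) x) \<le> e / real m" .
    qed
    also have "\<dots> = e" using l by simp
    finally show "l2 (tdiff y \<rho>) \<le> e" .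
  qed (use e in simp)
  have "l2 (\<lambda>x. mconv \<kappa> (\<lambda>x. G a a x + - \<rho> x) x + (mconv \<kappa> \<rho> x - \<rho> x)) \<le> e + e"
  proof (rule order_trans[OF l2_add_le add_mono[OF 1 2]])
    show "bper (mconv \<kappa> (\<lambda>x. G a a x + - \<rho> x))" by (intro cper_imp_bper cper_mconv m per li \<kappa>)
    have "bper (mconv \<kappa> \<rho>)"
      using \<rho> bper_locally_integrable[OF \<rho>] \<kappa> by (intro cper_imp_bper cper_mconv) (auto simp: bper_def)
    then show "bper (\<lambda>x. mconv \<kappa> \<rho> x - \<rho> x)" by (intro bper_diff \<rho>)
  qed
  then show ?thesis unfolding eq by simp
qed

lemma laminate_approx: "laminate_approx m l f ca cb blk sg t (2 * e) (real m * (S + real CARD('n))) h w dw"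
proof
  show "0 < real m * (S + real CARD('n))" using l S by (intro mult_pos_pos add_nonneg_pos) auto
  show "l2 (\<lambda>x. dw a a x - sg a * (h (blk a) x - (if blk a < l then 1/2 else if blk a = l then t else 0))) \<le> 2 * e"
    if "1 \<le> blk a" for a
    using diag[OF that] by (simp add: profile_def)
  show "(l2 (tdiff (s *\<^sub>R axis z 1) (\<lambda>x. of_bool (h 1 x \<noteq> 0))))\<^sup>2 \<le> real m * (S + real CARD('n)) * s"
    if "0 \<le> s" for z s
    by (rule base[OF that])
qed (use l t e f12 blk_le abs_sg blk_ca blk_cb bper_h h_val h_chain h_large partial shear in auto)

end

section \<open>The lower bound\<close>

lemma abs_matrix_nth_le: "\<bar>A $ a $ b\<bar> \<le> norm (A :: real ^ 'n ^ 'm)"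
  by (rule order_trans[OF component_le_norm_cart Finite_Cartesian_Product.norm_nth_le])

section \<open>Volume fractions in the case l = 1\<close>

context laminate_approx
begin

text \<open>The indicator lies between \<open>h 1\<close> and \<open>h 1 + h 2\<close>, since
  \<open>h 2\<close> is at least 1/2 where \<open>h 1\<close> is 1/2; the prescribed means are
  \<open>t\<close> and 0.\<close>

lemma mean_first_indicator:
  assumes "l = 1"
  shows "t - \<eta> \<le> mean (\<lambda>x. of_bool (h 1 x \<noteq> 0))" and "mean (\<lambda>x. of_bool (h 1 x \<noteq> 0)) \<le> t + 2 * \<eta>"
proof -
  have b: "bper (\<lambda>x. of_bool (h 1 x \<noteq> 0) :: real)" using \<theta>_bper[of 1] by (simp add: \<theta>_def[abs_def])
  have fbar: "fbar 1 = t" "fbar 2 = 0" unfolding fbar_def using assms by auto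
  have m1: "\<bar>mean (h 1) - t\<bar> \<le> \<eta>" using mean_h[of 1] l fbar by simp
  have m2: "mean (h 2) \<le> \<eta>"
  proof (cases "2 \<le> m")
    case True
    then show ?thesis using mean_h[of 2] fbar by simp
  next
    case False
    then have "h 2 = (\<lambda>x. 0)" using h_large[of 2] by (simp add: fun_eq_iff)
    then show ?thesis using eta by simp
  qed
  have "mean (h 1) \<le> mean (\<lambda>x. of_bool (h 1 x \<noteq> 0))"
  proof (rule mean_mono[OF h_bper b])
    fix x show "h 1 x \<le> of_bool (h 1 x \<noteq> 0)" using h_val[of 1 x] by auto
  qed
  then show "t - \<eta> \<le> mean (\<lambda>x. of_bool (h 1 x \<noteq> 0))" using m1 by linarith
  have "mean (\<lambda>x. of_bool (h 1 x \<noteq> 0)) \<le> mean (\<lambda>x. h 1 x + h 2 x)"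
  proof (rule mean_mono[OF b bper_add[OF h_bper h_bper]])
    fix x show "of_bool (h 1 x \<noteq> 0) \<le> h 1 x + h 2 x"
      using h_val[of 1 x] h_val[of 2 x] h_chain[of 1 x] by (auto simp: numeral_2_eq_2)
  qed
  also have "\<dots> = mean (h 1) + mean (h 2)" by (rule mean_add[OF h_bper h_bper])
  finally show "mean (\<lambda>x. of_bool (h 1 x \<noteq> 0)) \<le> t + 2 * \<eta>" using m1 m2 by linarith
qed

end

lemma (in well_coordinates) low_energy_exists:
  fixes X :: "real ^ 'n::_ \<Rightarrow> real ^ 'n::_ ^ 'n::_" and u :: "real ^ 'n::_ \<Rightarrow> real ^ 'n::_"
  assumes inj: "inj_on (well f :: nat \<Rightarrow> real ^ 'n::_ ^ 'n::_) {0..m}"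
    and l: "1 \<le> l" "l \<le> m" and t: "0 < t" "t < 1" and e: "0 < e" "e \<le> 1/2" and S: "0 \<le> S" and p: "2 \<le> p"
    and X: "X \<in> phase_arrangements (box 0 1) m f" and u: "u \<in> admissible_per p (comb (profile l t))"
    and EL: "(\<integral>\<^sup>+ x\<in>box 0 1. ennreal (norm (sym_part (weak_gradient u x) - X x) powr p) \<partial>lebesgue) \<le> ennreal (e powr p)"
    and TV: "(\<Sum>j = 1..m. total_variation (box 0 1) (phase f X j)) \<le> ennreal S"
  obtains \<kappa> E W G g where "low_energy m f ca cb l t e S \<kappa> E u W G g"
proof -
  obtain E where E: "\<And>j. E j \<in> sets borel" "\<And>j. E j \<subseteq> box 0 1" "\<And>j x. x \<in> E j \<Longrightarrow> X x = well f j"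
    "\<And>j. total_variation (box 0 1) (indicator (E j)) = total_variation (box 0 1) (phase f X j)"
    "AE x in lborel. \<forall>j\<in>{0..m}. x \<in> box 0 1 \<longrightarrow> X x = well f j \<longrightarrow> x \<in> E j"
    "(\<lambda>x. indicator (box 0 1) x *\<^sub>R X x) \<in> borel_measurable lebesgue"
    using borel_phases[OF X] by blast
  define W where "W = weak_gradient u"
  obtain G where G: "has_weak_gradient u W"
    "\<And>i j. G i j \<in> borel_measurable borel" "\<And>i j. periodic (G i j)"
    "\<And>i j. AE x in lborel. G i j x = W x $ i $ j"
    "\<And>i j. locally_integrable (G i j)" "\<And>i j. integrable cell (G i j)"
    "\<And>i j. mean (G i j) = comb (profile l t) $ i $ j" and Wm: "W \<in> borel_measurable lebesgue"
    using gradient_representative[OF u] unfolding W_def by blast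
  define D where "D x = sym_part (W x) - X x" for x
  define g where "g x = norm (indicator (box 0 1) x *\<^sub>R D x)" for x
  \<comment> \<open>The largest scale at which a translation by at most \<kappa> changes each phase
    by no more than \<open>e / m\<close> in L2 according to \<open>l2_tdiff_per_ind\<close>.\<close>
  define \<kappa> where "\<kappa> = (e / real m)\<^sup>2 / (S + real CARD('n))"
  have n: "0 < S + real CARD('n)" using S by (simp add: add_nonneg_pos)
  have D_nth: "D x $ a $ b = (W x $ a $ b + W x $ b $ a) / 2 - X x $ a $ b" for x a b
    by (simp add: D_def sym_part_def transpose_def)
  have Dm: "(\<lambda>x. indicator (box 0 1) x *\<^sub>R D x) \<in> borel_measurable lebesgue"
  proof -
    have "continuous_on UNIV (sym_part :: real ^ 'n::_ ^ 'n::_ \<Rightarrow> _)"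
      unfolding sym_part_def[abs_def] transpose_def by (intro continuous_intros)
    then have "sym_part \<in> borel_measurable (borel :: (real ^ 'n::_ ^ 'n::_) measure)"
      by (rule borel_measurable_continuous_onI)
    then have s: "(\<lambda>x. sym_part (W x)) \<in> borel_measurable lebesgue" by (rule measurable_compose[OF Wm])
    have "(\<lambda>x. indicator (box 0 1) x *\<^sub>R sym_part (W x) - indicator (box 0 1) x *\<^sub>R X x) \<in> borel_measurable lebesgue"
      by (intro borel_measurable_diff E(6) borel_measurable_scaleR s borel_measurable_indicator) simp
    then show ?thesis by (simp add: D_def scaleR_diff_right)
  qed
  have gD: "g x = norm (D x)" if "x \<in> box 0 1" for x using that by (simp add: g_def)
  have X_well: "\<exists>j\<in>{0..m}. X x = well f j" if "x \<in> box 0 1" for x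
    using X that by (auto simp: phase_arrangements_def wells_def)
  have well_off: "(well f j :: real ^ 'n::_ ^ 'n::_) $ a $ b = 0" if "a \<noteq> b" "j \<in> {0..m}" for a b j
    using that well_eq[of j] well_0_eq by (cases "j = 0") (auto simp: comb_nth)
  have "low_energy m f ca cb l t e S \<kappa> E u W G g"
  proof
    show "i = j" if "i \<in> {1..m}" "j \<in> {1..m}" "x \<in> E i" "x \<in> E j" for i j x
      using inj_onD[OF inj, of i j] E(3)[OF that(3)] E(3)[OF that(4)] that by auto
    show "total_variation (box 0 1) (indicator (E j)) \<le> ennreal S" if "j \<in> {1..m}" for j
    proof -
      have "total_variation (box 0 1) (phase f X j) \<le> (\<Sum>j = 1..m. total_variation (box 0 1) (phase f X j))"
        using that by (intro member_le_sum) auto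
      then show ?thesis using TV E(4)[of j] by (metis order_trans)
    qed
    show "0 < \<kappa>" using e l n by (simp add: \<kappa>_def)
    show "\<kappa> * (S + real CARD('n)) \<le> (e / real m)\<^sup>2" using n by (simp add: \<kappa>_def)
    show "g \<in> borel_measurable lebesgue"
      unfolding g_def[abs_def] by (rule measurable_compose[OF Dm borel_measurable_norm])
    show "(\<integral>\<^sup>+ x. ennreal ((g x)\<^sup>2) \<partial>lebesgue) \<le> ennreal (e\<^sup>2)"
      unfolding g_def by (rule nn_integral_box_square_le[OF p e(1) Dm]) (use EL in \<open>simp add: D_def W_def\<close>)
    show "AE x in lborel. x \<in> box 0 1 \<longrightarrow> \<bar>G a b x + G b a x\<bar> \<le> 2 * g x" if ab: "a \<noteq> b" for a b
      using G(4)[of a b] G(4)[of b a]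
    proof eventually_elim
      case (elim x)
      show ?case
      proof
        assume x: "x \<in> box 0 1"
        then have "X x $ a $ b = 0" using X_well[OF x] well_off[OF ab] by auto
        then have "G a b x + G b a x = 2 * D x $ a $ b" using elim by (simp add: D_nth)
        then show "\<bar>G a b x + G b a x\<bar> \<le> 2 * g x"
          using abs_matrix_nth_le[of "D x" a b] gD[OF x] by (simp add: abs_mult)
      qed
    qed
    show "AE x in lborel. x \<in> box 0 1 \<longrightarrow>
      \<bar>G a a x - sg a * (\<Sum>j = 1..m. profile j 1 (blk a) * indicator (E j) x)\<bar> \<le> 1 * g x" if a: "1 \<le> blk a" for a
      using G(4)[of a a] E(5)
    proof eventually_elim
      case (elim x)
      show ?case
      proof
        assume x: "x \<in> box 0 1"
        obtain j where j: "j \<in> {0..m}" "X x = well f j" using X_well[OF x] by blast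
        have xE: "x \<in> E k \<longleftrightarrow> k = j" if "k \<in> {1..m}" for k
        proof
          assume "x \<in> E k"
          then show "k = j" using E(3)[of x k] j inj_onD[OF inj, of k j] that by auto
        qed (use elim x j in blast)
        have "(\<Sum>k = 1..m. profile k 1 (blk a) * indicator (E k) x) = (\<Sum>k = 1..m. if k = j then profile k 1 (blk a) else 0)"
          by (intro sum.cong) (auto simp: xE indicator_def)
        then have "sg a * (\<Sum>k = 1..m. profile k 1 (blk a) * indicator (E k) x) = X x $ a $ a"
          using j a well_eq[of j] well_0_eq by (cases "j = 0") (auto simp: comb_nth profile_def)
        then have "G a a x - sg a * (\<Sum>k = 1..m. profile k 1 (blk a) * indicator (E k) x) = D x $ a $ a"
          using elim by (simp add: D_nth)
        then show "\<bar>G a a x - sg a * (\<Sum>k = 1..m. profile k 1 (blk a) * indicator (E k) x)\<bar> \<le> 1 * g x"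
          using abs_matrix_nth_le[of "D x" a a] gD[OF x] by simp
      qed
    qed
  qed (fact l t e S E G)+
  then show ?thesis by (rule that)
qed

lemma (in low_energy) first_order_bound:
  assumes "l = 1" and e8: "16 * e \<le> min t (1 - t)"
  shows "(min t (1 - t))\<^sup>2 / 4 \<le> real m * (2 ^ CARD('n) * real CARD('n) * S)"
proof -
  interpret A: laminate_approx m l f ca cb blk sg t "2 * e" "real m * (S + real CARD('n))" h w dw
    by (rule laminate_approx)
  let ?\<mu> = "mean (\<lambda>x. of_bool (h 1 x \<noteq> 0))" and ?r = "min t (1 - t)"
  \<comment> \<open>With \<eta> = 2e the fraction lies between \<open>t - 2 * e\<close> and
    \<open>t + 4 * e\<close>, which leaves at least half of the margin on either side.\<close>
  have "?r / 2 \<le> ?\<mu>" "?r / 2 \<le> 1 - ?\<mu>"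
    using A.mean_first_indicator[OF assms(1)] e8 e by (auto simp: min_def split: if_splits)
  then have "(?r / 2) * (?r / 2) \<le> ?\<mu> * (1 - ?\<mu>)" using t by (intro mult_mono) auto
  then show ?thesis using volume_fraction by (simp add: power2_eq_square)
qed

text \<open>The general bound contains \<open>S + CARD('n)\<close>. For \<open>l > 1\<close> the
  exponent of \<open>e\<close> is positive, and for small \<open>e\<close> the second summand takes
  up at most half of the constant; for \<open>l = 1\<close> the exponent is 0 and \<open>S\<close>
  is bounded directly.\<close>

lemma (in well_coordinates) low_energy_bound:
  assumes l: "1 \<le> l" "l \<le> m" and t: "0 < t" "t < 1"
  obtains c e1 where "0 < c" "0 < e1" "e1 \<le> 1/2"
    "\<And>e S \<kappa> E u W G g. low_energy m f ca cb l t e S \<kappa> E u W G g \<Longrightarrow> e \<le> e1 \<Longrightarrow>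
      c \<le> S * e powr (\<Sum>i = 1..<l. if f i = 1 then 1/2 else 1)"
proof (cases "l = 1")
  case True
  define c where "c = (min t (1 - t))\<^sup>2 / 4 / (real m * (2 ^ CARD('n) * real CARD('n)))"
  define e1 where "e1 = min t (1 - t) / 16"
  have 1: "0 < c" using t l by (simp add: c_def)
  have 2: "0 < e1" "e1 \<le> 1/2" using t by (auto simp: e1_def min_def)
  have "c \<le> S * e powr (\<Sum>i = 1..<l. if f i = 1 then 1/2 else 1)"
    if E: "low_energy m f ca cb l t e S \<kappa> E u W G g" and "e \<le> e1" for e S \<kappa> E u W G g
  proof -
    have "(min t (1 - t))\<^sup>2 / 4 \<le> S * (real m * (2 ^ CARD('n) * real CARD('n)))"
      using low_energy.first_order_bound[OF E True] \<open>e \<le> e1\<close> by (simp add: e1_def mult_ac)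
    then have "c \<le> S" unfolding c_def using l by (subst pos_divide_le_eq) auto
    moreover have "0 < e" by (rule low_energy.e(1)[OF E])
    ultimately show ?thesis using True by simp
  qed
  from that[OF 1 2 this] show ?thesis .
next
  case False
  define q where "q = (\<Sum>i = 1..<l. if f i = 1 then 1/2 else 1 :: real)"
  have q: "0 < q" unfolding q_def using False l by (intro sum_pos) auto
  obtain c e0 where c: "0 < c" "0 < e0" and b:
    "\<And>\<eta> L h w dw. laminate_approx m l f ca cb blk sg t \<eta> L h w dw \<Longrightarrow> \<eta> \<le> e0 \<Longrightarrow> c \<le> L * \<eta> powr q"
    using laminate_approx_lower_bound[OF l(1) t, of m f ca cb blk sg] unfolding q_def by metis
  define M where "M = real m * real CARD('n)"
  have M: "0 < M" using l by (simp add: M_def)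
  \<comment> \<open>The last entry makes \<open>M * (2 * e) powr q\<close> at most
    \<open>c / 2\<close>.\<close>
  define e1 where "e1 = Min {1/2, e0 / 2, (c / (2 * M)) powr (1 / q) / 2}"
  have e1: "0 < e1" "e1 \<le> 1/2" "e1 \<le> e0 / 2" "e1 \<le> (c / (2 * M)) powr (1 / q) / 2"
    unfolding e1_def using c M by auto
  have "c / (2 * (real m * 2 powr q)) \<le> S * e powr q"
    if E: "low_energy m f ca cb l t e S \<kappa> E u W G g" and e: "e \<le> e1" for e S \<kappa> E u W G g
  proof -
    have e0: "0 < e" by (rule low_energy.e(1)[OF E])
    have "c \<le> real m * (S + real CARD('n)) * (2 * e) powr q"
      by (rule b[OF low_energy.laminate_approx[OF E]]) (use e e1 in simp)
    also have "\<dots> = real m * S * (2 * e) powr q + M * (2 * e) powr q" by (simp add: M_def algebra_simps)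
    also have "M * (2 * e) powr q \<le> M * ((c / (2 * M)) powr (1 / q)) powr q"
      using e e1 e0 M q by (intro mult_left_mono powr_mono2) auto
    also have "\<dots> = c / 2" using q c M by (simp add: powr_powr)
    finally have "c / 2 \<le> real m * S * (2 * e) powr q" by simp
    also have "\<dots> = S * e powr q * (real m * 2 powr q)" using e0 by (simp add: powr_mult)
    finally have "c / 2 \<le> S * e powr q * (real m * 2 powr q)" .
    then have "c / 2 / (real m * 2 powr q) \<le> S * e powr q" using l by (subst pos_divide_le_eq) auto
    then show ?thesis by simp
  qed
  moreover have "0 < c / (2 * (real m * 2 powr q))" using c l by simp
  ultimately show ?thesis using that[of "c / (2 * (real m * 2 powr q))" e1] e1 unfolding q_def by blast
qed

lemma sum_weights:
  "(\<Sum>i = 1..<l. if f i = 1 then 1/2 else 1 :: real) = real (l - 1) - real (ones_upto f (l - 1)) / 2"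
proof -
  have s: "{1..<l} = {1..l - 1}" by auto
  have "(\<Sum>i = 1..<l. if f i = 1 then 1/2 else 1 :: real) = (\<Sum>i = 1..l - 1. 1 - of_bool (f i = 1) / 2)"
    unfolding s by (intro sum.cong) auto
  also have "\<dots> = real (l - 1) - (\<Sum>i = 1..l - 1. of_bool (f i = 1)) / 2"
    by (simp add: sum_subtractf flip: sum_divide_distrib)
  also have "(\<Sum>i = 1..l - 1. of_bool (f i = 1) :: real) = real (ones_upto f (l - 1))"
    by (simp add: ones_upto_def Int_def)
  finally show ?thesis .
qed

text \<open>If the energy were below \<open>R = c * \<epsilon> powr (p / (p + q))\<close>, one could
  take \<open>e = R powr (1 / p)\<close> and \<open>S = R / \<epsilon>\<close>. The exponent is
  chosen so that \<epsilon> cancels in \<open>S * e powr q\<close>, which then is a power of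
  \<open>c\<close> alone and too small.\<close>

lemma (in well_coordinates) min_energy_lower_bound:
  assumes inj: "inj_on (well f :: nat \<Rightarrow> real ^ 'n::_ ^ 'n::_) {0..m}"
    and l: "1 \<le> l" "l \<le> m" and t: "0 < t" "t < 1" and p: "2 \<le> p"
    and q: "q = (\<Sum>i = 1..<l. if f i = 1 then 1/2 else 1)"
  obtains c where "0 < c" "\<And>\<epsilon>. \<epsilon> \<in> {0<..<1} \<Longrightarrow>
    ennreal (c * \<epsilon> powr (p / (p + q))) \<le> min_energy (box 0 1) p \<epsilon> m f (comb (profile l t) :: real ^ 'n::_ ^ 'n::_)"
proof -
  have q0: "0 \<le> q" unfolding q by (intro sum_nonneg) auto
  obtain c0 e1 where c0: "0 < c0" and e1: "0 < e1" "e1 \<le> 1/2"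
    and b: "\<And>e S \<kappa> E u W G g. low_energy m f ca cb l t e S \<kappa> E u W G g \<Longrightarrow> e \<le> e1 \<Longrightarrow> c0 \<le> S * e powr q"
    using low_energy_bound[OF l t] unfolding q by metis
  \<comment> \<open>The entry 1 gives \<open>c powr (1 + q / p) \<le> c\<close>, the second one
    \<open>e \<le> e1\<close>, and the third the final contradiction.\<close>
  define c where "c = Min {1, e1 powr p, c0 / 2}"
  have c: "0 < c" "c \<le> 1" "c \<le> e1 powr p" "c \<le> c0 / 2" unfolding c_def using c0 e1 by auto
  have "ennreal (c * \<epsilon> powr (p / (p + q))) \<le> energy (box 0 1) p \<epsilon> m f u X"
    if \<epsilon>: "\<epsilon> \<in> {0<..<1}" and X: "X \<in> phase_arrangements (box 0 1) m f" and u: "u \<in> admissible_per p (comb (profile l t))"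
    for \<epsilon> and X :: "real ^ 'n::_ \<Rightarrow> real ^ 'n::_ ^ 'n::_" and u
  proof (rule ccontr)
    define \<alpha> R where "\<alpha> = p / (p + q)" and "R = c * \<epsilon> powr \<alpha>"
    have R: "0 < R" using c \<epsilon> by (simp add: R_def)
    have "R \<le> c * 1" unfolding R_def using c \<epsilon> p q0
      by (intro mult_left_mono powr_le1) (auto simp: \<alpha>_def)
    then have Rc: "R \<le> c" by simp
    let ?EL = "\<integral>\<^sup>+ x\<in>box 0 1. ennreal (norm (sym_part (weak_gradient u x) - X x) powr p) \<partial>lebesgue"
    let ?T = "\<Sum>j = 1..m. total_variation (box 0 1) (phase f X j)"
    assume "\<not> ennreal (c * \<epsilon> powr (p / (p + q))) \<le> energy (box 0 1) p \<epsilon> m f u X"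
    then have small: "?EL + ennreal \<epsilon> * ?T \<le> ennreal R"
      by (simp add: energy_def R_def \<alpha>_def not_le less_imp_le)
    define e S where "e = R powr (1 / p)" and "S = R / \<epsilon>"
    have ep: "e powr p = R" using R p by (simp add: e_def powr_powr)
    have "?EL \<le> ?EL + ennreal \<epsilon> * ?T" by simp
    then have EL: "?EL \<le> ennreal (e powr p)" unfolding ep using small by (rule order_trans)
    have "ennreal \<epsilon> * ?T \<le> ?EL + ennreal \<epsilon> * ?T" by simp
    then have "ennreal \<epsilon> * ?T \<le> ennreal R" using small by (rule order_trans)
    also have "\<dots> = ennreal \<epsilon> * ennreal S" using \<epsilon> R by (simp add: S_def ennreal_mult[symmetric])
    finally have T: "?T \<le> ennreal S"
      using \<epsilon> by (subst (asm) ennreal_mult_le_mult_iff) auto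
    have "e \<le> (e1 powr p) powr (1 / p)" unfolding e_def using Rc c R p by (intro powr_mono2) auto
    then have ee1: "e \<le> e1" using e1 p by (simp add: powr_powr)
    have e: "0 < e" "e \<le> 1/2" using R ee1 e1 by (auto simp: e_def)
    have S0: "0 \<le> S" using R \<epsilon> by (simp add: S_def)
    obtain \<kappa> E W G g where "low_energy m f ca cb l t e S \<kappa> E u W G g"
      by (rule low_energy_exists[OF inj l t e S0 p X u EL T])
    from b[OF this ee1] have "c0 \<le> S * e powr q" .
    also have "\<dots> = R powr (1 + q / p) / \<epsilon>"
      using R by (simp add: S_def e_def powr_powr powr_add)
    also have "R powr (1 + q / p) = c powr (1 + q / p) * \<epsilon> powr (\<alpha> * (1 + q / p))"
      unfolding R_def using c \<epsilon> by (simp add: powr_mult powr_powr)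
    also have "\<alpha> * (1 + q / p) = 1"
    proof -
      have "1 + q / p = (p + q) / p" using p by (simp add: add_divide_distrib)
      then show ?thesis using p q0 by (simp add: \<alpha>_def)
    qed
    also have "c powr (1 + q / p) * \<epsilon> powr 1 / \<epsilon> = c powr (1 + q / p)" using \<epsilon> by simp
    also have "\<dots> \<le> c powr 1" using c p q0 by (intro powr_mono') auto
    finally show False using c c0 by simp
  qed
  then have "ennreal (c * \<epsilon> powr (p / (p + q))) \<le> min_energy (box 0 1) p \<epsilon> m f (comb (profile l t) :: real ^ 'n::_ ^ 'n::_)"
    if "\<epsilon> \<in> {0<..<1}" for \<epsilon>
    unfolding min_energy_def using that by (intro INF_greatest)
  with c(1) show ?thesis by (rule that)
qed

theorem theorem1p9:
  fixes p :: real and m l :: nat and f :: "nat \<Rightarrow> nat"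
  assumes "2 \<le> p"
    and "l \<in> {1..m}"
    and "f \<in> admissible m"
    and "CARD('n::{finite,linorder}) = space_dim m f"
  shows "\<exists>c :: real ^ 'n::_ ^ 'n::_ \<Rightarrow> real.
    (\<forall>F \<in> laminates (wells m f) l - laminates (wells m f) (l - 1).
      c F > 0 \<and>
      (\<forall>\<epsilon> \<in> {0<..<1}.
        ennreal (c F * \<epsilon> powr (2 * p / (2 * p
          + 2 * (real (l - 1) - real (ones_upto f (l - 1))) + real (ones_upto f (l - 1)))))
        \<le> min_energy (box 0 1) p \<epsilon> m f F)) \<and>
    (\<forall>\<delta>>0. \<exists>\<eta>>0. \<forall>F \<in> laminates (wells m f) l - laminates (wells m f) (l - 1).
      infdist F (laminates (wells m f) (l - 1)) < \<eta> \<longrightarrow> c F < \<delta>)"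
proof -
  let ?K = "\<lambda>j. laminates (wells m f :: (real ^ 'n::_ ^ 'n::_) set) j"
  let ?\<alpha> = "2 * p / (2 * p + 2 * (real (l - 1) - real (ones_upto f (l - 1))) + real (ones_upto f (l - 1)))"
  obtain ca cb :: "nat \<Rightarrow> 'n" where "well_coordinates m f ca cb"
    by (rule well_coordinates_exist[OF assms(3,4)])
  then interpret well_coordinates m f ca cb .
  define q where "q = (\<Sum>i = 1..<l. if f i = 1 then 1/2 else 1 :: real)"
  have q0: "0 \<le> q" unfolding q_def by (intro sum_nonneg) auto
  have \<alpha>: "?\<alpha> = p / (p + q)"
  proof -
    have "2 * p + 2 * (real (l - 1) - real (ones_upto f (l - 1))) + real (ones_upto f (l - 1)) = 2 * (p + q)" (is "?d = _")
      unfolding q_def sum_weights by (simp add: algebra_simps)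
    then have "2 * p / ?d = 2 * p / (2 * (p + q))" by (rule arg_cong)
    then show ?thesis by (rule trans) (rule mult_divide_mult_cancel_left, simp)
  qed
  have ex: "\<exists>c>0. \<forall>\<epsilon>\<in>{0<..<1}. ennreal (c * \<epsilon> powr ?\<alpha>) \<le> min_energy (box 0 1) p \<epsilon> m f F"
    if F: "F \<in> ?K l - ?K (l - 1)" for F
  proof -
    have l: "1 \<le> l" "l \<le> m" using assms(2) by auto
    obtain t where t: "0 < t" "t < 1" and Ft: "F = comb (profile l t)"
      by (rule laminates_difference[OF F assms(2)])
    obtain c where "0 < c" "\<And>\<epsilon>. \<epsilon> \<in> {0<..<1} \<Longrightarrow> ennreal (c * \<epsilon> powr (p / (p + q))) \<le> min_energy (box 0 1) p \<epsilon> m f F"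
      unfolding Ft by (rule min_energy_lower_bound[OF inj_on_well[OF assms(3,4)] l t assms(1) q_def]) blast
    then show ?thesis unfolding \<alpha> by blast
  qed
  \<comment> \<open>One constant is selected for each \<open>F\<close>, because the limit assertion
    concerns a single function of \<open>F\<close>.\<close>
  define c0 where "c0 F = (SOME c. c > 0 \<and> (\<forall>\<epsilon>\<in>{0<..<1}. ennreal (c * \<epsilon> powr ?\<alpha>) \<le> min_energy (box 0 1) p \<epsilon> m f F))"
    for F :: "real ^ 'n::_ ^ 'n::_"
  have c0: "c0 F > 0" "\<And>\<epsilon>. \<epsilon> \<in> {0<..<1} \<Longrightarrow> ennreal (c0 F * \<epsilon> powr ?\<alpha>) \<le> min_energy (box 0 1) p \<epsilon> m f F"
    if "F \<in> ?K l - ?K (l - 1)" for F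
    using someI_ex[OF ex[OF that]] unfolding c0_def by auto
  \<comment> \<open>A smaller constant keeps the lower bound, and the cap by the distance yields the
    limit with \<eta> = \<delta>.\<close>
  define c where "c F = min (c0 F) (infdist F (?K (l - 1)))" for F
  show ?thesis
  proof (intro exI[of _ c] conjI ballI allI impI)
    fix F assume F: "F \<in> ?K l - ?K (l - 1)"
    have "closed (?K (l - 1))" using assms(2) by (intro closed_laminates) simp
    \<comment> \<open>The distance from an empty set is 0 by convention, so closedness alone would
      not make it positive.\<close>
    moreover have "?K (l - 1) \<noteq> {}" using well_in_laminates[of 0 "l - 1"] by blast
    ultimately have "infdist F (?K (l - 1)) \<noteq> 0" using F in_closed_iff_infdist_zero by blast
    then have "0 < infdist F (?K (l - 1))" using infdist_nonneg[of F "?K (l - 1)"] by linarith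
    then show "0 < c F" using c0(1)[OF F] by (simp add: c_def)
    fix \<epsilon> :: real assume \<epsilon>: "\<epsilon> \<in> {0<..<1}"
    have "ennreal (c F * \<epsilon> powr ?\<alpha>) \<le> ennreal (c0 F * \<epsilon> powr ?\<alpha>)"
      by (intro ennreal_leI mult_right_mono) (auto simp: c_def)
    also have "\<dots> \<le> min_energy (box 0 1) p \<epsilon> m f F" by (rule c0(2)[OF F \<epsilon>])
    finally show "ennreal (c F * \<epsilon> powr ?\<alpha>) \<le> min_energy (box 0 1) p \<epsilon> m f F" .
  next
    fix \<delta> :: real assume "0 < \<delta>"
    then show "\<exists>\<eta>>0. \<forall>F \<in> ?K l - ?K (l - 1). infdist F (?K (l - 1)) < \<eta> \<longrightarrow> c F < \<delta>"
      by (intro exI[of _ \<delta>]) (auto simp: c_def)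
  qed
qed

end
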